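(* Let $U$ be a complex disc. The category of graded comodules over the commutative Hopf algebra $H^0_{\mathcal D}(\mathcal A_\bullet(\Omega_U))$ is canonically equivalent to the category of variations of mixed $\mathbb Q$-Hodge-Tate structures on $U$.
   Context: Comodules are finite dimensional graded comodules over $\mathbb Q$. $\mathcal O=\mathcal O_U$, $\Omega_U$ is the holomorphic de Rham complex of $U$, tensor products are over $\mathbb Q$, $\mathbb Q(1)=2\pi i\,\mathbb Q$, and $\mathcal O^*$ stands for $\mathcal O^*\otimes_{\mathbb Z}\mathbb Q=\mathcal O/\mathbb Q(1)$ (via $\exp$). **The Hopf algebra.** Let $\overline{\Omega}=\Omega_U/\mathbb Q(1)$, $\mathcal A_0(\Omega_U)=\mathbb Q$, $\mathcal A_n(\Omega_U)=\overline\Omega\otimes\Omega_U^{\otimes(n-1)}$, graded by the total degree of forms; its degree $0$ part is $\mathcal A_\bullet(\mathcal O)$ with $\mathcal A_n(\mathcal O)=\mathcal O^*\otimes\mathcal O^{\otimes(n-1)}$. The differential is defined inductively by $\mathcal D(\overline x_1\otimes x_2\otimes\cdots\otimes x_n)=\overline{dx_1\cdot x_2}\otimes x_3\otimes\cdots\otimes x_n+(-1)^{|x_1|}\overline x_1\otimes\mathcal D(x_2\otimes\cdots\otimes x_n)$ (in the inductive step the same formula without bars; zero on tensors of length $\le1$). On $\mathcal A_\bullet(\mathcal O)$ the coproduct of $x=F_1\otimes g_2\otimes\cdots\otimes g_n$ is $1\otimes x+x\otimes1+\sum_{j=1}^{n-1}(F_1\otimes g_2\otimes\cdots\otimes g_j)\bigotimes(e^{g_{j+1}}\otimes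 g_{j+2}\otimes\cdots\otimes g_n)$. The product is induced, via $\mathrm{pr}:x_1\otimes x_2\otimes\cdots\otimes x_n\mapsto e^{x_1}\otimes x_2\otimes\cdots\otimes x_n$, by the product $m'$ on $\bigoplus_n\mathcal O^{\otimes n}$ with unit $1$ and $$\begin{aligned}m'(x_1\otimes\cdots\otimes x_p,y_1\otimes\cdots\otimes y_q)=\ &x_1\otimes m'(x_2\otimes\cdots\otimes x_p,y_1\otimes\cdots\otimes y_q)+y_1\otimes m'(x_1\otimes\cdots\otimes x_p,y_2\otimes\cdots\otimes y_q)\\&-\tfrac{x_1y_1}{2\pi i}\otimes2\pi i\otimes m'(x_2\otimes\cdots\otimes x_p,y_2\otimes\cdots\otimes y_q).\end{aligned}$$ $H^0_{\mathcal D}(\mathcal A_\bullet(\Omega_U))=\{x\in\mathcal A_\bullet(\mathcal O)\mid\mathcal D(x)=0\}$, a graded Hopf subalgebra (sections over $U$ of the corresponding sheaf). **Variations.** A variation of mixed $\mathbb Q$-Hodge-Tate structures on $U$ is a local system $H$ of finite dimensional $\mathbb Q$-vector spaces with an increasing filtration $W_\bullet$ by sub-local systems and a decreasing filtration $F^\bullet$ of $H\otimes\mathcal O$ by holomorphic subbundles satisfying Griffiths transversality $\nabla F^p\subset F^{p-1}\otimes\Omega^1$, such that in each fiber $\mathrm{gr}^W_m=0$ for odd $m$ and $\mathrm{gr}^W_{2n}\otimes\mathbb C=F^n_{(2n)}\cap\overline F{}^n_{(2n)}$ for the filtrations induced by $F$ and its conjugate.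
   Formalization: Variations are required to be mixed Hodge structures fiberwise (W finite, induced F and its conjugate opposed on gr^W), since the displayed condition alone allows F^{n+1} ≠ 0 on gr_{2n}; "canonically" means naturally compatible with V_n ≅ gr^W_{2n}; vector spaces lie in Q^(N). *)

theory Defs
  imports "HOL-Analysis.Analysis" "HOL-Library.Poly_Mapping" "HOL-Library.Function_Algebras"
begin

section \<open>Vector spaces inside free vector spaces\<close>

text \<open>
  \<^typ>\<open>'b \<Rightarrow>\<^sub>0 'k\<close> is the free \<open>'k\<close>-vector space on the basis \<open>'b\<close>.  Every vector space below is
  a subspace of a free one, or a quotient \<open>X/N\<close> of two such subspaces; elements of \<open>X/N\<close> are
  handled through representatives in \<open>X\<close>, equality being congruence modulo \<open>N\<close>.
\<close>

definition scl :: "'k::field \<Rightarrow> ('b \<Rightarrow>\<^sub>0 'k) \<Rightarrow> ('b \<Rightarrow>\<^sub>0 'k)" where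
  "scl c = Poly_Mapping.map ((*) c)"

lemma lookup_scl [simp]: "Poly_Mapping.lookup (scl c p) b = c * Poly_Mapping.lookup p b"
  by (simp add: scl_def Poly_Mapping.map.rep_eq when_def)

global_interpretation pm: vector_space "scl :: 'k::field \<Rightarrow> ('b \<Rightarrow>\<^sub>0 'k) \<Rightarrow> ('b \<Rightarrow>\<^sub>0 'k)"
  by unfold_locales (auto intro!: poly_mapping_eqI simp: Poly_Mapping.lookup_add algebra_simps)

definition linext :: "('a \<Rightarrow> ('b \<Rightarrow>\<^sub>0 'k::field)) \<Rightarrow> ('a \<Rightarrow>\<^sub>0 'k) \<Rightarrow> ('b \<Rightarrow>\<^sub>0 'k)" where
  "linext f p = (\<Sum>a\<in>Poly_Mapping.keys p. scl (Poly_Mapping.lookup p a) (f a))"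

text \<open>The tensor product of two free spaces is the free space on the pairs of basis elements.\<close>

definition tens :: "('a \<Rightarrow>\<^sub>0 'k::field) \<Rightarrow> ('b \<Rightarrow>\<^sub>0 'k) \<Rightarrow> ('a \<times> 'b \<Rightarrow>\<^sub>0 'k)" where
  "tens x y = linext (\<lambda>a. linext (\<lambda>b. Poly_Mapping.single (a, b) 1) y) x"

text \<open>
  Universe of finite dimensional rational vector spaces: the subspaces of \<open>\<rat>\<^sup>(\<^sup>\<nat>\<^sup>)\<close>.  Each finite
  dimensional rational vector space is isomorphic to one of them, so the categories built on this
  universe are equivalent to the ones built on any larger one.
\<close>

type_synonym qvec = "nat \<Rightarrow>\<^sub>0 rat"
type_synonym cvec = "nat \<Rightarrow>\<^sub>0 complex"

definition findim :: "qvec set \<Rightarrow> bool" where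
  "findim V \<longleftrightarrow> (\<exists>B. finite B \<and> V = pm.span B)"

definition qlinear :: "qvec set \<Rightarrow> qvec set \<Rightarrow> (qvec \<Rightarrow> qvec) \<Rightarrow> bool" where
  "qlinear V V' f \<longleftrightarrow> f ` V \<subseteq> V' \<and> (\<forall>u\<in>V. \<forall>v\<in>V. f (u + v) = f u + f v)
     \<and> (\<forall>q. \<forall>v\<in>V. f (scl q v) = scl q (f v))"

text \<open>
  \<open>\<rat>\<^sup>(\<^sup>\<nat>\<^sup>) \<otimes> \<complex> = \<complex>\<^sup>(\<^sup>\<nat>\<^sup>)\<close>.  Accordingly \<open>ctens c v\<close> is the pure tensor \<open>v \<otimes> c\<close>, the complexification
  \<open>V \<otimes> \<complex>\<close> of a subspace is the complex span of \<open>V\<close>, and complex conjugation acts on coordinates.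
\<close>

definition ctens :: "complex \<Rightarrow> qvec \<Rightarrow> cvec" where
  "ctens c v = scl c (Poly_Mapping.map of_rat v)"

definition complexification :: "qvec set \<Rightarrow> cvec set" where
  "complexification V = pm.span (ctens 1 ` V)"

definition conj_space :: "cvec set \<Rightarrow> cvec set" where
  "conj_space S = Poly_Mapping.map cnj ` S"


section \<open>Categories and equivalences\<close>

record ('o, 'm) cat =
  ob :: "'o set"
  hom :: "'o \<Rightarrow> 'o \<Rightarrow> 'm set"
  idn :: "'o \<Rightarrow> 'm"
  cmp :: "'m \<Rightarrow> 'm \<Rightarrow> 'm"   \<comment> \<open>\<open>cmp C g f\<close> is \<open>g \<circ> f\<close>\<close>

definition category :: "('o, 'm) cat \<Rightarrow> bool" where
  "category C \<longleftrightarrow>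
     (\<forall>a\<in>ob C. idn C a \<in> hom C a a) \<and>
     (\<forall>a\<in>ob C. \<forall>b\<in>ob C. \<forall>c\<in>ob C. \<forall>f\<in>hom C a b. \<forall>g\<in>hom C b c. cmp C g f \<in> hom C a c) \<and>
     (\<forall>a\<in>ob C. \<forall>b\<in>ob C. \<forall>f\<in>hom C a b. cmp C f (idn C a) = f \<and> cmp C (idn C b) f = f) \<and>
     (\<forall>a\<in>ob C. \<forall>b\<in>ob C. \<forall>c\<in>ob C. \<forall>d\<in>ob C. \<forall>f\<in>hom C a b. \<forall>g\<in>hom C b c. \<forall>h\<in>hom C c d.
        cmp C h (cmp C g f) = cmp C (cmp C h g) f)"

text \<open>
  Hom-sets of different pairs of objects may overlap, so the action of a functor on morphisms takes
  source and target as arguments.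
\<close>

definition is_functor ::
  "('o, 'm) cat \<Rightarrow> ('p, 'n) cat \<Rightarrow> ('o \<Rightarrow> 'p) \<Rightarrow> ('o \<Rightarrow> 'o \<Rightarrow> 'm \<Rightarrow> 'n) \<Rightarrow> bool" where
  "is_functor C D Fo Fm \<longleftrightarrow>
     (\<forall>a\<in>ob C. Fo a \<in> ob D) \<and>
     (\<forall>a\<in>ob C. \<forall>b\<in>ob C. \<forall>f\<in>hom C a b. Fm a b f \<in> hom D (Fo a) (Fo b)) \<and>
     (\<forall>a\<in>ob C. Fm a a (idn C a) = idn D (Fo a)) \<and>
     (\<forall>a\<in>ob C. \<forall>b\<in>ob C. \<forall>c\<in>ob C. \<forall>f\<in>hom C a b. \<forall>g\<in>hom C b c.
        Fm a c (cmp C g f) = cmp D (Fm b c g) (Fm a b f))"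

definition is_iso :: "('o, 'm) cat \<Rightarrow> 'o \<Rightarrow> 'o \<Rightarrow> 'm \<Rightarrow> bool" where
  "is_iso C a b f \<longleftrightarrow> f \<in> hom C a b \<and> (\<exists>g\<in>hom C b a. cmp C g f = idn C a \<and> cmp C f g = idn C b)"

definition natural_iso ::
  "('o, 'm) cat \<Rightarrow> ('p, 'n) cat \<Rightarrow> ('o \<Rightarrow> 'p) \<Rightarrow> ('o \<Rightarrow> 'o \<Rightarrow> 'm \<Rightarrow> 'n)
     \<Rightarrow> ('o \<Rightarrow> 'p) \<Rightarrow> ('o \<Rightarrow> 'o \<Rightarrow> 'm \<Rightarrow> 'n) \<Rightarrow> ('o \<Rightarrow> 'n) \<Rightarrow> bool" where
  "natural_iso C D Fo Fm Go Gm \<eta> \<longleftrightarrow>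
     (\<forall>a\<in>ob C. is_iso D (Fo a) (Go a) (\<eta> a)) \<and>
     (\<forall>a\<in>ob C. \<forall>b\<in>ob C. \<forall>f\<in>hom C a b. cmp D (\<eta> b) (Fm a b f) = cmp D (Gm a b f) (\<eta> a))"

definition is_equivalence ::
  "('o, 'm) cat \<Rightarrow> ('p, 'n) cat \<Rightarrow> ('o \<Rightarrow> 'p) \<Rightarrow> ('o \<Rightarrow> 'o \<Rightarrow> 'm \<Rightarrow> 'n) \<Rightarrow> bool" where
  "is_equivalence C D Fo Fm \<longleftrightarrow>
     category C \<and> category D \<and> is_functor C D Fo Fm \<and>
     (\<exists>Go Gm \<eta> \<epsilon>. is_functor D C Go Gm \<and>
        natural_iso C C (\<lambda>a. a) (\<lambda>a b f. f)
          (\<lambda>a. Go (Fo a)) (\<lambda>a b f. Gm (Fo a) (Fo b) (Fm a b f)) \<eta> \<and>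
        natural_iso D D (\<lambda>a. Fo (Go a)) (\<lambda>a b f. Fm (Go a) (Go b) (Gm a b f))
          (\<lambda>a. a) (\<lambda>a b f. f) \<epsilon>)"


section \<open>Graded comodules\<close>

text \<open>
  A graded Hopf algebra \<open>X/N\<close> presented by words: \<open>X = gh_reps\<close> and \<open>N = gh_null\<close> are subspaces of
  the free space on \<open>'w\<close>, both homogeneous for \<open>gh_deg\<close>, and the structure maps are given on words
  and extended linearly.  Tensor products of copies of \<open>X/N\<close> are formed inside those of the
  free space modulo \<open>N\<close>; over a field this embedding is injective.
  Comodules only see the coalgebra structure; \<open>gh_mult\<close> and \<open>gh_unit\<close> complete the data of the
  Hopf algebra (the antipode is determined, the algebra being graded and connected).  For
  \<open>H0_hopf\<close> below, \<open>X/N\<close> is a Hopf subalgebra of \<open>A(\<O>)\<close>, whose comodules are the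
  \<open>A(\<O>)\<close>-comodules with coaction in \<open>(X/N) \<otimes> V\<close>.
\<close>

record 'w graded_hopf =
  gh_deg :: "'w \<Rightarrow> nat"
  gh_reps :: "('w \<Rightarrow>\<^sub>0 rat) set"
  gh_null :: "('w \<Rightarrow>\<^sub>0 rat) set"
  gh_mult :: "'w \<Rightarrow> 'w \<Rightarrow> ('w \<Rightarrow>\<^sub>0 rat)"
  gh_unit :: "'w \<Rightarrow>\<^sub>0 rat"
  gh_comult :: "'w \<Rightarrow> ('w \<times> 'w \<Rightarrow>\<^sub>0 rat)"
  gh_counit :: "'w \<Rightarrow> rat"

definition gh_part :: "'w graded_hopf \<Rightarrow> nat \<Rightarrow> ('w \<Rightarrow>\<^sub>0 rat) set" where
  "gh_part A k = {x \<in> gh_reps A. \<forall>w\<in>Poly_Mapping.keys x. gh_deg A w = k}"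

text \<open>The kernels of \<open>Free('w) \<otimes> Y \<rightarrow> (Free('w)/N) \<otimes> Y\<close> and of
  \<open>Free('w) \<otimes> Free('w) \<otimes> Y \<rightarrow> (Free('w)/N) \<otimes> (Free('w)/N) \<otimes> Y\<close>, with \<open>Y = Free('b)\<close>.\<close>

definition null1 :: "'w graded_hopf \<Rightarrow> ('w \<times> 'b \<Rightarrow>\<^sub>0 rat) set" where
  "null1 A = pm.span {tens \<nu> y | \<nu> y. \<nu> \<in> gh_null A}"

definition null2 :: "'w graded_hopf \<Rightarrow> ('w \<times> 'w \<times> 'b \<Rightarrow>\<^sub>0 rat) set" where
  "null2 A = pm.span ({tens \<nu> (tens x y) | \<nu> x y. \<nu> \<in> gh_null A}
                    \<union> {tens x (tens \<nu> y) | x \<nu> y. \<nu> \<in> gh_null A})"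

text \<open>
  \<open>id_tens f\<close> is \<open>id \<otimes> f\<close>: it writes \<open>p = \<Sum>\<^sub>w w \<otimes> p\<^sub>w\<close> and sends it to \<open>\<Sum>\<^sub>w w \<otimes> f w p\<^sub>w\<close>.  The map
  \<open>f\<close> may depend on \<open>w\<close>, because for graded \<open>V\<close> the component \<open>p\<^sub>w\<close> lives in a degree depending on
  that of \<open>w\<close>.
\<close>

definition slice :: "'w \<Rightarrow> ('w \<times> 'b \<Rightarrow>\<^sub>0 rat) \<Rightarrow> ('b \<Rightarrow>\<^sub>0 rat)" where
  "slice w p = linext (\<lambda>(w', i). if w' = w then Poly_Mapping.single i 1 else 0) p"

definition id_tens ::
  "('w \<Rightarrow> ('b \<Rightarrow>\<^sub>0 rat) \<Rightarrow> ('c \<Rightarrow>\<^sub>0 rat)) \<Rightarrow> ('w \<times> 'b \<Rightarrow>\<^sub>0 rat) \<Rightarrow> ('w \<times> 'c \<Rightarrow>\<^sub>0 rat)" where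
  "id_tens f p = (\<Sum>w\<in>fst ` Poly_Mapping.keys p. tens (Poly_Mapping.single w 1) (f w (slice w p)))"

definition comult_tens_id ::
  "'w graded_hopf \<Rightarrow> ('w \<times> 'b \<Rightarrow>\<^sub>0 rat) \<Rightarrow> ('w \<times> 'w \<times> 'b \<Rightarrow>\<^sub>0 rat)" where
  "comult_tens_id A =
     linext (\<lambda>(w, i). linext (\<lambda>(w1, w2). Poly_Mapping.single (w1, w2, i) 1) (gh_comult A w))"

definition counit_tens_id :: "'w graded_hopf \<Rightarrow> ('w \<times> 'b \<Rightarrow>\<^sub>0 rat) \<Rightarrow> ('b \<Rightarrow>\<^sub>0 rat)" where
  "counit_tens_id A = linext (\<lambda>(w, i). Poly_Mapping.single i (gh_counit A w))"

text \<open>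
  A graded space is a family \<open>V\<^sub>n\<close>, \<open>n \<in> \<int>\<close>, standing for the external direct sum.  The coaction
  preserves degrees: \<open>V\<^sub>n \<rightarrow> \<Oplus>\<^sub>k A\<^sub>k \<otimes> V\<^sub>n\<^sub>-\<^sub>k\<close>.  The summands stay separate inside \<open>Free('w) \<otimes> \<rat>\<^sup>(\<^sup>\<nat>\<^sup>)\<close>
  because words of different degrees are different basis elements.
\<close>

record 'w comodule =
  cm_space :: "int \<Rightarrow> qvec set"
  cm_coact :: "int \<Rightarrow> qvec \<Rightarrow> ('w \<times> nat \<Rightarrow>\<^sub>0 rat)"

definition graded_comodule :: "'w graded_hopf \<Rightarrow> 'w comodule \<Rightarrow> bool" where
  "graded_comodule A M \<longleftrightarrow>
     (\<forall>n. findim (cm_space M n)) \<and> finite {n. cm_space M n \<noteq> {0}} \<and>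
     (\<forall>n. \<forall>v\<in>cm_space M n. cm_coact M n v \<in>
        pm.span (\<Union>k. {tens a v' | a v'. a \<in> gh_part A k \<and> v' \<in> cm_space M (n - int k)})) \<and>
     (\<forall>n. \<forall>u\<in>cm_space M n. \<forall>v\<in>cm_space M n.
        cm_coact M n (u + v) - (cm_coact M n u + cm_coact M n v) \<in> null1 A) \<and>
     (\<forall>n q. \<forall>v\<in>cm_space M n. cm_coact M n (scl q v) - scl q (cm_coact M n v) \<in> null1 A) \<and>
     (\<forall>n. \<forall>v\<in>cm_space M n. counit_tens_id A (cm_coact M n v) = v) \<and>
     (\<forall>n. \<forall>v\<in>cm_space M n.
        comult_tens_id A (cm_coact M n v)
        - id_tens (\<lambda>w. cm_coact M (n - int (gh_deg A w))) (cm_coact M n v) \<in> null2 A)"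

definition comodule_hom ::
  "'w graded_hopf \<Rightarrow> 'w comodule \<Rightarrow> 'w comodule \<Rightarrow> (int \<Rightarrow> qvec \<Rightarrow> qvec) set" where
  "comodule_hom A M M' = {\<phi>.
     (\<forall>n. qlinear (cm_space M n) (cm_space M' n) (\<phi> n)) \<and>
     (\<forall>n v. v \<notin> cm_space M n \<longrightarrow> \<phi> n v = 0) \<and>
     (\<forall>n. \<forall>v\<in>cm_space M n.
        id_tens (\<lambda>w. \<phi> (n - int (gh_deg A w))) (cm_coact M n v) - cm_coact M' n (\<phi> n v) \<in> null1 A)}"

definition comodule_cat :: "'w graded_hopf \<Rightarrow> ('w comodule, int \<Rightarrow> qvec \<Rightarrow> qvec) cat" where
  "comodule_cat A = \<lparr>
     ob = {M. graded_comodule A M},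
     hom = comodule_hom A,
     idn = (\<lambda>M n v. if v \<in> cm_space M n then v else 0),
     cmp = (\<lambda>\<psi> \<phi> n v. \<psi> n (\<phi> n v)) \<rparr>"


section \<open>The Hopf algebra \<open>H\<^sup>0\<^sub>D(A(\<Omega>\<^sub>U))\<close>\<close>

text \<open>
  For \<open>U\<close> open in \<open>\<complex>\<close>, a pair \<open>(f, g)\<close> stands for the holomorphic form \<open>f + g dz\<close>.  Functions on
  \<open>U\<close> are extended by \<open>0\<close>, so that equality of HOL functions is equality on \<open>U\<close>.  Addition and
  multiplication of functions and addition of pairs are pointwise resp. componentwise.
\<close>

type_synonym form = "(complex \<Rightarrow> complex) \<times> (complex \<Rightarrow> complex)"

definition holo_funs :: "complex set \<Rightarrow> (complex \<Rightarrow> complex) set" where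
  "holo_funs U = {f. f holomorphic_on U \<and> (\<forall>z. z \<notin> U \<longrightarrow> f z = 0)}"

definition forms :: "complex set \<Rightarrow> form set" where
  "forms U = holo_funs U \<times> holo_funs U"

definition forms0 :: "complex set \<Rightarrow> form set" where
  "forms0 U = holo_funs U \<times> {0}"

definition const_form :: "complex set \<Rightarrow> complex \<Rightarrow> form" where
  "const_form U c = ((\<lambda>z. if z \<in> U then c else 0), 0)"

definition form_scale :: "complex \<Rightarrow> form \<Rightarrow> form" where
  "form_scale c x = ((\<lambda>z. c * fst x z), (\<lambda>z. c * snd x z))"

definition form_mult :: "form \<Rightarrow> form \<Rightarrow> form" where
  "form_mult x y = (fst x * fst y, fst x * snd y + snd x * fst y)"

definition form_d :: "complex set \<Rightarrow> form \<Rightarrow> form" where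
  "form_d U x = (0, (\<lambda>z. if z \<in> U then deriv (fst x) z else 0))"

text \<open>The additive extension of \<open>x \<mapsto> (-1)\<^bsup>|x|\<^esup> x\<close> from homogeneous to arbitrary forms.\<close>

definition form_sign :: "form \<Rightarrow> form" where
  "form_sign x = (fst x, - snd x)"

text \<open>
  A word \<open>[x\<^sub>1, \<dots>, x\<^sub>n]\<close> represents the class of \<open>x\<^sub>1 \<otimes> \<dots> \<otimes> x\<^sub>n\<close> in \<open>A\<^sub>n(\<Omega>\<^sub>U)\<close>, whose first factor is
  \<open>\<Omega>\<^sub>U/\<rat>(1)\<close>; the empty word spans \<open>A\<^sub>0 = \<rat>\<close>.  Hence \<open>A(\<Omega>\<^sub>U)\<close> is the free space on words in
  \<open>forms U\<close> modulo the span of the relations below: multilinearity over \<open>\<rat>\<close>, and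
  vanishing if the first letter is in \<open>\<rat>(1)\<close>.  For functions the class of the first letter
  \<open>x\<^sub>1\<close> in \<open>\<O>/\<rat>(1)\<close> is \<open>e\<^bsup>x\<^sub>1\<^esup>\<close> in \<open>\<O>\<^sup>* \<otimes> \<rat>\<close>, so that the projection \<open>pr\<close> is the identity on words.
\<close>

type_synonym fword = "form list"

definition tensor_rels :: "complex set \<Rightarrow> (fword \<Rightarrow>\<^sub>0 rat) set" where
  "tensor_rels U =
     {Poly_Mapping.single (u @ [x + y] @ v) 1
        - (Poly_Mapping.single (u @ [x] @ v) 1 + Poly_Mapping.single (u @ [y] @ v) 1)
      | u x y v. u \<in> lists (forms U) \<and> x \<in> forms U \<and> y \<in> forms U \<and> v \<in> lists (forms U)} \<union>
     {Poly_Mapping.single (u @ [form_scale (of_rat q) x] @ v) 1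
        - scl q (Poly_Mapping.single (u @ [x] @ v) 1)
      | u q x v. u \<in> lists (forms U) \<and> x \<in> forms U \<and> v \<in> lists (forms U)} \<union>
     {Poly_Mapping.single (const_form U (2 * pi * \<i> * of_rat q) # v) 1
      | q v. v \<in> lists (forms U)}"

definition cons_lin :: "form \<Rightarrow> (fword \<Rightarrow>\<^sub>0 rat) \<Rightarrow> (fword \<Rightarrow>\<^sub>0 rat)" where
  "cons_lin x = linext (\<lambda>w. Poly_Mapping.single (x # w) 1)"

fun diff_word :: "complex set \<Rightarrow> fword \<Rightarrow> (fword \<Rightarrow>\<^sub>0 rat)" where
  "diff_word U (x # y # w) =
     Poly_Mapping.single (form_mult (form_d U x) y # w) 1
     + cons_lin (form_sign x) (diff_word U (y # w))"
| "diff_word U [x] = 0"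
| "diff_word U [] = 0"

fun mult_word :: "complex set \<Rightarrow> fword \<Rightarrow> fword \<Rightarrow> (fword \<Rightarrow>\<^sub>0 rat)" where
  "mult_word U [] w = Poly_Mapping.single w 1"
| "mult_word U (x # xs) [] = Poly_Mapping.single (x # xs) 1"
| "mult_word U (x # xs) (y # ys) =
     cons_lin x (mult_word U xs (y # ys)) + cons_lin y (mult_word U (x # xs) ys)
     - cons_lin (form_scale (1 / (2 * pi * \<i>)) (form_mult x y))
         (cons_lin (const_form U (2 * pi * \<i>)) (mult_word U xs ys))"

text \<open>
  Becoming the first letter of the second tensor factor turns \<open>g\<^sub>j\<^sub>+\<^sub>1\<close> into \<open>e\<^bsup>g\<^sub>j\<^sub>+\<^sub>1\<^esup>\<close>, by the convention
  on first letters.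
\<close>

definition comult_word :: "fword \<Rightarrow> (fword \<times> fword \<Rightarrow>\<^sub>0 rat)" where
  "comult_word w =
     (if w = [] then Poly_Mapping.single ([], []) 1
      else Poly_Mapping.single ([], w) 1 + Poly_Mapping.single (w, []) 1
           + (\<Sum>j = 1..<length w. Poly_Mapping.single (take j w, drop j w) 1))"

text \<open>\<open>A(\<O>)\<close> is the image in \<open>A(\<Omega>\<^sub>U)\<close> of the span of the words in \<open>forms0 U\<close>.\<close>

definition words0 :: "complex set \<Rightarrow> (fword \<Rightarrow>\<^sub>0 rat) set" where
  "words0 U = pm.span {Poly_Mapping.single w 1 | w. w \<in> lists (forms0 U)}"

definition H0_hopf :: "complex set \<Rightarrow> fword graded_hopf" where
  "H0_hopf U = \<lparr>
     gh_deg = length,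
     gh_reps = {x \<in> words0 U. linext (diff_word U) x \<in> pm.span (tensor_rels U)},
     gh_null = words0 U \<inter> pm.span (tensor_rels U),
     gh_mult = mult_word U,
     gh_unit = Poly_Mapping.single [] 1,
     gh_comult = comult_word,
     gh_counit = (\<lambda>w. if w = [] then 1 else 0) \<rparr>"


section \<open>Variations of mixed Hodge-Tate structures\<close>

text \<open>
  A local system of finite dimensional rational vector spaces, given by its espace etale: fibres
  \<open>H z\<close> and a topology on the total space \<open>{(z, v). z \<in> U \<and> v \<in> H z}\<close> that is locally, over
  \<open>U\<close> and linearly on fibres, a product with a discrete vector space.
\<close>

definition local_system ::
  "complex set \<Rightarrow> (complex \<times> qvec) topology \<Rightarrow> (complex \<Rightarrow> qvec set) \<Rightarrow> bool" where
  "local_system U T H \<longleftrightarrow>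
     (\<forall>z\<in>U. findim (H z)) \<and> topspace T = Sigma U H \<and> continuous_map T (top_of_set U) fst \<and>
     (\<forall>z0\<in>U. \<exists>N V \<tau>. open N \<and> z0 \<in> N \<and> N \<subseteq> U \<and> findim V \<and>
        (\<forall>z\<in>N. qlinear V (H z) (\<tau> z)) \<and>
        homeomorphic_map (prod_topology (top_of_set N) (discrete_topology V))
          (subtopology T (Sigma N H)) (\<lambda>(z, v). (z, \<tau> z v)))"

definition flat_section ::
  "(complex \<times> qvec) topology \<Rightarrow> complex set \<Rightarrow> (complex \<Rightarrow> qvec) \<Rightarrow> bool" where
  "flat_section T N \<sigma> \<longleftrightarrow> continuous_map (top_of_set N) T (\<lambda>z. (z, \<sigma> z))"

text \<open>
  A list of pairs \<open>(f\<^sub>i, \<sigma>\<^sub>i)\<close> with \<open>f\<^sub>i\<close> holomorphic and \<open>\<sigma>\<^sub>i\<close> flat on \<open>N\<close> stands for the section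
  \<open>s = \<Sum>\<^sub>i \<sigma>\<^sub>i \<otimes> f\<^sub>i\<close> of \<open>H \<otimes> \<O>\<close> over \<open>N\<close>; then \<open>\<nabla>s = (\<Sum>\<^sub>i \<sigma>\<^sub>i \<otimes> f\<^sub>i') dz\<close>.
\<close>

type_synonym hexpr = "((complex \<Rightarrow> complex) \<times> (complex \<Rightarrow> qvec)) list"

definition hexprs :: "(complex \<times> qvec) topology \<Rightarrow> complex set \<Rightarrow> hexpr set" where
  "hexprs T N = lists {(f, \<sigma>). f holomorphic_on N \<and> flat_section T N \<sigma>}"

definition hval :: "hexpr \<Rightarrow> complex \<Rightarrow> cvec" where
  "hval ps z = (\<Sum>(f, \<sigma>)\<leftarrow>ps. ctens (f z) (\<sigma> z))"

definition hnabla :: "hexpr \<Rightarrow> complex \<Rightarrow> cvec" where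
  "hnabla ps z = (\<Sum>(f, \<sigma>)\<leftarrow>ps. ctens (deriv f z) (\<sigma> z))"

definition holo_section ::
  "(complex \<times> qvec) topology \<Rightarrow> complex set \<Rightarrow> (complex \<Rightarrow> cvec) \<Rightarrow> bool" where
  "holo_section T N s \<longleftrightarrow>
     (\<forall>z0\<in>N. \<exists>N' ps. open N' \<and> z0 \<in> N' \<and> N' \<subseteq> N \<and> ps \<in> hexprs T N' \<and> (\<forall>z\<in>N'. s z = hval ps z))"

text \<open>A holomorphic subbundle is locally spanned by a pointwise independent holomorphic frame.\<close>

definition holo_subbundle ::
  "complex set \<Rightarrow> (complex \<times> qvec) topology \<Rightarrow> (complex \<Rightarrow> cvec set) \<Rightarrow> bool" where
  "holo_subbundle U T F \<longleftrightarrow>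
     (\<forall>z0\<in>U. \<exists>N ss. open N \<and> z0 \<in> N \<and> N \<subseteq> U \<and> (\<forall>s\<in>set ss. holo_section T N s) \<and>
        (\<forall>z\<in>N. distinct (map (\<lambda>s. s z) ss) \<and> \<not> pm.dependent (set (map (\<lambda>s. s z) ss))
           \<and> pm.span (set (map (\<lambda>s. s z) ss)) = F z))"

definition griffiths_transversal ::
  "complex set \<Rightarrow> (complex \<times> qvec) topology \<Rightarrow> (int \<Rightarrow> complex \<Rightarrow> cvec set) \<Rightarrow> bool" where
  "griffiths_transversal U T F \<longleftrightarrow>
     (\<forall>p N ps. open N \<and> N \<subseteq> U \<and> ps \<in> hexprs T N \<and> (\<forall>z\<in>N. hval ps z \<in> F p z)
        \<longrightarrow> (\<forall>z\<in>N. hnabla ps z \<in> F (p - 1) z))"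

text \<open>
  Subspaces of \<open>gr\<^sup>W\<^sub>m \<otimes> \<complex>\<close> are represented by their preimages in \<open>W\<^sub>m \<otimes> \<complex>\<close>.  In particular
  \<open>gr_filt W m F'\<close> is the filtration step on \<open>gr\<^sup>W\<^sub>m \<otimes> \<complex>\<close> induced by \<open>F'\<close>, the zero subspace
  is \<open>W\<^sub>m\<^sub>-\<^sub>1 \<otimes> \<complex>\<close>, and the whole space is \<open>W\<^sub>m \<otimes> \<complex>\<close>.
\<close>

definition sum_space :: "cvec set \<Rightarrow> cvec set \<Rightarrow> cvec set" where
  "sum_space S S' = {x + y | x y. x \<in> S \<and> y \<in> S'}"

definition gr_filt :: "(int \<Rightarrow> qvec set) \<Rightarrow> int \<Rightarrow> cvec set \<Rightarrow> cvec set" where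
  "gr_filt W m F' =
     sum_space (F' \<inter> complexification (W m)) (complexification (W (m - 1)))"

text \<open>\<open>gr\<^sup>W\<^sub>m\<close> carries a pure Hodge structure of weight \<open>m\<close>: the induced filtration and its
  conjugate are \<open>m\<close>-opposed, \<open>gr\<^sup>W\<^sub>m \<otimes> \<complex> = F\<^sup>p \<oplus> conj F\<^bsup>m+1-p\<^esup>\<close> for all \<open>p\<close>.\<close>

definition mixed_hodge :: "(int \<Rightarrow> qvec set) \<Rightarrow> (int \<Rightarrow> cvec set) \<Rightarrow> bool" where
  "mixed_hodge W F \<longleftrightarrow>
     (\<forall>m p. gr_filt W m (F p) \<inter> gr_filt W m (conj_space (F (m + 1 - p)))
              = complexification (W (m - 1)) \<and>
            sum_space (gr_filt W m (F p)) (gr_filt W m (conj_space (F (m + 1 - p))))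
              = complexification (W m))"

definition hodge_tate :: "(int \<Rightarrow> qvec set) \<Rightarrow> (int \<Rightarrow> cvec set) \<Rightarrow> bool" where
  "hodge_tate W F \<longleftrightarrow> mixed_hodge W F \<and>
     (\<forall>m. odd m \<longrightarrow> W m = W (m - 1)) \<and>
     (\<forall>n. complexification (W (2 * n))
            = gr_filt W (2 * n) (F n) \<inter> gr_filt W (2 * n) (conj_space (F n)))"

record variation =
  vt_fib :: "complex \<Rightarrow> qvec set"
  vt_top :: "(complex \<times> qvec) topology"
  vt_W :: "int \<Rightarrow> complex \<Rightarrow> qvec set"
  vt_F :: "int \<Rightarrow> complex \<Rightarrow> cvec set"

definition HT_variation :: "complex set \<Rightarrow> variation \<Rightarrow> bool" where
  "HT_variation U X \<longleftrightarrow>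
     local_system U (vt_top X) (vt_fib X) \<and>
     (\<forall>m. \<forall>z\<in>U. vt_W X m z \<subseteq> vt_W X (m + 1) z \<and> vt_W X m z \<subseteq> vt_fib X z) \<and>
     (\<forall>m. local_system U (subtopology (vt_top X) (Sigma U (vt_W X m))) (vt_W X m)) \<and>
     (\<exists>a b. \<forall>z\<in>U. vt_W X a z = {0} \<and> vt_W X b z = vt_fib X z) \<and>
     (\<forall>p. holo_subbundle U (vt_top X) (vt_F X p)) \<and>
     (\<forall>p. \<forall>z\<in>U. vt_F X (p + 1) z \<subseteq> vt_F X p z) \<and>
     griffiths_transversal U (vt_top X) (vt_F X) \<and>
     (\<forall>z\<in>U. hodge_tate (\<lambda>m. vt_W X m z) (\<lambda>p. vt_F X p z))"

text \<open>The complexification of \<open>f\<close> sends \<open>\<Sum>\<^sub>i v\<^sub>i \<otimes> c\<^sub>i\<close> to \<open>\<Sum>\<^sub>i f v\<^sub>i \<otimes> c\<^sub>i\<close>; this says that it maps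
  \<open>S \<subseteq> V \<otimes> \<complex>\<close> into \<open>S'\<close>.\<close>

definition complexified_maps :: "qvec set \<Rightarrow> (qvec \<Rightarrow> qvec) \<Rightarrow> cvec set \<Rightarrow> cvec set \<Rightarrow> bool" where
  "complexified_maps V f S S' \<longleftrightarrow>
     (\<forall>cs :: (complex \<times> qvec) list. snd ` set cs \<subseteq> V \<and> (\<Sum>(c, v)\<leftarrow>cs. ctens c v) \<in> S
        \<longrightarrow> (\<Sum>(c, v)\<leftarrow>cs. ctens c (f v)) \<in> S')"

definition variation_hom ::
  "complex set \<Rightarrow> variation \<Rightarrow> variation \<Rightarrow> (complex \<Rightarrow> qvec \<Rightarrow> qvec) set" where
  "variation_hom U X Y = {\<phi>.
     (\<forall>z\<in>U. qlinear (vt_fib X z) (vt_fib Y z) (\<phi> z)) \<and>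
     (\<forall>z v. z \<notin> U \<or> v \<notin> vt_fib X z \<longrightarrow> \<phi> z v = 0) \<and>
     continuous_map (vt_top X) (vt_top Y) (\<lambda>(z, v). (z, \<phi> z v)) \<and>
     (\<forall>m. \<forall>z\<in>U. \<phi> z ` vt_W X m z \<subseteq> vt_W Y m z) \<and>
     (\<forall>p. \<forall>z\<in>U. complexified_maps (vt_fib X z) (\<phi> z) (vt_F X p z) (vt_F Y p z))}"

definition variation_cat :: "complex set \<Rightarrow> (variation, complex \<Rightarrow> qvec \<Rightarrow> qvec) cat" where
  "variation_cat U = \<lparr>
     ob = {X. HT_variation U X},
     hom = variation_hom U,
     idn = (\<lambda>X z v. if z \<in> U \<and> v \<in> vt_fib X z then v else 0),
     cmp = (\<lambda>\<psi> \<phi> z v. \<psi> z (\<phi> z v)) \<rparr>"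


section \<open>Compatibility with the fibre functors\<close>

text \<open>
  A functor from graded comodules to variations is compatible with the canonical fibre functors if
  it comes with isomorphisms of local systems from the constant one \<open>V\<^sub>n\<close> to \<open>gr\<^sup>W\<^sub>2\<^sub>n\<close>, natural in the
  comodule.  Here \<open>\<theta> M n z v \<in> W\<^sub>2\<^sub>n\<close> represents the image of \<open>v\<close> in the fibre of
  \<open>gr\<^sup>W\<^sub>2\<^sub>n = W\<^sub>2\<^sub>n / W\<^sub>2\<^sub>n\<^sub>-\<^sub>1\<close> at \<open>z\<close>.
\<close>

definition gr_compatible ::
  "fword graded_hopf \<Rightarrow> complex set \<Rightarrow> (fword comodule \<Rightarrow> variation)
     \<Rightarrow> (fword comodule \<Rightarrow> fword comodule \<Rightarrow> (int \<Rightarrow> qvec \<Rightarrow> qvec) \<Rightarrow> (complex \<Rightarrow> qvec \<Rightarrow> qvec))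
     \<Rightarrow> bool" where
  "gr_compatible A U Fo Fm \<longleftrightarrow>
     (\<exists>\<theta> :: fword comodule \<Rightarrow> int \<Rightarrow> complex \<Rightarrow> qvec \<Rightarrow> qvec.
       (\<forall>M\<in>ob (comodule_cat A). \<forall>n. \<forall>z\<in>U.
          (\<forall>v\<in>cm_space M n. \<theta> M n z v \<in> vt_W (Fo M) (2 * n) z) \<and>
          (\<forall>u\<in>cm_space M n. \<forall>v\<in>cm_space M n.
             \<theta> M n z (u + v) - (\<theta> M n z u + \<theta> M n z v) \<in> vt_W (Fo M) (2 * n - 1) z) \<and>
          (\<forall>q. \<forall>v\<in>cm_space M n.
             \<theta> M n z (scl q v) - scl q (\<theta> M n z v) \<in> vt_W (Fo M) (2 * n - 1) z) \<and>
          (\<forall>v\<in>cm_space M n. \<theta> M n z v \<in> vt_W (Fo M) (2 * n - 1) z \<longrightarrow> v = 0) \<and>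
          (\<forall>x\<in>vt_W (Fo M) (2 * n) z. \<exists>v\<in>cm_space M n. x - \<theta> M n z v \<in> vt_W (Fo M) (2 * n - 1) z)) \<and>
       (\<forall>M\<in>ob (comodule_cat A). \<forall>n. \<forall>v\<in>cm_space M n. \<forall>z0\<in>U.
          \<exists>N \<sigma>. open N \<and> z0 \<in> N \<and> N \<subseteq> U \<and> flat_section (vt_top (Fo M)) N \<sigma> \<and>
            (\<forall>z\<in>N. \<sigma> z \<in> vt_W (Fo M) (2 * n) z \<and> \<sigma> z - \<theta> M n z v \<in> vt_W (Fo M) (2 * n - 1) z)) \<and>
       (\<forall>M\<in>ob (comodule_cat A). \<forall>M'\<in>ob (comodule_cat A). \<forall>\<phi>\<in>hom (comodule_cat A) M M'.
          \<forall>n. \<forall>v\<in>cm_space M n. \<forall>z\<in>U.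
            Fm M M' \<phi> z (\<theta> M n z v) - \<theta> M' n z (\<phi> n v) \<in> vt_W (Fo M') (2 * n - 1) z))"

end

theory Submission
  imports Defs "HOL-Complex_Analysis.Cauchy_Integral_Formula"
begin

text \<open>Fix a \<open>\<rat>\<close>-linear functional \<open>e\<close> on functions with \<open>e(2\<pi>i) = 1\<close>.  Both categories are compared with the same
  category of period matrices: a finite index set with degrees \<open>d\<close> and a unipotent matrix \<open>S\<close> of holomorphic functions,
  strictly triangular for \<open>d\<close> off the diagonal, with \<open>dS\<^sub>i\<^sub>j = \<Sum> dS\<^sub>i\<^sub>l S\<^sub>l\<^sub>j\<close> (sum over \<open>d l = d i - 1\<close>) and
  \<open>e(2\<pi>i S\<^sub>i\<^sub>j) = 0\<close> for \<open>i \<noteq> j\<close>; morphisms are the graded rational matrices that intertwine the period matrices.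
  The matrix coefficients of a comodule are determined by letters \<open>g\<^sub>i\<^sub>j = - 2\<pi>i S\<^sub>i\<^sub>j\<close>, because products of rational
  functionals separate \<open>A(\<O>)\<close> and coassociativity reduces them to the words \<open>g \<otimes> 2\<pi>i \<otimes> \<dots> \<otimes> 2\<pi>i\<close>; the condition
  \<open>D = 0\<close> is the differential equation.  On a disc the local system of a variation is trivial, the decomposition
  \<open>F\<^sup>p \<oplus> W\<^sub>2\<^sub>p\<^sub>-\<^sub>2 = H\<close> near weight \<open>2p\<close> produces the rows of \<open>S\<close>, Griffiths transversality is the same differential
  equation, and the gauge condition on \<open>e\<close> singles out the rational frame.\<close>

text \<open>The obstacle is the quotient by \<open>\<rat>(1)\<close> in the first tensor factor: a
  matrix coefficient of a comodule fixes its letters only up to rational multiples of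
  \<open>2\<pi>i\<close>. On the side of variations this corresponds to the rational unipotent
  changes of a flat frame that respect the weight filtration. The functional \<open>e\<close>
  removes both ambiguities at once: it lifts classes modulo \<open>\<rat>(1)\<close> to functions,
  and it normalises the flat frame, that is, it splits the weight filtration rationally. It is not
  canonical, and the functor depends on it; but on graded pieces the functor acts as the comodule
  morphism itself, which gives the compatibility with the fibre functors. The letters
  \<open>2\<pi>i\<close> pad a step of height \<open>h\<close> to weight \<open>h\<close>. They are
  closed, and they vanish at the beginning of a tensor factor, so the differential and the coproduct
  hardly see them. The factor \<open>- 2\<pi>i\<close> is forced: with letters \<open>c S\<close>
  the terms of \<open>D\<close> add up to multiples of \<open>c * 2\<pi>i + c * c\<close>.\<close>

abbreviation lookup where "lookup \<equiv> Poly_Mapping.lookup"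
abbreviation single where "single \<equiv> Poly_Mapping.single"
abbreviation keys where "keys \<equiv> Poly_Mapping.keys"


section \<open>Equivalences through common models\<close>

text \<open>The quasi-inverse picks an object of \<open>C\<close> over each \<open>y\<close> up to
  isomorphism. The counit \<open>ep\<close> is the chosen isomorphism; on morphisms one conjugates
  by it and pulls back along the bijection of hom-sets. Identities in \<open>C\<close> are checked
  after applying \<open>Fm\<close>, by faithfulness.\<close>

lemma is_equivalence_if_fully_faithful_ess_surj:
  assumes C: "category C" and D: "category D" and F: "is_functor C D Fo Fm"
    and ff: "\<And>a b. a \<in> ob C \<Longrightarrow> b \<in> ob C \<Longrightarrow> bij_betw (Fm a b) (hom C a b) (hom D (Fo a) (Fo b))"
    and es: "\<And>y. y \<in> ob D \<Longrightarrow> \<exists>x\<in>ob C. \<exists>g. is_iso D (Fo x) y g"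
  shows "is_equivalence C D Fo Fm"
proof -
  have "\<forall>y\<in>ob D. \<exists>x g g'. x \<in> ob C \<and> g \<in> hom D (Fo x) y \<and> g' \<in> hom D y (Fo x)
           \<and> cmp D g' g = idn D (Fo x) \<and> cmp D g g' = idn D y"
    using es unfolding is_iso_def by blast
  then obtain Go ep ei where G: "\<And>y. y \<in> ob D \<Longrightarrow> Go y \<in> ob C"
    and ep: "\<And>y. y \<in> ob D \<Longrightarrow> ep y \<in> hom D (Fo (Go y)) y"
    and ei: "\<And>y. y \<in> ob D \<Longrightarrow> ei y \<in> hom D y (Fo (Go y))"
    and ie: "\<And>y. y \<in> ob D \<Longrightarrow> cmp D (ei y) (ep y) = idn D (Fo (Go y))"
    and ee: "\<And>y. y \<in> ob D \<Longrightarrow> cmp D (ep y) (ei y) = idn D y"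
    by (metis (no_types, lifting) bchoice)
  have FO: "Fo a \<in> ob D" if "a \<in> ob C" for a using F that unfolding is_functor_def by blast
  have FM: "Fm a b f \<in> hom D (Fo a) (Fo b)" if "a \<in> ob C" "b \<in> ob C" "f \<in> hom C a b" for a b f
    using F that unfolding is_functor_def by blast
  have FI: "Fm a a (idn C a) = idn D (Fo a)" if "a \<in> ob C" for a
    using F that unfolding is_functor_def by blast
  have FC: "Fm a c (cmp C g f) = cmp D (Fm b c g) (Fm a b f)"
    if "a \<in> ob C" "b \<in> ob C" "c \<in> ob C" "f \<in> hom C a b" "g \<in> hom C b c" for a b c f g
    using F that unfolding is_functor_def by blast
  have Cid: "idn C a \<in> hom C a a" if "a \<in> ob C" for a using C that unfolding category_def by blast
  have Did: "idn D a \<in> hom D a a" if "a \<in> ob D" for a using D that unfolding category_def by blast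
  have Ccm: "cmp C g f \<in> hom C a c" if "a \<in> ob C" "b \<in> ob C" "c \<in> ob C" "f \<in> hom C a b" "g \<in> hom C b c" for a b c f g
    using C that unfolding category_def by blast
  have Dcm: "cmp D g f \<in> hom D a c" if "a \<in> ob D" "b \<in> ob D" "c \<in> ob D" "f \<in> hom D a b" "g \<in> hom D b c" for a b c f g
    using D that unfolding category_def by blast
  have Dl: "cmp D (idn D b) f = f" and Dr: "cmp D f (idn D a) = f" if "a \<in> ob D" "b \<in> ob D" "f \<in> hom D a b" for a b f
    using D that unfolding category_def by blast+
  have Das: "cmp D h (cmp D g f) = cmp D (cmp D h g) f"
    if "a \<in> ob D" "b \<in> ob D" "c \<in> ob D" "d \<in> ob D" "f \<in> hom D a b" "g \<in> hom D b c" "h \<in> hom D c d" for a b c d f g h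
    using D that unfolding category_def by blast
  \<comment> \<open>Hom-sets of different pairs of objects may overlap, so the inverse of
    \<open>Fm\<close> is taken for each pair separately.\<close>
  define L where "L a b = inv_into (hom C a b) (Fm a b)" for a b
  have L: "L a b g \<in> hom C a b" "Fm a b (L a b g) = g"
    if "a \<in> ob C" "b \<in> ob C" "g \<in> hom D (Fo a) (Fo b)" for a b g
    using ff[OF that(1,2)] that(3) unfolding L_def bij_betw_def
    by (metis inv_into_into, metis f_inv_into_f)
  have LU: "f = f'" if "a \<in> ob C" "b \<in> ob C" "f \<in> hom C a b" "f' \<in> hom C a b" "Fm a b f = Fm a b f'" for a b f f'
    using ff[OF that(1,2)] that(3-) unfolding bij_betw_def inj_on_def by blast
  define Gm where "Gm y y' f = L (Go y) (Go y') (cmp D (ei y') (cmp D f (ep y)))" for y y' f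
  define et where "et a = L a (Go (Fo a)) (ei (Fo a))" for a
  have arr: "cmp D (ei y') (cmp D f (ep y)) \<in> hom D (Fo (Go y)) (Fo (Go y'))"
    if "y \<in> ob D" "y' \<in> ob D" "f \<in> hom D y y'" for y y' f
    using that by (meson Dcm ei ep FO G)
  have GmH: "Gm y y' f \<in> hom C (Go y) (Go y')" and FGm: "Fm (Go y) (Go y') (Gm y y' f) = cmp D (ei y') (cmp D f (ep y))"
    if "y \<in> ob D" "y' \<in> ob D" "f \<in> hom D y y'" for y y' f
    unfolding Gm_def using L[OF G[OF that(1)] G[OF that(2)] arr[OF that]] by auto
  have GF: "is_functor D C Go Gm"
    unfolding is_functor_def
  proof (intro conjI ballI)
    fix a assume a: "a \<in> ob D" show "Go a \<in> ob C" using G a .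
    show "Gm a a (idn D a) = idn C (Go a)"
      by (rule LU[of "Go a" "Go a"]) (simp_all add: G a GmH Did Cid FGm FI ie Dl[OF FO[OF G[OF a]] a ep[OF a]])
  next
    fix a b f assume "a \<in> ob D" "b \<in> ob D" "f \<in> hom D a b"
    then show "Gm a b f \<in> hom C (Go a) (Go b)" by (rule GmH)
  next
    fix a b c f g assume h: "a \<in> ob D" "b \<in> ob D" "c \<in> ob D" "f \<in> hom D a b" "g \<in> hom D b c"
    note fo = FO[OF G[OF h(1)]] FO[OF G[OF h(2)]] FO[OF G[OF h(3)]]
    have fe: "cmp D f (ep a) \<in> hom D (Fo (Go a)) b" using Dcm fo h ep by blast
    have "cmp D (cmp D (ei c) (cmp D g (ep b))) (cmp D (ei b) (cmp D f (ep a)))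
        = cmp D (ei c) (cmp D (cmp D g (ep b)) (cmp D (ei b) (cmp D f (ep a))))"
      by (rule Das[symmetric, where a="Fo (Go a)" and b="Fo (Go b)" and c=c and d="Fo (Go c)"]) (use fo h fe ei ep Dcm in blast)+
    also have "cmp D (cmp D g (ep b)) (cmp D (ei b) (cmp D f (ep a))) = cmp D g (cmp D (ep b) (cmp D (ei b) (cmp D f (ep a))))"
      by (rule Das[symmetric, where a="Fo (Go a)" and b="Fo (Go b)" and c=b and d=c]) (use fo h fe ei ep Dcm in blast)+
    also have "cmp D (ep b) (cmp D (ei b) (cmp D f (ep a))) = cmp D (cmp D (ep b) (ei b)) (cmp D f (ep a))"
      by (rule Das[where a="Fo (Go a)" and c="Fo (Go b)" and b=b and d=b]) (use fo h fe ei ep Dcm in blast)+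
    also have "\<dots> = cmp D f (ep a)" using ee h Dl[OF fo(1) h(2) fe] by simp
    also have "cmp D g (cmp D f (ep a)) = cmp D (cmp D g f) (ep a)"
      by (rule Das[where a="Fo (Go a)" and b=a and c=b and d=c]) (use fo h fe ei ep Dcm in blast)+
    finally have eq: "cmp D (cmp D (ei c) (cmp D g (ep b))) (cmp D (ei b) (cmp D f (ep a))) = cmp D (ei c) (cmp D (cmp D g f) (ep a))" .
    have gf: "cmp D g f \<in> hom D a c" using Dcm h by blast
    have cc: "cmp C (Gm b c g) (Gm a b f) \<in> hom C (Go a) (Go c)" using Ccm[OF G[OF h(1)] G[OF h(2)] G[OF h(3)]] GmH h by blast
    have "Fm (Go a) (Go c) (cmp C (Gm b c g) (Gm a b f)) = cmp D (Fm (Go b) (Go c) (Gm b c g)) (Fm (Go a) (Go b) (Gm a b f))"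
      using FC[OF G[OF h(1)] G[OF h(2)] G[OF h(3)]] GmH h by blast
    then show "Gm a c (cmp D g f) = cmp C (Gm b c g) (Gm a b f)"
      by (intro LU[of "Go a" "Go c"]) (simp_all add: G h GmH gf cc FGm eq)
  qed
  have etH: "et a \<in> hom C a (Go (Fo a))" and Fet: "Fm a (Go (Fo a)) (et a) = ei (Fo a)" if "a \<in> ob C" for a
    unfolding et_def using L[OF that G[OF FO[OF that]] ei[OF FO[OF that]]] by auto
  have "natural_iso C C (\<lambda>a. a) (\<lambda>a b f. f) (\<lambda>a. Go (Fo a)) (\<lambda>a b f. Gm (Fo a) (Fo b) (Fm a b f)) et"
    unfolding natural_iso_def
  proof (intro conjI ballI)
    fix a assume a: "a \<in> ob C"
    let ?a = "Go (Fo a)"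
    have oa: "?a \<in> ob C" "Fo a \<in> ob D" using a G FO by auto
    define k where "k = L ?a a (ep (Fo a))"
    have k: "k \<in> hom C ?a a" "Fm ?a a k = ep (Fo a)" unfolding k_def using L[OF oa(1) a ep[OF oa(2)]] by auto
    have "cmp C k (et a) = idn C a"
      by (rule LU[of a a]) (use a oa k etH Ccm Cid FC[OF a oa(1) a etH[OF a] k(1)] ee Fet FI in auto)
    moreover have "cmp C (et a) k = idn C ?a"
      by (rule LU[of ?a ?a]) (use a oa k etH Ccm Cid FC[OF oa(1) a oa(1) k(1) etH[OF a]] ie Fet FI in auto)
    ultimately show "is_iso C a ?a (et a)" unfolding is_iso_def using k etH a by blast
  next
    fix a b f assume h: "a \<in> ob C" "b \<in> ob C" "f \<in> hom C a b"
    let ?a = "Go (Fo a)" and ?b = "Go (Fo b)"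
    have oa: "?a \<in> ob C" "Fo a \<in> ob D" "?b \<in> ob C" "Fo b \<in> ob D" "Fo ?a \<in> ob D" "Fo ?b \<in> ob D" using h G FO by auto
    have f: "Fm a b f \<in> hom D (Fo a) (Fo b)" using FM h by blast
    have g: "Gm (Fo a) (Fo b) (Fm a b f) \<in> hom C ?a ?b" using GmH oa f by blast
    have "cmp D (cmp D (ei (Fo b)) (cmp D (Fm a b f) (ep (Fo a)))) (ei (Fo a))
        = cmp D (ei (Fo b)) (cmp D (cmp D (Fm a b f) (ep (Fo a))) (ei (Fo a)))"
      by (rule Das[symmetric, where a="Fo a" and b="Fo ?a" and c="Fo b" and d="Fo ?b"]) (use oa f ei ep Dcm in blast)+
    also have "cmp D (cmp D (Fm a b f) (ep (Fo a))) (ei (Fo a)) = cmp D (Fm a b f) (cmp D (ep (Fo a)) (ei (Fo a)))"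
      by (rule Das[symmetric, where a="Fo a" and b="Fo ?a" and c="Fo a" and d="Fo b"]) (use oa f ei ep Dcm in blast)+
    also have "\<dots> = Fm a b f" using ee oa Dr[OF oa(2,4) f] by simp
    finally have eq: "cmp D (cmp D (ei (Fo b)) (cmp D (Fm a b f) (ep (Fo a)))) (ei (Fo a)) = cmp D (ei (Fo b)) (Fm a b f)" .
    show "cmp C (et b) f = cmp C (Gm (Fo a) (Fo b) (Fm a b f)) (et a)"
    proof (rule LU[of a ?b])
      show "cmp C (et b) f \<in> hom C a ?b" using Ccm[OF h(1,2) oa(3) h(3) etH[OF h(2)]] .
      show "cmp C (Gm (Fo a) (Fo b) (Fm a b f)) (et a) \<in> hom C a ?b" using Ccm[OF h(1) oa(1,3) etH[OF h(1)] g] .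
    qed (use h oa FC[OF h(1,2) oa(3) h(3) etH[OF h(2)]] FC[OF h(1) oa(1,3) etH[OF h(1)] g] Fet FGm f eq in auto)
  qed
  moreover have "natural_iso D D (\<lambda>a. Fo (Go a)) (\<lambda>a b f. Fm (Go a) (Go b) (Gm a b f)) (\<lambda>a. a) (\<lambda>a b f. f) ep"
    unfolding natural_iso_def
  proof (intro conjI ballI)
    fix a assume a: "a \<in> ob D"
    then show "is_iso D (Fo (Go a)) a (ep a)" unfolding is_iso_def using ep ei ie ee by blast
  next
    fix a b f assume h: "a \<in> ob D" "b \<in> ob D" "f \<in> hom D a b"
    note fo = FO[OF G[OF h(1)]] FO[OF G[OF h(2)]]
    have fe: "cmp D f (ep a) \<in> hom D (Fo (Go a)) b" using Dcm fo h ep by blast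
    have "cmp D (ep b) (cmp D (ei b) (cmp D f (ep a))) = cmp D (cmp D (ep b) (ei b)) (cmp D f (ep a))"
      by (rule Das[where a="Fo (Go a)" and c="Fo (Go b)" and b=b and d=b]) (use fo h fe ei ep Dcm in blast)+
    also have "\<dots> = cmp D f (ep a)" using ee h Dl[OF fo(1) h(2) fe] by simp
    finally show "cmp D (ep b) (Fm (Go a) (Go b) (Gm a b f)) = cmp D f (ep a)" using FGm h by simp
  qed
  ultimately show ?thesis unfolding is_equivalence_def using C D F GF by blast
qed

text \<open>Neither category is mapped to the other directly; only the models \<open>x\<close> have
  realisations \<open>A x\<close> and \<open>B x\<close>, with hom-sets matched by \<open>t\<close>.
  Every \<open>M\<close> in \<open>C\<close> is therefore replaced by an isomorphic
  \<open>A (k M)\<close>, and morphisms are conjugated by \<open>i\<close> and \<open>j\<close>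
  before \<open>t\<close> applies.\<close>

lemma equivalence_through_common_models:
  fixes A :: "'x \<Rightarrow> 'o" and B :: "'x \<Rightarrow> 'p"
  assumes C: "category C" and D: "category D"
    and AO: "\<And>x. x \<in> X \<Longrightarrow> A x \<in> ob C" and BO: "\<And>x. x \<in> X \<Longrightarrow> B x \<in> ob D"
    and t: "\<And>x y. x \<in> X \<Longrightarrow> y \<in> X \<Longrightarrow> bij_betw (t x y) (hom C (A x) (A y)) (hom D (B x) (B y))"
    and tid: "\<And>x. x \<in> X \<Longrightarrow> t x x (idn C (A x)) = idn D (B x)"
    and tcm: "\<And>x y z f g. x \<in> X \<Longrightarrow> y \<in> X \<Longrightarrow> z \<in> X \<Longrightarrow> f \<in> hom C (A x) (A y) \<Longrightarrow> g \<in> hom C (A y) (A z)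
        \<Longrightarrow> t x z (cmp C g f) = cmp D (t y z g) (t x y f)"
    and k: "\<And>M. M \<in> ob C \<Longrightarrow> k M \<in> X"
    and i: "\<And>M. M \<in> ob C \<Longrightarrow> i M \<in> hom C M (A (k M))"
    and j: "\<And>M. M \<in> ob C \<Longrightarrow> j M \<in> hom C (A (k M)) M"
    and ji: "\<And>M. M \<in> ob C \<Longrightarrow> cmp C (j M) (i M) = idn C M"
    and ij: "\<And>M. M \<in> ob C \<Longrightarrow> cmp C (i M) (j M) = idn C (A (k M))"
    and es: "\<And>y. y \<in> ob D \<Longrightarrow> \<exists>x\<in>X. \<exists>g. is_iso D (B x) y g"
  shows "is_equivalence C D (\<lambda>M. B (k M)) (\<lambda>M M' f. t (k M) (k M') (cmp C (i M') (cmp C f (j M))))"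
proof (rule is_equivalence_if_fully_faithful_ess_surj[OF C D])
  have Cid: "idn C a \<in> hom C a a" if "a \<in> ob C" for a using C that unfolding category_def by blast
  have Ccm: "cmp C g f \<in> hom C a c" if "a \<in> ob C" "b \<in> ob C" "c \<in> ob C" "f \<in> hom C a b" "g \<in> hom C b c" for a b c f g
    using C that unfolding category_def by blast
  have Dcm: "cmp D g f \<in> hom D a c" if "a \<in> ob D" "b \<in> ob D" "c \<in> ob D" "f \<in> hom D a b" "g \<in> hom D b c" for a b c f g
    using D that unfolding category_def by blast
  have Cl: "cmp C (idn C b) f = f" and Cr: "cmp C f (idn C a) = f" if "a \<in> ob C" "b \<in> ob C" "f \<in> hom C a b" for a b f
    using C that unfolding category_def by blast+
  have Dl: "cmp D (idn D b) f = f" and Dr: "cmp D f (idn D a) = f" if "a \<in> ob D" "b \<in> ob D" "f \<in> hom D a b" for a b f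
    using D that unfolding category_def by blast+
  have Cas: "cmp C h (cmp C g f) = cmp C (cmp C h g) f"
    if "a \<in> ob C" "b \<in> ob C" "c \<in> ob C" "d \<in> ob C" "f \<in> hom C a b" "g \<in> hom C b c" "h \<in> hom C c d" for a b c d f g h
    using C that unfolding category_def by blast
  have Das: "cmp D h (cmp D g f) = cmp D (cmp D h g) f"
    if "a \<in> ob D" "b \<in> ob D" "c \<in> ob D" "d \<in> ob D" "f \<in> hom D a b" "g \<in> hom D b c" "h \<in> hom D c d" for a b c d f g h
    using D that unfolding category_def by blast
  have tH: "t x y f \<in> hom D (B x) (B y)" if "x \<in> X" "y \<in> X" "f \<in> hom C (A x) (A y)" for x y f
    using t[OF that(1,2)] that(3) by (auto simp: bij_betw_def)
  have conj_hom: "cmp C (i M') (cmp C f (j M)) \<in> hom C (A (k M)) (A (k M'))" if "M \<in> ob C" "M' \<in> ob C" "f \<in> hom C M M'" for M M' f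
    using that by (meson Ccm i j AO k)
  have conj_hom': "cmp C (j M') (cmp C f (i M)) \<in> hom C M M'" if "M \<in> ob C" "M' \<in> ob C" "f \<in> hom C (A (k M)) (A (k M'))" for M M' f
    using that by (meson Ccm i j AO k)
  have conj_inv: "cmp C (j M') (cmp C (cmp C (i M') (cmp C f (j M))) (i M)) = f" if h: "M \<in> ob C" "M' \<in> ob C" "f \<in> hom C M M'" for M M' f
  proof -
    note o = AO[OF k[OF h(1)]] AO[OF k[OF h(2)]]
    have fj: "cmp C f (j M) \<in> hom C (A (k M)) M'" using Ccm o h j by blast
    have "cmp C (cmp C (i M') (cmp C f (j M))) (i M) = cmp C (i M') (cmp C (cmp C f (j M)) (i M))"
      by (rule Cas[symmetric, where a=M and b="A (k M)" and c=M' and d="A (k M')"]) (use o h fj i in blast)+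
    also have "cmp C (cmp C f (j M)) (i M) = cmp C f (cmp C (j M) (i M))"
      by (rule Cas[symmetric, where a=M and b="A (k M)" and c=M and d="M'"]) (use o h fj i j in blast)+
    also have "\<dots> = f" using ji h Cr by simp
    also have "cmp C (j M') (cmp C (i M') f) = cmp C (cmp C (j M') (i M')) f"
      by (rule Cas[where a=M and b=M' and c="A (k M')" and d="M'"]) (use o h fj i j in blast)+
    also have "\<dots> = f" using ji h Cl by simp
    finally show ?thesis .
  qed
  have conj_inv': "cmp C (i M') (cmp C (cmp C (j M') (cmp C f (i M))) (j M)) = f" if h: "M \<in> ob C" "M' \<in> ob C" "f \<in> hom C (A (k M)) (A (k M'))" for M M' f
  proof -
    note o = AO[OF k[OF h(1)]] AO[OF k[OF h(2)]]
    have fj: "cmp C f (i M) \<in> hom C M (A (k M'))" using Ccm o h i by blast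
    have "cmp C (cmp C (j M') (cmp C f (i M))) (j M) = cmp C (j M') (cmp C (cmp C f (i M)) (j M))"
      by (rule Cas[symmetric, where a="A (k M)" and b="M" and c="A (k M')" and d="M'"]) (use o h fj j in blast)+
    also have "cmp C (cmp C f (i M)) (j M) = cmp C f (cmp C (i M) (j M))"
      by (rule Cas[symmetric, where a="A (k M)" and b="M" and c="A (k M)" and d="A (k M')"]) (use o h fj i j in blast)+
    also have "\<dots> = f" using ij h Cr o by simp
    also have "cmp C (i M') (cmp C (j M') f) = cmp C (cmp C (i M') (j M')) f"
      by (rule Cas[where a="A (k M)" and b="A (k M')" and c="M'" and d="A (k M')"]) (use o h fj i j in blast)+
    also have "\<dots> = f" using ij h Cl o by simp
    finally show ?thesis .
  qed
  let ?F = "\<lambda>M M' f. t (k M) (k M') (cmp C (i M') (cmp C f (j M)))"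
  show "is_functor C D (\<lambda>M. B (k M)) ?F"
    unfolding is_functor_def
  proof (intro conjI ballI)
    fix M assume M: "M \<in> ob C"
    show "B (k M) \<in> ob D" using BO k M by blast
    show "?F M M (idn C M) = idn D (B (k M))"
      using tid[OF k[OF M]] ij[OF M] Cl[OF AO[OF k[OF M]] M j[OF M]] by simp
  next
    fix a b f assume "a \<in> ob C" "b \<in> ob C" "f \<in> hom C a b"
    then show "?F a b f \<in> hom D (B (k a)) (B (k b))" using tH conj_hom k by blast
  next
    fix a b c f g assume h: "a \<in> ob C" "b \<in> ob C" "c \<in> ob C" "f \<in> hom C a b" "g \<in> hom C b c"
    note o = AO[OF k[OF h(1)]] AO[OF k[OF h(2)]] AO[OF k[OF h(3)]]
    have fj: "cmp C f (j a) \<in> hom C (A (k a)) b" using Ccm o h j by blast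
    have gj: "cmp C g (j b) \<in> hom C (A (k b)) c" using Ccm o h j by blast
    have ifj: "cmp C (i b) (cmp C f (j a)) \<in> hom C (A (k a)) (A (k b))" using conj_hom h by blast
    have "cmp C (cmp C (i c) (cmp C g (j b))) (cmp C (i b) (cmp C f (j a)))
       = cmp C (i c) (cmp C (cmp C g (j b)) (cmp C (i b) (cmp C f (j a))))"
      by (rule Cas[symmetric, where a="A (k a)" and b="A (k b)" and c=c and d="A (k c)"]) (use o h fj gj ifj i j in blast)+
    also have "cmp C (cmp C g (j b)) (cmp C (i b) (cmp C f (j a))) = cmp C g (cmp C (j b) (cmp C (i b) (cmp C f (j a))))"
      by (rule Cas[symmetric, where a="A (k a)" and b="A (k b)" and c=b and d="c"]) (use o h fj gj ifj i j in blast)+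
    also have "cmp C (j b) (cmp C (i b) (cmp C f (j a))) = cmp C (cmp C (j b) (i b)) (cmp C f (j a))"
      by (rule Cas[where a="A (k a)" and b="b" and c="A (k b)" and d="b"]) (use o h fj gj ifj i j in blast)+
    also have "\<dots> = cmp C f (j a)" using ji h Cl[OF o(1) h(2) fj] by simp
    also have "cmp C g (cmp C f (j a)) = cmp C (cmp C g f) (j a)"
      by (rule Cas[where a="A (k a)" and b="a" and c="b" and d="c"]) (use o h fj gj ifj i j in blast)+
    finally show "?F a c (cmp C g f) = cmp D (?F b c g) (?F a b f)"
      using tcm[OF k[OF h(1)] k[OF h(2)] k[OF h(3)] conj_hom[OF h(1,2,4)] conj_hom[OF h(2,3,5)]] by simp
  qed
  show "bij_betw (?F M M') (hom C M M') (hom D (B (k M)) (B (k M')))" if h: "M \<in> ob C" "M' \<in> ob C" for M M'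
  proof -
    have "bij_betw (\<lambda>f. cmp C (i M') (cmp C f (j M))) (hom C M M') (hom C (A (k M)) (A (k M')))"
      by (rule bij_betw_byWitness[where f'="\<lambda>f. cmp C (j M') (cmp C f (i M))"])
        (use conj_inv[OF h] conj_inv'[OF h] conj_hom[OF h] conj_hom'[OF h] in auto)
    from bij_betw_trans[OF this t[OF k[OF h(1)] k[OF h(2)]]] show ?thesis by (simp add: o_def)
  qed
  show "\<exists>x\<in>ob C. \<exists>g. is_iso D (B (k x)) y g" if y: "y \<in> ob D" for y
  proof -
    obtain x g g' where x: "x \<in> X" and g: "g \<in> hom D (B x) y" "g' \<in> hom D y (B x)"
      "cmp D g' g = idn D (B x)" "cmp D g g' = idn D y"
      using es[OF y] unfolding is_iso_def by blast
    \<comment> \<open>\<open>k (A x)\<close> need not be \<open>x\<close>, so the isomorphism from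
      \<open>B x\<close> to \<open>y\<close> is precomposed with the image under \<open>t\<close> of
      the isomorphism between the two models.\<close>
    let ?M = "A x"
    have M: "?M \<in> ob C" using AO x .
    have kx: "k ?M \<in> X" using k M .
    note bo = BO[OF x] BO[OF kx]
    let ?i = "t x (k ?M) (i ?M)" and ?j = "t (k ?M) x (j ?M)"
    have ih: "?i \<in> hom D (B x) (B (k ?M))" and jh: "?j \<in> hom D (B (k ?M)) (B x)" using tH x kx i j M by auto
    have 1: "cmp D ?j ?i = idn D (B x)" using tcm[OF x kx x i[OF M] j[OF M]] ji[OF M] tid x by simp
    have 2: "cmp D ?i ?j = idn D (B (k ?M))" using tcm[OF kx x kx j[OF M] i[OF M]] ij[OF M] tid kx by simp
    have gj: "cmp D g ?j \<in> hom D (B (k ?M)) y" using Dcm[OF bo(2,1) y jh g(1)] .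
    have ig: "cmp D ?i g' \<in> hom D y (B (k ?M))" using Dcm[OF y bo g(2) ih] .
    have "cmp D (cmp D ?i g') (cmp D g ?j) = cmp D ?i (cmp D g' (cmp D g ?j))"
      using Das[OF bo(2) y bo gj g(2) ih] by simp
    also have "cmp D g' (cmp D g ?j) = cmp D (cmp D g' g) ?j" using Das[OF bo(2,1) y bo(1) jh g(1,2)] .
    also have "\<dots> = ?j" using g(3) Dl[OF bo(2,1) jh] by simp
    finally have 3: "cmp D (cmp D ?i g') (cmp D g ?j) = idn D (B (k ?M))" using 2 by simp
    have "cmp D (cmp D g ?j) (cmp D ?i g') = cmp D g (cmp D ?j (cmp D ?i g'))"
      using Das[OF y bo(2,1) y ig jh g(1)] by simp
    also have "cmp D ?j (cmp D ?i g') = cmp D (cmp D ?j ?i) g'" using Das[OF y bo bo(1) g(2) ih jh] .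
    also have "\<dots> = g'" using 1 Dl[OF y bo(1) g(2)] by simp
    finally have 4: "cmp D (cmp D g ?j) (cmp D ?i g') = idn D y" using g(4) by simp
    show ?thesis using M gj ig 3 4 unfolding is_iso_def by blast
  qed
qed

section \<open>Linear extensions and rational functionals\<close>

lemma lookup_linext_superset:
  assumes "finite K" "keys p \<subseteq> K"
  shows "linext f p = (\<Sum>a\<in>K. scl (lookup p a) (f a))"
  unfolding linext_def
  by (rule sum.mono_neutral_left) (use assms in \<open>auto simp: Poly_Mapping.in_keys_iff pm.scale_zero_left\<close>)

lemma linext_add: "linext f (p + q) = linext f p + linext f q"
proof -
  let ?K = "keys p \<union> keys q"
  have "keys (p + q) \<subseteq> ?K" by (rule Poly_Mapping.keys_add)
  then show ?thesis
    by (simp add: lookup_linext_superset[of ?K] Poly_Mapping.lookup_add pm.scale_left_distrib sum.distrib)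
qed

lemma linext_scl: "linext f (scl c p) = scl c (linext f p)"
proof -
  have "keys (scl c p) \<subseteq> keys p" by (auto simp: Poly_Mapping.in_keys_iff)
  then show ?thesis
    by (simp add: lookup_linext_superset[of "keys p"] pm.scale_sum_right)
qed

lemma linext_zero [simp]: "linext f 0 = 0" by (simp add: linext_def)

lemma linext_minus: "linext f (- p) = - linext f p"
  using linext_add[of f p "-p"] by (simp add: eq_neg_iff_add_eq_0 add.commute)

lemma linext_diff: "linext f (p - q) = linext f p - linext f q"
  using linext_add[of f p "-q"] by (simp add: linext_minus)

lemma linext_sum: "linext f (\<Sum>i\<in>I. p i) = (\<Sum>i\<in>I. linext f (p i))"
  by (induction I rule: infinite_finite_induct) (auto simp: linext_add)

lemma scl_single [simp]: "scl c (single a d) = single a (c * d)"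
  by (rule poly_mapping_eqI) (simp add: Poly_Mapping.lookup_single when_def)

lemma linext_single [simp]: "linext f (single a c) = scl c (f a)"
  by (subst lookup_linext_superset[of "{a}"]) auto

lemma linext_cong: "(\<And>a. a \<in> keys p \<Longrightarrow> f a = g a) \<Longrightarrow> linext f p = linext g p"
  unfolding linext_def by simp

lemma linext_linext: "linext f (linext g p) = linext (\<lambda>a. linext f (g a)) p"
  unfolding linext_def[of g] linext_def[of "\<lambda>a. linext f (g a)"] linext_sum linext_scl ..

lemma linext_fun_add: "linext (\<lambda>a. f a + g a) p = linext f p + linext g p"
  by (simp add: linext_def pm.scale_right_distrib sum.distrib)

lemma linext_fun_sum: "linext (\<lambda>a. \<Sum>i\<in>I. f i a) p = (\<Sum>i\<in>I. linext (f i) p)"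
  by (simp add: linext_def pm.scale_sum_right sum.swap[of _ I])

lemma linext_fun_scl: "linext (\<lambda>a. scl c (f a)) p = scl c (linext f p)"
  by (simp add: linext_def pm.scale_sum_right pm.scale_scale mult.commute)

lemma linext_fun_zero [simp]: "linext (\<lambda>a. 0) p = 0"
  by (simp add: linext_def)

lemma linext_id: "linext (\<lambda>a. single a 1) p = p"
proof (rule poly_mapping_eqI)
  fix k
  show "lookup (linext (\<lambda>a. single a 1) p) k = lookup p k"
    by (auto simp: linext_def Poly_Mapping.lookup_sum Poly_Mapping.lookup_single when_def sum.delta Poly_Mapping.in_keys_iff)
qed

lemma linext_in_span:
  assumes "x \<in> pm.span S" "\<And>s. s \<in> S \<Longrightarrow> linext f s \<in> pm.span T"
  shows "linext f x \<in> pm.span T"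
  using assms(1)
  by (induction rule: pm.span_induct_alt) (auto simp: linext_add linext_scl pm.span_zero assms(2) intro!: pm.span_add pm.span_scale)

lemma lookup_linext: "lookup (linext f p) b = (\<Sum>a\<in>keys p. lookup p a * lookup (f a) b)"
  by (simp add: linext_def Poly_Mapping.lookup_sum)

lemma lookup_tens [simp]: "lookup (tens x y) (a, b) = lookup x a * lookup y b"
proof -
  have 1: "lookup (linext (\<lambda>b. single (a', b) 1) y) (a, b) = (if a' = a then lookup y b else 0)" for a'
    by (auto simp: lookup_linext Poly_Mapping.lookup_single when_def sum.delta Poly_Mapping.in_keys_iff if_distrib cong: if_cong)
  show ?thesis
    unfolding tens_def by (auto simp: lookup_linext[of _ x] 1 if_distrib sum.delta Poly_Mapping.in_keys_iff cong: if_cong)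
qed

lemma tens_eqI: "(\<And>a b. lookup p (a, b) = lookup q (a, b)) \<Longrightarrow> p = q"
  by (rule poly_mapping_eqI) auto

lemma tens_add_left: "tens (x + x') y = tens x y + tens x' y"
  and tens_add_right: "tens x (y + y') = tens x y + tens x y'"
  and tens_scl_left: "tens (scl c x) y = scl c (tens x y)"
  and tens_scl_right: "tens x (scl c y) = scl c (tens x y)"
  and tens_minus_left: "tens (x - x') y = tens x y - tens x' y"
  and tens_minus_right: "tens x (y - y') = tens x y - tens x y'"
  and tens_zero_left [simp]: "tens 0 y = 0"
  and tens_zero_right [simp]: "tens x 0 = 0"
  and tens_single: "tens (single a c) (single b d) = single (a, b) (c * d)"
  by (rule tens_eqI; simp add: Poly_Mapping.lookup_add Poly_Mapping.lookup_minus Poly_Mapping.lookup_single when_def algebra_simps)+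

lemma tens_sum_left: "tens (\<Sum>i\<in>I. x i) y = (\<Sum>i\<in>I. tens (x i) y)"
  by (induction I rule: infinite_finite_induct) (auto simp: tens_add_left)

lemma tens_sum_right: "tens y (\<Sum>i\<in>I. x i) = (\<Sum>i\<in>I. tens y (x i))"
  by (induction I rule: infinite_finite_induct) (auto simp: tens_add_right)

lemma tens_linext_left: "tens (linext f p) y = linext (\<lambda>a. tens (f a) y) p"
  by (simp add: linext_def tens_sum_left tens_scl_left)

lemma tens_linext_right: "tens y (linext f p) = linext (\<lambda>a. tens y (f a)) p"
  by (simp add: linext_def tens_sum_right tens_scl_right)

lemma linext_tens: "linext f (tens x y) = linext (\<lambda>a. linext (\<lambda>b. f (a, b)) y) x"
  unfolding tens_def by (simp add: linext_linext)

text \<open>The values may lie in a larger field: rational functionals detect the relations of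
  \<open>A(\<O>)\<close>, complex ones evaluate and differentiate letters at a point.\<close>

definition wsum :: "('a \<Rightarrow> 'k::field_char_0) \<Rightarrow> ('a \<Rightarrow>\<^sub>0 rat) \<Rightarrow> 'k" where
  "wsum f p = (\<Sum>a\<in>keys p. of_rat (lookup p a) * f a)"

lemma wsum_superset:
  assumes "finite K" "keys p \<subseteq> K"
  shows "wsum f p = (\<Sum>a\<in>K. of_rat (lookup p a) * f a)"
  unfolding wsum_def
  by (rule sum.mono_neutral_left) (use assms in \<open>auto simp: Poly_Mapping.in_keys_iff\<close>)

lemma wsum_add: "wsum f (p + q) = wsum f p + wsum f q"
proof -
  let ?K = "keys p \<union> keys q"
  have "keys (p + q) \<subseteq> ?K" by (rule Poly_Mapping.keys_add)
  then show ?thesis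
    by (simp add: wsum_superset[of ?K] Poly_Mapping.lookup_add of_rat_add distrib_right sum.distrib)
qed

lemma wsum_scl: "wsum f (scl c p) = of_rat c * wsum f p"
proof -
  have "keys (scl c p) \<subseteq> keys p" by (auto simp: Poly_Mapping.in_keys_iff)
  then show ?thesis
    by (simp add: wsum_superset[of "keys p"] of_rat_mult sum_distrib_left mult.assoc)
qed

lemma wsum_zero [simp]: "wsum f 0 = 0" by (simp add: wsum_def)

lemma wsum_minus: "wsum f (- p) = - wsum f p"
  using wsum_add[of f p "-p"] by (simp add: eq_neg_iff_add_eq_0 add.commute)

lemma wsum_diff: "wsum f (p - q) = wsum f p - wsum f q"
  using wsum_add[of f p "-q"] by (simp add: wsum_minus)

lemma wsum_sum: "wsum f (\<Sum>i\<in>I. p i) = (\<Sum>i\<in>I. wsum f (p i))"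
  by (induction I rule: infinite_finite_induct) (auto simp: wsum_add)

lemma wsum_single [simp]: "wsum f (single a c) = of_rat c * f a"
  by (subst wsum_superset[of "{a}"]) auto

lemma wsum_cong: "(\<And>a. a \<in> keys p \<Longrightarrow> f a = g a) \<Longrightarrow> wsum f p = wsum g p"
  unfolding wsum_def by simp

lemma wsum_linext: "wsum f (linext g p) = wsum (\<lambda>a. wsum f (g a)) p"
  unfolding linext_def wsum_sum wsum_scl by (simp add: wsum_def)

lemma wsum_fun_add: "wsum (\<lambda>a. f a + g a) p = wsum f p + wsum g p"
  by (simp add: wsum_def distrib_left sum.distrib)

lemma wsum_fun_mult: "wsum (\<lambda>a. c * f a) p = c * wsum f p"
  by (simp add: wsum_def sum_distrib_left mult.left_commute)

lemma wsum_fun_mult_right: "wsum (\<lambda>a. f a * c) p = wsum f p * c"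
  by (simp add: wsum_def sum_distrib_right mult.assoc)

lemma wsum_fun_zero [simp]: "wsum (\<lambda>a. 0) p = 0"
  by (simp add: wsum_def)

lemma of_rat_wsum: "of_rat (wsum c p) = wsum (\<lambda>i. of_rat (c i)) p"
  by (simp add: wsum_def of_rat_sum of_rat_mult)

lemma wsum_tens: "wsum f (tens x y) = wsum (\<lambda>a. wsum (\<lambda>b. f (a, b)) y) x"
  unfolding tens_def by (simp add: wsum_linext)

lemma wsum_span_zero:
  assumes "x \<in> pm.span S" "\<And>s. s \<in> S \<Longrightarrow> wsum f s = 0"
  shows "wsum f x = 0"
  using assms(1) by (induction rule: pm.span_induct_alt) (auto simp: wsum_add wsum_scl assms(2))

lemma wsum_delta [simp]: "wsum (\<lambda>i. if i = j then 1 else 0) v = of_rat (lookup v j)"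
  by (auto simp: wsum_def sum.delta Poly_Mapping.in_keys_iff if_distrib cong: if_cong)

lemma linear_functional_eq_wsum:
  fixes h :: "('a \<Rightarrow>\<^sub>0 rat) \<Rightarrow> rat"
  assumes "\<And>x y. h (x + y) = h x + h y" "\<And>q x. h (scl q x) = q * h x"
  shows "h v = wsum (\<lambda>i. h (single i 1)) v"
proof -
  have z: "h 0 = 0" using assms(2)[of 0 0] by simp
  have s: "h (\<Sum>i\<in>I. p i) = (\<Sum>i\<in>I. h (p i))" for p :: "'a \<Rightarrow> 'a \<Rightarrow>\<^sub>0 rat" and I
    by (induction I rule: infinite_finite_induct) (auto simp: assms z)
  have "h v = h (linext (\<lambda>a. single a 1) v)" by (simp add: linext_id)
  also have "\<dots> = wsum (\<lambda>i. h (single i 1)) v"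
    unfolding linext_def s assms(2) by (simp add: wsum_def)
  finally show ?thesis .
qed

text \<open>These are coordinate functionals of a basis of the whole free space that extends
  \<open>B\<close>. A functional on a free space is given by its values on the basis elements, hence
  has the form \<open>wsum c\<close>.\<close>

lemma dual_functionals:
  fixes B :: "('a \<Rightarrow>\<^sub>0 rat) set"
  assumes "pm.independent B"
  obtains c :: "('a \<Rightarrow>\<^sub>0 rat) \<Rightarrow> 'a \<Rightarrow> rat"
  where "\<And>b b'. b \<in> B \<Longrightarrow> b' \<in> B \<Longrightarrow> wsum (c b) b' = (if b = b' then 1 else 0)"
proof
  let ?E = "pm.extend_basis B"
  have E: "pm.independent ?E" "pm.span ?E = UNIV" "B \<subseteq> ?E"
    using pm.independent_extend_basis[OF assms] pm.span_extend_basis[OF assms] pm.extend_basis_superset[OF assms] by auto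
  let ?c = "\<lambda>b i. pm.representation ?E (single i 1) b"
  fix b b' assume b: "b \<in> B" "b' \<in> B"
  have "wsum (?c b) b' = pm.representation ?E b' b"
    by (rule linear_functional_eq_wsum[symmetric])
       (use E in \<open>auto simp: pm.representation_add pm.representation_scale\<close>)
  also have "\<dots> = (if b = b' then 1 else 0)"
    using pm.representation_basis[OF E(1)] E(3) b by auto
  finally show "wsum (?c b) b' = (if b = b' then 1 else 0)" .
qed

lemma dual_functionals_expansion:
  fixes B :: "('a \<Rightarrow>\<^sub>0 rat) set"
  assumes B: "finite B" and c: "\<And>b b'. b \<in> B \<Longrightarrow> b' \<in> B \<Longrightarrow> wsum (c b) b' = (if b = b' then 1 else (0::rat))"
    and v: "v \<in> pm.span B"
  shows "v = (\<Sum>b\<in>B. scl (wsum (c b) v) b)"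
  using v
proof (induction rule: pm.span_induct_alt)
  case base then show ?case by (simp add: pm.scale_zero_left)
next
  case (step q b v)
  have "(\<Sum>b'\<in>B. scl (wsum (c b') (scl q b + v)) b') = (\<Sum>b'\<in>B. scl (q * wsum (c b') b) b') + (\<Sum>b'\<in>B. scl (wsum (c b') v) b')"
    by (simp add: wsum_add wsum_scl of_rat_eq_id pm.scale_left_distrib sum.distrib)
  also have "(\<Sum>b'\<in>B. scl (q * wsum (c b') b) b') = (\<Sum>b'\<in>B. if b' = b then scl q b else 0)"
    by (rule sum.cong) (use c step(1) in \<open>auto simp: pm.scale_zero_left\<close>)
  also have "\<dots> = scl q b" using B step(1) by simp
  finally show ?case using step.IH by simp
qed

lemma findim_basis:
  assumes "findim V"
  obtains B where "finite B" "pm.independent B" "V = pm.span B" "B \<subseteq> V"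
proof -
  obtain S where S: "finite S" "V = pm.span S" using assms unfolding findim_def by blast
  obtain B where B: "B \<subseteq> S" "pm.independent B" "S \<subseteq> pm.span B" using pm.maximal_independent_subset[of S] by blast
  have "pm.span B = pm.span S"
    by (metis B(1,3) pm.span_mono pm.span_span subset_antisym)
  then show ?thesis using that[of B] B S finite_subset pm.span_superset by metis
qed

text \<open>A list of functionals is a product functional on tensors of the same length and vanishes
  on all other words, so it selects one weight. Concatenation of lists is then dual to
  deconcatenation of words.\<close>

fun wev :: "(form \<Rightarrow> 'k::field_char_0) list \<Rightarrow> fword \<Rightarrow> 'k" where
  "wev [] [] = 1"
| "wev (l # ls) (x # xs) = l x * wev ls xs"
| "wev _ _ = 0"

section \<open>Functionals on words\<close>

definition lev :: "(form \<Rightarrow> 'k::field_char_0) list \<Rightarrow> (fword \<Rightarrow>\<^sub>0 rat) \<Rightarrow> 'k" where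
  "lev ls = wsum (wev ls)"

definition qlin :: "complex set \<Rightarrow> (form \<Rightarrow> 'k::field_char_0) \<Rightarrow> bool" where
  "qlin U l \<longleftrightarrow> (\<forall>x\<in>forms U. \<forall>y\<in>forms U. l (x + y) = l x + l y)
     \<and> (\<forall>q. \<forall>x\<in>forms U. l (form_scale (of_rat q) x) = of_rat q * l x)"

definition tform :: "complex set \<Rightarrow> form" where
  "tform U = const_form U (2 * pi * \<i>)"

text \<open>The first tensor factor is taken modulo \<open>\<rat>(1)\<close>, so a product
  functional descends to the quotient if its first member kills \<open>2\<pi>i\<close>; the later
  members are arbitrary linear functionals.\<close>

definition adm :: "complex set \<Rightarrow> (form \<Rightarrow> 'k::field_char_0) list \<Rightarrow> bool" where
  "adm U ls \<longleftrightarrow> (\<forall>l\<in>set ls. qlin U l) \<and> (ls \<noteq> [] \<longrightarrow> hd ls (tform U) = 0)"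

definition prep :: "fword \<Rightarrow> (fword \<Rightarrow>\<^sub>0 rat) \<Rightarrow> (fword \<Rightarrow>\<^sub>0 rat)" where
  "prep u = linext (\<lambda>w. single (u @ w) 1)"

text \<open>The relation about \<open>2\<pi>i\<close> concerns first letters only and is lost once
  another letter is put in front. The span of the remaining relations is stable under prefixes, as
  inductions on words require.\<close>

definition multilinear_rels :: "complex set \<Rightarrow> (fword \<Rightarrow>\<^sub>0 rat) set" where
  "multilinear_rels U =
     {single (u @ [x + y] @ v) 1
        - (single (u @ [x] @ v) 1 + single (u @ [y] @ v) 1)
      | u x y v. u \<in> lists (forms U) \<and> x \<in> forms U \<and> y \<in> forms U \<and> v \<in> lists (forms U)} \<union>
     {single (u @ [form_scale (of_rat q) x] @ v) 1
        - scl q (single (u @ [x] @ v) 1)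
      | u q x v. u \<in> lists (forms U) \<and> x \<in> forms U \<and> v \<in> lists (forms U)}"

lemma multilinear_rels_subset: "multilinear_rels U \<subseteq> tensor_rels U"
  unfolding multilinear_rels_def tensor_rels_def by blast

lemma wev_append_right: "wev ls (u @ w) = wev (take (length u) ls) u * wev (drop (length u) ls) w"
proof (induction u arbitrary: ls)
  case Nil then show ?case by simp
next
  case (Cons a u) then show ?case by (cases ls) auto
qed

lemma wev_length: "length ls \<noteq> length w \<Longrightarrow> wev ls w = 0"
  by (induction ls w rule: wev.induct) auto

lemma forms_add: "x \<in> forms U \<Longrightarrow> y \<in> forms U \<Longrightarrow> x + y \<in> forms U"
  by (cases x; cases y) (auto simp: forms_def holo_funs_def plus_fun_def intro!: holomorphic_intros)

lemma forms_scale: "x \<in> forms U \<Longrightarrow> form_scale c x \<in> forms U"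
  by (cases x) (auto simp: forms_def holo_funs_def form_scale_def intro!: holomorphic_intros)

lemma forms_zero: "0 \<in> forms U"
  by (simp add: forms_def holo_funs_def zero_prod_def zero_fun_def mem_Times_iff)

lemma forms0_subset: "forms0 U \<subseteq> forms U"
  using forms_zero[of U] by (simp add: forms_def forms0_def zero_prod_def subset_iff mem_Times_iff)

lemma const_form_in: "const_form U c \<in> forms0 U"
proof -
  have "(\<lambda>z. if z \<in> U then c else 0) holomorphic_on U"
    by (rule holomorphic_transform[of "\<lambda>_. c"]) auto
  then show ?thesis by (auto simp: forms0_def holo_funs_def const_form_def)
qed

lemma tform_in: "tform U \<in> forms0 U" unfolding tform_def by (rule const_form_in)

lemma const_form_eq_scale: "const_form U (2 * pi * \<i> * of_rat q) = form_scale (of_rat q) (tform U)"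
  by (auto simp: const_form_def tform_def form_scale_def zero_fun_def)

lemma tform_cons_rel: "v \<in> lists (forms U) \<Longrightarrow> single (tform U # v) 1 \<in> tensor_rels U"
  unfolding tensor_rels_def tform_def using of_rat_1
  by (smt (verit, best) UnCI mem_Collect_eq mult.right_neutral)

lemma wev_add_letter:
  assumes "\<And>l. l \<in> set ls \<Longrightarrow> l y = l x + l x'"
  shows "wev ls (u @ [y] @ v) = wev ls (u @ [x] @ v) + wev ls (u @ [x'] @ v)"
proof (cases "drop (length u) ls")
  case Nil then show ?thesis by (simp add: wev_append_right)
next
  case (Cons l r)
  then have "l \<in> set ls" by (metis in_set_dropD list.set_intros(1))
  with Cons show ?thesis by (simp add: wev_append_right assms algebra_simps)
qed

lemma wev_scale_letter:
  assumes "\<And>l. l \<in> set ls \<Longrightarrow> l y = c * l x"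
  shows "wev ls (u @ [y] @ v) = c * wev ls (u @ [x] @ v)"
proof (cases "drop (length u) ls")
  case Nil then show ?thesis by (simp add: wev_append_right)
next
  case (Cons l r)
  then have "l \<in> set ls" by (metis in_set_dropD list.set_intros(1))
  with Cons show ?thesis by (simp add: wev_append_right assms algebra_simps)
qed

lemma lev_tensor_rels:
  assumes "adm U ls" "x \<in> pm.span (tensor_rels U)"
  shows "lev ls x = 0"
  unfolding lev_def
proof (rule wsum_span_zero[OF assms(2)])
  fix s assume "s \<in> tensor_rels U"
  then consider
    (1) u x y v where "u \<in> lists (forms U)" "x \<in> forms U" "y \<in> forms U" "v \<in> lists (forms U)"
      "s = single (u @ [x + y] @ v) 1
        - (single (u @ [x] @ v) 1 + single (u @ [y] @ v) 1)"
  | (2) u q x v where "u \<in> lists (forms U)" "x \<in> forms U" "v \<in> lists (forms U)"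
      "s = single (u @ [form_scale (of_rat q) x] @ v) 1
        - scl q (single (u @ [x] @ v) 1)"
  | (3) q v where "v \<in> lists (forms U)" "s = single (const_form U (2 * pi * \<i> * of_rat q) # v) 1"
    unfolding tensor_rels_def by blast
  then show "wsum (wev ls) s = 0"
  proof cases
    case 1
    have "wev ls (u @ [x + y] @ v) = wev ls (u @ [x] @ v) + wev ls (u @ [y] @ v)"
      by (rule wev_add_letter) (use assms(1) 1 in \<open>auto simp: adm_def qlin_def\<close>)
    then show ?thesis unfolding 1(5) by (simp add: wsum_diff wsum_add)
  next
    case 2
    have "wev ls (u @ [form_scale (of_rat q) x] @ v) = of_rat q * wev ls (u @ [x] @ v)"
      by (rule wev_scale_letter) (use assms(1) 2 in \<open>auto simp: adm_def qlin_def\<close>)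
    then show ?thesis unfolding 2(4) by (simp add: wsum_diff wsum_scl)
  next
    case 3
    have "tform U \<in> forms U" using tform_in forms0_subset by blast
    then have "wev ls (const_form U (2 * pi * \<i> * of_rat q) # v) = 0"
      unfolding const_form_eq_scale using assms(1) by (cases ls) (auto simp: adm_def qlin_def)
    then show ?thesis unfolding 3(2) by simp
  qed
qed

lemma words0_iff: "x \<in> words0 U \<longleftrightarrow> keys x \<subseteq> lists (forms0 U)"
proof
  assume "x \<in> words0 U"
  then show "keys x \<subseteq> lists (forms0 U)"
    unfolding words0_def
  proof (induction rule: pm.span_induct_alt)
    case (step c s y)
    then have "keys (scl c s) \<subseteq> lists (forms0 U)" by (auto split: if_splits)
    then show ?case using step(2) Poly_Mapping.keys_add[of "scl c s" y] by auto
  qed simp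
next
  assume "keys x \<subseteq> lists (forms0 U)"
  then have "linext (\<lambda>w. single w 1) x \<in> words0 U"
    unfolding linext_def words0_def
    by (intro pm.span_sum pm.span_scale pm.span_base) auto
  then show "x \<in> words0 U" by (simp add: linext_id)
qed

lemma words0_span [simp]: "pm.span (words0 U) = words0 U"
  by (simp add: words0_def pm.span_span)

lemma linext_words:
  assumes "\<And>w. w \<in> keys x \<Longrightarrow> f w \<in> pm.span S"
  shows "linext f x \<in> pm.span S"
  unfolding linext_def by (intro pm.span_sum pm.span_scale assms)

lemma prep_Nil [simp]: "prep [] x = x" by (simp add: prep_def linext_id)

lemma prep_append: "prep (u @ v) x = prep u (prep v x)"
  by (simp add: prep_def linext_linext)

lemma prep_single [simp]: "prep u (single w c) = single (u @ w) c"
  by (simp add: prep_def)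

lemma prep_add: "prep u (x + y) = prep u x + prep u y" and prep_diff: "prep u (x - y) = prep u x - prep u y"
  and prep_scl: "prep u (scl c x) = scl c (prep u x)" and prep_zero [simp]: "prep u 0 = 0"
  and prep_sum: "prep u (\<Sum>i\<in>I. p i) = (\<Sum>i\<in>I. prep u (p i))"
  by (simp_all add: prep_def linext_add linext_diff linext_scl linext_sum)

lemma cons_lin_eq_prep: "cons_lin x = prep [x]"
  by (simp add: cons_lin_def prep_def fun_eq_iff)

lemma prep_multilinear:
  assumes "u \<in> lists (forms U)" "x \<in> pm.span (multilinear_rels U)"
  shows "prep u x \<in> pm.span (multilinear_rels U)"
  unfolding prep_def
proof (rule linext_in_span[OF assms(2)])
  fix s assume "s \<in> multilinear_rels U"
  then consider
    (1) a x y v where "a \<in> lists (forms U)" "x \<in> forms U" "y \<in> forms U" "v \<in> lists (forms U)"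
      "s = single (a @ [x + y] @ v) 1
        - (single (a @ [x] @ v) 1 + single (a @ [y] @ v) 1)"
  | (2) a q x v where "a \<in> lists (forms U)" "x \<in> forms U" "v \<in> lists (forms U)"
      "s = single (a @ [form_scale (of_rat q) x] @ v) 1
        - scl q (single (a @ [x] @ v) 1)"
    unfolding multilinear_rels_def by blast
  then show "linext (\<lambda>w. single (u @ w) 1) s \<in> pm.span (multilinear_rels U)"
  proof cases
    case 1
    have "linext (\<lambda>w. single (u @ w) 1) s = single ((u @ a) @ [x + y] @ v) 1
        - (single ((u @ a) @ [x] @ v) 1 + single ((u @ a) @ [y] @ v) 1)"
      unfolding 1(5) by (simp add: linext_diff linext_add)
    moreover have "u @ a \<in> lists (forms U)" using 1 assms by auto
    ultimately show ?thesis using 1 unfolding multilinear_rels_def by (blast intro: pm.span_base)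
  next
    case 2
    have "linext (\<lambda>w. single (u @ w) 1) s = single ((u @ a) @ [form_scale (of_rat q) x] @ v) 1
        - scl q (single ((u @ a) @ [x] @ v) 1)"
      unfolding 2(4) by (simp add: linext_diff linext_scl del: scl_single)
    moreover have "u @ a \<in> lists (forms U)" using 2 assms by auto
    ultimately show ?thesis using 2 unfolding multilinear_rels_def by (blast intro: pm.span_base)
  qed
qed

lemma single_zero_letter:
  assumes "u \<in> lists (forms U)" "v \<in> lists (forms U)"
  shows "single (u @ [0] @ v) 1 \<in> pm.span (multilinear_rels U)"
proof -
  have "form_scale (of_rat 0) 0 = 0" by (simp add: form_scale_def zero_prod_def zero_fun_def)
  then have "single (u @ [0] @ v) (1::rat)
      = single (u @ [form_scale (of_rat 0) 0] @ v) 1 - scl 0 (single (u @ [0] @ v) 1)"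
    by (simp add: pm.scale_zero_left)
  then show ?thesis using assms forms_zero unfolding multilinear_rels_def
    by (intro pm.span_base UnI2) blast
qed

lemma forms_sum: "(\<And>k. k \<in> K \<Longrightarrow> y k \<in> forms U) \<Longrightarrow> (\<Sum>k\<in>K. y k) \<in> forms U"
  by (induction K rule: infinite_finite_induct) (auto simp: forms_zero forms_add)

lemma single_sum_letter:
  assumes "u \<in> lists (forms U)" "v \<in> lists (forms U)" "finite K" "\<And>k. k \<in> K \<Longrightarrow> y k \<in> forms U"
  shows "single (u @ [\<Sum>k\<in>K. y k] @ v) 1 - (\<Sum>k\<in>K. single (u @ [y k] @ v) 1)
    \<in> pm.span (multilinear_rels U)"
  using assms(3,4)
proof (induction K rule: finite_induct)
  case empty then show ?case using single_zero_letter[OF assms(1,2)] by simp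
next
  case (insert k K)
  have s: "(\<Sum>k\<in>K. y k) \<in> forms U" using insert forms_sum by blast
  have "single (u @ [y k + (\<Sum>k\<in>K. y k)] @ v) 1
      - (single (u @ [y k] @ v) 1 + single (u @ [\<Sum>k\<in>K. y k] @ v) 1) \<in> pm.span (multilinear_rels U)"
    unfolding multilinear_rels_def by (rule pm.span_base, rule UnI1) (use s insert.prems assms in blast)
  from pm.span_add[OF this insert.IH] show ?case using insert by (simp add: algebra_simps)
qed

lemma single_scale_letter:
  assumes "u \<in> lists (forms U)" "v \<in> lists (forms U)" "x \<in> forms U"
  shows "single (u @ [form_scale (of_rat q) x] @ v) 1 - scl q (single (u @ [x] @ v) 1)
    \<in> pm.span (multilinear_rels U)"
  using assms unfolding multilinear_rels_def by (blast intro: pm.span_base)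

definition qsc :: "rat \<Rightarrow> (complex \<Rightarrow> complex) \<Rightarrow> complex \<Rightarrow> complex" where
  "qsc q f = (\<lambda>z. of_rat q * f z)"

global_interpretation qf: vector_space qsc
  by unfold_locales (auto simp: qsc_def fun_eq_iff of_rat_add of_rat_mult algebra_simps)

lemma subspace_holo_funs: "qf.subspace (holo_funs U)"
  by (auto simp: qf.subspace_def holo_funs_def qsc_def plus_fun_def zero_fun_def intro!: holomorphic_intros)

lemma sum_fun_apply: "(\<Sum>i\<in>I. f i) z = (\<Sum>i\<in>I. f i z)"
  by (induction I rule: infinite_finite_induct) auto

lemma lookup_prep_single: "lookup (prep [y] p) u = (case u of [] \<Rightarrow> 0 | y' # u' \<Rightarrow> if y' = y then lookup p u' else 0)"
  by (cases u) (auto simp: prep_def lookup_linext Poly_Mapping.lookup_single when_def sum.delta Poly_Mapping.in_keys_iff if_distrib cong: if_cong)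

text \<open>Products of linear functionals, the first of which kills \<open>2\<pi>i\<close>, separate the points of \<open>A(\<O>)\<close>:
  expand every letter in a rational basis of the functions that contains \<open>2\<pi>i\<close>.\<close>

lemma product_functionals_separate:
  assumes U: "U \<noteq> {}" and x: "x \<in> words0 U"
    and lev: "\<And>ls :: (form \<Rightarrow> rat) list. adm U ls \<Longrightarrow> lev ls x = 0"
  shows "x \<in> pm.span (tensor_rels U)"
proof -
  let ?t = "fst (tform U)"
  have t0: "?t \<noteq> 0" using U by (auto simp: tform_def const_form_def fun_eq_iff)
  have tU: "?t \<in> holo_funs U" using tform_in[of U] by (auto simp: forms0_def)
  have "qf.independent {?t}" using t0 by (simp add: qf.dependent_single)
  then obtain B where B: "{?t} \<subseteq> B" "B \<subseteq> holo_funs U" "qf.independent B" "holo_funs U \<subseteq> qf.span B"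
    using qf.maximal_independent_subset_extend[of "{?t}" "holo_funs U"] tU by blast
  define r where "r b y = qf.representation B (fst y) b" for b and y :: form
  have spB: "fst y \<in> qf.span B" if "y \<in> forms U" for y using that B(4) by (auto simp: forms_def)
  have ql: "qlin U (r b)" for b
    unfolding qlin_def r_def
  proof (intro conjI ballI allI)
    fix x y assume "x \<in> forms U" "y \<in> forms U"
    then show "qf.representation B (fst (x + y)) b = qf.representation B (fst x) b + qf.representation B (fst y) b"
      using qf.representation_add[OF B(3) spB spB] by simp
  next
    fix q x assume "x \<in> forms U"
    then show "qf.representation B (fst (form_scale (of_rat q) x)) b = of_rat q * qf.representation B (fst x) b"
      using qf.representation_scale[OF B(3) spB, of x q] by (simp add: form_scale_def qsc_def of_rat_eq_id)
  qed
  \<comment> \<open>The finitely many basis functions that occur in letters of \<open>x\<close>; the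
    expansion of each such letter is a sum over \<open>Cs\<close>.\<close>
  define Cs where "Cs = (\<Union>w\<in>keys x. \<Union>y\<in>set w. {b. r b y \<noteq> 0})"
  have finC: "finite Cs" unfolding Cs_def r_def by (auto intro: qf.finite_representation)
  have CB: "Cs \<subseteq> B" unfolding Cs_def r_def using qf.representation_ne_zero by blast
  define bf where "bf b = (b, 0::complex \<Rightarrow> complex)" for b :: "complex \<Rightarrow> complex"
  have bfU: "bf b \<in> forms U" if "b \<in> B" for b using that B(2) forms_zero[of U] by (auto simp: bf_def forms_def zero_prod_def)
  have exp: "y = (\<Sum>b\<in>Cs. form_scale (of_rat (r b y)) (bf b))" if "y \<in> forms0 U" "{b. r b y \<noteq> 0} \<subseteq> Cs" for y
  proof (rule prod_eqI)
    have fy: "fst y \<in> qf.span B" using that(1) forms0_subset spB by blast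
    have "fst y = (\<Sum>b | r b y \<noteq> 0. qsc (r b y) b)"
      using qf.sum_nonzero_representation_eq[OF B(3) fy] by (simp add: r_def)
    also have "\<dots> = (\<Sum>b\<in>Cs. qsc (r b y) b)"
      by (rule sum.mono_neutral_left) (use that finC in auto)
    finally show "fst y = fst (\<Sum>b\<in>Cs. form_scale (of_rat (r b y)) (bf b))"
      by (simp add: fst_sum form_scale_def qsc_def bf_def)
    show "snd y = snd (\<Sum>b\<in>Cs. form_scale (of_rat (r b y)) (bf b))"
      using that(1) by (auto simp: forms0_def snd_sum form_scale_def bf_def fun_eq_iff sum_fun_apply)
  qed
  \<comment> \<open>Multilinear expansion of a word into words in the basis letters.\<close>
  define NF where "NF = rec_list (single [] (1::rat)) (\<lambda>y w n. \<Sum>b\<in>Cs. scl (r b y) (prep [bf b] n))"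
  have NF_simps: "NF [] = single [] 1" "NF (y # w) = (\<Sum>b\<in>Cs. scl (r b y) (prep [bf b] (NF w)))" for y w
    by (auto simp: NF_def)
  have red: "single (p @ w) 1 - prep p (NF w) \<in> pm.span (multilinear_rels U)"
    if "p \<in> lists (forms U)" "w \<in> lists (forms0 U)" "\<And>y. y \<in> set w \<Longrightarrow> {b. r b y \<noteq> 0} \<subseteq> Cs" for p w
    using that
  proof (induction w arbitrary: p)
    case Nil then show ?case by (simp add: NF_simps pm.span_zero)
  next
    case (Cons y w)
    have wU: "w \<in> lists (forms U)" using Cons.prems(2) forms0_subset by auto
    let ?y = "\<lambda>b. form_scale (of_rat (r b y)) (bf b)"
    have 1: "single (p @ [y] @ w) 1 - (\<Sum>b\<in>Cs. single (p @ [?y b] @ w) 1) \<in> pm.span (multilinear_rels U)"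
    proof -
      have ye: "(\<Sum>b\<in>Cs. ?y b) = y" by (rule exp[symmetric]) (use Cons.prems in auto)
      show ?thesis using single_sum_letter[OF Cons.prems(1) wU finC, of ?y] CB bfU forms_scale unfolding ye by blast
    qed
    have 2: "(\<Sum>b\<in>Cs. single (p @ [?y b] @ w) 1 - scl (r b y) (single (p @ [bf b] @ w) 1)) \<in> pm.span (multilinear_rels U)"
      by (rule pm.span_sum, rule single_scale_letter) (use Cons.prems wU CB bfU in auto)
    have 3: "(\<Sum>b\<in>Cs. scl (r b y) (single ((p @ [bf b]) @ w) 1 - prep (p @ [bf b]) (NF w))) \<in> pm.span (multilinear_rels U)"
      by (rule pm.span_sum, rule pm.span_scale, rule Cons.IH) (use Cons.prems CB bfU in auto)
    have e: "single (p @ y # w) 1 - prep p (NF (y # w)) =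
      (single (p @ [y] @ w) 1 - (\<Sum>b\<in>Cs. single (p @ [?y b] @ w) 1))
      + (\<Sum>b\<in>Cs. single (p @ [?y b] @ w) 1 - scl (r b y) (single (p @ [bf b] @ w) 1))
      + (\<Sum>b\<in>Cs. scl (r b y) (single ((p @ [bf b]) @ w) 1 - prep (p @ [bf b]) (NF w)))"
      by (simp add: NF_simps prep_sum prep_scl prep_append sum_subtractf pm.scale_right_diff_distrib del: scl_single)
    show ?case unfolding e by (intro pm.span_add 1 2 3)
  qed
  \<comment> \<open>The coefficient of a basis word in the normal form is the value of the product
    of the coordinate functionals of its letters, so the hypothesis on \<open>x\<close> speaks about
    these coefficients.\<close>
  have lk: "lookup (NF w) u = (if set u \<subseteq> bf ` Cs then wev (map (\<lambda>y. r (fst y)) u) w else 0)" for w u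
  proof (induction w arbitrary: u)
    case Nil then show ?case by (cases u) (auto simp: NF_simps Poly_Mapping.lookup_single when_def)
  next
    case (Cons y w)
    show ?case
    proof (cases u)
      case Nil then show ?thesis unfolding NF_simps Poly_Mapping.lookup_sum lookup_scl lookup_prep_single by simp
    next
      case 2: (Cons y' u')
      have "lookup (NF (y # w)) u = (\<Sum>b\<in>Cs. r b y * (if y' = bf b then lookup (NF w) u' else 0))"
        unfolding NF_simps Poly_Mapping.lookup_sum \<open>u = y' # u'\<close> lookup_scl lookup_prep_single list.case ..
      also have "\<dots> = (if y' \<in> bf ` Cs then r (fst y') y * lookup (NF w) u' else 0)"
      proof (cases "y' \<in> bf ` Cs")
        case True
        then obtain b0 where b0: "b0 \<in> Cs" "y' = bf b0" by blast
        have "(\<Sum>b\<in>Cs. r b y * (if y' = bf b then lookup (NF w) u' else 0))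
            = (\<Sum>b\<in>Cs. if b0 = b then r b y * lookup (NF w) u' else 0)"
          by (rule sum.cong) (auto simp: b0(2) bf_def)
        also have "\<dots> = r b0 y * lookup (NF w) u'" using b0(1) finC by simp
        finally show ?thesis using True by (simp add: b0(2) bf_def)
      next
        case False then show ?thesis by (auto intro!: sum.neutral)
      qed
      also have "lookup (NF w) u' = (if set u' \<subseteq> bf ` Cs then wev (map (\<lambda>y. r (fst y)) u') w else 0)" by (rule Cons.IH)
      finally show ?thesis unfolding \<open>u = y' # u'\<close> by simp
    qed
  qed
  have lk2: "lookup (linext NF x) u = (if set u \<subseteq> bf ` Cs then lev (map (\<lambda>y. r (fst y)) u) x else 0)" for u
    unfolding lookup_linext lk lev_def wsum_def by (simp add: of_rat_eq_id)
  have "linext NF x = linext (\<lambda>w. single w 1) (linext NF x)" by (simp add: linext_id)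
  also have "\<dots> \<in> pm.span (tensor_rels U)"
  proof (rule linext_words)
    fix u assume "u \<in> keys (linext NF x)"
    then have n: "set u \<subseteq> bf ` Cs" "lev (map (\<lambda>y. r (fst y)) u) x \<noteq> 0"
      using lk2[of u] by (auto simp: Poly_Mapping.in_keys_iff split: if_splits)
    \<comment> \<open>A basis word with nonzero coefficient violates admissibility, which can only
      be due to its first functional. Hence the word starts with \<open>2\<pi>i\<close> and is
      itself a relation.\<close>
    then have "\<not> adm U (map (\<lambda>y. r (fst y)) u)" using lev by blast
    then have u: "u \<noteq> []" "r (fst (hd u)) (tform U) \<noteq> 0" using ql by (auto simp: adm_def hd_map)
    have ft: "fst (hd u) = ?t" using u(2) qf.representation_basis[OF B(3), of ?t] B(1) by (auto simp: r_def split: if_splits)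
    have "hd u \<in> bf ` Cs" using n(1) u(1) by (meson list.set_sel(1) subsetD)
    then obtain b where b: "hd u = bf b" by blast
    have "snd (hd u) = snd (tform U)" unfolding b by (simp add: bf_def tform_def const_form_def)
    with ft have "hd u = tform U" by (rule prod_eqI)
    moreover have "set u \<subseteq> forms U" using n(1) CB bfU by blast
    then have "set (tl u) \<subseteq> forms U" by (cases u) simp_all
    then have "tl u \<in> lists (forms U)" by blast
    ultimately show "single u 1 \<in> pm.span (tensor_rels U)"
      using tform_cons_rel[of "tl u" U] u(1) by (metis list.collapse pm.span_base)
  qed
  finally have 1: "linext NF x \<in> pm.span (tensor_rels U)" .
  have "linext (\<lambda>w. single ([] @ w) 1 - prep [] (NF w)) x \<in> pm.span (multilinear_rels U)"
  proof (rule linext_words, rule red)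
    fix w assume w: "w \<in> keys x"
    show "w \<in> lists (forms0 U)" using x w unfolding words0_iff by blast
    show "{b. r b y \<noteq> 0} \<subseteq> Cs" if "y \<in> set w" for y using that w unfolding Cs_def by blast
  qed simp
  also have "linext (\<lambda>w. single ([] @ w) 1 - prep [] (NF w)) x = x - linext NF x"
    using linext_fun_add[of "\<lambda>w. single w 1 - NF w" NF x] by (simp add: linext_id eq_diff_eq)
  finally have "x - linext NF x \<in> pm.span (tensor_rels U)" using pm.span_mono[OF multilinear_rels_subset] by blast
  from pm.span_add[OF this 1] show ?thesis by simp
qed

section \<open>Contraction with product functionals, and the coproduct as deconcatenation\<close>

lemma H0_simps [simp]:
  "gh_deg (H0_hopf U) = length"
  "gh_reps (H0_hopf U) = {x \<in> words0 U. linext (diff_word U) x \<in> pm.span (tensor_rels U)}"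
  "gh_null (H0_hopf U) = words0 U \<inter> pm.span (tensor_rels U)"
  "gh_comult (H0_hopf U) = comult_word"
  "gh_counit (H0_hopf U) = (\<lambda>w. if w = [] then 1 else 0)"
  by (simp_all add: H0_hopf_def)

text \<open>Contraction of the first tensor factor with a product functional. Applied to a coaction
  it turns a comodule into a space with operators; \<open>pairing1\<close> and
  \<open>pairing2\<close> go on to a scalar.\<close>

definition opw :: "(form \<Rightarrow> rat) list \<Rightarrow> (fword \<times> 'b \<Rightarrow>\<^sub>0 rat) \<Rightarrow> ('b \<Rightarrow>\<^sub>0 rat)" where
  "opw ls = linext (\<lambda>(w, i). scl (wev ls w) (single i 1))"

definition pairing1 :: "(form \<Rightarrow> 'k::field_char_0) list \<Rightarrow> ('b \<Rightarrow> rat) \<Rightarrow> (fword \<times> 'b \<Rightarrow>\<^sub>0 rat) \<Rightarrow> 'k" where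
  "pairing1 ls c = wsum (\<lambda>(w, i). wev ls w * of_rat (c i))"

definition pairing2 :: "(form \<Rightarrow> 'k::field_char_0) list \<Rightarrow> (form \<Rightarrow> 'k) list \<Rightarrow> ('b \<Rightarrow> rat)
    \<Rightarrow> (fword \<times> fword \<times> 'b \<Rightarrow>\<^sub>0 rat) \<Rightarrow> 'k" where
  "pairing2 ls ms c = wsum (\<lambda>(w1, w2, i). wev ls w1 * wev ms w2 * of_rat (c i))"

lemma opw_tens: "opw ls (tens a v) = scl (lev ls a) v"
proof -
  have "opw ls (tens a v) = linext (\<lambda>w. scl (wev ls w) v) a"
    unfolding opw_def linext_tens by (simp add: linext_fun_scl linext_id del: scl_single)
  also have "\<dots> = scl (lev ls a) v"
    unfolding linext_def lev_def wsum_def pm.scale_sum_left by (simp add: of_rat_eq_id)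
  finally show ?thesis .
qed

lemma pairing1_tens: "pairing1 ls c (tens a v) = lev ls a * of_rat (wsum c v)"
  unfolding pairing1_def wsum_tens by (simp add: wsum_fun_mult wsum_fun_mult_right of_rat_wsum lev_def)

lemma pairing1_opw: "wsum c (opw ls p) = pairing1 ls c p" for c :: "'b \<Rightarrow> rat"
  unfolding opw_def pairing1_def wsum_linext by (rule wsum_cong) (auto simp: of_rat_eq_id)

lemma pairing2_tens: "pairing2 ls ms c (tens x q) = lev ls x * pairing1 ms c q"
  unfolding pairing2_def wsum_tens pairing1_def lev_def
  by (subst wsum_fun_mult_right[symmetric], subst wsum_fun_mult[symmetric]) (simp add: split_def mult.assoc)

lemma opw_add: "opw ls (p + q) = opw ls p + opw ls q" and opw_diff: "opw ls (p - q) = opw ls p - opw ls q"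
  and opw_scl: "opw ls (scl c p) = scl c (opw ls p)" and opw_zero [simp]: "opw ls 0 = 0"
  and opw_sum: "opw ls (\<Sum>j\<in>I. f j) = (\<Sum>j\<in>I. opw ls (f j))"
  by (simp_all add: opw_def linext_add linext_scl linext_diff linext_sum)

lemma pairing1_add: "pairing1 ls c (p + q) = pairing1 ls c p + pairing1 ls c q"
  and pairing1_diff: "pairing1 ls c (p - q) = pairing1 ls c p - pairing1 ls c q"
  and pairing1_scl: "pairing1 ls c (scl r p) = of_rat r * pairing1 ls c p"
  and pairing1_zero [simp]: "pairing1 ls c 0 = 0"
  and pairing1_sum: "pairing1 ls c (\<Sum>j\<in>I. f j) = (\<Sum>j\<in>I. pairing1 ls c (f j))"
  by (simp_all add: pairing1_def wsum_add wsum_diff wsum_scl wsum_sum)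

lemma pairing1_null1:
  fixes p :: "fword \<times> 'b \<Rightarrow>\<^sub>0 rat"
  assumes "adm U ls" "p \<in> null1 (H0_hopf U)" shows "pairing1 ls c p = 0"
  unfolding pairing1_def
proof (rule wsum_span_zero[OF assms(2)[unfolded null1_def]])
  fix s :: "fword \<times> 'b \<Rightarrow>\<^sub>0 rat" assume "s \<in> {tens \<nu> y |\<nu> y. \<nu> \<in> gh_null (H0_hopf U)}"
  then show "wsum (\<lambda>(w, i). wev ls w * of_rat (c i)) s = 0"
    using lev_tensor_rels[OF assms(1)] by (auto simp: pairing1_tens[unfolded pairing1_def])
qed

lemma eq_if_wsum_eq: "(\<And>c :: 'b \<Rightarrow> rat. wsum c x = wsum c y) \<Longrightarrow> x = y"
  by (rule poly_mapping_eqI) (metis wsum_delta of_rat_eq_iff)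

lemma opw_null1:
  assumes "adm U ls" "p \<in> null1 (H0_hopf U)" shows "opw ls p = 0"
  by (rule eq_if_wsum_eq) (simp add: pairing1_opw pairing1_null1[OF assms])

lemma pairing2_null2:
  fixes p :: "fword \<times> fword \<times> 'b \<Rightarrow>\<^sub>0 rat"
  assumes "adm U ls" "adm U ms" "p \<in> null2 (H0_hopf U)" shows "pairing2 ls ms c p = 0"
  unfolding pairing2_def
proof (rule wsum_span_zero[OF assms(3)[unfolded null2_def]])
  fix s :: "fword \<times> fword \<times> 'b \<Rightarrow>\<^sub>0 rat" assume "s \<in> {tens \<nu> (tens x y) |\<nu> x y. \<nu> \<in> gh_null (H0_hopf U)} \<union>
      {tens x (tens \<nu> y) |x \<nu> y. \<nu> \<in> gh_null (H0_hopf U)}"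
  then show "wsum (\<lambda>(w1, w2, i). wev ls w1 * wev ms w2 * of_rat (c i)) s = 0"
    using lev_tensor_rels[OF assms(1)] lev_tensor_rels[OF assms(2)]
    by (auto simp: pairing2_tens[unfolded pairing2_def] pairing1_tens)
qed

definition col :: "'b \<Rightarrow> ('a \<times> 'b \<Rightarrow>\<^sub>0 rat) \<Rightarrow> ('a \<Rightarrow>\<^sub>0 rat)" where
  "col i = linext (\<lambda>(w, i'). if i' = i then single w 1 else 0)"

lemma lookup_col: "lookup (col i p) w = lookup p (w, i)"
proof -
  have "lookup (col i p) w = (\<Sum>a\<in>keys p. if a = (w, i) then lookup p a else 0)"
    unfolding col_def lookup_linext by (rule sum.cong) (auto simp: Poly_Mapping.lookup_single when_def split: prod.split)
  then show ?thesis by (simp add: Poly_Mapping.in_keys_iff)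
qed

lemma lookup_slice: "lookup (slice w p) i = lookup p (w, i)"
proof -
  have "lookup (slice w p) i = (\<Sum>a\<in>keys p. if a = (w, i) then lookup p a else 0)"
    unfolding slice_def lookup_linext by (rule sum.cong) (auto simp: Poly_Mapping.lookup_single when_def split: prod.split)
  then show ?thesis by (simp add: Poly_Mapping.in_keys_iff)
qed

lemma slice_add: "slice w (p + q) = slice w p + slice w q" and slice_scl: "slice w (scl c p) = scl c (slice w p)"
  and slice_zero [simp]: "slice w 0 = 0"
  and slice_sum: "slice w (\<Sum>j\<in>I. f j) = (\<Sum>j\<in>I. slice w (f j))"
  by (simp_all add: slice_def linext_add linext_scl linext_sum)

lemma slice_tens: "slice w (tens a v) = scl (lookup a w) v"
  by (rule poly_mapping_eqI) (simp add: lookup_slice)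

lemma col_expand: "p = (\<Sum>i\<in>snd ` keys p. tens (col i p) (single i 1))"
proof (rule tens_eqI)
  fix a b
  have "lookup (\<Sum>i\<in>snd ` keys p. tens (col i p) (single i 1)) (a, b)
     = (\<Sum>i\<in>snd ` keys p. if i = b then lookup p (a, i) else 0)"
    unfolding Poly_Mapping.lookup_sum lookup_tens lookup_col by (rule sum.cong) (simp_all add: Poly_Mapping.lookup_single when_def)
  also have "\<dots> = lookup p (a, b)"
    by (auto simp: Poly_Mapping.in_keys_iff intro!: rev_image_eqI)
  finally show "lookup p (a, b) = lookup (\<Sum>i\<in>snd ` keys p. tens (col i p) (single i 1)) (a, b)" by simp
qed

lemma slice_expand: "p = (\<Sum>w\<in>fst ` keys p. tens (single w 1) (slice w p))"
proof (rule tens_eqI)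
  fix a b
  have "lookup (\<Sum>w\<in>fst ` keys p. tens (single w 1) (slice w p)) (a, b)
     = (\<Sum>w\<in>fst ` keys p. if w = a then lookup p (w, b) else 0)"
    unfolding Poly_Mapping.lookup_sum lookup_tens lookup_slice by (rule sum.cong) (simp_all add: Poly_Mapping.lookup_single when_def)
  also have "\<dots> = lookup p (a, b)"
    by (auto simp: Poly_Mapping.in_keys_iff intro!: rev_image_eqI)
  finally show "lookup p (a, b) = lookup (\<Sum>w\<in>fst ` keys p. tens (single w 1) (slice w p)) (a, b)" by simp
qed

lemma lev_single [simp]: "lev ls (single w r) = of_rat r * wev ls w"
  by (simp add: lev_def)

lemma opw_expand: "opw ls p = (\<Sum>w\<in>fst ` keys p. scl (wev ls w) (slice w p))"
  by (subst slice_expand) (simp add: opw_sum opw_tens)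

lemma pairing1_expand: "pairing1 ls c p = (\<Sum>w\<in>fst ` keys p. wev ls w * of_rat (wsum c (slice w p)))"
  by (subst slice_expand) (simp add: pairing1_sum pairing1_tens)

text \<open>Expand along the basis of the second factor: each coefficient \<open>col i p\<close> is
  killed by all admissible products, so it is null by
  \<open>product_functionals_separate\<close>.\<close>

lemma null1I:
  assumes U: "U \<noteq> {}" and p: "fst ` keys p \<subseteq> lists (forms0 U)"
    and z: "\<And>ls. adm U ls \<Longrightarrow> opw ls p = 0"
  shows "p \<in> null1 (H0_hopf U)"
proof -
  have "col i p \<in> gh_null (H0_hopf U)" for i
  proof -
    have w: "col i p \<in> words0 U"
      unfolding words0_iff using p by (force simp: Poly_Mapping.in_keys_iff lookup_col)
    have "lev ls (col i p) = 0" if "adm U ls" for ls :: "(form \<Rightarrow> rat) list"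
    proof -
      have "lev ls (col i p) = lookup (opw ls p) i"
        unfolding lev_def col_def wsum_linext unfolding opw_def lookup_linext unfolding wsum_def[of _ p]
        by (rule sum.cong[OF refl]) (simp add: of_rat_eq_id Poly_Mapping.lookup_single when_def split: prod.split if_split)
      then show ?thesis using z[OF that] by simp
    qed
    then show ?thesis using w product_functionals_separate[OF U w] by simp
  qed
  then have "(\<Sum>i\<in>snd ` keys p. tens (col i p) (single i 1)) \<in> null1 (H0_hopf U)"
    unfolding null1_def by (intro pm.span_sum pm.span_base) blast
  then show ?thesis by (subst col_expand)
qed

text \<open>The two summands containing the empty word are the cuts at the ends of \<open>w\<close>;
  the empty word has a single cut.\<close>

lemma comult_word_eq: "comult_word w = (\<Sum>j\<le>length w. single (take j w, drop j w) 1)"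
proof (cases "w = []")
  case False
  then obtain n where n: "length w = Suc n" by (cases w) auto
  have "{..length w} = insert 0 (insert (length w) {1..<length w})" using n by auto
  then show ?thesis using False n by (simp add: comult_word_def)
qed (simp add: comult_word_def)

lemma wev_append_left: "wev (ls @ ms) w = wev ls (take (length ls) w) * wev ms (drop (length ls) w)"
proof (induction ls arbitrary: w)
  case Nil then show ?case by simp
next
  case (Cons a u) then show ?case by (cases w) (auto simp: mult.assoc)
qed

text \<open>Among all cuts of a word only the one after \<open>length ls\<close> letters is seen by
  both functionals.\<close>

lemma pairing2_comult: "pairing2 ls ms c (comult_tens_id (H0_hopf U) p) = pairing1 (ls @ ms) c p"
proof -
  have "wsum (\<lambda>a. wsum (\<lambda>(w1, w2, i). wev ls w1 * wev ms w2 * of_rat (c i)) ((\<lambda>(w1, w2). single (w1, w2, i) 1) a)) (comult_word w)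
     = wev (ls @ ms) w * of_rat (c i)" for w i
  proof -
    have "wsum (\<lambda>a. wsum (\<lambda>(w1, w2, i). wev ls w1 * wev ms w2 * of_rat (c i)) ((\<lambda>(w1, w2). single (w1, w2, i) 1) a)) (comult_word w)
      = (\<Sum>j\<le>length w. wev ls (take j w) * wev ms (drop j w) * of_rat (c i))"
      unfolding comult_word_eq wsum_sum by simp
    also have "\<dots> = (\<Sum>j\<le>length w. if j = length ls then wev (ls @ ms) w * of_rat (c i) else 0)"
      by (rule sum.cong) (auto simp: wev_append_left wev_length)
    also have "\<dots> = wev (ls @ ms) w * of_rat (c i)"
      by (auto simp: wev_append_left wev_length)
    finally show ?thesis .
  qed
  then show ?thesis
    unfolding pairing2_def comult_tens_id_def wsum_linext pairing1_def by (intro wsum_cong) (auto simp: wsum_linext)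
qed

lemma pairing2_id_tens:
  "pairing2 ls ms c (id_tens f p) = (\<Sum>w\<in>fst ` keys p. wev ls w * pairing1 ms c (f w (slice w p)))"
  unfolding id_tens_def by (simp add: pairing2_def wsum_sum pairing2_tens[unfolded pairing2_def])

lemma opw_id_tens: "opw ls (id_tens f p) = (\<Sum>w\<in>fst ` keys p. scl (wev ls w) (f w (slice w p)))"
  unfolding id_tens_def by (simp add: opw_sum opw_tens)

lemma keys_id_tens: "fst ` keys (id_tens f p) \<subseteq> fst ` keys p"
proof
  fix w assume "w \<in> fst ` keys (id_tens f p)"
  then obtain i where "lookup (id_tens f p) (w, i) \<noteq> 0" by (auto simp: Poly_Mapping.in_keys_iff)
  then have "\<exists>w'\<in>fst ` keys p. lookup (tens (single w' 1) (f w' (slice w' p))) (w, i) \<noteq> 0"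
    unfolding id_tens_def Poly_Mapping.lookup_sum by (meson sum.neutral)
  then show "w \<in> fst ` keys p" by (auto simp: Poly_Mapping.lookup_single when_def split: if_splits)
qed

lemma findim_subspace: "findim V \<Longrightarrow> pm.subspace V"
  by (auto simp: findim_def pm.subspace_span)

lemma wev_combination:
  "wev (a @ (\<lambda>x. c * g x + k x) # b) w = c * wev (a @ g # b) w + wev (a @ k # b) w"
proof (induction a arbitrary: w)
  case Nil then show ?case by (cases w) (auto simp: algebra_simps)
next
  case (Cons l a) then show ?case by (cases w) (auto simp: algebra_simps)
qed

lemma opw_fun:
  assumes "\<And>w. wev ls w = c * wev ls1 w + wev ls2 w"
  shows "opw ls p = scl c (opw ls1 p) + opw ls2 p"
proof -
  have "opw ls p = linext (\<lambda>x. scl c ((\<lambda>(w, i). scl (wev ls1 w) (single i 1)) x) + (\<lambda>(w, i). scl (wev ls2 w) (single i 1)) x) p"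
    unfolding opw_def by (rule linext_cong) (auto simp: assms Poly_Mapping.single_add)
  then show ?thesis unfolding linext_fun_add linext_fun_scl opw_def .
qed

section \<open>Comodules as spaces with operators\<close>

locale comod =
  fixes U :: "complex set" and M :: "fword comodule"
  assumes U: "U \<noteq> {}" and M: "graded_comodule (H0_hopf U) M"
begin

abbreviation "V \<equiv> cm_space M"
abbreviation "\<rho> \<equiv> cm_coact M"

text \<open>The operator by which a product functional, seen as an element of the dual algebra, acts
  on the comodule; it lowers the degree by the length of the list.\<close>

definition act :: "(form \<Rightarrow> rat) list \<Rightarrow> int \<Rightarrow> qvec \<Rightarrow> qvec" where
  "act ls n v = opw ls (\<rho> n v)"

lemma findim_V: "findim (V n)" and finite_V: "finite {n. V n \<noteq> {0}}"
  using M unfolding graded_comodule_def by blast+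

lemma subspace_V: "pm.subspace (V n)" using findim_V findim_subspace by blast

lemma coact_span: "v \<in> V n \<Longrightarrow> \<rho> n v \<in> pm.span (\<Union>k. {tens a v' | a v'. a \<in> gh_part (H0_hopf U) k \<and> v' \<in> V (n - int k)})"
  using M unfolding graded_comodule_def by blast

lemma coact_induct [consumes 1, case_names zero step]:
  assumes "v \<in> V n" "P 0"
    and "\<And>q a k v' p. a \<in> gh_part (H0_hopf U) k \<Longrightarrow> v' \<in> V (n - int k) \<Longrightarrow> P p \<Longrightarrow> P (scl q (tens a v') + p)"
  shows "P (\<rho> n v)"
  using coact_span[OF assms(1)]
  by (induction rule: pm.span_induct_alt) (use assms(2,3) in auto)

lemma coact_words: "v \<in> V n \<Longrightarrow> fst ` keys (\<rho> n v) \<subseteq> lists (forms0 U)"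
proof (induction rule: coact_induct)
  case (step q a k v' p)
  have "keys a \<subseteq> lists (forms0 U)" using step(1) by (auto simp: gh_part_def words0_iff)
  then have "fst ` keys (scl q (tens a v')) \<subseteq> lists (forms0 U)" by (auto simp: Poly_Mapping.in_keys_iff)
  then show ?case using step(3) Poly_Mapping.keys_add[of "scl q (tens a v')" p] by blast
qed auto

lemma slice_coact: "v \<in> V n \<Longrightarrow> slice w (\<rho> n v) \<in> V (n - int (length w))"
proof (induction rule: coact_induct)
  case (step q a k v' p)
  have "scl (lookup a w) v' \<in> V (n - int (length w))"
  proof (cases "w \<in> keys a")
    case True then show ?thesis using step(1,2) subspace_V by (auto simp: gh_part_def pm.subspace_scale)
  next
    case False then show ?thesis using subspace_V by (simp add: Poly_Mapping.in_keys_iff pm.scale_zero_left pm.subspace_0)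
  qed
  then show ?case using step(3) unfolding slice_add slice_scl slice_tens by (rule pm.subspace_add[OF subspace_V pm.subspace_scale[OF subspace_V]])
qed (use subspace_V pm.subspace_0 in auto)

lemma act_in: "v \<in> V n \<Longrightarrow> act ls n v \<in> V (n - int (length ls))"
  unfolding act_def opw_expand
proof (rule pm.subspace_sum[OF subspace_V])
  fix w assume "v \<in> V n"
  then show "scl (wev ls w) (slice w (\<rho> n v)) \<in> V (n - int (length ls))"
    using slice_coact[of v n w] subspace_V[of "n - int (length ls)"]
    by (cases "length ls = length w") (auto simp: pm.subspace_scale wev_length pm.scale_zero_left pm.subspace_0)
qed

lemma coact_add_null: "u \<in> V n \<Longrightarrow> v \<in> V n \<Longrightarrow> \<rho> n (u + v) - (\<rho> n u + \<rho> n v) \<in> null1 (H0_hopf U)"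
  and coact_scl_null: "v \<in> V n \<Longrightarrow> \<rho> n (scl q v) - scl q (\<rho> n v) \<in> null1 (H0_hopf U)"
  using M unfolding graded_comodule_def by blast+

text \<open>The coaction is linear only modulo \<open>null1\<close>. Admissible functionals do not
  see the error, so their operators are honestly linear.\<close>

lemma pairing1_coact_add:
  assumes "adm U ls" "u \<in> V n" "v \<in> V n"
  shows "pairing1 ls c (\<rho> n (u + v)) = pairing1 ls c (\<rho> n u) + pairing1 ls c (\<rho> n v)"
  using pairing1_null1[OF assms(1) coact_add_null[OF assms(2,3)], of c] by (simp add: pairing1_diff pairing1_add)

lemma pairing1_coact_scl:
  assumes "adm U ls" "v \<in> V n"
  shows "pairing1 ls c (\<rho> n (scl q v)) = of_rat q * pairing1 ls c (\<rho> n v)"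
  using pairing1_null1[OF assms(1) coact_scl_null[OF assms(2), of q], of c] by (simp add: pairing1_diff pairing1_scl)

lemma pairing1_coact_zero: "adm U ls \<Longrightarrow> pairing1 ls c (\<rho> n 0) = 0"
  using pairing1_coact_scl[of ls 0 n c 0, OF _ pm.subspace_0[OF subspace_V]] by (simp add: pm.subspace_0 pm.scale_zero_left)

lemma pairing1_coact_sum:
  assumes "adm U ls" "\<And>b. b \<in> B \<Longrightarrow> b \<in> V n"
  shows "pairing1 ls c (\<rho> n (\<Sum>b\<in>B. scl (q b) b)) = (\<Sum>b\<in>B. of_rat (q b) * pairing1 ls c (\<rho> n b))"
  using assms(2)
proof (induction B rule: infinite_finite_induct)
  case (insert b B)
  have "(\<Sum>b\<in>B. scl (q b) b) \<in> V n" "scl (q b) b \<in> V n"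
    using insert subspace_V[of n] by (auto intro!: pm.subspace_sum pm.subspace_scale)
  then show ?case using insert assms(1) by (simp add: pairing1_coact_add pairing1_coact_scl)
qed (use pairing1_coact_zero assms in auto)

lemma act_add: "adm U ls \<Longrightarrow> u \<in> V n \<Longrightarrow> v \<in> V n \<Longrightarrow> act ls n (u + v) = act ls n u + act ls n v"
  unfolding act_def by (rule eq_if_wsum_eq) (simp add: wsum_add pairing1_opw pairing1_coact_add)

lemma act_scl: "adm U ls \<Longrightarrow> v \<in> V n \<Longrightarrow> act ls n (scl q v) = scl q (act ls n v)"
  unfolding act_def by (rule eq_if_wsum_eq) (simp add: wsum_scl pairing1_opw pairing1_coact_scl)

lemma act_Nil: "v \<in> V n \<Longrightarrow> act [] n v = v"
proof -
  assume "v \<in> V n"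
  then have "counit_tens_id (H0_hopf U) (\<rho> n v) = v" using M unfolding graded_comodule_def by blast
  moreover have "opw [] p = counit_tens_id (H0_hopf U) p" for p :: "fword \<times> nat \<Rightarrow>\<^sub>0 rat"
    unfolding opw_def counit_tens_id_def by (rule linext_cong) (auto simp: wev.simps split: prod.split list.split intro!: arg_cong[of _ _ "single _"] simp: neq_Nil_conv)
  ultimately show ?thesis by (simp add: act_def)
qed

text \<open>In the iterated coaction the intermediate vector lies in degree
  \<open>n - length ls\<close>, where it is expanded in the basis \<open>B\<close> with dual
  functionals \<open>d\<close>. Words of any other length are invisible to
  \<open>ls\<close>.\<close>

lemma coassoc:
  assumes "v \<in> V n" "adm U ls" "adm U ms" and B: "finite B" "V (n - int (length ls)) = pm.span B"
    and d: "\<And>b b'. b \<in> B \<Longrightarrow> b' \<in> B \<Longrightarrow> wsum (d b) b' = (if b = b' then 1 else (0::rat))"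
  shows "pairing1 (ls @ ms) c (\<rho> n v) = (\<Sum>b\<in>B. pairing1 ls (d b) (\<rho> n v) * pairing1 ms c (\<rho> (n - int (length ls)) b))"
proof -
  let ?p = "\<rho> n v" and ?m = "n - int (length ls)"
  have "comult_tens_id (H0_hopf U) ?p - id_tens (\<lambda>w. \<rho> (n - int (length w))) ?p \<in> null2 (H0_hopf U)"
    using M assms(1) unfolding graded_comodule_def by auto
  from pairing2_null2[OF assms(2,3) this, of c]
  have "pairing1 (ls @ ms) c ?p = pairing2 ls ms c (id_tens (\<lambda>w. \<rho> (n - int (length w))) ?p)"
    unfolding pairing2_comult[symmetric, of _ _ _ _ U] by (simp add: pairing2_def wsum_diff)
  also have "\<dots> = (\<Sum>w\<in>fst ` keys ?p. \<Sum>b\<in>B. wev ls w * of_rat (wsum (d b) (slice w ?p)) * pairing1 ms c (\<rho> ?m b))"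
    unfolding pairing2_id_tens
  proof (rule sum.cong[OF refl])
    fix w
    show "wev ls w * pairing1 ms c (\<rho> (n - int (length w)) (slice w ?p))
       = (\<Sum>b\<in>B. wev ls w * of_rat (wsum (d b) (slice w ?p)) * pairing1 ms c (\<rho> ?m b))"
    proof (cases "length ls = length w")
      case True
      have "slice w ?p \<in> pm.span B" using slice_coact[OF assms(1), of w] B(2) True by simp
      from dual_functionals_expansion[OF B(1) d this]
      have "pairing1 ms c (\<rho> ?m (slice w ?p)) = pairing1 ms c (\<rho> ?m (\<Sum>b\<in>B. scl (wsum (d b) (slice w ?p)) b))" by simp
      also have "\<dots> = (\<Sum>b\<in>B. of_rat (wsum (d b) (slice w ?p)) * pairing1 ms c (\<rho> ?m b))"
        by (rule pairing1_coact_sum[OF assms(3)]) (use B pm.span_superset in blast)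
      finally show ?thesis using True by (simp add: sum_distrib_left mult.assoc)
    qed (simp add: wev_length)
  qed
  also have "\<dots> = (\<Sum>b\<in>B. pairing1 ls (d b) ?p * pairing1 ms c (\<rho> ?m b))"
    unfolding pairing1_expand[of ls] by (subst sum.swap) (simp add: sum_distrib_right)
  finally show ?thesis .
qed

text \<open>Coassociativity as composition of operators. Admissibility of \<open>ms\<close> reflects
  that a cut turns the first letter of the second factor into a class modulo
  \<open>\<rat>(1)\<close>.\<close>

lemma act_append:
  assumes v: "v \<in> V n" and a: "adm U ls" "adm U ms"
  shows "act (ls @ ms) n v = act ms (n - int (length ls)) (act ls n v)"
proof -
  let ?m = "n - int (length ls)"
  obtain B where B: "finite B" "pm.independent B" "V ?m = pm.span B" "B \<subseteq> V ?m" using findim_basis[OF findim_V] by metis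
  obtain d :: "qvec \<Rightarrow> nat \<Rightarrow> rat" where d: "\<And>b b'. b \<in> B \<Longrightarrow> b' \<in> B \<Longrightarrow> wsum (d b) b' = (if b = b' then 1 else 0)"
    using dual_functionals[OF B(2)] by metis
  have "act ls n v \<in> pm.span B" using act_in[OF v, of ls] B(3) by simp
  from dual_functionals_expansion[OF B(1) d this]
  have e: "act ls n v = (\<Sum>b\<in>B. scl (wsum (d b) (act ls n v)) b)" .
  show ?thesis
  proof (rule eq_if_wsum_eq)
    fix c
    have "wsum c (act ms ?m (act ls n v)) = pairing1 ms c (\<rho> ?m (\<Sum>b\<in>B. scl (wsum (d b) (act ls n v)) b))"
      unfolding act_def[of ms] pairing1_opw using e by simp
    also have "\<dots> = (\<Sum>b\<in>B. pairing1 ls (d b) (\<rho> n v) * pairing1 ms c (\<rho> ?m b))"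
      using pairing1_coact_sum[OF a(2), of B ?m c "\<lambda>b. wsum (d b) (act ls n v)"] B(4) by (auto simp: act_def pairing1_opw of_rat_eq_id)
    also have "\<dots> = wsum c (act (ls @ ms) n v)"
      using coassoc[OF v a B(1,3) d, of c] by (simp add: act_def pairing1_opw)
    finally show "wsum c (act (ls @ ms) n v) = wsum c (act ms ?m (act ls n v))" by simp
  qed
qed

lemma act_letter:
  "act (a @ (\<lambda>x. c * g x + k x) # b) n v = scl c (act (a @ g # b) n v) + act (a @ k # b) n v"
  unfolding act_def by (rule opw_fun) (rule wev_combination)

end

lemma qlinear_sum:
  assumes "qlinear V V' f" "pm.subspace V" "\<And>j. j \<in> J \<Longrightarrow> g j \<in> V"
  shows "f (\<Sum>j\<in>J. scl (q j) (g j)) = (\<Sum>j\<in>J. scl (q j) (f (g j)))"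
proof -
  have f0: "f 0 = 0" using assms(1) pm.subspace_0[OF assms(2)] unfolding qlinear_def by (metis pm.scale_zero_left)
  show ?thesis
    using assms(3)
  proof (induction J rule: infinite_finite_induct)
    case (insert j J)
    have "(\<Sum>j\<in>J. scl (q j) (g j)) \<in> V" "scl (q j) (g j) \<in> V"
      using insert assms(2) by (auto intro!: pm.subspace_sum pm.subspace_scale)
    then show ?case using insert assms(1) by (auto simp: qlinear_def)
  qed (simp_all add: f0)
qed

locale comod_pair = src: comod U M + tgt: comod U M' for U M M'
begin

definition graded_linear :: "(int \<Rightarrow> qvec \<Rightarrow> qvec) \<Rightarrow> bool" where
  "graded_linear f \<longleftrightarrow> (\<forall>n. qlinear (cm_space M n) (cm_space M' n) (f n))"

text \<open>A congruence modulo \<open>null1\<close> becomes an equation between vectors: admissible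
  functionals annihilate \<open>null1\<close>, and by \<open>null1I\<close> they detect it.\<close>

lemma coaction_compatible_iff:
  assumes f: "graded_linear f" and v: "v \<in> cm_space M n"
  shows "id_tens (\<lambda>w. f (n - int (length w))) (cm_coact M n v) - cm_coact M' n (f n v) \<in> null1 (H0_hopf U)
    \<longleftrightarrow> (\<forall>ls. adm U ls \<longrightarrow> tgt.act ls n (f n v) = f (n - int (length ls)) (src.act ls n v))"
proof -
  let ?p = "cm_coact M n v"
  have q: "qlinear (cm_space M m) (cm_space M' m) (f m)" for m using f unfolding graded_linear_def by blast
  have fv: "f n v \<in> cm_space M' n" using q v unfolding qlinear_def by blast
  have 1: "opw ls (id_tens (\<lambda>w. f (n - int (length w))) ?p) = f (n - int (length ls)) (src.act ls n v)" for ls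
  proof -
    let ?W = "{w \<in> fst ` keys ?p. length w = length ls}"
    have "opw ls (id_tens (\<lambda>w. f (n - int (length w))) ?p) = (\<Sum>w\<in>?W. scl (wev ls w) (f (n - int (length ls)) (slice w ?p)))"
      unfolding opw_id_tens by (rule sum.mono_neutral_cong_right) (auto simp: wev_length wev_length[OF not_sym] pm.scale_zero_left)
    also have "\<dots> = f (n - int (length ls)) (\<Sum>w\<in>?W. scl (wev ls w) (slice w ?p))"
      by (rule qlinear_sum[OF q src.subspace_V, symmetric]) (use src.slice_coact[OF v] in \<open>auto, metis fst_conv\<close>)
    also have "(\<Sum>w\<in>?W. scl (wev ls w) (slice w ?p)) = src.act ls n v"
      unfolding src.act_def opw_expand by (rule sum.mono_neutral_left) (auto simp: wev_length wev_length[OF not_sym] pm.scale_zero_left)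
    finally show ?thesis .
  qed
  show ?thesis
  proof
    assume a: "id_tens (\<lambda>w. f (n - int (length w))) ?p - cm_coact M' n (f n v) \<in> null1 (H0_hopf U)"
    show "\<forall>ls. adm U ls \<longrightarrow> tgt.act ls n (f n v) = f (n - int (length ls)) (src.act ls n v)"
      using opw_null1[OF _ a] by (simp add: opw_diff 1 tgt.act_def)
  next
    assume a: "\<forall>ls. adm U ls \<longrightarrow> tgt.act ls n (f n v) = f (n - int (length ls)) (src.act ls n v)"
    let ?q = "id_tens (\<lambda>w. f (n - int (length w))) ?p"
    have "fst ` keys (?q - cm_coact M' n (f n v)) \<subseteq> lists (forms0 U)"
      using Poly_Mapping.keys_diff[of ?q "cm_coact M' n (f n v)"] keys_id_tens[of "\<lambda>w. f (n - int (length w))" ?p]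
        src.coact_words[OF v] tgt.coact_words[OF fv] by blast
    then show "?q - cm_coact M' n (f n v) \<in> null1 (H0_hopf U)"
      by (rule null1I[OF src.U]) (use a in \<open>simp add: opw_diff 1 tgt.act_def\<close>)
  qed
qed

lemma comodule_hom_iff:
  "f \<in> comodule_hom (H0_hopf U) M M' \<longleftrightarrow>
    graded_linear f \<and> (\<forall>n v. v \<notin> cm_space M n \<longrightarrow> f n v = 0) \<and>
    (\<forall>n. \<forall>v\<in>cm_space M n. \<forall>ls. adm U ls \<longrightarrow> tgt.act ls n (f n v) = f (n - int (length ls)) (src.act ls n v))"
  using coaction_compatible_iff[of f] by (auto simp: comodule_hom_def graded_linear_def)

text \<open>The reduction splits a functional into its value at \<open>2\<pi>i\<close> times \<open>E\<close> and a functional that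
  may start a new tensor factor, where coassociativity applies.\<close>

lemma intertwines_if_intertwines_basic:
  assumes f: "graded_linear f" and E: "qlin U E" "E (tform U) = 1"
    and basic: "\<And>l m n v. qlin U l \<Longrightarrow> l (tform U) = 0 \<Longrightarrow> v \<in> cm_space M n \<Longrightarrow>
       tgt.act (l # replicate m E) n (f n v) = f (n - int (Suc m)) (src.act (l # replicate m E) n v)"
    and v: "v \<in> cm_space M n" and ls: "adm U ls"
  shows "tgt.act ls n (f n v) = f (n - int (length ls)) (src.act ls n v)"
proof -
  have q: "qlinear (cm_space M m) (cm_space M' m) (f m)" for m using f unfolding graded_linear_def by blast
  have fin: "f n v \<in> cm_space M' n" if "v \<in> cm_space M n" for n v using q that unfolding qlinear_def by blast
  \<comment> \<open>Generalised over the length \<open>m\<close> of the block of copies of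
    \<open>E\<close>, because the multiple of \<open>E\<close> split off from the head of the tail
    is absorbed into that block.\<close>
  have main: "tgt.act (l # replicate m E @ rs) n (f n v) = f (n - int (length (l # replicate m E @ rs))) (src.act (l # replicate m E @ rs) n v)"
    if "qlin U l" "l (tform U) = 0" "\<forall>r\<in>set rs. qlin U r" "v \<in> cm_space M n" for l m rs n v
    using that
  proof (induction rs arbitrary: l m n v)
    case Nil then show ?case using basic by simp
  next
    case (Cons r rs)
    define \<kappa> where "\<kappa> x = r x - r (tform U) * E x" for x
    have r: "r = (\<lambda>x. r (tform U) * E x + \<kappa> x)" by (simp add: \<kappa>_def)
    have tU: "tform U \<in> forms U" using tform_in forms0_subset by blast
    have k: "qlin U \<kappa>" "\<kappa> (tform U) = 0" using Cons.prems(3) E by (auto simp: qlin_def \<kappa>_def algebra_simps)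
    have ad: "adm U (l # replicate m E)" "adm U (\<kappa> # rs)" using Cons.prems k E by (auto simp: adm_def)
    let ?N = "n - int (length (l # replicate m E @ r # rs))" and ?m = "n - int (length (l # replicate m E))"
    have sp: "src.act (l # replicate m E @ r # rs) n v = scl (r (tform U)) (src.act (l # replicate (Suc m) E @ rs) n v)
        + src.act (\<kappa> # rs) (n - int (length (l # replicate m E))) (src.act (l # replicate m E) n v)" if "v \<in> cm_space M n" for n v
    proof -
      have "src.act (l # replicate m E @ r # rs) n v = src.act ((l # replicate m E) @ (\<lambda>x. r (tform U) * E x + \<kappa> x) # rs) n v"
        by (subst r) simp
      also have "\<dots> = scl (r (tform U)) (src.act ((l # replicate m E) @ E # rs) n v) + src.act ((l # replicate m E) @ \<kappa> # rs) n v"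
        by (rule src.act_letter)
      also have "(l # replicate m E) @ E # rs = l # replicate (Suc m) E @ rs" by (simp add: replicate_app_Cons_same)
      finally show ?thesis using src.act_append[OF that ad] by simp
    qed
    have tp: "tgt.act (l # replicate m E @ r # rs) n v = scl (r (tform U)) (tgt.act (l # replicate (Suc m) E @ rs) n v)
        + tgt.act (\<kappa> # rs) (n - int (length (l # replicate m E))) (tgt.act (l # replicate m E) n v)" if "v \<in> cm_space M' n" for n v
    proof -
      have "tgt.act (l # replicate m E @ r # rs) n v = tgt.act ((l # replicate m E) @ (\<lambda>x. r (tform U) * E x + \<kappa> x) # rs) n v"
        by (subst r) simp
      also have "\<dots> = scl (r (tform U)) (tgt.act ((l # replicate m E) @ E # rs) n v) + tgt.act ((l # replicate m E) @ \<kappa> # rs) n v"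
        by (rule tgt.act_letter)
      also have "(l # replicate m E) @ E # rs = l # replicate (Suc m) E @ rs" by (simp add: replicate_app_Cons_same)
      finally show ?thesis using tgt.act_append[OF that ad] by simp
    qed
    have 1: "tgt.act (l # replicate (Suc m) E @ rs) n (f n v) = f ?N (src.act (l # replicate (Suc m) E @ rs) n v)"
      using Cons.IH[OF Cons.prems(1,2) _ Cons.prems(4), of "Suc m"] Cons.prems(3) by simp
    let ?w = "src.act (l # replicate m E) n v"
    have w: "?w \<in> cm_space M ?m" using src.act_in[OF Cons.prems(4)] by blast
    have 2: "tgt.act (l # replicate m E) n (f n v) = f ?m ?w"
      using basic[OF Cons.prems(1,2,4), of m] by simp
    have 3: "tgt.act (\<kappa> # rs) ?m (f ?m ?w) = f ?N (src.act (\<kappa> # rs) ?m ?w)"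
      using Cons.IH[OF k _ w, of 0] Cons.prems(3) by (simp add: algebra_simps)
    have i1: "src.act (l # replicate (Suc m) E @ rs) n v \<in> cm_space M ?N"
      using src.act_in[OF Cons.prems(4), of "l # replicate (Suc m) E @ rs"] by simp
    have i2: "src.act (\<kappa> # rs) ?m ?w \<in> cm_space M ?N"
      using src.act_in[OF w, of "\<kappa> # rs"] by (simp add: algebra_simps)
    have "f ?N (scl (r (tform U)) (src.act (l # replicate (Suc m) E @ rs) n v) + src.act (\<kappa> # rs) ?m ?w)
      = scl (r (tform U)) (f ?N (src.act (l # replicate (Suc m) E @ rs) n v)) + f ?N (src.act (\<kappa> # rs) ?m ?w)"
      using q[of ?N] i1 i2 pm.subspace_scale[OF src.subspace_V i1] unfolding qlinear_def by metis
    then show ?case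
      unfolding sp[OF Cons.prems(4)] tp[OF fin[OF Cons.prems(4)]] 1 2 3 by simp
  qed
  show ?thesis
  proof (cases ls)
    case Nil then show ?thesis using src.act_Nil[OF v] tgt.act_Nil[OF fin[OF v]] by simp
  next
    case (Cons l rs) then show ?thesis using main[of l rs v n 0] ls v by (auto simp: adm_def)
  qed
qed

end

section \<open>The category of graded comodules\<close>

context comod begin

lemma id_qlinear: "qlinear (V n) (V n) (\<lambda>v. if v \<in> V n then v else 0)"
  using subspace_V[of n] by (auto simp: qlinear_def pm.subspace_add pm.subspace_scale)

end

text \<open>Once colinearity is expressed as commutation with all admissible operators, closure
  under composition is immediate. The remaining care goes to the convention that maps vanish outside
  their domain.\<close>

lemma category_comodule_cat:
  assumes U: "U \<noteq> {}"
  shows "category (comodule_cat (H0_hopf U))"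
proof -
  have cm: "comod U a" if "a \<in> ob (comodule_cat (H0_hopf U))" for a
    using that U by (simp add: comodule_cat_def comod_def)
  have hm: "f \<in> hom (comodule_cat (H0_hopf U)) a b \<longleftrightarrow>
    (\<forall>n. qlinear (cm_space a n) (cm_space b n) (f n)) \<and> (\<forall>n v. v \<notin> cm_space a n \<longrightarrow> f n v = 0) \<and>
    (\<forall>n. \<forall>v\<in>cm_space a n. \<forall>ls. adm U ls \<longrightarrow> comod.act b ls n (f n v) = f (n - int (length ls)) (comod.act a ls n v))"
    if "a \<in> ob (comodule_cat (H0_hopf U))" "b \<in> ob (comodule_cat (H0_hopf U))" for a b f
  proof -
    interpret comod_pair U a b using cm that by (simp add: comod_pair_def)
    show ?thesis using comodule_hom_iff[of f] by (simp add: comodule_cat_def graded_linear_def)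
  qed
  have f0: "f n 0 = 0" if "qlinear (cm_space a n) W (f n)" "a \<in> ob (comodule_cat (H0_hopf U))" for a n W and f :: "int \<Rightarrow> qvec \<Rightarrow> qvec"
  proof -
    interpret comod U a using cm that by simp
    show ?thesis using that(1) pm.subspace_0[OF subspace_V, of n] unfolding qlinear_def by (metis pm.scale_zero_left)
  qed
  show ?thesis
    unfolding category_def
  proof (intro conjI ballI)
    fix a assume a: "a \<in> ob (comodule_cat (H0_hopf U))"
    interpret comod U a using cm a .
    show "idn (comodule_cat (H0_hopf U)) a \<in> hom (comodule_cat (H0_hopf U)) a a"
      unfolding hm[OF a a] using id_qlinear act_in by (simp add: comodule_cat_def)
  next
    fix a b c f g
    assume o: "a \<in> ob (comodule_cat (H0_hopf U))" "b \<in> ob (comodule_cat (H0_hopf U))" "c \<in> ob (comodule_cat (H0_hopf U))"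
      and fg: "f \<in> hom (comodule_cat (H0_hopf U)) a b" "g \<in> hom (comodule_cat (H0_hopf U)) b c"
    interpret comod U a using cm o by simp
    have f: "qlinear (cm_space a n) (cm_space b n) (f n)" "v \<notin> cm_space a n \<Longrightarrow> f n v = 0"
      "v \<in> cm_space a n \<Longrightarrow> adm U ls \<Longrightarrow> comod.act b ls n (f n v) = f (n - int (length ls)) (comod.act a ls n v)" for n v ls
      using fg(1) unfolding hm[OF o(1,2)] by blast+
    have g: "qlinear (cm_space b n) (cm_space c n) (g n)" 
      "v \<in> cm_space b n \<Longrightarrow> adm U ls \<Longrightarrow> comod.act c ls n (g n v) = g (n - int (length ls)) (comod.act b ls n v)" for n v ls
      using fg(2) unfolding hm[OF o(2,3)] by blast+
    have fin: "f n v \<in> cm_space b n" if "v \<in> cm_space a n" for n v using f(1) that unfolding qlinear_def by blast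
    have "(\<lambda>n v. g n (f n v)) \<in> hom (comodule_cat (H0_hopf U)) a c"
      unfolding hm[OF o(1,3)]
    proof (intro conjI allI ballI impI)
      fix n show "qlinear (cm_space a n) (cm_space c n) (\<lambda>v. g n (f n v))"
        using f(1)[of n] g(1)[of n] fin unfolding qlinear_def by (auto simp: image_subset_iff)
    next
      fix n v assume "v \<notin> cm_space a n" then show "g n (f n v) = 0" using f(2)[of v n] f0[where f=g and n=n, OF g(1)[of n] o(2)] by simp
    next
      fix n v and ls :: "(form \<Rightarrow> rat) list" assume v: "v \<in> cm_space a n" and ls: "adm U ls"
      show "comod.act c ls n (g n (f n v)) = g (n - int (length ls)) (f (n - int (length ls)) (act ls n v))"
        using g(2)[OF fin[OF v] ls] f(3)[OF v ls] by simp
    qed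
    then show "cmp (comodule_cat (H0_hopf U)) g f \<in> hom (comodule_cat (H0_hopf U)) a c" by (simp add: comodule_cat_def)
  next
    fix a b f
    assume o: "a \<in> ob (comodule_cat (H0_hopf U))" "b \<in> ob (comodule_cat (H0_hopf U))"
      and f: "f \<in> hom (comodule_cat (H0_hopf U)) a b"
    have f': "qlinear (cm_space a n) (cm_space b n) (f n)" "v \<notin> cm_space a n \<Longrightarrow> f n v = 0" for n v
      using f unfolding hm[OF o(1,2)] by blast+
    have fin: "f n v \<in> cm_space b n" if "v \<in> cm_space a n" for n v using f'(1) that unfolding qlinear_def by blast
    have z: "f n 0 = 0" for n by (rule f0[where f=f and n=n, OF f'(1)[of n] o(1)])
    show "cmp (comodule_cat (H0_hopf U)) f (idn (comodule_cat (H0_hopf U)) a) = f"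
      by (auto simp: comodule_cat_def fun_eq_iff f'(2) z)
    show "cmp (comodule_cat (H0_hopf U)) (idn (comodule_cat (H0_hopf U)) b) f = f"
      using fin f'(2) by (fastforce simp: comodule_cat_def fun_eq_iff)
  next
    fix a b c d f g h
    show "cmp (comodule_cat (H0_hopf U)) h (cmp (comodule_cat (H0_hopf U)) g f) = cmp (comodule_cat (H0_hopf U)) (cmp (comodule_cat (H0_hopf U)) h g) f"
      by (simp add: comodule_cat_def)
  qed
qed

context comod_pair begin

lemma inverse_hom:
  assumes f: "f \<in> comodule_hom (H0_hopf U) M M'" and bij: "\<And>n. bij_betw (f n) (cm_space M n) (cm_space M' n)"
  defines "g \<equiv> \<lambda>n v. if v \<in> cm_space M' n then inv_into (cm_space M n) (f n) v else 0"
  shows "g \<in> comodule_hom (H0_hopf U) M' M"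
    and "v \<in> cm_space M n \<Longrightarrow> g n (f n v) = v" and "w \<in> cm_space M' n \<Longrightarrow> f n (g n w) = w"
proof -
  interpret op: comod_pair U M' M ..
  have f': "qlinear (cm_space M n) (cm_space M' n) (f n)"
    "v \<in> cm_space M n \<Longrightarrow> adm U ls \<Longrightarrow> tgt.act ls n (f n v) = f (n - int (length ls)) (src.act ls n v)" for n v and ls :: "(form \<Rightarrow> rat) list"
    using f unfolding comodule_hom_iff graded_linear_def by blast+
  have fin: "f n v \<in> cm_space M' n" if "v \<in> cm_space M n" for n v using f'(1) that unfolding qlinear_def by blast
  have gf: "g n (f n v) = v" if "v \<in> cm_space M n" for n v
    using fin[OF that] bij[of n] that unfolding g_def bij_betw_def by simp
  have fg: "f n (g n w) = w" and gin: "g n w \<in> cm_space M n" if "w \<in> cm_space M' n" for n w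
    using bij[of n] that unfolding g_def bij_betw_def by (auto simp: f_inv_into_f inv_into_into)
  show "v \<in> cm_space M n \<Longrightarrow> g n (f n v) = v" "w \<in> cm_space M' n \<Longrightarrow> f n (g n w) = w" by (fact gf, fact fg)
  have inj: "x = y" if "x \<in> cm_space M n" "y \<in> cm_space M n" "f n x = f n y" for x y n using gf that by metis
  show "g \<in> comodule_hom (H0_hopf U) M' M"
    unfolding op.comodule_hom_iff op.graded_linear_def
  proof (intro conjI allI ballI impI)
    fix n show "qlinear (cm_space M' n) (cm_space M n) (g n)"
      unfolding qlinear_def
    proof (intro conjI ballI allI)
      show "g n ` cm_space M' n \<subseteq> cm_space M n" using gin by blast
    next
      fix u v assume uv: "u \<in> cm_space M' n" "v \<in> cm_space M' n"
      have s: "g n u + g n v \<in> cm_space M n" "u + v \<in> cm_space M' n"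
        using uv gin pm.subspace_add src.subspace_V tgt.subspace_V by blast+
      have "f n (g n u + g n v) = u + v" using f'(1)[of n] uv gin fg unfolding qlinear_def by simp
      then show "g n (u + v) = g n u + g n v" using gf[OF s(1)] by simp
    next
      fix q v assume uv: "v \<in> cm_space M' n"
      have s: "scl q (g n v) \<in> cm_space M n" using uv gin pm.subspace_scale src.subspace_V by blast
      have "f n (scl q (g n v)) = scl q v" using f'(1)[of n] uv gin fg unfolding qlinear_def by simp
      then show "g n (scl q v) = scl q (g n v)" using gf[OF s] by simp
    qed
  next
    fix n v assume "v \<notin> cm_space M' n" then show "g n v = 0" by (simp add: g_def)
  next
    fix n v and ls :: "(form \<Rightarrow> rat) list" assume v: "v \<in> cm_space M' n" and ls: "adm U ls"
    have 1: "src.act ls n (g n v) \<in> cm_space M (n - int (length ls))" using src.act_in gin v by blast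
    have "f (n - int (length ls)) (src.act ls n (g n v)) = tgt.act ls n v" using f'(2)[OF gin[OF v] ls] fg[OF v] by simp
    then show "src.act ls n (g n v) = g (n - int (length ls)) (tgt.act ls n v)" using gf[OF 1] by simp
  qed
qed

end

section \<open>Period matrices and their comodules\<close>

text \<open>\<open>e\<close> is defined on all functions and has no continuity;
  \<open>gauge_exists\<close> obtains it as a coordinate of a Hamel basis containing
  \<open>2\<pi>i\<close>. Its kernel is a complement of \<open>\<rat>(1)\<close>, so every class
  modulo \<open>\<rat>(1)\<close> has exactly one representative with \<open>e = 0\<close>.\<close>

locale gauge =
  fixes U :: "complex set" and e :: "(complex \<Rightarrow> complex) \<Rightarrow> rat"
  assumes U_ne: "U \<noteq> {}" and U_open: "open U"
    and e_add: "e (f + g) = e f + e g" and e_scl: "e (qsc q f) = q * e f"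
    and e_t: "e (fst (tform U)) = 1"

lemma gauge_exists:
  assumes "U \<noteq> {}" "open U" obtains e where "gauge U e"
proof
  let ?t = "fst (tform U)" let ?E = "qf.extend_basis {?t}"
  have "?t \<noteq> 0" using assms by (auto simp: tform_def const_form_def fun_eq_iff)
  then have ind: "qf.independent {?t}" by (simp add: qf.dependent_single)
  note E = qf.independent_extend_basis[OF ind] qf.span_extend_basis[OF ind] qf.extend_basis_superset[OF ind]
  show "gauge U (\<lambda>f. qf.representation ?E f ?t)"
    by unfold_locales (use assms E qf.representation_basis[OF E(1), of ?t] in \<open>auto simp: qf.representation_add qf.representation_scale\<close>)
qed

context gauge begin

definition E :: "form \<Rightarrow> rat" where "E x = e (fst x)"

lemma E_qlin: "qlin U E"
proof -
  have "fst (form_scale (of_rat q) x) = qsc q (fst x)" for q x by (simp add: form_scale_def qsc_def)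
  then show ?thesis by (simp add: qlin_def E_def e_add e_scl of_rat_eq_id)
qed

lemma E_t [simp]: "E (tform U) = 1" by (simp add: E_def e_t)

lemma e_zero [simp]: "e 0 = 0" using e_add[of 0 0] by simp

lemma e_sum: "e (\<Sum>i\<in>I. f i) = (\<Sum>i\<in>I. e (f i))"
  by (induction I rule: infinite_finite_induct) (simp_all only: sum.infinite sum.empty sum.insert e_add e_zero not_False_eq_True)

end

record period_data =
  pI :: "nat set"
  pd :: "nat \<Rightarrow> int"
  pS :: "nat \<Rightarrow> nat \<Rightarrow> complex \<Rightarrow> complex"

definition supp_in :: "nat set \<Rightarrow> (nat \<Rightarrow>\<^sub>0 'k::zero) set" where
  "supp_in K = {v. keys v \<subseteq> K}"

lemma supp_in_subspace: "pm.subspace (supp_in K)"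
  unfolding pm.subspace_def supp_in_def
  by (auto simp: Poly_Mapping.in_keys_iff Poly_Mapping.lookup_add subset_iff) (metis add.right_neutral)

lemma supp_in_eq_span: "supp_in K = pm.span ((\<lambda>i. single i (1::'k::field)) ` K)"
proof (rule set_eqI)
  fix v :: "nat \<Rightarrow>\<^sub>0 'k"
  show "v \<in> supp_in K \<longleftrightarrow> v \<in> pm.span ((\<lambda>i. single i (1::'k::field)) ` K)"
  proof
    assume v: "v \<in> supp_in K"
    have "linext (\<lambda>i. single i 1) v \<in> pm.span ((\<lambda>i. single i (1::'k::field)) ` K)"
      by (rule linext_words, rule pm.span_base) (use v in \<open>auto simp: supp_in_def\<close>)
    then show "v \<in> pm.span ((\<lambda>i. single i (1::'k::field)) ` K)" by (simp add: linext_id)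
  next
    assume "v \<in> pm.span ((\<lambda>i. single i (1::'k::field)) ` K)"
    moreover have "(\<lambda>i. single i (1::'k::field)) ` K \<subseteq> supp_in K" by (auto simp: supp_in_def)
    ultimately show "v \<in> supp_in K" using pm.span_minimal[OF _ supp_in_subspace] by blast
  qed
qed

lemma findim_supp_in: "finite K \<Longrightarrow> findim (supp_in K)"
  unfolding findim_def supp_in_eq_span by blast

lemma single_in_supp: "i \<in> K \<Longrightarrow> single i c \<in> supp_in K"
  by (auto simp: supp_in_def)

text \<open>\<open>S_ode\<close> says that the derivative of row \<open>i\<close> is a combination
  of the rows one degree lower. The coefficients are forced: within one degree \<open>S\<close> is
  the identity matrix, so they are the entries of that derivative in degree
  \<open>d i - 1\<close>.\<close>

locale period = gauge +
  fixes X :: period_data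
  assumes fin_I: "finite (pI X)"
    and S_holo: "\<And>i j. i \<in> pI X \<Longrightarrow> j \<in> pI X \<Longrightarrow> pS X i j \<in> holo_funs U"
    and S_diag: "\<And>i z. i \<in> pI X \<Longrightarrow> z \<in> U \<Longrightarrow> pS X i i z = 1"
    and S_tri: "\<And>i j. i \<in> pI X \<Longrightarrow> j \<in> pI X \<Longrightarrow> i \<noteq> j \<Longrightarrow> pd X i \<le> pd X j \<Longrightarrow> pS X i j = 0"
    and S_gauge: "\<And>i j. i \<in> pI X \<Longrightarrow> j \<in> pI X \<Longrightarrow> i \<noteq> j \<Longrightarrow> e (\<lambda>z. 2 * pi * \<i> * pS X i j z) = 0"
    and S_ode: "\<And>i j z. i \<in> pI X \<Longrightarrow> j \<in> pI X \<Longrightarrow> z \<in> U \<Longrightarrow>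
      deriv (pS X i j) z = (\<Sum>l\<in>{l\<in>pI X. pd X l = pd X i - 1}. deriv (pS X i l) z * pS X l j z)"

section \<open>Coproducts of words padded with \<open>2\<pi>i\<close>\<close>

definition pull_left :: "'a list \<Rightarrow> ('a list \<times> 'b \<Rightarrow>\<^sub>0 rat) \<Rightarrow> ('a list \<times> 'b \<Rightarrow>\<^sub>0 rat)" where
  "pull_left u = linext (\<lambda>(w1, w2). single (u @ w1, w2) 1)"

lemma pull_left_tens: "pull_left u (tens x y) = tens (prep u x) y"
  unfolding pull_left_def linext_tens prep_def tens_linext_left
  by (rule linext_cong) (simp add: tens_def)

text \<open>The error terms of the coproducts below have a second factor that begins with
  \<open>2\<pi>i\<close>, so it is enough to divide by null elements on the right. This space is
  stable under prefixes in the first factor.\<close>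

definition right_null :: "complex set \<Rightarrow> (fword \<times> fword \<Rightarrow>\<^sub>0 rat) set" where
  "right_null U = pm.span {tens x \<nu> | x \<nu>. \<nu> \<in> gh_null (H0_hopf U)}"

lemma pull_left_right_null: "p \<in> right_null U \<Longrightarrow> pull_left u p \<in> right_null U"
  unfolding right_null_def pull_left_def
proof (rule linext_in_span)
  fix s :: "fword \<times> fword \<Rightarrow>\<^sub>0 rat" assume "s \<in> {tens x \<nu> |x \<nu>. \<nu> \<in> gh_null (H0_hopf U)}"
  then obtain x \<nu> where s: "s = tens x \<nu>" "\<nu> \<in> gh_null (H0_hopf U)" by blast
  have "pull_left u s = tens (prep u x) \<nu>" unfolding s(1) by (rule pull_left_tens)
  then show "linext (\<lambda>(w1, w2). single (u @ w1, w2) 1) s \<in> pm.span {tens x \<nu> |x \<nu>. \<nu> \<in> gh_null (H0_hopf U)}"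
    unfolding pull_left_def[symmetric] using s(2) by (intro pm.span_base) blast
qed

lemma tform_word_null: "v \<in> lists (forms0 U) \<Longrightarrow> single (tform U # v) 1 \<in> gh_null (H0_hopf U)"
  using tform_cons_rel[of v U] tform_in[of U] forms0_subset[of U]
  by (auto simp: words0_iff intro!: pm.span_base)

text \<open>A cut in front of one of the letters \<open>2\<pi>i\<close> of the prefix gives a second
  factor that is zero modulo \<open>\<rat>(1)\<close>. What remains is the cut in front of
  \<open>g\<close> and the cuts of \<open>x\<close>, the one directly after the prefix
  included.\<close>

lemma comult_prep:
  assumes g: "g \<in> forms0 U" and x: "x \<in> words0 U"
  shows "linext comult_word (prep (g # replicate k (tform U)) x)
    - (tens (single [] 1) (prep (g # replicate k (tform U)) x)
       + pull_left (g # replicate k (tform U)) (linext comult_word x)) \<in> right_null U"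
proof -
  let ?u = "g # replicate k (tform U)"
  have one: "comult_word (?u @ w) - (single ([], ?u @ w) 1 + pull_left ?u (comult_word w)) \<in> right_null U"
    if w: "w \<in> lists (forms0 U)" for w
  proof -
    let ?f = "\<lambda>j. single (take j (?u @ w), drop j (?u @ w)) (1::rat)"
    have s: "{..length (?u @ w)} = {0} \<union> {1..k} \<union> (\<lambda>j. j + Suc k) ` {..length w}"
    proof (intro set_eqI iffI)
      fix j assume j: "j \<in> {..length (?u @ w)}"
      show "j \<in> {0} \<union> {1..k} \<union> (\<lambda>j. j + Suc k) ` {..length w}"
      proof (cases "j \<le> k")
        case False
        then have "j = (j - Suc k) + Suc k" "j - Suc k \<in> {..length w}" using j by auto
        then show ?thesis by blast
      qed auto
    qed auto
    have "comult_word (?u @ w) = sum ?f {0} + sum ?f {1..k} + sum ?f ((\<lambda>j. j + Suc k) ` {..length w})"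
      unfolding comult_word_eq s by (subst sum.union_disjoint; (force simp: sum.union_disjoint)?)
    also have "sum ?f ((\<lambda>j. j + Suc k) ` {..length w}) = (\<Sum>j\<le>length w. ?f (j + Suc k))"
      by (subst sum.reindex) (auto simp: inj_on_def)
    also have "\<dots> = pull_left ?u (comult_word w)"
      unfolding comult_word_eq pull_left_def linext_sum by (simp add: take_replicate)
    finally have "comult_word (?u @ w) - (single ([], ?u @ w) 1 + pull_left ?u (comult_word w)) = sum ?f {1..k}" by simp
    also have "\<dots> \<in> right_null U"
      unfolding right_null_def
    proof (rule pm.span_sum, rule pm.span_base)
      fix j assume j: "j \<in> {1..k}"
      let ?v = "replicate (k - j) (tform U) @ w"
      have "drop j (?u @ w) = replicate (Suc (k - j)) (tform U) @ w"
        using j by (cases j) (auto simp: Suc_diff_Suc drop_Cons')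
      then have e: "?f j = tens (single (take j (?u @ w)) 1) (single (tform U # ?v) 1)"
        by (simp add: tens_single)
      have "?v \<in> lists (forms0 U)" using w tform_in by auto
      then show "?f j \<in> {tens x \<nu> |x \<nu>. \<nu> \<in> gh_null (H0_hopf U)}"
        unfolding e using tform_word_null by blast
    qed
    finally show ?thesis .
  qed
  have "linext (\<lambda>w. comult_word (?u @ w) - (single ([], ?u @ w) 1 + pull_left ?u (comult_word w))) x \<in> right_null U"
    unfolding right_null_def by (rule linext_words) (use one x in \<open>auto simp: words0_iff right_null_def\<close>)
  also have "linext (\<lambda>w. comult_word (?u @ w) - (single ([], ?u @ w) 1 + pull_left ?u (comult_word w))) x
     = linext comult_word (prep ?u x) - (tens (single [] 1) (prep ?u x) + pull_left ?u (linext comult_word x))"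
  proof -
    have 1: "linext comult_word (prep ?u x) = linext (\<lambda>w. comult_word (?u @ w)) x"
      unfolding prep_def linext_linext by simp
    have 2: "tens (single [] 1) (prep ?u x) = linext (\<lambda>w. single ([], ?u @ w) 1) x"
      unfolding prep_def tens_linext_right tens_single by simp
    have 3: "pull_left ?u (linext comult_word x) = linext (\<lambda>w. pull_left ?u (comult_word w)) x"
      unfolding pull_left_def linext_linext ..
    have 4: "linext (\<lambda>w. a w - (b w + c w)) x = linext a x - (linext b x + linext c x)" for a b c :: "fword \<Rightarrow> (fword \<times> fword \<Rightarrow>\<^sub>0 rat)"
      using linext_fun_add[of "\<lambda>w. a w - (b w + c w)" "\<lambda>w. b w + c w" x] by (simp add: linext_fun_add eq_diff_eq)
    show ?thesis unfolding 1 2 3 4 ..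
  qed
  finally show ?thesis .
qed

context period begin

abbreviation "I \<equiv> pI X"
abbreviation "d \<equiv> pd X"
abbreviation "S \<equiv> pS X"
abbreviation "t \<equiv> tform U"

definition gf :: "nat \<Rightarrow> nat \<Rightarrow> form" where
  "gf i j = ((\<lambda>z. - (2 * pi * \<i>) * S i j z), 0)"

lemma gf_in: "i \<in> I \<Longrightarrow> j \<in> I \<Longrightarrow> gf i j \<in> forms0 U"
  using S_holo[of i j] by (auto simp: gf_def forms0_def holo_funs_def intro!: holomorphic_intros)

lemma E_gf: "i \<in> I \<Longrightarrow> j \<in> I \<Longrightarrow> i \<noteq> j \<Longrightarrow> E (gf i j) = 0"
proof -
  assume a: "i \<in> I" "j \<in> I" "i \<noteq> j"
  have "(\<lambda>z. - (2 * pi * \<i>) * S i j z) = qsc (-1) (\<lambda>z. 2 * pi * \<i> * S i j z)" by (simp add: qsc_def)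
  then show ?thesis using e_scl[of "-1"] S_gauge[OF a] by (simp add: E_def gf_def)
qed

text \<open>A sum over the chains of strictly decreasing degree from \<open>i\<close> to
  \<open>j\<close>. A step from \<open>i\<close> to \<open>l\<close> of height
  \<open>h = d i - d l\<close> contributes the letter \<open>gf i l\<close> and \<open>h - 1\<close>
  letters \<open>2\<pi>i\<close>, so that every word has length \<open>d i - d j\<close>.\<close>

function cf :: "nat \<Rightarrow> nat \<Rightarrow> (fword \<Rightarrow>\<^sub>0 rat)" where
  "cf i j = (if i = j then single [] 1
     else (\<Sum>l\<in>{l\<in>I. d j \<le> d l \<and> d l < d i}. prep (gf i l # replicate (nat (d i - d l) - 1) t) (cf l j)))"
  by pat_completeness auto
termination by (relation "Wellfounded.measure (\<lambda>(i, j). nat (d i - d j))") auto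

declare cf.simps [simp del]

abbreviation "uw i l \<equiv> gf i l # replicate (nat (d i - d l) - 1) t"
abbreviation "mid i j \<equiv> {l\<in>I. d j \<le> d l \<and> d l < d i}"

lemma cf_diag: "cf i i = single [] 1" by (subst cf.simps) simp
lemma cf_rec: "i \<noteq> j \<Longrightarrow> cf i j = (\<Sum>l\<in>mid i j. prep (uw i l) (cf l j))" by (subst cf.simps) simp
lemma cf_zero: "i \<noteq> j \<Longrightarrow> d i \<le> d j \<Longrightarrow> cf i j = 0"
proof -
  assume a: "i \<noteq> j" "d i \<le> d j"
  then have "mid i j = {}" by auto
  then show ?thesis using cf_rec[OF a(1)] by (simp only: sum.empty)
qed

lemma cf_induct [consumes 2, case_names step]:
  assumes "i \<in> I" "j \<in> I"
    "\<And>i j. i \<in> I \<Longrightarrow> j \<in> I \<Longrightarrow> (\<And>l. i \<noteq> j \<Longrightarrow> l \<in> mid i j \<Longrightarrow> P l j) \<Longrightarrow> P i j"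
  shows "P i j"
  using assms(1,2)
proof (induction "nat (d i - d j)" arbitrary: i rule: less_induct)
  case less
  show ?case
  proof (rule assms(3)[OF less.prems])
    fix l assume "l \<in> mid i j"
    then show "P l j" by (intro less.hyps) (use less.prems in auto)
  qed
qed

lemma keys_sum_subset: "(\<And>l. l \<in> K \<Longrightarrow> keys (f l) \<subseteq> B) \<Longrightarrow> keys (\<Sum>l\<in>K. f l) \<subseteq> B"
  using Poly_Mapping.keys_sum[of f K] by blast

lemma keys_prep: "keys (prep u x) \<subseteq> (\<lambda>w. u @ w) ` keys x"
proof -
  have "keys (\<Sum>w\<in>keys x. scl (lookup x w) (single (u @ w) 1)) \<subseteq> (\<lambda>w. u @ w) ` keys x"
    by (rule keys_sum_subset) auto
  then show ?thesis by (simp add: prep_def linext_def)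
qed

lemma cf_keys:
  assumes "i \<in> I" "j \<in> I"
  shows "keys (cf i j) \<subseteq> {w \<in> lists (forms0 U). int (length w) = d i - d j}"
  using assms
proof (induction i j rule: cf_induct)
  case (step i j)
  show ?case
  proof (cases "i = j")
    case False
    show ?thesis unfolding cf_rec[OF False]
    proof (rule keys_sum_subset)
      fix l assume l: "l \<in> mid i j"
      have "(\<lambda>w. uw i l @ w) ` keys (cf l j) \<subseteq> {w \<in> lists (forms0 U). int (length w) = d i - d j}"
      proof (rule image_subsetI)
        fix w assume "w \<in> keys (cf l j)"
        then have w: "w \<in> lists (forms0 U)" "int (length w) = d l - d j"
          using step(3)[OF False l] l step(2) by blast+
        have "uw i l \<in> lists (forms0 U)" using gf_in[of i l] step(1) l tform_in[of U] by auto
        with w show "uw i l @ w \<in> {w \<in> lists (forms0 U). int (length w) = d i - d j}" using l by auto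
      qed
      then show "keys (prep (uw i l) (cf l j)) \<subseteq> {w \<in> lists (forms0 U). int (length w) = d i - d j}"
        using keys_prep by blast
    qed
  qed (simp add: cf_diag)
qed

lemma cf_words0: "i \<in> I \<Longrightarrow> j \<in> I \<Longrightarrow> cf i j \<in> words0 U"
  using cf_keys[of i j] by (auto simp: words0_iff)

lemma fin_mid: "finite (mid i j)" using fin_I by simp

text \<open>By \<open>comult_prep\<close> a chain from \<open>i\<close> to \<open>j\<close> can be
  cut only at its nodes; cutting at \<open>m\<close> leaves a chain from \<open>i\<close> to
  \<open>m\<close> and a chain from \<open>m\<close> to \<open>j\<close>.\<close>

lemma cf_comult:
  assumes "i \<in> I" "j \<in> I"
  shows "linext comult_word (cf i j) - (\<Sum>m\<in>I. tens (cf i m) (cf m j)) \<in> right_null U"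
  using assms
proof (induction i j rule: cf_induct)
  case (step i j)
  show ?case
  proof (cases "i = j")
    case True
    have "(\<Sum>m\<in>I. tens (cf i m) (cf m i)) = (\<Sum>m\<in>I. if m = i then single ([], []) 1 else 0)"
    proof (rule sum.cong[OF refl])
      fix m show "tens (cf i m) (cf m i) = (if m = i then single ([], []) 1 else 0)"
        using cf_zero[of i m] cf_zero[of m i] by (cases "m = i"; cases "d i \<le> d m") (auto simp: cf_diag tens_single)
    qed
    also have "\<dots> = linext comult_word (cf i i)" using fin_I step(1) by (simp add: cf_diag comult_word_def)
    finally show ?thesis using True by (simp add: right_null_def pm.span_zero)
  next
    case False
    let ?e = "single [] (1::rat)"
    let ?T = "\<lambda>l. tens ?e (prep (uw i l) (cf l j)) + pull_left (uw i l) (linext comult_word (cf l j))"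
    let ?T' = "\<lambda>l. tens ?e (prep (uw i l) (cf l j)) + pull_left (uw i l) (\<Sum>m\<in>I. tens (cf l m) (cf m j))"
    have a: "(\<Sum>l\<in>mid i j. linext comult_word (prep (uw i l) (cf l j)) - ?T l) \<in> right_null U"
      unfolding right_null_def
      by (rule pm.span_sum, rule comult_prep[unfolded right_null_def]) (use step gf_in cf_words0 in auto)
    have b: "(\<Sum>l\<in>mid i j. pull_left (uw i l) (linext comult_word (cf l j) - (\<Sum>m\<in>I. tens (cf l m) (cf m j)))) \<in> right_null U"
      unfolding right_null_def
      by (rule pm.span_sum, rule pull_left_right_null[unfolded right_null_def]) (use step(3)[OF False] in \<open>auto simp: right_null_def\<close>)
    have "(\<Sum>l\<in>mid i j. linext comult_word (prep (uw i l) (cf l j)) - ?T' l) \<in> right_null U"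
      using pm.span_add[OF a[unfolded right_null_def] b[unfolded right_null_def]]
      by (simp add: right_null_def pull_left_def linext_diff sum_subtractf sum.distrib algebra_simps)
    moreover have "(\<Sum>l\<in>mid i j. ?T' l) = (\<Sum>m\<in>I. tens (cf i m) (cf m j))"
    proof -
      have "(\<Sum>l\<in>mid i j. ?T' l) = tens ?e (cf i j) + (\<Sum>m\<in>I. \<Sum>l\<in>mid i j. tens (prep (uw i l) (cf l m)) (cf m j))"
        unfolding cf_rec[OF False] tens_sum_right sum.distrib pull_left_def linext_sum
        unfolding pull_left_def[symmetric] pull_left_tens by (subst sum.swap[of _ I]) simp
      also have "(\<Sum>m\<in>I. \<Sum>l\<in>mid i j. tens (prep (uw i l) (cf l m)) (cf m j)) = (\<Sum>m\<in>I. if m = i then 0 else tens (cf i m) (cf m j))"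
      proof (rule sum.cong[OF refl])
        fix m assume m: "m \<in> I"
        show "(\<Sum>l\<in>mid i j. tens (prep (uw i l) (cf l m)) (cf m j)) = (if m = i then 0 else tens (cf i m) (cf m j))"
        proof (cases "m = i")
          case True
          have "cf l i = 0" if "l \<in> mid i j" for l using that by (intro cf_zero) auto
          then show ?thesis using True by (auto intro!: sum.neutral)
        next
          case mi: False
          show ?thesis
          proof (cases "d j \<le> d m")
            case False
            then have "cf m j = 0" by (intro cf_zero) auto
            then show ?thesis using mi by simp
          next
            case True
            have "(\<Sum>l\<in>mid i j. tens (prep (uw i l) (cf l m)) (cf m j)) = (\<Sum>l\<in>mid i m. tens (prep (uw i l) (cf l m)) (cf m j))"
            proof (rule sum.mono_neutral_right)
              show "\<forall>l\<in>mid i j - mid i m. tens (prep (uw i l) (cf l m)) (cf m j) = 0"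
              proof
                fix l assume "l \<in> mid i j - mid i m"
                then have "cf l m = 0" by (intro cf_zero) auto
                then show "tens (prep (uw i l) (cf l m)) (cf m j) = 0" by simp
              qed
            qed (use True fin_I in auto)
            also have "\<dots> = tens (cf i m) (cf m j)" using cf_rec[of i m] mi by (simp add: tens_sum_left)
            finally show ?thesis using mi by simp
          qed
        qed
      qed
      \<comment> \<open>The cut before the first letter is the term \<open>m = i\<close>, which the
        sum over nonempty first factors leaves out.\<close>
      also have "tens ?e (cf i j) + \<dots> = (\<Sum>m\<in>I. tens (cf i m) (cf m j))"
        using fin_I step(1) by (simp add: sum.remove[of I i] cf_diag)
      finally show ?thesis .
    qed
    ultimately show ?thesis
      unfolding cf_rec[OF False] linext_sum using cf_rec[OF False] by (simp add: sum_subtractf)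
  qed
qed

lemma lev_prep: "lev ls (prep u x) = wev (take (length u) ls) u * lev (drop (length u) ls) x"
  unfolding lev_def prep_def wsum_linext by (simp add: wev_append_right wsum_fun_mult)

lemma lev_zero [simp]: "lev ls 0 = 0" by (simp add: lev_def)

lemma lev_sum: "lev ls (\<Sum>i\<in>K. f i) = (\<Sum>i\<in>K. lev ls (f i))" by (simp add: lev_def wsum_sum)

lemma lev_Nil_cf: "i \<in> I \<Longrightarrow> j \<in> I \<Longrightarrow> lev [] (cf i j) = (if i = j then 1 else 0)"
  by (cases "i = j") (simp_all add: cf_diag cf_rec lev_sum lev_prep)

text \<open>Each word begins with a letter \<open>gf i l\<close> with \<open>l \<noteq> i\<close>,
  and \<open>E\<close> kills it by the gauge condition.\<close>

lemma lev_E_cf: "i \<in> I \<Longrightarrow> j \<in> I \<Longrightarrow> lev (replicate (Suc q) E) (cf i j) = 0"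
proof (cases "i = j")
  case False
  assume i: "i \<in> I" "j \<in> I"
  have "lev (replicate (Suc q) E) (prep (uw i l) (cf l j)) = 0" if "l \<in> mid i j" for l
  proof -
    have "i \<noteq> l" "l \<in> I" using that by auto
    then show ?thesis using E_gf[of i l] i by (simp add: lev_prep)
  qed
  then show ?thesis unfolding cf_rec[OF False] lev_sum by (intro sum.neutral) blast
qed (simp add: cf_diag)

lemma wev_replicate_E: "wev (replicate k E) (replicate k t) = 1"
  by (induction k) auto

text \<open>\<open>E\<close> sends \<open>2\<pi>i\<close> to 1 and kills the letter of every proper
  step. Hence a functional followed by copies of \<open>E\<close> sees only the chain that passes
  from \<open>i\<close> to \<open>j\<close> in one step.\<close>

lemma lev_basic_cf:
  assumes i: "i \<in> I" "j \<in> I"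
  shows "lev (l # replicate m E) (cf i j) = (if d i - d j = int (Suc m) then l (gf i j) else 0)"
proof (cases "i = j \<or> d i \<le> d j")
  case True then show ?thesis using cf_zero[of i j] by (cases "i = j") (auto simp: cf_diag)
next
  case False
  then have ij: "i \<noteq> j" by simp
  have "lev (l # replicate m E) (prep (uw i k) (cf k j)) = (if k = j then (if d i - d j = int (Suc m) then l (gf i j) else 0) else 0)"
    if k: "k \<in> mid i j" for k
  proof -
    let ?p = "nat (d i - d k) - 1"
    have kI: "k \<in> I" using k by auto
    have p: "int ?p = d i - d k - 1" using k by auto
    \<comment> \<open>The block of copies of \<open>E\<close> is longer than the padding of the
      first step, as long, or shorter; only equal length together with \<open>k = j\<close>
      survives.\<close>
    consider "?p < m" | "?p = m" | "m < ?p" by linarith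
    then show ?thesis
    proof cases
      case 1
      then obtain q where q: "m = ?p + Suc q" by (metis add_Suc_right less_imp_Suc_add)
      have dr: "drop (length (uw i k)) (l # replicate m E) = replicate (Suc q) E"
      proof -
        have "m - ?p = Suc q" using q by linarith
        moreover have "drop (length (uw i k)) (l # replicate m E) = replicate (m - ?p) E" by simp
        ultimately show ?thesis by (simp only:)
      qed
      have nz: "d i - d j = int (Suc m) \<Longrightarrow> k \<noteq> j" using p 1 by auto
      have "lev (drop (length (uw i k)) (l # replicate m E)) (cf k j) = 0"
        unfolding dr by (rule lev_E_cf[OF kI i(2)])
      then show ?thesis unfolding lev_prep using nz by simp
    next
      case 2
      have iff: "k = j \<Longrightarrow> d i - d j = int (Suc m)" using p 2 by simp
      have "drop (length (uw i k)) (l # replicate m E) = []" "take (length (uw i k)) (l # replicate m E) = l # replicate ?p E" using 2 by auto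
      then show ?thesis unfolding lev_prep using iff wev_replicate_E[of ?p] by (simp add: lev_Nil_cf[OF kI i(2)])
    next
      case 3
      have nz: "d i - d j = int (Suc m) \<Longrightarrow> k \<noteq> j" using p 3 by auto
      have "wev (take (length (uw i k)) (l # replicate m E)) (uw i k) = 0" by (rule wev_length) (use 3 in auto)
      then have "lev (l # replicate m E) (prep (uw i k) (cf k j)) = 0" by (simp only: lev_prep mult_zero_left)
      then show ?thesis using nz by auto
    qed
  qed
  then have "lev (l # replicate m E) (cf i j) = (\<Sum>k\<in>mid i j. if k = j then (if d i - d j = int (Suc m) then l (gf i j) else 0) else 0)"
    unfolding cf_rec[OF ij] lev_sum by (intro sum.cong) auto
  also have "\<dots> = (if d i - d j = int (Suc m) then l (gf i j) else 0)"
    using False i fin_mid by (subst sum.delta) auto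
  finally show ?thesis .
qed

end

section \<open>The differential of the matrix coefficients\<close>

definition mult_head :: "form \<Rightarrow> (fword \<Rightarrow>\<^sub>0 rat) \<Rightarrow> (fword \<Rightarrow>\<^sub>0 rat)" where
  "mult_head a = linext (\<lambda>w. case w of [] \<Rightarrow> 0 | y # r \<Rightarrow> single (form_mult a y # r) 1)"

lemma mult_head_prep: "mult_head a (prep (y # u) x) = prep (form_mult a y # u) x"
  unfolding mult_head_def prep_def linext_linext by simp

lemma mult_head_empty: "mult_head a (single [] c) = 0"
  unfolding mult_head_def by (simp add: pm.scale_zero_right)

lemma mult_head_sum: "mult_head a (\<Sum>i\<in>K. f i) = (\<Sum>i\<in>K. mult_head a (f i))"
  unfolding mult_head_def linext_sum ..

lemma form_mult_d_in:
  assumes "open U" "g \<in> forms0 U" "y \<in> forms0 U"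
  shows "form_mult (form_d U g) y \<in> forms U"
proof -
  have g: "fst g \<in> holo_funs U" and y: "fst y \<in> holo_funs U" "snd y = 0" using assms by (auto simp: forms0_def)
  have "(\<lambda>z. if z \<in> U then deriv (fst g) z else 0) holomorphic_on U"
    by (rule holomorphic_transform[of "deriv (fst g)"]) (use g assms(1) in \<open>auto simp: holo_funs_def intro!: holomorphic_deriv\<close>)
  then have "(\<lambda>z. (if z \<in> U then deriv (fst g) z else 0) * fst y z) holomorphic_on U"
    using y by (auto simp: holo_funs_def intro!: holomorphic_intros)
  moreover have "form_mult (form_d U g) y = (0, (\<lambda>z. (if z \<in> U then deriv (fst g) z else 0) * fst y z))"
    by (simp add: form_mult_def form_d_def y(2) fun_eq_iff)
  ultimately show ?thesis using forms_zero[of U] by (simp add: forms_def holo_funs_def mem_Times_iff)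
qed

context gauge begin

lemma form_d_t: "form_d U (tform U) = 0"
proof -
  have "deriv (fst (tform U)) z = 0" if "z \<in> U" for z
  proof -
    have "((\<lambda>_. 2 * pi * \<i>) has_field_derivative 0) (at z)" by simp
    then have "(fst (tform U) has_field_derivative 0) (at z)"
      by (rule has_field_derivative_transform_within_open[OF _ U_open that]) (simp add: tform_def const_form_def)
    then show ?thesis by (rule DERIV_imp_deriv)
  qed
  then show ?thesis by (simp add: form_d_def zero_prod_def fun_eq_iff)
qed

lemma form_sign0: "g \<in> forms0 U \<Longrightarrow> form_sign g = g"
  by (cases g) (auto simp: form_sign_def forms0_def)

lemma form_mult_zero: "form_mult 0 y = 0"
  by (simp add: form_mult_def zero_prod_def)

text \<open>Constants are closed and functions carry no sign, so the differential passes through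
  letters \<open>2\<pi>i\<close>; what these letters produce themselves are words with a zero
  letter.\<close>

lemma diff_word_replicate:
  assumes "w \<in> lists (forms0 U)"
  shows "diff_word U (replicate k (tform U) @ w) - prep (replicate k (tform U)) (diff_word U w) \<in> pm.span (multilinear_rels U)"
proof (induction k)
  case 0 then show ?case by (simp add: pm.span_zero)
next
  case (Suc k)
  let ?t = "tform U"
  show ?case
  proof (cases "replicate k ?t @ w")
    case Nil then show ?thesis by (simp add: pm.span_zero)
  next
    case (Cons y r)
    have "replicate k ?t @ w \<in> lists (forms0 U)" using assms tform_in by auto
    then have r: "r \<in> lists (forms U)" unfolding Cons using forms0_subset by auto
    have "diff_word U (replicate (Suc k) ?t @ w) = single ([] @ [0] @ r) 1 + prep [?t] (diff_word U (replicate k ?t @ w))"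
      by (simp add: Cons form_d_t form_mult_zero form_sign0 tform_in cons_lin_eq_prep)
    moreover have "prep (replicate (Suc k) ?t) (diff_word U w) = prep [?t] (prep (replicate k ?t) (diff_word U w))"
      using prep_append[of "[?t]" "replicate k ?t"] by simp
    ultimately have e: "diff_word U (replicate (Suc k) ?t @ w) - prep (replicate (Suc k) ?t) (diff_word U w)
      = single ([] @ [0] @ r) 1 + prep [?t] (diff_word U (replicate k ?t @ w) - prep (replicate k ?t) (diff_word U w))"
      by (simp add: prep_diff)
    have tU: "[?t] \<in> lists (forms U)" using tform_in forms0_subset by auto
    show ?thesis unfolding e
      using pm.span_add[OF single_zero_letter[OF lists.Nil r] prep_multilinear[OF tU Suc]] .
  qed
qed

text \<open>The new head is \<open>dg\<close> times the next letter, which is \<open>2\<pi>i\<close>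
  if the prefix is padded and otherwise the first letter of whatever follows.\<close>

definition head_term :: "form \<Rightarrow> nat \<Rightarrow> (fword \<Rightarrow>\<^sub>0 rat) \<Rightarrow> (fword \<Rightarrow>\<^sub>0 rat)" where
  "head_term g k x = (if k = 0 then mult_head (form_d U g) x
     else prep (form_mult (form_d U g) (tform U) # replicate (k - 1) (tform U)) x)"

lemma diff_prep:
  assumes g: "g \<in> forms0 U" and x: "x \<in> words0 U"
  shows "linext (diff_word U) (prep (g # replicate k (tform U)) x)
    - (head_term g k x + prep (g # replicate k (tform U)) (linext (diff_word U) x)) \<in> pm.span (multilinear_rels U)"
proof -
  let ?t = "tform U" let ?u = "g # replicate k ?t"
  have gU: "[g] \<in> lists (forms U)" using g forms0_subset by auto
  have one: "diff_word U (?u @ w) - (head_term g k (single w 1) + prep ?u (diff_word U w)) \<in> pm.span (multilinear_rels U)"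
    if w: "w \<in> lists (forms0 U)" for w
  proof -
    have h: "diff_word U (?u @ w) = head_term g k (single w 1) + prep [g] (diff_word U (replicate k ?t @ w))"
    proof (cases k)
      case 0 then show ?thesis
        by (cases w) (auto simp: head_term_def mult_head_def pm.scale_zero_right form_sign0[OF g] cons_lin_eq_prep)
    next
      case (Suc k') then show ?thesis by (simp add: head_term_def form_sign0[OF g] cons_lin_eq_prep)
    qed
    have "prep ?u (diff_word U w) = prep [g] (prep (replicate k ?t) (diff_word U w))"
      using prep_append[of "[g]" "replicate k ?t"] by simp
    then have "diff_word U (?u @ w) - (head_term g k (single w 1) + prep ?u (diff_word U w))
      = prep [g] (diff_word U (replicate k ?t @ w) - prep (replicate k ?t) (diff_word U w))"
      unfolding h by (simp add: prep_diff)
    then show ?thesis using prep_multilinear[OF gU diff_word_replicate[OF w]] by simp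
  qed
  have "linext (\<lambda>w. diff_word U (?u @ w) - (head_term g k (single w 1) + prep ?u (diff_word U w))) x \<in> pm.span (multilinear_rels U)"
    by (rule linext_words) (use one x in \<open>auto simp: words0_iff\<close>)
  also have "linext (\<lambda>w. diff_word U (?u @ w) - (head_term g k (single w 1) + prep ?u (diff_word U w))) x
    = linext (diff_word U) (prep ?u x) - (head_term g k x + prep ?u (linext (diff_word U) x))"
  proof -
    have 1: "linext (diff_word U) (prep ?u x) = linext (\<lambda>w. diff_word U (?u @ w)) x"
      unfolding prep_def linext_linext by simp
    have 2: "head_term g k x = linext (\<lambda>w. head_term g k (single w 1)) x"
      unfolding head_term_def mult_head_def prep_def by (cases "k = 0") simp_all
    have 3: "prep ?u (linext (diff_word U) x) = linext (\<lambda>w. prep ?u (diff_word U w)) x"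
      unfolding prep_def linext_linext ..
    have 4: "linext (\<lambda>w. a w - (b w + c w)) x = linext a x - (linext b x + linext c x)" for a b c :: "fword \<Rightarrow> (fword \<Rightarrow>\<^sub>0 rat)"
      using linext_fun_add[of "\<lambda>w. a w - (b w + c w)" "\<lambda>w. b w + c w" x] by (simp add: linext_fun_add eq_diff_eq)
    show ?thesis unfolding 1 4 3 by (subst 2) (rule refl)
  qed
  finally show ?thesis .
qed

end

context period begin

lemma deriv_gf: "i \<in> I \<Longrightarrow> j \<in> I \<Longrightarrow> z \<in> U \<Longrightarrow> deriv (fst (gf i j)) z = - (2 * pi * \<i>) * deriv (S i j) z"
proof -
  assume a: "i \<in> I" "j \<in> I" "z \<in> U"
  have "S i j field_differentiable at z"
    using S_holo[OF a(1,2)] a(3) U_open by (auto simp: holo_funs_def intro: holomorphic_on_imp_differentiable_at)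
  from deriv_cmult[OF this, of "- (2 * pi * \<i>)"] show ?thesis by (simp add: gf_def)
qed

text \<open>This is \<open>S_ode\<close> for the entry \<open>i\<close>, \<open>k\<close>,
  multiplied by \<open>(2\<pi>i)^2\<close>: the sign in \<open>gf\<close> survives in the linear
  term and squares away in the products.\<close>

lemma letters_cancel:
  assumes "i \<in> I" "k \<in> I"
  shows "form_mult (form_d U (gf i k)) t + (\<Sum>l\<in>{l\<in>I. d l = d i - 1}. form_mult (form_d U (gf i l)) (gf l k)) = 0"
proof (rule prod_eqI)
  have f: "fst (form_mult (form_d U a) b) = 0" for a b by (simp add: form_mult_def form_d_def)
  show "fst (form_mult (form_d U (gf i k)) t + (\<Sum>l\<in>{l\<in>I. d l = d i - 1}. form_mult (form_d U (gf i l)) (gf l k))) = fst (0::form)"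
    unfolding fst_add fst_sum f by simp
  have sn: "snd (form_mult (form_d U a) b) z = (if z \<in> U then deriv (fst a) z else 0) * fst b z" for a b z
    by (simp add: form_mult_def form_d_def)
  have "(if z \<in> U then deriv (fst (gf i k)) z else 0) * fst t z
      + (\<Sum>l\<in>{l\<in>I. d l = d i - 1}. (if z \<in> U then deriv (fst (gf i l)) z else 0) * fst (gf l k) z) = 0" for z
  proof (cases "z \<in> U")
    case True
    have sq: "(- c * x) * (- c * y) = c * c * (x * y)" for c x y :: complex by (simp add: algebra_simps)
    have "(\<Sum>l\<in>{l\<in>I. d l = d i - 1}. deriv (fst (gf i l)) z * fst (gf l k) z)
      = (2 * pi * \<i>) * (2 * pi * \<i>) * (\<Sum>l\<in>{l\<in>I. d l = d i - 1}. deriv (S i l) z * S l k z)"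
      unfolding sum_distrib_left
    proof (rule sum.cong[OF refl])
      fix l assume "l \<in> {l\<in>I. d l = d i - 1}"
      then show "deriv (fst (gf i l)) z * fst (gf l k) z = 2 * pi * \<i> * (2 * pi * \<i>) * (deriv (S i l) z * S l k z)"
        using deriv_gf[OF assms(1) _ True, of l] sq[of "2 * pi * \<i>"] by (simp only: gf_def fst_conv mem_Collect_eq)
    qed
    also have "\<dots> = (2 * pi * \<i>) * (2 * pi * \<i>) * deriv (S i k) z" using S_ode[OF assms True] by simp
    finally show ?thesis using True assms by (simp add: deriv_gf tform_def const_form_def)
  qed simp
  then show "snd (form_mult (form_d U (gf i k)) t + (\<Sum>l\<in>{l\<in>I. d l = d i - 1}. form_mult (form_d U (gf i l)) (gf l k))) = snd (0::form)"
    unfolding fun_eq_iff snd_add snd_sum plus_fun_apply sum_fun_apply sn by simp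
qed

text \<open>The heads created by \<open>D\<close> are grouped by the next node \<open>l'\<close>, at
  least two degrees below \<open>i\<close>. It is reached directly, and then the head absorbs a
  letter \<open>2\<pi>i\<close>, or through a node \<open>l\<close> of degree
  \<open>d i - 1\<close>, and then the head absorbs \<open>gf l l'\<close>. The tails agree, and the
  heads add up to zero by \<open>letters_cancel\<close>. Staying inside
  \<open>multilinear_rels\<close> lets the induction prepend letters.\<close>

lemma cf_diff:
  assumes "i \<in> I" "j \<in> I"
  shows "linext (diff_word U) (cf i j) \<in> pm.span (multilinear_rels U)"
  using assms
proof (induction i j rule: cf_induct)
  case (step i j)
  let ?D = "linext (diff_word U)"
  show ?case
  proof (cases "i = j")
    case True then show ?thesis by (simp add: cf_diag pm.scale_zero_right pm.span_zero)
  next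
    case False
    let ?k = "\<lambda>l. nat (d i - d l) - 1" let ?n = "\<lambda>l. nat (d i - d l) - 2"
    let ?a = "\<lambda>l'. form_mult (form_d U (gf i l')) t" let ?b = "\<lambda>l l'. form_mult (form_d U (gf i l)) (gf l l')"
    have a: "(\<Sum>l\<in>mid i j. ?D (prep (uw i l) (cf l j)) - (head_term (gf i l) (?k l) (cf l j) + prep (uw i l) (?D (cf l j)))) \<in> pm.span (multilinear_rels U)"
      by (rule pm.span_sum, rule diff_prep) (use step gf_in cf_words0 in auto)
    have b: "(\<Sum>l\<in>mid i j. prep (uw i l) (?D (cf l j))) \<in> pm.span (multilinear_rels U)"
    proof (rule pm.span_sum, rule prep_multilinear)
      fix l assume l: "l \<in> mid i j"
      show "uw i l \<in> lists (forms U)" using gf_in[of i l] step(1) l tform_in[of U] forms0_subset[of U] by auto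
      show "?D (cf l j) \<in> pm.span (multilinear_rels U)" using step(3)[OF False l] .
    qed
    \<comment> \<open>First steps of height at least two, which carry padding, and of height one,
      which carry none.\<close>
    let ?M2 = "{l\<in>mid i j. d l \<le> d i - 2}" and ?L = "{l\<in>mid i j. d l = d i - 1}"
    have part: "mid i j = ?M2 \<union> ?L" "?M2 \<inter> ?L = {}" by auto
    have f: "finite ?M2" "finite ?L" using fin_I by auto
    have "(\<Sum>l\<in>mid i j. head_term (gf i l) (?k l) (cf l j))
      = (\<Sum>l\<in>?M2. head_term (gf i l) (?k l) (cf l j)) + (\<Sum>l\<in>?L. head_term (gf i l) (?k l) (cf l j))"
      by (subst part(1)) (rule sum.union_disjoint[OF f part(2)])
    also have "(\<Sum>l\<in>?M2. head_term (gf i l) (?k l) (cf l j)) = (\<Sum>l\<in>?M2. prep (?a l # replicate (?n l) t) (cf l j))"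
      by (rule sum.cong) (auto simp: head_term_def nat_diff_distrib' diff_Suc split: nat.split)
    also have "(\<Sum>l\<in>?L. head_term (gf i l) (?k l) (cf l j)) = (\<Sum>l\<in>?L. \<Sum>l'\<in>?M2. prep (?b l l' # replicate (?n l') t) (cf l' j))"
    proof (rule sum.cong[OF refl])
      fix l assume l: "l \<in> ?L"
      have k0: "?k l = 0" using l by auto
      show "head_term (gf i l) (?k l) (cf l j) = (\<Sum>l'\<in>?M2. prep (?b l l' # replicate (?n l') t) (cf l' j))"
      proof (cases "l = j")
        case True
        then have "?M2 = {}" using l by auto
        then show ?thesis unfolding k0 head_term_def using True by (simp only: cf_diag mult_head_empty sum.empty if_True simp_thms)
      next
        case False
        have m: "mid l j = ?M2" using l by auto
        have "head_term (gf i l) (?k l) (cf l j) = (\<Sum>l'\<in>mid l j. prep (?b l l' # replicate (nat (d l - d l') - 1) t) (cf l' j))"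
          unfolding k0 head_term_def cf_rec[OF False] mult_head_sum mult_head_prep by simp
        also have "\<dots> = (\<Sum>l'\<in>?M2. prep (?b l l' # replicate (?n l') t) (cf l' j))"
          unfolding m
        proof (rule sum.cong[OF refl])
          fix l' assume "l' \<in> ?M2"
          then have "nat (d l - d l') - 1 = ?n l'" using l by auto
          then show "prep (?b l l' # replicate (nat (d l - d l') - 1) t) (cf l' j) = prep (?b l l' # replicate (?n l') t) (cf l' j)" by simp
        qed
        finally show ?thesis .
      qed
    qed
    also have "(\<Sum>l\<in>?M2. prep (?a l # replicate (?n l) t) (cf l j)) + (\<Sum>l\<in>?L. \<Sum>l'\<in>?M2. prep (?b l l' # replicate (?n l') t) (cf l' j))
      = (\<Sum>l'\<in>?M2. prep (?a l' # replicate (?n l') t) (cf l' j) + (\<Sum>l\<in>?L. prep (?b l l' # replicate (?n l') t) (cf l' j)))"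
      unfolding sum.distrib by (subst sum.swap) simp
    also have "\<dots> \<in> pm.span (multilinear_rels U)"
    proof (rule pm.span_sum)
      fix l' assume l': "l' \<in> ?M2"
      have L: "?L = {l\<in>I. d l = d i - 1}" using l' by auto
      have l'I: "l' \<in> I" using l' by auto
      let ?r = "replicate (?n l') t"
      have aU: "?a l' \<in> forms U" using form_mult_d_in[OF U_open gf_in[OF step(1) l'I] tform_in] .
      have bU: "?b l l' \<in> forms U" if "l \<in> ?L" for l using form_mult_d_in[OF U_open gf_in gf_in] that l'I step(1) by auto
      let ?s = "\<Sum>l\<in>?L. ?b l l'"
      have s: "?s \<in> forms U" using bU by (rule forms_sum)
      have z: "?a l' + ?s = 0" using letters_cancel[OF step(1) l'I] unfolding L .
      have "linext (\<lambda>w. single ([] @ [?a l'] @ ?r @ w) 1 + (\<Sum>l\<in>?L. single ([] @ [?b l l'] @ ?r @ w) 1)) (cf l' j) \<in> pm.span (multilinear_rels U)"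
      proof (rule linext_words)
        fix w assume "w \<in> keys (cf l' j)"
        then have "w \<in> lists (forms0 U)" using cf_keys[OF l'I step(2)] by blast
        moreover have "?r \<in> lists (forms0 U)" using tform_in[of U] by auto
        ultimately have v: "?r @ w \<in> lists (forms U)" using lists_mono[OF forms0_subset[of U]] by (auto simp only: append_in_lists_conv)
        let ?v = "?r @ w"
        have 1: "single ([] @ [?a l' + ?s] @ ?v) 1 - (single ([] @ [?a l'] @ ?v) 1 + single ([] @ [?s] @ ?v) 1) \<in> pm.span (multilinear_rels U)"
          unfolding multilinear_rels_def by (rule pm.span_base, rule UnI1) (use aU s v in blast)
        have 2: "single ([] @ [?s] @ ?v) 1 - (\<Sum>l\<in>?L. single ([] @ [?b l l'] @ ?v) 1) \<in> pm.span (multilinear_rels U)"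
          by (rule single_sum_letter[OF _ v f(2)]) (use bU in auto)
        have 3: "single ([] @ [0] @ ?v) 1 \<in> pm.span (multilinear_rels U)" by (rule single_zero_letter[OF _ v]) simp
        have "single ([] @ [0] @ ?v) 1
          - (single ([] @ [?a l' + ?s] @ ?v) 1 - (single ([] @ [?a l'] @ ?v) 1 + single ([] @ [?s] @ ?v) 1))
          - (single ([] @ [?s] @ ?v) 1 - (\<Sum>l\<in>?L. single ([] @ [?b l l'] @ ?v) 1)) \<in> pm.span (multilinear_rels U)"
          by (intro pm.span_diff 1 2 3)
        then show "single ([] @ [?a l'] @ ?v) 1 + (\<Sum>l\<in>?L. single ([] @ [?b l l'] @ ?v) 1) \<in> pm.span (multilinear_rels U)"
          unfolding z by (simp add: algebra_simps)
      qed
      then show "prep (?a l' # ?r) (cf l' j) + (\<Sum>l\<in>?L. prep (?b l l' # ?r) (cf l' j)) \<in> pm.span (multilinear_rels U)"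
        by (simp add: linext_fun_add linext_fun_sum prep_def)
    qed
    finally have c: "(\<Sum>l\<in>mid i j. head_term (gf i l) (?k l) (cf l j)) \<in> pm.span (multilinear_rels U)" .
    have "?D (cf i j) = (\<Sum>l\<in>mid i j. ?D (prep (uw i l) (cf l j)) - (head_term (gf i l) (?k l) (cf l j) + prep (uw i l) (?D (cf l j))))
      + (\<Sum>l\<in>mid i j. head_term (gf i l) (?k l) (cf l j)) + (\<Sum>l\<in>mid i j. prep (uw i l) (?D (cf l j)))"
      unfolding cf_rec[OF False] linext_sum by (simp add: sum_subtractf sum.distrib)
    then show ?thesis using pm.span_add[OF pm.span_add[OF a c] b] by simp
  qed
qed

section \<open>The comodule of a period matrix\<close>

definition A :: "fword comodule" where
  "A = \<lparr> cm_space = (\<lambda>n. supp_in {i\<in>I. d i = n}),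
     cm_coact = (\<lambda>n. linext (\<lambda>i. \<Sum>j\<in>I. tens (cf i j) (single j 1))) \<rparr>"

lemma A_simps [simp]: "cm_space A n = supp_in {i\<in>I. d i = n}"
  "cm_coact A n = linext (\<lambda>i. \<Sum>j\<in>I. tens (cf i j) (single j 1))"
  by (simp_all add: A_def)

lemma cf_part: "i \<in> I \<Longrightarrow> j \<in> I \<Longrightarrow> cf i j \<in> gh_part (H0_hopf U) (nat (d i - d j))"
  using cf_keys[of i j] cf_words0[of i j] cf_diff[of i j] pm.span_mono[OF multilinear_rels_subset[of U]] by (auto simp: gh_part_def)

definition assoc :: "nat \<Rightarrow> (fword \<times> fword \<Rightarrow>\<^sub>0 rat) \<Rightarrow> (fword \<times> fword \<times> nat \<Rightarrow>\<^sub>0 rat)" where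
  "assoc j = linext (\<lambda>(w1, w2). single (w1, w2, j) 1)"

lemma assoc_tens: "assoc j (tens x y) = tens x (tens y (single j 1))"
proof -
  have "tens y (single j 1) = linext (\<lambda>b. single (b, j) 1) y" by (simp add: tens_def)
  then show ?thesis unfolding assoc_def linext_tens tens_def[of x] by (simp add: linext_linext)
qed

lemma assoc_right_null: "p \<in> right_null U \<Longrightarrow> assoc j p \<in> null2 (H0_hopf U)"
  unfolding right_null_def assoc_def null2_def
proof (rule linext_in_span)
  fix s :: "fword \<times> fword \<Rightarrow>\<^sub>0 rat" assume "s \<in> {tens x \<nu> |x \<nu>. \<nu> \<in> gh_null (H0_hopf U)}"
  then obtain x \<nu> where s: "s = tens x \<nu>" "\<nu> \<in> gh_null (H0_hopf U)" by blast
  have "assoc j s = tens x (tens \<nu> (single j 1))" unfolding s(1) by (rule assoc_tens)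
  then show "linext (\<lambda>(w1, w2). single (w1, w2, j) 1) s \<in> pm.span ({tens \<nu> (tens x y) | \<nu> x y. \<nu> \<in> gh_null (H0_hopf U)}
                    \<union> {tens x (tens \<nu> y) | x \<nu> y. \<nu> \<in> gh_null (H0_hopf U)})"
    unfolding assoc_def[symmetric] using s(2) by (intro pm.span_base) blast
qed

lemma comult_tens_id_tens:
  "comult_tens_id (H0_hopf U) (tens a (single j 1)) = assoc j (linext comult_word a)"
  unfolding comult_tens_id_def assoc_def linext_linext linext_tens by simp

lemma id_tens_linext:
  fixes p :: "'w \<times> 'b \<Rightarrow>\<^sub>0 rat"
  shows "id_tens (\<lambda>_. linext f) p = linext (\<lambda>(w, i). tens (single w 1) (f i)) p"
proof -
  have "linext (\<lambda>(w, i). tens (single w 1) (f i)) (tens (single w 1) v) = tens (single w 1) (linext f v)" for w :: 'w and v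
    unfolding linext_tens by (simp add: tens_linext_right)
  then show ?thesis
    unfolding id_tens_def
    using arg_cong[OF slice_expand[of p], of "linext (\<lambda>(w, i). tens (single w 1) (f i))"]
    unfolding linext_sum by simp
qed

lemma comod_A: "comod U A"
proof
  show "U \<noteq> {}" by (rule U_ne)
  let ?f = "\<lambda>i. \<Sum>j\<in>I. tens (cf i j) (single j (1::rat))"
  show "graded_comodule (H0_hopf U) A"
    unfolding graded_comodule_def A_simps
  proof (intro conjI allI ballI)
    fix n show "findim (supp_in {i \<in> I. d i = n})" using fin_I by (intro findim_supp_in) simp
  next
    have "{n. supp_in {i \<in> I. d i = n} \<noteq> {0::qvec}} \<subseteq> d ` I"
    proof
      fix n assume "n \<in> {n. supp_in {i \<in> I. d i = n} \<noteq> {0::qvec}}"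
      moreover have "supp_in {} = {0::qvec}" by (auto simp: supp_in_def)
      ultimately have "{i \<in> I. d i = n} \<noteq> {}" by force
      then show "n \<in> d ` I" by auto
    qed
    then show "finite {n. supp_in {i \<in> I. d i = n} \<noteq> {0::qvec}}" using fin_I finite_subset by blast
  next
    fix n and v :: qvec assume v: "v \<in> supp_in {i \<in> I. d i = n}"
    show "linext ?f v \<in> pm.span (\<Union>k. {tens a v' |a v'. a \<in> gh_part (H0_hopf U) k \<and> v' \<in> supp_in {i \<in> I. d i = n - int k}})"
    proof (rule linext_words, rule pm.span_sum)
      fix i j assume "i \<in> keys v" and j: "j \<in> I"
      then have i: "i \<in> I" "d i = n" using v by (auto simp: supp_in_def)
      show "tens (cf i j) (single j (1::rat)) \<in> pm.span (\<Union>k. {tens a v' |a v'. a \<in> gh_part (H0_hopf U) k \<and> v' \<in> supp_in {i \<in> I. d i = n - int k}})"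
      proof (cases "d j \<le> d i")
        case True
        then have "single j (1::rat) \<in> supp_in {k \<in> I. d k = n - int (nat (d i - d j))}"
          by (intro single_in_supp) (use i j True in simp)
        then show ?thesis using cf_part[OF i(1) j] by (intro pm.span_base) blast
      next
        case False
        then have "cf i j = 0" by (intro cf_zero) auto
        then show ?thesis by (simp add: pm.span_zero)
      qed
    qed
  next
    fix u v :: qvec
    show "linext ?f (u + v) - (linext ?f u + linext ?f v) \<in> null1 (H0_hopf U)"
      by (simp add: linext_add null1_def pm.span_zero)
  next
    fix q v show "linext ?f (scl q v) - scl q (linext ?f v) \<in> null1 (H0_hopf U)"
      by (simp add: linext_scl null1_def pm.span_zero)
  next
    fix n and v :: qvec assume v: "v \<in> supp_in {i \<in> I. d i = n}"
    have "counit_tens_id (H0_hopf U) p = opw [] p" for p :: "fword \<times> nat \<Rightarrow>\<^sub>0 rat"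
      unfolding opw_def counit_tens_id_def by (rule linext_cong) (auto simp: wev.simps neq_Nil_conv split: prod.split)
    then have "counit_tens_id (H0_hopf U) (linext ?f v) = linext (\<lambda>i. opw [] (?f i)) v"
      by (simp add: opw_def linext_linext)
    also have "\<dots> = linext (\<lambda>i. single i 1) v"
    proof (rule linext_cong)
      fix i assume "i \<in> keys v"
      then have i: "i \<in> I" using v by (auto simp: supp_in_def)
      have "opw [] (?f i) = (\<Sum>j\<in>I. if i = j then single j 1 else 0)"
        unfolding opw_sum opw_tens by (rule sum.cong) (auto simp: pm.scale_zero_left lev_Nil_cf i)
      then show "opw [] (?f i) = single i 1" using i fin_I by simp
    qed
    finally show "counit_tens_id (H0_hopf U) (linext ?f v) = v" by (simp add: linext_id)
  next
    fix n and v :: qvec assume v: "v \<in> supp_in {i \<in> I. d i = n}"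
    have 1: "comult_tens_id (H0_hopf U) (linext ?f v) = linext (\<lambda>i. comult_tens_id (H0_hopf U) (?f i)) v"
      unfolding comult_tens_id_def linext_linext ..
    have 2: "id_tens (\<lambda>w. linext ?f) (linext ?f v) = linext (\<lambda>i. id_tens (\<lambda>w. linext ?f) (?f i)) v"
      unfolding id_tens_linext linext_linext ..
    have "linext (\<lambda>i. comult_tens_id (H0_hopf U) (?f i) - id_tens (\<lambda>w. linext ?f) (?f i)) v \<in> null2 (H0_hopf U)"
      unfolding null2_def
    proof (rule linext_words, fold null2_def)
      fix i assume "i \<in> keys v"
      then have i: "i \<in> I" using v by (auto simp: supp_in_def)
      have a: "comult_tens_id (H0_hopf U) (?f i) = (\<Sum>j\<in>I. assoc j (linext comult_word (cf i j)))"
        unfolding comult_tens_id_tens[symmetric] by (simp add: comult_tens_id_def linext_sum)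
      have "id_tens (\<lambda>w. linext ?f) (?f i) = (\<Sum>m\<in>I. linext (\<lambda>w. tens (single w 1) (?f m)) (cf i m))"
        unfolding id_tens_linext linext_sum linext_tens by simp
      also have "\<dots> = (\<Sum>m\<in>I. tens (cf i m) (?f m))"
      proof (rule sum.cong[OF refl])
        fix m show "linext (\<lambda>w. tens (single w 1) (?f m)) (cf i m) = tens (cf i m) (?f m)"
          using tens_linext_left[of "\<lambda>w. single w 1" "cf i m" "?f m"] by (simp add: linext_id)
      qed
      also have "\<dots> = (\<Sum>j\<in>I. assoc j (\<Sum>m\<in>I. tens (cf i m) (cf m j)))"
        unfolding tens_sum_right assoc_def linext_sum by (subst sum.swap) (simp add: assoc_tens[unfolded assoc_def])
      finally have b: "id_tens (\<lambda>w. linext ?f) (?f i) = (\<Sum>j\<in>I. assoc j (\<Sum>m\<in>I. tens (cf i m) (cf m j)))" .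
      have "(\<Sum>j\<in>I. assoc j (linext comult_word (cf i j) - (\<Sum>m\<in>I. tens (cf i m) (cf m j)))) \<in> null2 (H0_hopf U)"
        unfolding null2_def by (rule pm.span_sum, fold null2_def) (intro assoc_right_null cf_comult i)
      then show "comult_tens_id (H0_hopf U) (?f i) - id_tens (\<lambda>w. linext ?f) (?f i) \<in> null2 (H0_hopf U)"
        unfolding a b by (simp add: assoc_def linext_diff sum_subtractf)
    qed
    also have "linext (\<lambda>i. comult_tens_id (H0_hopf U) (?f i) - id_tens (\<lambda>w. linext ?f) (?f i)) v
      = comult_tens_id (H0_hopf U) (linext ?f v) - id_tens (\<lambda>w. linext ?f) (linext ?f v)"
      unfolding 1 2 using linext_fun_add[of "\<lambda>i. comult_tens_id (H0_hopf U) (?f i) - id_tens (\<lambda>w. linext ?f) (?f i)" "\<lambda>i. id_tens (\<lambda>w. linext ?f) (?f i)" v]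
      by (simp add: eq_diff_eq)
    finally show "comult_tens_id (H0_hopf U) (linext ?f v) - id_tens (\<lambda>w. linext ?f) (linext ?f v) \<in> null2 (H0_hopf U)" .
  qed
qed

text \<open>Basic operators read off single letters by \<open>lev_basic_cf\<close>; this turns
  conditions on comodule maps between models into conditions on period matrices.\<close>

lemma act_basic_A:
  "comod.act A (l # replicate m E) n v = linext (\<lambda>i. \<Sum>j\<in>{j\<in>I. d i - d j = int (Suc m)}. single j (l (gf i j))) v"
  if v: "v \<in> supp_in I"
proof -
  interpret cA: comod U A by (rule comod_A)
  have "cA.act (l # replicate m E) n v = linext (\<lambda>i. \<Sum>j\<in>I. scl (lev (l # replicate m E) (cf i j)) (single j 1)) v"
    unfolding cA.act_def A_simps opw_def linext_linext unfolding linext_sum unfolding opw_def[symmetric] opw_tens ..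
  also have "\<dots> = linext (\<lambda>i. \<Sum>j\<in>{j\<in>I. d i - d j = int (Suc m)}. single j (l (gf i j))) v"
  proof (rule linext_cong)
    fix i assume "i \<in> keys v"
    then have i: "i \<in> I" using v by (auto simp: supp_in_def)
    show "(\<Sum>j\<in>I. scl (lev (l # replicate m E) (cf i j)) (single j 1)) = (\<Sum>j\<in>{j\<in>I. d i - d j = int (Suc m)}. single j (l (gf i j)))"
      by (rule sum.mono_neutral_cong_right) (auto simp: fin_I lev_basic_cf i)
  qed
  finally show ?thesis .
qed

end

lemma qlinear_linext:
  assumes "qlinear (supp_in K) W f" "v \<in> supp_in K"
  shows "f v = linext (\<lambda>i. f (single i 1)) v"
proof -
  have "f (linext (\<lambda>i. single i 1) v) = linext (\<lambda>i. f (single i 1)) v"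
    unfolding linext_def by (rule qlinear_sum[OF assms(1) supp_in_subspace]) (use assms(2) in \<open>auto simp: supp_in_def\<close>)
  then show ?thesis by (simp add: linext_id)
qed

lemma lookup_linext_superset': 
  assumes "finite K" "keys p \<subseteq> K"
  shows "lookup (linext f p) b = (\<Sum>a\<in>K. lookup p a * lookup (f a) b)"
  by (simp add: lookup_linext_superset[OF assms] Poly_Mapping.lookup_sum)

lemma qlin_sum:
  assumes "qlin U l" "\<And>j. j \<in> J \<Longrightarrow> x j \<in> forms U"
  shows "l (\<Sum>j\<in>J. form_scale (of_rat (q j)) (x j)) = (\<Sum>j\<in>J. of_rat (q j) * l (x j))"
proof -
  have "form_scale (of_rat 0) 0 = 0" by (simp add: form_scale_def zero_prod_def zero_fun_def)
  then have l0: "l 0 = 0" using assms(1) forms_zero[of U] unfolding qlin_def by (metis mult_zero_left of_rat_0)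
  show ?thesis
    using assms(2)
  proof (induction J rule: infinite_finite_induct)
    case (insert j J)
    have "(\<Sum>j\<in>J. form_scale (of_rat (q j)) (x j)) \<in> forms U" "form_scale (of_rat (q j)) (x j) \<in> forms U"
      using insert by (auto intro!: forms_sum forms_scale)
    then show ?case using insert assms(1) by (simp add: qlin_def)
  qed (simp_all add: l0)
qed

context gauge begin

text \<open>Functionals that kill \<open>2\<pi>i\<close> determine a function modulo
  \<open>\<rat>(1)\<close>, and \<open>E\<close> fixes the remaining rational multiple: subtracting
  a multiple of \<open>E\<close> makes any functional kill \<open>2\<pi>i\<close>.\<close>

lemma eq_if_functionals_eq:
  assumes "E x = E y" "\<And>l :: form \<Rightarrow> rat. qlin U l \<Longrightarrow> l (tform U) = 0 \<Longrightarrow> l x = l y"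
  shows "fst x = fst y"
proof (rule ccontr)
  let ?f = "fst x - fst y" let ?B = "qf.extend_basis {?f}"
  assume "fst x \<noteq> fst y"
  then have "?f \<noteq> 0" by (metis eq_iff_diff_eq_0)
  then have ind: "qf.independent {?f}" by (simp add: qf.dependent_single)
  note B = qf.independent_extend_basis[OF ind] qf.span_extend_basis[OF ind] qf.extend_basis_superset[OF ind]
  define L where "L f = qf.representation ?B f ?f" for f
  have La: "L (f + g) = L f + L g" and Ls: "L (qsc q f) = q * L f" for f g q
    using B by (auto simp: L_def qf.representation_add qf.representation_scale)
  have Lf: "L ?f = 1" using qf.representation_basis[OF B(1), of ?f] B(3) by (simp add: L_def)
  let ?l = "\<lambda>x. L (fst x) - L (fst (tform U)) * E x"
  have "fst (form_scale (of_rat q) x) = qsc q (fst x)" for q x by (simp add: form_scale_def qsc_def)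
  then have "qlin U ?l" by (simp add: qlin_def La Ls E_def e_add e_scl algebra_simps of_rat_eq_id)
  from assms(2)[OF this] have "L (fst x) = L (fst y)" using assms(1) by simp
  moreover have "L (fst x) = L ?f + L (fst y)" unfolding La[symmetric] by simp
  ultimately show False using Lf by simp
qed

end

section \<open>Homomorphisms between period comodules\<close>

locale period_pair = src: period U e X + tgt: period U e Y for U e X Y
begin

sublocale comod_pair U src.A tgt.A
  by (intro comod_pair.intro src.comod_A tgt.comod_A)

definition intertwines :: "(nat \<Rightarrow> nat \<Rightarrow> rat) \<Rightarrow> bool" where
  "intertwines m \<longleftrightarrow> (\<forall>i\<in>pI X. \<forall>k\<in>pI Y. \<forall>z\<in>U.
      (\<Sum>j\<in>pI X. pS X i j z * of_rat (m j k)) = (\<Sum>j\<in>pI Y. of_rat (m i j) * pS Y j k z))"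

definition mat :: "(int \<Rightarrow> qvec \<Rightarrow> qvec) \<Rightarrow> nat \<Rightarrow> nat \<Rightarrow> rat" where
  "mat f i j = lookup (f (pd X i) (single i 1)) j"

lemma mat_zero:
  assumes "graded_linear f" "i \<in> pI X" "\<not> (j \<in> pI Y \<and> pd Y j = pd X i)" shows "mat f i j = 0"
proof -
  have "single i 1 \<in> cm_space src.A (pd X i)" using assms(2) by (auto intro: single_in_supp)
  then have "f (pd X i) (single i 1) \<in> cm_space tgt.A (pd X i)"
    using assms(1) unfolding graded_linear_def qlinear_def by blast
  then show ?thesis using assms(3) unfolding mat_def tgt.A_simps supp_in_def by (auto simp: Poly_Mapping.in_keys_iff)
qed

text \<open>If the degree of \<open>i\<close> does not exceed that of \<open>k\<close>,
  triangularity reduces both sides to the entry \<open>i\<close>, \<open>k\<close> of the matrix. So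
  only entries that strictly lower the degree impose a condition, and there
  \<open>- 2\<pi>i S\<close> is a letter.\<close>

lemma intertwines_iff_letters:
  assumes f: "graded_linear f"
  shows "intertwines (mat f) \<longleftrightarrow> (\<forall>i\<in>pI X. \<forall>k\<in>pI Y. pd Y k < pd X i \<longrightarrow>
    (\<Sum>j\<in>{j\<in>pI X. pd X j = pd Y k}. form_scale (of_rat (mat f j k)) (src.gf i j))
    = (\<Sum>j\<in>{j\<in>pI Y. pd Y j = pd X i}. form_scale (of_rat (mat f i j)) (tgt.gf j k)))"
proof -
  have nz: "j \<in> pI Y \<and> pd Y j = pd X i" if "mat f i j \<noteq> 0" "i \<in> pI X" for i j using mat_zero[OF f that(2)] that(1) by blast
  have l: "(\<Sum>j\<in>pI X. pS X i j z * of_rat (mat f j k)) = (\<Sum>j\<in>{j\<in>pI X. pd X j = pd Y k}. pS X i j z * of_rat (mat f j k))" for i k z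
    by (rule sum.mono_neutral_right) (use src.fin_I nz in auto)
  have r: "(\<Sum>j\<in>pI Y. of_rat (mat f i j) * pS Y j k z) = (\<Sum>j\<in>{j\<in>pI Y. pd Y j = pd X i}. of_rat (mat f i j) * pS Y j k z)" if "i \<in> pI X" for i k z
    by (rule sum.mono_neutral_right) (use tgt.fin_I nz that in auto)
  have eq: "(\<Sum>j\<in>{j\<in>pI X. pd X j = pd Y k}. form_scale (of_rat (mat f j k)) (src.gf i j))
      = (\<Sum>j\<in>{j\<in>pI Y. pd Y j = pd X i}. form_scale (of_rat (mat f i j)) (tgt.gf j k))
    \<longleftrightarrow> (\<forall>z\<in>U. (\<Sum>j\<in>pI X. pS X i j z * of_rat (mat f j k)) = (\<Sum>j\<in>pI Y. of_rat (mat f i j) * pS Y j k z))"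
    (is "?L = ?R \<longleftrightarrow> ?W") if ik: "i \<in> pI X" "k \<in> pI Y" for i k
  proof -
    let ?c = "- (2 * complex_of_real pi * \<i>)"
    have c: "?c \<noteq> 0" by simp
    have s: "snd ?L = snd ?R" unfolding snd_sum fun_eq_iff sum_fun_apply by (simp add: form_scale_def src.gf_def tgt.gf_def)
    have fl: "fst ?L z = ?c * (\<Sum>j\<in>{j\<in>pI X. pd X j = pd Y k}. pS X i j z * of_rat (mat f j k))" for z
      unfolding fst_sum sum_fun_apply sum_distrib_left by (rule sum.cong[OF refl]) (simp add: form_scale_def src.gf_def)
    have fr: "fst ?R z = ?c * (\<Sum>j\<in>{j\<in>pI Y. pd Y j = pd X i}. of_rat (mat f i j) * pS Y j k z)" for z
      unfolding fst_sum sum_fun_apply sum_distrib_left by (rule sum.cong[OF refl]) (simp add: form_scale_def tgt.gf_def)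
    have z0: "pS X i j z = 0" if "z \<notin> U" "j \<in> pI X" for j z using src.S_holo[OF ik(1) that(2)] that(1) by (simp add: holo_funs_def)
    have z1: "pS Y j k z = 0" if "z \<notin> U" "j \<in> pI Y" for j z using tgt.S_holo[OF that(2) ik(2)] that(1) by (simp add: holo_funs_def)
    have "?L = ?R \<longleftrightarrow> (\<forall>z. fst ?L z = fst ?R z)" unfolding prod_eq_iff fun_eq_iff[of "fst ?L"] using s by (simp only: simp_thms)
    also have "\<dots> \<longleftrightarrow> (\<forall>z. (\<Sum>j\<in>pI X. pS X i j z * of_rat (mat f j k)) = (\<Sum>j\<in>pI Y. of_rat (mat f i j) * pS Y j k z))"
      unfolding fl fr l r[OF ik(1)] mult_cancel_left using c by simp
    also have "\<dots> \<longleftrightarrow> ?W" by (metis (no_types, lifting) z0 z1 mult_zero_left mult_zero_right sum.neutral)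
    finally show ?thesis .
  qed
  have high: "(\<Sum>j\<in>pI X. pS X i j z * of_rat (mat f j k)) = (\<Sum>j\<in>pI Y. of_rat (mat f i j) * pS Y j k z)"
    if ik: "i \<in> pI X" "k \<in> pI Y" "pd X i \<le> pd Y k" "z \<in> U" for i k z
  proof -
    have "(\<Sum>j\<in>pI X. pS X i j z * of_rat (mat f j k)) = (\<Sum>j\<in>pI X. if j = i then of_rat (mat f i k) else 0)"
    proof (rule sum.cong[OF refl])
      fix j assume j: "j \<in> pI X"
      consider "j = i" | "j \<noteq> i" "pd X j = pd Y k" | "j \<noteq> i" "pd X j \<noteq> pd Y k" by blast
      then show "pS X i j z * of_rat (mat f j k) = (if j = i then of_rat (mat f i k) else 0)"
      proof cases
        case 1 then show ?thesis using src.S_diag ik by simp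
      next
        case 2 then show ?thesis using src.S_tri[OF ik(1) j] ik by simp
      next
        case 3 then show ?thesis using nz[OF _ j] by auto
      qed
    qed
    moreover have "(\<Sum>j\<in>pI Y. of_rat (mat f i j) * pS Y j k z) = (\<Sum>j\<in>pI Y. if j = k then of_rat (mat f i k) else 0)"
    proof (rule sum.cong[OF refl])
      fix j assume j: "j \<in> pI Y"
      consider "j = k" | "j \<noteq> k" "pd Y j = pd X i" | "j \<noteq> k" "pd Y j \<noteq> pd X i" by blast
      then show "of_rat (mat f i j) * pS Y j k z = (if j = k then of_rat (mat f i k) else 0)"
      proof cases
        case 1 then show ?thesis using tgt.S_diag ik by simp
      next
        case 2 then show ?thesis using tgt.S_tri[OF j ik(2)] ik by simp
      next
        case 3 then show ?thesis using nz[OF _ ik(1)] by auto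
      qed
    qed
    ultimately show ?thesis using ik src.fin_I tgt.fin_I by simp
  qed
  show ?thesis
    unfolding intertwines_def
  proof (intro ball_cong refl)
    fix i k assume ik: "i \<in> pI X" "k \<in> pI Y"
    show "(\<forall>z\<in>U. (\<Sum>j\<in>pI X. pS X i j z * of_rat (mat f j k)) = (\<Sum>j\<in>pI Y. of_rat (mat f i j) * pS Y j k z))
      \<longleftrightarrow> (pd Y k < pd X i \<longrightarrow> (\<Sum>j\<in>{j\<in>pI X. pd X j = pd Y k}. form_scale (of_rat (mat f j k)) (src.gf i j))
        = (\<Sum>j\<in>{j\<in>pI Y. pd Y j = pd X i}. form_scale (of_rat (mat f i j)) (tgt.gf j k)))"
    proof (cases "pd Y k < pd X i")
      case True then show ?thesis unfolding eq[OF ik] by (simp only: simp_thms)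
    next
      case False
      then have "\<forall>z\<in>U. (\<Sum>j\<in>pI X. pS X i j z * of_rat (mat f j k)) = (\<Sum>j\<in>pI Y. of_rat (mat f i j) * pS Y j k z)"
        using high[OF ik] by (auto simp only: not_less)
      with False show ?thesis by (simp only: simp_thms)
    qed
  qed
qed

lemma lookup_basic_left:
  assumes f: "graded_linear f" and i: "i \<in> pI X" and k: "k \<in> pI Y"
  shows "lookup (tgt.act (l # replicate m src.E) (pd X i) (f (pd X i) (single i 1))) k
    = (if pd X i - pd Y k = int (Suc m) then \<Sum>j\<in>{j\<in>pI Y. pd Y j = pd X i}. mat f i j * l (tgt.gf j k) else 0)"
proof -
  let ?v = "f (pd X i) (single i 1)"
  have "single i 1 \<in> cm_space src.A (pd X i)" using i by (auto intro: single_in_supp)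
  then have v: "?v \<in> supp_in {j\<in>pI Y. pd Y j = pd X i}"
    using f unfolding graded_linear_def qlinear_def tgt.A_simps by blast
  then have v': "?v \<in> supp_in (pI Y)" by (auto simp: supp_in_def)
  have lk: "lookup (\<Sum>k\<in>{k\<in>pI Y. pd Y j - pd Y k = int (Suc m)}. single k (l (tgt.gf j k))) k
     = (if pd Y j - pd Y k = int (Suc m) then l (tgt.gf j k) else 0)" for j
    using k tgt.fin_I by (simp add: Poly_Mapping.lookup_sum Poly_Mapping.lookup_single when_def)
  have "lookup (tgt.act (l # replicate m src.E) (pd X i) ?v) k
     = (\<Sum>j\<in>{j\<in>pI Y. pd Y j = pd X i}. lookup ?v j * (if pd Y j - pd Y k = int (Suc m) then l (tgt.gf j k) else 0))"
    unfolding tgt.act_basic_A[OF v'] lk[symmetric]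
    by (rule lookup_linext_superset') (use v tgt.fin_I in \<open>auto simp: supp_in_def\<close>)
  then show ?thesis by (simp add: mat_def)
qed

lemma lookup_basic_right:
  assumes f: "graded_linear f" and i: "i \<in> pI X" and k: "k \<in> pI Y"
  shows "lookup (f (pd X i - int (Suc m)) (src.act (l # replicate m src.E) (pd X i) (single i 1))) k
    = (if pd X i - pd Y k = int (Suc m) then \<Sum>j\<in>{j\<in>pI X. pd X j = pd Y k}. l (src.gf i j) * mat f j k else 0)"
proof -
  let ?J = "{j\<in>pI X. pd X i - pd X j = int (Suc m)}"
  let ?w = "\<Sum>j\<in>?J. single j (l (src.gf i j))"
  have w: "src.act (l # replicate m src.E) (pd X i) (single i 1) = ?w"
    using src.act_basic_A[of "single i 1" l m] i by (simp add: single_in_supp)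
  have "single j (l (src.gf i j)) \<in> supp_in {j\<in>pI X. pd X j = pd X i - int (Suc m)}" if "j \<in> ?J" for j
    using that by (intro single_in_supp) auto
  have q: "qlinear (supp_in {j\<in>pI X. pd X j = pd X i - int (Suc m)}) (cm_space tgt.A (pd X i - int (Suc m))) (f (pd X i - int (Suc m)))"
    using f unfolding graded_linear_def by simp
  have "f (pd X i - int (Suc m)) ?w = f (pd X i - int (Suc m)) (\<Sum>j\<in>?J. scl (l (src.gf i j)) (single j 1))" by simp
  also have "\<dots> = (\<Sum>j\<in>?J. scl (l (src.gf i j)) (f (pd X i - int (Suc m)) (single j 1)))"
    by (rule qlinear_sum[OF q supp_in_subspace]) (auto intro: single_in_supp)
  also have "\<dots> = (\<Sum>j\<in>?J. scl (l (src.gf i j)) (f (pd X j) (single j 1)))"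
    by (rule sum.cong[OF refl]) (auto simp: algebra_simps)
  finally have "lookup (f (pd X i - int (Suc m)) ?w) k = (\<Sum>j\<in>?J. l (src.gf i j) * mat f j k)"
    by (simp add: Poly_Mapping.lookup_sum mat_def)
  also have "\<dots> = (if pd X i - pd Y k = int (Suc m) then \<Sum>j\<in>{j\<in>pI X. pd X j = pd Y k}. l (src.gf i j) * mat f j k else 0)"
  proof (cases "pd X i - pd Y k = int (Suc m)")
    case True
    then have "?J = {j\<in>pI X. pd X j = pd Y k}" by auto
    then show ?thesis using True by simp
  next
    case False
    then have "mat f j k = 0" if "j \<in> ?J" for j using that by (intro mat_zero[OF f]) auto
    then show ?thesis using False by simp
  qed
  finally show ?thesis unfolding w .
qed

text \<open>Basic operators compare sums of letters under functionals that kill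
  \<open>2\<pi>i\<close>, which yields equality modulo \<open>\<rat>(1)\<close>. The gauge condition
  makes \<open>E\<close> vanish on both sides, so the sums themselves agree. Conversely, commuting
  with basic operators is enough by \<open>intertwines_if_intertwines_basic\<close>.\<close>

lemma hom_iff_intertwines:
  "f \<in> comodule_hom (H0_hopf U) src.A tgt.A \<longleftrightarrow>
    graded_linear f \<and> (\<forall>n v. v \<notin> cm_space src.A n \<longrightarrow> f n v = 0) \<and> intertwines (mat f)"
proof (cases "graded_linear f")
  case False then show ?thesis unfolding comodule_hom_iff by blast
next
  case f: True
  have gU: "src.gf i j \<in> forms U" if "i \<in> pI X" "j \<in> pI X" for i j using src.gf_in[OF that] forms0_subset by blast
  have hU: "tgt.gf i j \<in> forms U" if "i \<in> pI Y" "j \<in> pI Y" for i j using tgt.gf_in[OF that] forms0_subset by blast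
  let ?P = "\<lambda>l :: form \<Rightarrow> rat. \<forall>i\<in>pI X. \<forall>k\<in>pI Y. pd Y k < pd X i \<longrightarrow>
     (\<Sum>j\<in>{j\<in>pI Y. pd Y j = pd X i}. mat f i j * l (tgt.gf j k)) = (\<Sum>j\<in>{j\<in>pI X. pd X j = pd Y k}. l (src.gf i j) * mat f j k)"
  have P_iff: "?P l \<longleftrightarrow> (\<forall>i\<in>pI X. \<forall>k\<in>pI Y. pd Y k < pd X i \<longrightarrow>
    l (\<Sum>j\<in>{j\<in>pI X. pd X j = pd Y k}. form_scale (of_rat (mat f j k)) (src.gf i j))
    = l (\<Sum>j\<in>{j\<in>pI Y. pd Y j = pd X i}. form_scale (of_rat (mat f i j)) (tgt.gf j k)))" if "qlin U l" for l :: "form \<Rightarrow> rat"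
    by (intro ball_cong refl imp_cong) (subst (1 2) qlin_sum[OF that]; auto simp: gU hU of_rat_eq_id mult.commute)
  show ?thesis
  proof
    assume "f \<in> comodule_hom (H0_hopf U) src.A tgt.A"
    then have h: "tgt.act ls n (f n v) = f (n - int (length ls)) (src.act ls n v)" and o: "\<forall>n v. v \<notin> cm_space src.A n \<longrightarrow> f n v = 0"
      if "v \<in> cm_space src.A n" "adm U ls" for n v ls
      using that unfolding comodule_hom_iff by blast+
    have o: "\<forall>n v. v \<notin> cm_space src.A n \<longrightarrow> f n v = 0"
      using \<open>f \<in> comodule_hom (H0_hopf U) src.A tgt.A\<close> unfolding comodule_hom_iff by blast
    have P: "?P l" if l: "qlin U l" "l (tform U) = 0" for l :: "form \<Rightarrow> rat"
    proof (intro ballI impI)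
      fix i k assume ik: "i \<in> pI X" "k \<in> pI Y" "pd Y k < pd X i"
      define m where "m = nat (pd X i - pd Y k) - 1"
      have m: "pd X i - pd Y k = int (Suc m)" using ik by (simp add: m_def)
      have ad: "adm U (l # replicate m src.E)" using l src.E_qlin by (auto simp: adm_def)
      have v: "single i 1 \<in> cm_space src.A (pd X i)" using ik by (auto intro: single_in_supp)
      show "(\<Sum>j\<in>{j\<in>pI Y. pd Y j = pd X i}. mat f i j * l (tgt.gf j k)) = (\<Sum>j\<in>{j\<in>pI X. pd X j = pd Y k}. l (src.gf i j) * mat f j k)"
        using lookup_basic_left[OF f ik(1,2), of l m] lookup_basic_right[OF f ik(1,2), of m l] h[OF v ad] m by simp
    qed
    show "graded_linear f \<and> (\<forall>n v. v \<notin> cm_space src.A n \<longrightarrow> f n v = 0) \<and> intertwines (mat f)"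
      unfolding intertwines_iff_letters[OF f]
    proof (intro conjI f o ballI impI)
      fix i k assume ik: "i \<in> pI X" "k \<in> pI Y" "pd Y k < pd X i"
      let ?L = "\<Sum>j\<in>{j\<in>pI X. pd X j = pd Y k}. form_scale (of_rat (mat f j k)) (src.gf i j)"
      let ?R = "\<Sum>j\<in>{j\<in>pI Y. pd Y j = pd X i}. form_scale (of_rat (mat f i j)) (tgt.gf j k)"
      have "src.E (src.gf i j) = 0" if "j \<in> {j\<in>pI X. pd X j = pd Y k}" for j
        by (rule src.E_gf) (use that ik in auto)
      then have "src.E ?L = 0" by (subst qlin_sum[OF src.E_qlin]) (use ik gU in auto)
      moreover have "src.E (tgt.gf j k) = 0" if "j \<in> {j\<in>pI Y. pd Y j = pd X i}" for j
        by (rule tgt.E_gf) (use that ik in auto)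
      then have "src.E ?R = 0" by (subst qlin_sum[OF src.E_qlin]) (use ik hU in auto)
      ultimately have "fst ?L = fst ?R"
        by (intro src.eq_if_functionals_eq) (use P P_iff ik in auto)
      moreover have "snd ?L = snd ?R" unfolding snd_sum fun_eq_iff sum_fun_apply by (simp add: form_scale_def src.gf_def tgt.gf_def)
      ultimately show "?L = ?R" by (rule prod_eqI)
    qed
  next
    assume a: "graded_linear f \<and> (\<forall>n v. v \<notin> cm_space src.A n \<longrightarrow> f n v = 0) \<and> intertwines (mat f)"
    have P: "?P l" if "qlin U l" for l :: "form \<Rightarrow> rat"
      unfolding P_iff[OF that] using a intertwines_iff_letters[OF f] by simp
    show "f \<in> comodule_hom (H0_hopf U) src.A tgt.A"
      unfolding comodule_hom_iff
    proof (intro conjI allI ballI impI)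
      show "graded_linear f" by (rule f)
      fix n v show "v \<notin> cm_space src.A n \<Longrightarrow> f n v = 0" using a by blast
    next
      fix n v and ls :: "(form \<Rightarrow> rat) list" assume v: "v \<in> cm_space src.A n" and ls: "adm U ls"
      show "tgt.act ls n (f n v) = f (n - int (length ls)) (src.act ls n v)"
      proof (rule intertwines_if_intertwines_basic[OF f src.E_qlin src.E_t _ v ls])
        fix l :: "form \<Rightarrow> rat" and m n v assume l: "qlin U l" "l (tform U) = 0" and v: "v \<in> cm_space src.A n"
        let ?ls = "l # replicate m src.E"
        have ad: "adm U ?ls" using l src.E_qlin by (auto simp: adm_def)
        have q: "qlinear (supp_in {i\<in>pI X. pd X i = n}) (cm_space tgt.A n) (f n)" for n using f unfolding graded_linear_def by simp
        have one: "tgt.act ?ls n (f n (single i 1)) = f (n - int (Suc m)) (src.act ?ls n (single i 1))"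
          if i: "i \<in> pI X" "pd X i = n" for i
        proof (rule poly_mapping_eqI)
          fix k
          have si: "single i 1 \<in> cm_space src.A n" using i by (auto intro: single_in_supp)
          have 1: "f n (single i 1) \<in> cm_space tgt.A n" using q si unfolding qlinear_def src.A_simps by blast
          have 2: "src.act ?ls n (single i 1) \<in> cm_space src.A (n - int (Suc m))"
            using src.act_in[OF si, of ?ls] by simp
          have 3: "f (n - int (Suc m)) (src.act ?ls n (single i 1)) \<in> cm_space tgt.A (n - int (Suc m))"
            using q[of "n - int (Suc m)"] 2 unfolding qlinear_def src.A_simps by blast
          have 4: "tgt.act ?ls n (f n (single i 1)) \<in> cm_space tgt.A (n - int (Suc m))"
            using tgt.act_in[OF 1, of ?ls] by simp
          show "lookup (tgt.act ?ls n (f n (single i 1))) k = lookup (f (n - int (Suc m)) (src.act ?ls n (single i 1))) k"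
          proof (cases "k \<in> pI Y")
            case True
            have "pd Y k < pd X i" if "pd X i - pd Y k = int (Suc m)" using that by simp
            then have "(if pd X i - pd Y k = int (Suc m) then \<Sum>j\<in>{j\<in>pI Y. pd Y j = pd X i}. mat f i j * l (tgt.gf j k) else 0)
               = (if pd X i - pd Y k = int (Suc m) then \<Sum>j\<in>{j\<in>pI X. pd X j = pd Y k}. l (src.gf i j) * mat f j k else 0)"
              using P[OF l(1)] i(1) True by presburger
            then show ?thesis
              using lookup_basic_left[OF f i(1) True, of l m] lookup_basic_right[OF f i(1) True, of m l] i(2) by simp
          next
            case False
            then have "k \<notin> keys (tgt.act ?ls n (f n (single i 1)))"
              "k \<notin> keys (f (n - int (Suc m)) (src.act ?ls n (single i 1)))"
              using 3 4 unfolding tgt.A_simps supp_in_def by blast+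
            then show ?thesis by (simp add: Poly_Mapping.in_keys_iff)
          qed
        qed
        have l1: "qlinear (supp_in {i\<in>pI X. pd X i = n}) UNIV (\<lambda>v. tgt.act ?ls n (f n v))"
          using q[of n] tgt.act_add[OF ad] tgt.act_scl[OF ad] unfolding qlinear_def by (auto simp: image_subset_iff)
        have l2: "qlinear (supp_in {i\<in>pI X. pd X i = n}) UNIV (\<lambda>v. f (n - int (Suc m)) (src.act ?ls n v))"
        proof -
          have "src.act ?ls n v \<in> supp_in {i\<in>pI X. pd X i = n - int (Suc m)}" if "v \<in> supp_in {i\<in>pI X. pd X i = n}" for v
            using src.act_in[of v n ?ls] that by simp
          then show ?thesis using q[of "n - int (Suc m)"] src.act_add[OF ad] src.act_scl[OF ad] unfolding qlinear_def by (auto simp: image_subset_iff)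
        qed
        have v': "v \<in> supp_in {i\<in>pI X. pd X i = n}" using v by simp
        have "tgt.act ?ls n (f n v) = linext (\<lambda>i. tgt.act ?ls n (f n (single i 1))) v"
          by (rule qlinear_linext[OF l1 v'])
        also have "\<dots> = linext (\<lambda>i. f (n - int (Suc m)) (src.act ?ls n (single i 1))) v"
          by (rule linext_cong, rule one) (use v' in \<open>auto simp: supp_in_def\<close>)
        also have "\<dots> = f (n - int (Suc m)) (src.act ?ls n v)"
          by (rule qlinear_linext[OF l2 v', symmetric])
        finally show "tgt.act ?ls n (f n v) = f (n - int (Suc m)) (src.act ?ls n v)" .
      qed
    qed
  qed
qed

end

section \<open>The period matrix of a comodule\<close>

locale comod_gauge = gauge U e + comod U M for U e M
begin

text \<open>One numbering for the bases of all degrees. The spaces \<open>V n\<close> lie in the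
  same free space and need not be independent of one another there, so the functionals
  \<open>c\<close> are dual to \<open>b\<close> only within one degree.\<close>

lemma basis_exists:
  obtains N :: nat and d :: "nat \<Rightarrow> int" and b :: "nat \<Rightarrow> qvec" and c :: "nat \<Rightarrow> nat \<Rightarrow> rat"
  where "\<And>i. i < N \<Longrightarrow> b i \<in> V (d i)"
    and "\<And>n. V n = pm.span (b ` {i. i < N \<and> d i = n})"
    and "\<And>i j. i < N \<Longrightarrow> j < N \<Longrightarrow> d i = d j \<Longrightarrow> wsum (c i) (b j) = (if i = j then 1 else 0)"
proof -
  have "\<forall>n. \<exists>B. finite B \<and> pm.independent B \<and> V n = pm.span B" by (metis findim_basis findim_V)
  then obtain B where B: "finite (B n)" "pm.independent (B n)" "V n = pm.span (B n)" for n by metis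
  have "\<forall>n. \<exists>c :: qvec \<Rightarrow> nat \<Rightarrow> rat. \<forall>b\<in>B n. \<forall>b'\<in>B n. wsum (c b) b' = (if b = b' then 1 else 0)"
    by (metis dual_functionals B(2))
  then obtain D :: "int \<Rightarrow> qvec \<Rightarrow> nat \<Rightarrow> rat"
    where D: "b \<in> B n \<Longrightarrow> b' \<in> B n \<Longrightarrow> wsum (D n b) b' = (if b = b' then 1 else 0)" for n b b' by metis
  let ?S = "Sigma {n. V n \<noteq> {0}} B"
  have "finite ?S" using finite_V B(1) by blast
  then obtain N h where h: "bij_betw h {..<N::nat} ?S" using ex_bij_betw_nat_finite[of ?S] by (auto simp: atLeast0LessThan)
  have hin: "h i \<in> ?S" if "i < N" for i using h that by (auto simp: bij_betw_def)
  let ?d = "\<lambda>i. fst (h i)" and ?b = "\<lambda>i. snd (h i)"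
  have hB: "?b i \<in> B (?d i)" "V (?d i) \<noteq> {0}" if "i < N" for i using hin[OF that] by (cases "h i"; simp)+
  show ?thesis
  proof
    show "?b i \<in> V (?d i)" if "i < N" for i unfolding B(3) by (rule pm.span_base[OF hB(1)[OF that]])
    show "V n = pm.span (?b ` {i. i < N \<and> ?d i = n})" for n
    proof (cases "V n = {0}")
      case True
      then have e: "{i. i < N \<and> ?d i = n} = {}" using hB(2) by force
      show ?thesis unfolding e True by (simp add: pm.span_empty)
    next
      case False
      have "?b ` {i. i < N \<and> ?d i = n} = B n"
      proof
        show "?b ` {i. i < N \<and> ?d i = n} \<subseteq> B n" using hB(1) by blast
        show "B n \<subseteq> ?b ` {i. i < N \<and> ?d i = n}"
        proof
          fix x assume "x \<in> B n"
          then have "(n, x) \<in> h ` {..<N}" using False h by (simp add: bij_betw_def)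
          then obtain i where "i < N" "h i = (n, x)" by auto
          then show "x \<in> ?b ` {i. i < N \<and> ?d i = n}" by (auto intro!: rev_image_eqI[of i])
        qed
      qed
      then show ?thesis using B(3) by simp
    qed
    show "wsum (D (?d i) (?b i)) (?b j) = (if i = j then 1 else 0)" if ij: "i < N" "j < N" "?d i = ?d j" for i j
    proof -
      have "?b i = ?b j \<longleftrightarrow> i = j" using h ij by (auto simp: bij_betw_def inj_on_def prod_eq_iff)
      moreover have "?b i \<in> B (?d i)" "?b j \<in> B (?d i)" using hB(1)[OF ij(1)] hB(1)[OF ij(2)] ij(3) by simp_all
      ultimately show ?thesis using D by simp
    qed
  qed
qed

end

locale comod_basis = comod_gauge +
  fixes N :: nat and d :: "nat \<Rightarrow> int" and b :: "nat \<Rightarrow> qvec" and c :: "nat \<Rightarrow> nat \<Rightarrow> rat"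
  assumes b_in: "i < N \<Longrightarrow> b i \<in> V (d i)"
    and V_span: "V n = pm.span (b ` {i. i < N \<and> d i = n})"
    and dual: "i < N \<Longrightarrow> j < N \<Longrightarrow> d i = d j \<Longrightarrow> wsum (c i) (b j) = (if i = j then 1 else 0)"
begin

text \<open>The coefficient of \<open>b j\<close> in the coaction of \<open>b i\<close>. Only words
  of length \<open>d i - d j\<close> are kept because \<open>c j\<close> is a coordinate on degree
  \<open>d j\<close> alone, while all summands of the coaction share one free space.\<close>

definition a :: "nat \<Rightarrow> nat \<Rightarrow> (fword \<Rightarrow>\<^sub>0 rat)" where
  "a i j = linext (\<lambda>(w, m). if int (length w) = d i - d j then scl (c j m) (single w 1) else 0) (\<rho> (d i) (b i))"

lemma expand: "v \<in> V n \<Longrightarrow> v = (\<Sum>i\<in>{i. i < N \<and> d i = n}. scl (wsum (c i) v) (b i))"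
proof -
  assume v: "v \<in> V n"
  let ?J = "{i. i < N \<and> d i = n}"
  have inj: "inj_on b ?J"
  proof (rule inj_onI)
    fix i j assume "i \<in> ?J" "j \<in> ?J" "b i = b j"
    then show "i = j" using dual[of i i] dual[of i j] by (auto split: if_splits)
  qed
  let ?c = "\<lambda>x. c (the_inv_into ?J b x)"
  have inv: "the_inv_into ?J b (b i) = i" if "i \<in> ?J" for i using the_inv_into_f_f[OF inj that] .
  have "v = (\<Sum>x\<in>b ` ?J. scl (wsum (?c x) v) x)"
  proof (rule dual_functionals_expansion)
    fix x y assume xy: "x \<in> b ` ?J" "y \<in> b ` ?J"
    obtain i where i: "i \<in> ?J" "x = b i" using xy by blast
    obtain j where j: "j \<in> ?J" "y = b j" using xy by blast
    show "wsum (?c x) y = (if x = y then 1 else 0)"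
      using dual[of i j] inv[OF i(1)] inj_onD[OF inj _ i(1) j(1)] i j by auto
  qed (use v V_span in auto)
  also have "\<dots> = (\<Sum>i\<in>?J. scl (wsum (c i) v) (b i))"
    using inv by (simp add: sum.reindex[OF inj])
  finally show ?thesis .
qed

lemma a_part: "i < N \<Longrightarrow> d j \<le> d i \<Longrightarrow> a i j \<in> gh_part (H0_hopf U) (nat (d i - d j))"
proof -
  assume i: "i < N" and ji: "d j \<le> d i"
  let ?k = "nat (d i - d j)"
  have sub: "x + y \<in> gh_part (H0_hopf U) ?k" "scl q x \<in> gh_part (H0_hopf U) ?k" "0 \<in> gh_part (H0_hopf U) ?k"
    if "x \<in> gh_part (H0_hopf U) ?k" "y \<in> gh_part (H0_hopf U) ?k" for x y q
  proof -
    have w: "x + y \<in> words0 U" "scl q x \<in> words0 U" "0 \<in> words0 U"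
    proof -
      have "pm.subspace (words0 U)" by (simp add: words0_def)
      then show "x + y \<in> words0 U" "scl q x \<in> words0 U" "0 \<in> words0 U"
        using that by (simp_all add: gh_part_def pm.subspace_add pm.subspace_scale pm.subspace_0)
    qed
    show "x + y \<in> gh_part (H0_hopf U) ?k"
      using that w Poly_Mapping.keys_add[of x y] by (auto simp: gh_part_def linext_add intro: pm.span_add)
    show "scl q x \<in> gh_part (H0_hopf U) ?k"
      using that w by (auto simp: gh_part_def linext_scl Poly_Mapping.in_keys_iff intro: pm.span_scale)
    show "0 \<in> gh_part (H0_hopf U) ?k" using w by (simp add: gh_part_def pm.span_zero)
  qed
  have z: "0 \<in> gh_part (H0_hopf U) ?k" by (simp add: gh_part_def pm.span_zero words0_def)
  show ?thesis
    unfolding a_def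
  proof (induction rule: coact_induct[OF b_in[OF i]])
    case 1 then show ?case using z by simp
  next
    case (2 q x k v' p)
    have "linext (\<lambda>(w, m). if int (length w) = d i - d j then scl (c j m) (single w 1) else 0) (tens x v')
        = (if int k = d i - d j then scl (wsum (c j) v') x else 0)"
    proof -
      have "linext (\<lambda>(w, m). if int (length w) = d i - d j then scl (c j m) (single w 1) else 0) (tens x v')
        = linext (\<lambda>w. scl (if int k = d i - d j then wsum (c j) v' else 0) (single w 1)) x"
        unfolding linext_tens
      proof (rule linext_cong)
        fix w assume "w \<in> keys x"
        then have "length w = k" using 2(1) by (auto simp: gh_part_def)
        then show "linext (\<lambda>m. case (w, m) of (w, m) \<Rightarrow> if int (length w) = d i - d j then scl (c j m) (single w 1) else 0) v'
           = scl (if int k = d i - d j then wsum (c j) v' else 0) (single w 1)"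
          by (cases "int k = d i - d j")
            (simp_all add: linext_def wsum_def of_rat_eq_id pm.scale_sum_left pm.scale_zero_left del: scl_single)
      qed
      also have "\<dots> = (if int k = d i - d j then scl (wsum (c j) v') x else 0)"
        unfolding linext_fun_scl linext_id by (simp add: pm.scale_zero_left)
      finally show ?thesis .
    qed
    moreover have "k = ?k" if "int k = d i - d j" using that by linarith
    ultimately have "linext (\<lambda>(w, m). if int (length w) = d i - d j then scl (c j m) (single w 1) else 0) (tens x v') \<in> gh_part (H0_hopf U) ?k"
      using 2(1) z sub(2) by auto
    then show ?case unfolding linext_add linext_scl using 2(3) sub by blast
  qed
qed

lemma lev_a: "int (length ls) = d i - d j \<Longrightarrow> lev ls (a i j) = pairing1 ls (c j) (\<rho> (d i) (b i))"
  unfolding a_def lev_def wsum_linext pairing1_def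
  by (rule wsum_cong) (auto simp: wev_length)

lemma coassoc_a:
  assumes "i < N" "j < N" "adm U ls" "adm U ms" "int (length ls + length ms) = d i - d j"
  shows "lev (ls @ ms) (a i j) = (\<Sum>l\<in>{l. l < N \<and> d l = d i - int (length ls)}. lev ls (a i l) * lev ms (a l j))"
proof -
  let ?m = "d i - int (length ls)"
  let ?J = "{l. l < N \<and> d l = ?m}"
  have inj: "inj_on b ?J"
  proof (rule inj_onI)
    fix i j assume "i \<in> ?J" "j \<in> ?J" "b i = b j"
    then show "i = j" using dual[of i i] dual[of i j] by (auto split: if_splits)
  qed
  let ?c = "\<lambda>x. c (the_inv_into ?J b x)"
  have inv: "the_inv_into ?J b (b i) = i" if "i \<in> ?J" for i using the_inv_into_f_f[OF inj that] .
  have "pairing1 (ls @ ms) (c j) (\<rho> (d i) (b i)) = (\<Sum>x\<in>b ` ?J. pairing1 ls (?c x) (\<rho> (d i) (b i)) * pairing1 ms (c j) (\<rho> ?m x))"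
  proof (rule coassoc[OF b_in[OF assms(1)] assms(3,4)])
    fix x y assume xy: "x \<in> b ` ?J" "y \<in> b ` ?J"
    obtain i where i: "i \<in> ?J" "x = b i" using xy by blast
    obtain j where j: "j \<in> ?J" "y = b j" using xy by blast
    show "wsum (?c x) y = (if x = y then 1 else 0)"
      using dual[of i j] inv[OF i(1)] inj_onD[OF inj _ i(1) j(1)] i j by auto
  qed (use V_span in auto)
  also have "\<dots> = (\<Sum>l\<in>?J. pairing1 ls (c l) (\<rho> (d i) (b i)) * pairing1 ms (c j) (\<rho> ?m (b l)))"
    using inv by (simp add: sum.reindex[OF inj])
  also have "\<dots> = (\<Sum>l\<in>?J. lev ls (a i l) * lev ms (a l j))"
    by (rule sum.cong[OF refl]) (use assms(5) in \<open>simp add: lev_a\<close>)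
  finally show ?thesis using lev_a[of "ls @ ms" i j] assms(5) by simp
qed

text \<open>The identity on the first tensor factor and \<open>E\<close> on the others: the first
  letter is replaced by its representative modulo \<open>\<rat>(1)\<close> on which \<open>e\<close>
  vanishes, every further letter by a rational number.\<close>

definition gw :: "fword \<Rightarrow> complex \<Rightarrow> complex" where
  "gw w = (case w of [] \<Rightarrow> 0 | x # xs \<Rightarrow> qsc (prod_list (map E xs)) (fst x - qsc (E x) (fst (tform U))))"

definition gfun :: "(fword \<Rightarrow>\<^sub>0 rat) \<Rightarrow> complex \<Rightarrow> complex" where
  "gfun p = (\<Sum>w\<in>keys p. qsc (lookup p w) (gw w))"

lemma wev_replicate: "wev (replicate (length xs) (\<lambda>x. of_rat (E x) :: 'k::field_char_0)) xs = of_rat (prod_list (map E xs))"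
  by (induction xs) (auto simp: of_rat_mult)

lemma gw_holo: "w \<in> lists (forms0 U) \<Longrightarrow> gw w \<in> holo_funs U"
  using tform_in[of U] subspace_holo_funs[of U]
  by (cases w) (auto simp: gw_def forms0_def intro!: qf.subspace_scale qf.subspace_diff dest: qf.subspace_0)

lemma gfun_holo: "p \<in> words0 U \<Longrightarrow> gfun p \<in> holo_funs U"
  unfolding gfun_def words0_iff
  by (intro qf.subspace_sum qf.subspace_scale subspace_holo_funs gw_holo) blast

lemma e_gw: "e (gw w) = 0"
proof (cases w)
  case Nil then show ?thesis by (simp add: gw_def)
next
  case (Cons x xs)
  have "e (fst x - qsc (E x) (fst (tform U))) + e (qsc (E x) (fst (tform U))) = e (fst x)" unfolding e_add[symmetric] by simp
  then show ?thesis by (simp add: Cons gw_def e_scl e_t E_def)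
qed

lemma e_gfun: "e (gfun p) = 0"
  unfolding gfun_def e_sum e_scl e_gw by simp

text \<open>A functional that is linear on functions and kills \<open>2\<pi>i\<close> is evaluated on \<open>gfun p\<close> by
  using it on the first letters and \<open>e\<close> on the others.\<close>

lemma functional_gfun:
  fixes l :: "form \<Rightarrow> 'k::field_char_0"
  assumes l: "qlin U l" "l (tform U) = 0" and p: "p \<in> words0 U" "\<And>w. w \<in> keys p \<Longrightarrow> length w = Suc m"
  shows "l (gfun p, 0) = lev (l # replicate m (\<lambda>x. of_rat (E x))) p"
proof -
  let ?K = "keys p"
  have wU: "w \<in> lists (forms0 U)" if "w \<in> ?K" for w using p(1) that by (auto simp: words0_iff)
  have gU: "(gw w, 0) \<in> forms U" if "w \<in> ?K" for w
    using gw_holo[OF wU[OF that]] forms0_subset[of U] by (auto simp: forms0_def)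
  have tU: "tform U \<in> forms U" using tform_in forms0_subset by blast
  have "(gfun p, 0) = (\<Sum>w\<in>?K. form_scale (of_rat (lookup p w)) (gw w, 0))"
  proof (rule prod_eqI)
    show "snd (gfun p, 0) = snd (\<Sum>w\<in>?K. form_scale (of_rat (lookup p w)) (gw w, 0))"
      unfolding snd_sum fun_eq_iff sum_fun_apply by (simp add: form_scale_def)
  qed (simp add: fst_sum gfun_def qsc_def form_scale_def)
  then have "l (gfun p, 0) = (\<Sum>w\<in>?K. of_rat (lookup p w) * l (gw w, 0))"
    using qlin_sum[OF l(1), of ?K "\<lambda>w. (gw w, 0)" "lookup p"] gU by simp
  also have "\<dots> = (\<Sum>w\<in>?K. of_rat (lookup p w) * wev (l # replicate m (\<lambda>x. of_rat (E x))) w)"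
  proof (rule sum.cong[OF refl], rule arg_cong[of _ _ "(*) _"])
    fix w assume w: "w \<in> ?K"
    then obtain x xs where c: "w = x # xs" "length xs = m" using p(2)[OF w] by (cases w) auto
    have x: "x \<in> forms0 U" using wU[OF w] c by simp
    then have xU: "x \<in> forms U" using forms0_subset by blast
    let ?r = "prod_list (map E xs)"
    let ?y = "x + form_scale (of_rat (- E x)) (tform U)"
    have yU: "?y \<in> forms U" using xU tU by (intro forms_add forms_scale)
    have "(gw w, 0) = form_scale (of_rat ?r) ?y"
    proof (rule prod_eqI)
      show "fst (gw w, 0) = fst (form_scale (of_rat ?r) ?y)"
        by (simp add: c gw_def qsc_def form_scale_def fun_eq_iff of_rat_minus)
      show "snd (gw w, 0) = snd (form_scale (of_rat ?r) ?y)"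
        using x by (auto simp: form_scale_def forms0_def fun_eq_iff tform_def const_form_def)
    qed
    then have "l (gw w, 0) = of_rat ?r * (l x + of_rat (- E x) * l (tform U))"
      using l(1) xU tU yU forms_scale unfolding qlin_def by simp
    then show "l (gw w, 0) = wev (l # replicate m (\<lambda>x. of_rat (E x))) w"
      using wev_replicate[of xs, where 'k='k] c l(2) by (simp add: mult.commute)
  qed
  finally show ?thesis by (simp add: lev_def wsum_def)
qed

end

section \<open>The differential equation of the period matrix of a comodule\<close>

lemma lev_cons_lin: "lev (l # ls) (cons_lin y q) = l y * lev ls q"
  unfolding lev_def cons_lin_def wsum_linext by (simp add: wsum_fun_mult)

lemma lev_combination: "lev (a @ (\<lambda>x. c * g x + k x) # b) p = c * lev (a @ g # b) p + lev (a @ k # b) p"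
  unfolding lev_def wev_combination by (simp add: wsum_fun_add wsum_fun_mult)

lemma deriv_qlin:
  assumes "open U" "z \<in> U" shows "qlin U (\<lambda>x. deriv (fst x) z)"
proof -
  have df: "fst x field_differentiable at z" if "x \<in> forms U" for x
    using that assms by (auto simp: forms_def holo_funs_def intro: holomorphic_on_imp_differentiable_at)
  show ?thesis
    unfolding qlin_def
  proof (intro conjI ballI allI)
    fix x y assume "x \<in> forms U" "y \<in> forms U"
    then show "deriv (fst (x + y)) z = deriv (fst x) z + deriv (fst y) z"
      using deriv_add[OF df df, of x y] by (simp add: plus_fun_def)
  next
    fix q x assume "x \<in> forms U"
    then show "deriv (fst (form_scale (of_rat q) x)) z = of_rat q * deriv (fst x) z"
      using deriv_cmult[OF df, of x "of_rat q"] by (simp add: form_scale_def)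
  qed
qed

context comod_basis begin

abbreviation "EC \<equiv> \<lambda>x. of_rat (E x) :: complex"

lemma EC_qlin: "qlin U EC" using E_qlin by (simp add: qlin_def of_rat_add of_rat_mult)

lemma a_keys: "i < N \<Longrightarrow> d j \<le> d i \<Longrightarrow> w \<in> keys (a i j) \<Longrightarrow> w \<in> lists (forms0 U) \<and> int (length w) = d i - d j"
  using a_part[of i j] by (auto simp: gh_part_def words0_iff)

lemma a_words0: "i < N \<Longrightarrow> d j \<le> d i \<Longrightarrow> a i j \<in> words0 U"
  using a_part[of i j] by (simp add: gh_part_def)

text \<open>Evaluation at \<open>z\<close>, corrected by a multiple of \<open>E\<close> so that it
  may stand first in a list. On \<open>gfun\<close>, where \<open>e\<close> vanishes, it is
  evaluation itself.\<close>

definition \<kappa> :: "complex \<Rightarrow> form \<Rightarrow> complex" where "\<kappa> z x = fst x z - 2 * pi * \<i> * EC x"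

lemma \<kappa>_qlin: "qlin U (\<kappa> z)"
  using EC_qlin unfolding qlin_def \<kappa>_def by (simp add: form_scale_def algebra_simps)

lemma \<kappa>_t: "z \<in> U \<Longrightarrow> \<kappa> z (tform U) = 0" by (simp only: \<kappa>_def E_t) (simp add: tform_def const_form_def)

lemma deriv_t: "z \<in> U \<Longrightarrow> deriv (fst (tform U)) z = 0"
  using arg_cong[OF form_d_t, of "\<lambda>x. snd x z"] by (simp add: form_d_def)

lemma gfun_lev:
  assumes "i < N" "d i - d j = int (Suc m)" "z \<in> U"
  shows "gfun (a i j) z = lev (\<kappa> z # replicate m EC) (a i j)"
    and "deriv (gfun (a i j)) z = lev ((\<lambda>x. deriv (fst x) z) # replicate m EC) (a i j)"
proof -
  have w: "a i j \<in> words0 U" "\<And>w. w \<in> keys (a i j) \<Longrightarrow> length w = Suc m"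
    using a_words0[of i j] a_keys[of i j] assms by force+
  have "\<kappa> z (gfun (a i j), 0) = lev (\<kappa> z # replicate m EC) (a i j)"
    by (rule functional_gfun[OF \<kappa>_qlin \<kappa>_t[OF assms(3)] w])
  then show "gfun (a i j) z = lev (\<kappa> z # replicate m EC) (a i j)" by (simp add: \<kappa>_def E_def e_gfun)
  show "deriv (gfun (a i j)) z = lev ((\<lambda>x. deriv (fst x) z) # replicate m EC) (a i j)"
    using functional_gfun[OF deriv_qlin[OF U_open assms(3)] deriv_t[OF assms(3)] w] by simp
qed

text \<open>The condition \<open>D = 0\<close>, read off with the coefficient of \<open>dz\<close> at \<open>z\<close> as first functional.\<close>

lemma lev_closed:
  assumes "i < N" "d i - d j = int (Suc (Suc m))" "z \<in> U"
  shows "lev ((\<lambda>x. deriv (fst x) z) # (\<lambda>x. fst x z) # replicate m EC) (a i j) = 0"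
proof -
  let ?\<delta> = "\<lambda>x :: form. snd x z"
  have "qlin U ?\<delta>" by (simp add: qlin_def form_scale_def)
  then have ad: "adm U (?\<delta> # replicate m EC)" using EC_qlin by (auto simp: adm_def tform_def const_form_def)
  have "linext (diff_word U) (a i j) \<in> pm.span (tensor_rels U)" using a_part[of i j] assms by (simp add: gh_part_def)
  from lev_tensor_rels[OF ad this] have "wsum (\<lambda>w. lev (?\<delta> # replicate m EC) (diff_word U w)) (a i j) = 0"
    by (simp add: lev_def wsum_linext)
  also have "wsum (\<lambda>w. lev (?\<delta> # replicate m EC) (diff_word U w)) (a i j) = wsum (wev ((\<lambda>x. deriv (fst x) z) # (\<lambda>x. fst x z) # replicate m EC)) (a i j)"
  proof (rule wsum_cong)
    fix w assume w: "w \<in> keys (a i j)"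
    have wl: "w \<in> lists (forms0 U)" "length w = Suc (Suc m)" using a_keys[OF assms(1) _ w] assms(2) by force+
    then obtain x y r where c: "w = x # y # r" by (metis Suc_length_conv)
    have x: "snd x = 0" "snd y = 0" using wl c by (auto simp: forms0_def)
    have "lev (?\<delta> # replicate m EC) (cons_lin (form_sign x) (diff_word U (y # r))) = 0"
      unfolding lev_cons_lin by (simp add: form_sign_def x)
    moreover have "snd (form_mult (form_d U x) y) z = deriv (fst x) z * fst y z"
      using assms(3) by (simp add: form_mult_def form_d_def)
    ultimately show "lev (?\<delta> # replicate m EC) (diff_word U w) = wev ((\<lambda>x. deriv (fst x) z) # (\<lambda>x. fst x z) # replicate m EC) w"
      unfolding c by (simp add: lev_def wsum_add)
  qed
  finally show ?thesis by (simp add: lev_def)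
qed

text \<open>The second functional in \<open>lev_closed\<close> is evaluation, which equals
  \<open>2\<pi>i E + \<kappa> z\<close>. The part with \<open>E\<close> gives the derivative of
  \<open>gfun\<close>. Since \<open>\<kappa> z\<close> kills \<open>2\<pi>i\<close>, coassociativity
  splits the other part after the first entry and produces the sum over \<open>l\<close>.\<close>

lemma gfun_ode:
  assumes "i < N" "j < N" "d i - d j = int (Suc (Suc m))" "z \<in> U"
  shows "2 * pi * \<i> * deriv (gfun (a i j)) z + (\<Sum>l\<in>{l. l < N \<and> d l = d i - 1}. deriv (gfun (a i l)) z * gfun (a l j) z) = 0"
proof -
  let ?D = "\<lambda>x :: form. deriv (fst x) z"
  have ev: "(\<lambda>x :: form. fst x z) = (\<lambda>x. 2 * pi * \<i> * EC x + \<kappa> z x)" by (simp add: \<kappa>_def)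
  have "0 = lev ([?D] @ (\<lambda>x. 2 * pi * \<i> * EC x + \<kappa> z x) # replicate m EC) (a i j)"
    using lev_closed[OF assms(1,3,4)] unfolding ev by simp
  also have "\<dots> = 2 * pi * \<i> * lev ([?D] @ EC # replicate m EC) (a i j) + lev ([?D] @ \<kappa> z # replicate m EC) (a i j)"
    by (rule lev_combination)
  also have "lev ([?D] @ EC # replicate m EC) (a i j) = deriv (gfun (a i j)) z"
    using gfun_lev(2)[OF assms(1,3,4)] by simp
  also have "lev ([?D] @ \<kappa> z # replicate m EC) (a i j) = (\<Sum>l\<in>{l. l < N \<and> d l = d i - int (length [?D])}. lev [?D] (a i l) * lev (\<kappa> z # replicate m EC) (a l j))"
    by (rule coassoc_a[OF assms(1,2)])
       (use assms deriv_qlin[OF U_open assms(4)] deriv_t \<kappa>_qlin \<kappa>_t EC_qlin in \<open>auto simp: adm_def\<close>)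
  also have "\<dots> = (\<Sum>l\<in>{l. l < N \<and> d l = d i - 1}. deriv (gfun (a i l)) z * gfun (a l j) z)"
  proof (rule sum.cong)
    fix l assume l: "l \<in> {l. l < N \<and> d l = d i - 1}"
    have "d i - d l = int (Suc 0)" "d l - d j = int (Suc m)" "l < N" using l assms by auto
    then show "lev [?D] (a i l) * lev (\<kappa> z # replicate m EC) (a l j) = deriv (gfun (a i l)) z * gfun (a l j) z"
      using gfun_lev(2)[OF assms(1), of l 0 z] gfun_lev(1)[of l j m z] assms(4) by simp
  qed simp
  finally show ?thesis by simp
qed

definition S :: "nat \<Rightarrow> nat \<Rightarrow> complex \<Rightarrow> complex" where
  "S i j = (if i = j then (\<lambda>z. if z \<in> U then 1 else 0)
     else if d j < d i then (\<lambda>z. - (1 / (2 * pi * \<i>)) * gfun (a i j) z) else 0)"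

definition X :: period_data where "X = \<lparr> pI = {..<N}, pd = d, pS = S \<rparr>"

lemma X_simps [simp]: "pI X = {..<N}" "pd X = d" "pS X = S" by (simp_all add: X_def)

lemma deriv_S_low: "i < N \<Longrightarrow> d j < d i \<Longrightarrow> z \<in> U \<Longrightarrow> deriv (S i j) z = - (1 / (2 * pi * \<i>)) * deriv (gfun (a i j)) z"
proof -
  assume h: "i < N" "d j < d i" "z \<in> U"
  have "gfun (a i j) field_differentiable at z"
    using gfun_holo[OF a_words0[of i j]] h U_open by (auto simp: holo_funs_def intro: holomorphic_on_imp_differentiable_at)
  from deriv_cmult[OF this, of "- (1 / (2 * pi * \<i>))"] show ?thesis using h by (auto simp: S_def)
qed

lemma period_X: "period U e X"
proof
  fix i j assume "i \<in> pI X" "j \<in> pI X"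
  then have ij: "i < N" "j < N" by auto
  have one: "(\<lambda>z. if z \<in> U then 1 else 0) \<in> holo_funs U"
    using const_form_in[of U 1] by (simp add: const_form_def forms0_def)
  show "pS X i j \<in> holo_funs U"
  proof -
    have "(\<lambda>z. - (1 / (2 * pi * \<i>)) * gfun (a i j) z) \<in> holo_funs U" if "d j < d i"
      using gfun_holo[OF a_words0[of i j]] ij that by (auto simp: holo_funs_def intro!: holomorphic_intros)
    then show ?thesis using one qf.subspace_0[OF subspace_holo_funs[of U]] by (simp add: S_def)
  qed
  show "i \<noteq> j \<Longrightarrow> pd X i \<le> pd X j \<Longrightarrow> pS X i j = 0" by (simp add: S_def)
  show "i \<noteq> j \<Longrightarrow> e (\<lambda>z. 2 * pi * \<i> * pS X i j z) = 0"
  proof -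
    assume "i \<noteq> j"
    then have "(\<lambda>z. 2 * pi * \<i> * pS X i j z) = (if d j < d i then qsc (-1) (gfun (a i j)) else 0)"
      by (auto simp: S_def qsc_def fun_eq_iff)
    then show ?thesis using e_scl[of "-1"] e_gfun e_zero by simp
  qed
  fix z assume z: "z \<in> U"
  let ?L = "{l. l < N \<and> d l = d i - 1}"
  have "deriv (S i j) z = (\<Sum>l\<in>?L. deriv (S i l) z * S l j z)"
  proof -
    \<comment> \<open>Up to degree difference 1 the equation is formal, because \<open>S\<close> is
      the identity within one degree; from 2 on it is \<open>gfun_ode\<close>.\<close>
    consider (diag) "i = j" | (high) "i \<noteq> j" "d i \<le> d j" | (one) "d i - d j = 1" | (low) m where "d i - d j = int (Suc (Suc m))"
    proof -
      have "d i - d j = int (Suc (Suc (nat (d i - d j - 2))))" if "d i - d j \<ge> 2" using that by simp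
      moreover have "i = j \<or> (i \<noteq> j \<and> d i \<le> d j) \<or> d i - d j = 1 \<or> d i - d j \<ge> 2" by linarith
      ultimately show ?thesis using that by blast
    qed
    then show ?thesis
    proof cases
      case diag
      have "((\<lambda>_. 1 :: complex) has_field_derivative 0) (at z)" by simp
      then have "(S i j has_field_derivative 0) (at z)"
        by (rule has_field_derivative_transform_within_open[OF _ U_open z]) (simp add: diag S_def)
      then have "deriv (S i j) z = 0" by (rule DERIV_imp_deriv)
      moreover have "S l j z = 0" if "l \<in> ?L" for l using that diag by (auto simp: S_def)
      ultimately show ?thesis by simp
    next
      case high
      then have "S i j = (\<lambda>z. 0)" by (simp add: S_def zero_fun_def)
      moreover have "S l j z = 0" if "l \<in> ?L" for l using that high by (auto simp: S_def)
      ultimately show ?thesis by simp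
    next
      case one
      have "(\<Sum>l\<in>?L. deriv (S i l) z * S l j z) = (\<Sum>l\<in>?L. if l = j then deriv (S i j) z else 0)"
        by (rule sum.cong[OF refl]) (use one z in \<open>auto simp: S_def\<close>)
      then show ?thesis using one ij by simp
    next
      case low
      let ?c = "2 * complex_of_real pi * \<i>"
      have c: "?c \<noteq> 0" by simp
      have "(\<Sum>l\<in>?L. deriv (S i l) z * S l j z) = (\<Sum>l\<in>?L. (1 / (?c * ?c)) * (deriv (gfun (a i l)) z * gfun (a l j) z))"
      proof (rule sum.cong[OF refl])
        fix l assume l: "l \<in> ?L"
        have "d j < d l" using l low by auto
        then have "S l j z = - (1 / ?c) * gfun (a l j) z" by (auto simp: S_def)
        moreover have "deriv (S i l) z = - (1 / ?c) * deriv (gfun (a i l)) z" using deriv_S_low[of i l z] l ij z by auto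
        moreover have "(- (1 / c) * x) * (- (1 / c) * y) = (1 / (c * c)) * (x * y)" for c x y :: complex by simp
        ultimately show "deriv (S i l) z * S l j z = (1 / (?c * ?c)) * (deriv (gfun (a i l)) z * gfun (a l j) z)" by (simp only:)
      qed
      also have "\<dots> = (1 / (?c * ?c)) * (\<Sum>l\<in>?L. deriv (gfun (a i l)) z * gfun (a l j) z)" by (simp only: sum_distrib_left)
      also have "(\<Sum>l\<in>?L. deriv (gfun (a i l)) z * gfun (a l j) z) = - (?c * deriv (gfun (a i j)) z)"
        using gfun_ode[OF ij low z] by (simp add: eq_neg_iff_add_eq_0 add.commute)
      also have "(1 / (?c * ?c)) * - (?c * deriv (gfun (a i j)) z) = - (1 / ?c) * deriv (gfun (a i j)) z"
        using c by (simp add: field_simps)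
      also have "\<dots> = deriv (S i j) z" using deriv_S_low[of i j z] low ij z by simp
      finally show ?thesis by simp
    qed
  qed
  moreover have "{l \<in> pI X. pd X l = pd X i - 1} = ?L" by auto
  ultimately show "deriv (pS X i j) z = (\<Sum>l\<in>{l \<in> pI X. pd X l = pd X i - 1}. deriv (pS X i l) z * pS X l j z)" by simp
next
  show "finite (pI X)" by simp
  show "pS X i i z = 1" if "z \<in> U" for i z using that by (simp add: S_def)
qed

definition to_A :: "int \<Rightarrow> qvec \<Rightarrow> qvec" where
  "to_A n v = (if v \<in> V n then \<Sum>i\<in>{i. i < N \<and> d i = n}. single i (wsum (c i) v) else 0)"

lemma lookup_to_A: "v \<in> V n \<Longrightarrow> lookup (to_A n v) i = (if i < N \<and> d i = n then wsum (c i) v else 0)"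
  by (simp add: to_A_def Poly_Mapping.lookup_sum Poly_Mapping.lookup_single when_def)

text \<open>The coefficients \<open>a i j\<close> are never compared with \<open>cf i j\<close>. It
  is enough to compare basic operators, and on both sides these evaluate \<open>l\<close> at the
  letter \<open>gf i j\<close>: by \<open>functional_gfun\<close> for \<open>M\<close>, by
  \<open>act_basic_A\<close> for the model.\<close>

lemma to_A_iso:
  shows "to_A \<in> comodule_hom (H0_hopf U) M (period.A U X)"
    and "bij_betw (to_A n) (V n) (cm_space (period.A U X) n)"
proof -
  interpret p: period U e X by (rule period_X)
  interpret cp: comod_pair U M p.A by (intro comod_pair.intro comod_axioms p.comod_A)
  have inA: "to_A n v \<in> supp_in {i. i < N \<and> d i = n}" if "v \<in> V n" for n v
    using lookup_to_A[OF that] by (auto simp: supp_in_def Poly_Mapping.in_keys_iff split: if_splits)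
  have gl: "cp.graded_linear to_A"
    unfolding cp.graded_linear_def qlinear_def
  proof (intro allI conjI ballI)
    fix n show "to_A n ` V n \<subseteq> cm_space p.A n" using inA by auto
  next
    fix n u v assume "u \<in> V n" "v \<in> V n"
    then show "to_A n (u + v) = to_A n u + to_A n v"
      using pm.subspace_add[OF subspace_V, of u n v]
      by (intro poly_mapping_eqI) (simp add: lookup_to_A Poly_Mapping.lookup_add wsum_add)
  next
    fix n q v assume "v \<in> V n"
    then show "to_A n (scl q v) = scl q (to_A n v)"
      using pm.subspace_scale[OF subspace_V, of v n q]
      by (intro poly_mapping_eqI) (simp add: lookup_to_A wsum_scl of_rat_eq_id)
  qed
  have gf: "p.gf i j = (gfun (a i j), 0)" if "d j < d i" for i j
    using that by (auto simp: p.gf_def S_def fun_eq_iff)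
  have basic: "cp.tgt.act (l # replicate m E) n (to_A n v) = to_A (n - int (Suc m)) (act (l # replicate m E) n v)"
    if l: "qlin U l" "l (tform U) = 0" and v: "v \<in> V n" for l :: "form \<Rightarrow> rat" and m n v
  proof (rule poly_mapping_eqI)
    fix j
    let ?ls = "l # replicate m E" let ?J = "{i. i < N \<and> d i = n}"
    have ad: "adm U ?ls" using l E_qlin by (auto simp: adm_def)
    have im: "act ?ls n v \<in> V (n - int (Suc m))" using act_in[OF v, of ?ls] by simp
    have tA: "to_A n v \<in> supp_in (pI X)" using inA[OF v] by (auto simp: supp_in_def)
    have "lookup (cp.tgt.act ?ls n (to_A n v)) j
       = (\<Sum>i\<in>?J. lookup (to_A n v) i * lookup (\<Sum>j\<in>{j\<in>pI X. pd X i - pd X j = int (Suc m)}. single j (l (p.gf i j))) j)"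
      unfolding p.act_basic_A[OF tA] by (rule lookup_linext_superset') (use inA[OF v] in \<open>auto simp: supp_in_def\<close>)
    also have "\<dots> = (\<Sum>i\<in>?J. wsum (c i) v * (if j < N \<and> d j = n - int (Suc m) then l (p.gf i j) else 0))"
      by (rule sum.cong[OF refl]) (use v in \<open>auto simp: lookup_to_A Poly_Mapping.lookup_sum Poly_Mapping.lookup_single when_def\<close>)
    also have "\<dots> = (if j < N \<and> d j = n - int (Suc m) then \<Sum>i\<in>?J. wsum (c i) v * l (p.gf i j) else 0)"
      by (cases "j < N \<and> d j = n - int (Suc m)") (simp_all only: if_True if_False simp_thms mult_zero_right sum.neutral_const)
    also have "\<dots> = (if j < N \<and> d j = n - int (Suc m) then wsum (c j) (act ?ls n v) else 0)"
    proof (cases "j < N \<and> d j = n - int (Suc m)")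
      case True
      have "wsum (c j) (act ?ls n v) = pairing1 ?ls (c j) (\<rho> n (\<Sum>i\<in>?J. scl (wsum (c i) v) (b i)))"
        unfolding act_def pairing1_opw using expand[OF v] by simp
      also have "\<dots> = wsum (c j) (act ?ls n (\<Sum>i\<in>?J. scl (wsum (c i) v) (b i)))" unfolding act_def pairing1_opw ..
      also have "act ?ls n (\<Sum>i\<in>?J. scl (wsum (c i) v) (b i)) = (\<Sum>i\<in>?J. scl (wsum (c i) v) (act ?ls n (b i)))"
      proof (rule qlinear_sum[of "V n" UNIV])
        show "qlinear (V n) UNIV (act ?ls n)" using act_add[OF ad] act_scl[OF ad] by (simp add: qlinear_def)
      qed (use subspace_V b_in in auto)
      also have "wsum (c j) \<dots> = (\<Sum>i\<in>?J. wsum (c i) v * wsum (c j) (act ?ls n (b i)))"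
        by (simp add: wsum_sum wsum_scl of_rat_eq_id)
      also have "\<dots> = (\<Sum>i\<in>?J. wsum (c i) v * l (p.gf i j))"
      proof (rule sum.cong[OF refl])
        fix i assume i: "i \<in> ?J"
        have dij: "d i - d j = int (Suc m)" using i True by auto
        have w: "a i j \<in> words0 U" "\<And>w. w \<in> keys (a i j) \<Longrightarrow> length w = Suc m"
          using a_words0[of i j] a_keys[of i j] i dij by force+
        have "wsum (c j) (act ?ls n (b i)) = lev ?ls (a i j)"
          using lev_a[of ?ls i j] dij i by (simp add: act_def pairing1_opw)
        also have "\<dots> = l (gfun (a i j), 0)" using functional_gfun[OF l w] by (simp add: of_rat_eq_id)
        also have "(gfun (a i j), 0) = p.gf i j" using gf[of j i] dij by simp
        finally show "wsum (c i) v * wsum (c j) (act ?ls n (b i)) = wsum (c i) v * l (p.gf i j)" by simp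
      qed
      finally show ?thesis using True by simp
    next
      case False then show ?thesis by (simp only: if_False)
    qed
    also have "\<dots> = lookup (to_A (n - int (Suc m)) (act ?ls n v)) j" using lookup_to_A[OF im] by simp
    finally show "lookup (cp.tgt.act ?ls n (to_A n v)) j = lookup (to_A (n - int (Suc m)) (act ?ls n v)) j" .
  qed
  show "to_A \<in> comodule_hom (H0_hopf U) M p.A"
    unfolding cp.comodule_hom_iff
  proof (intro conjI gl allI ballI impI)
    fix n v assume "v \<notin> V n" then show "to_A n v = 0" by (simp add: to_A_def)
  next
    fix n v and ls :: "(form \<Rightarrow> rat) list" assume "v \<in> V n" "adm U ls"
    then show "cp.tgt.act ls n (to_A n v) = to_A (n - int (length ls)) (act ls n v)"
      by (intro cp.intertwines_if_intertwines_basic[OF gl E_qlin E_t basic])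
  qed
  show "bij_betw (to_A n) (V n) (cm_space p.A n)"
  proof (rule bij_betw_byWitness[where f'="\<lambda>v. \<Sum>i\<in>{i. i < N \<and> d i = n}. scl (lookup v i) (b i)"])
    let ?J = "{i. i < N \<and> d i = n}"
    show "\<forall>v\<in>V n. (\<Sum>i\<in>?J. scl (lookup (to_A n v) i) (b i)) = v"
    proof
      fix v assume v: "v \<in> V n"
      have "(\<Sum>i\<in>?J. scl (lookup (to_A n v) i) (b i)) = (\<Sum>i\<in>?J. scl (wsum (c i) v) (b i))"
        by (rule sum.cong[OF refl]) (simp add: lookup_to_A[OF v])
      then show "(\<Sum>i\<in>?J. scl (lookup (to_A n v) i) (b i)) = v" using expand[OF v] by simp
    qed
    have inV: "(\<Sum>i\<in>?J. scl (lookup v i) (b i)) \<in> V n" for v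
      using subspace_V[of n] b_in by (auto intro!: pm.subspace_sum pm.subspace_scale)
    then show "(\<lambda>v. \<Sum>i\<in>?J. scl (lookup v i) (b i)) ` cm_space p.A n \<subseteq> V n" by blast
    show "to_A n ` V n \<subseteq> cm_space p.A n" using inA by auto
    show "\<forall>v\<in>cm_space p.A n. to_A n (\<Sum>i\<in>?J. scl (lookup v i) (b i)) = v"
    proof
      fix v assume v: "v \<in> cm_space p.A n"
      have "wsum (c i) (\<Sum>j\<in>?J. scl (lookup v j) (b j)) = lookup v i" if i: "i \<in> ?J" for i
      proof -
        have "wsum (c i) (\<Sum>j\<in>?J. scl (lookup v j) (b j)) = (\<Sum>j\<in>?J. if j = i then lookup v i else 0)"
          unfolding wsum_sum wsum_scl by (rule sum.cong[OF refl]) (use i dual in \<open>auto simp: of_rat_eq_id\<close>)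
        then show ?thesis using i by simp
      qed
      moreover have "lookup v i = 0" if "i \<notin> ?J" for i
        using v that by (auto simp: supp_in_def subset_iff Poly_Mapping.in_keys_iff)
      ultimately show "to_A n (\<Sum>i\<in>?J. scl (lookup v i) (b i)) = v"
        by (intro poly_mapping_eqI) (auto simp: lookup_to_A[OF inV])
    qed
  qed
qed

end

context comod_gauge begin

lemma iso_to_period:
  obtains X f g where "period U e X" "f \<in> comodule_hom (H0_hopf U) M (period.A U X)"
    "g \<in> comodule_hom (H0_hopf U) (period.A U X) M"
    "\<And>n v. v \<in> cm_space M n \<Longrightarrow> g n (f n v) = v"
    "\<And>n v. v \<in> cm_space (period.A U X) n \<Longrightarrow> f n (g n v) = v"
proof (rule basis_exists)
  fix N :: nat and d :: "nat \<Rightarrow> int" and b :: "nat \<Rightarrow> qvec" and c :: "nat \<Rightarrow> nat \<Rightarrow> rat"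
  assume h: "\<And>i. i < N \<Longrightarrow> b i \<in> V (d i)" "\<And>n. V n = pm.span (b ` {i. i < N \<and> d i = n})"
    "\<And>i j. i < N \<Longrightarrow> j < N \<Longrightarrow> d i = d j \<Longrightarrow> wsum (c i) (b j) = (if i = j then 1 else (0::rat))"
  interpret cb: comod_basis U e M N d b c
    by (intro comod_basis.intro comod_gauge_axioms comod_basis_axioms.intro h)
  interpret p: period U e cb.X by (rule cb.period_X)
  interpret cp: comod_pair U M p.A by (intro comod_pair.intro comod_axioms p.comod_A)
  note inv = cp.inverse_hom[OF cb.to_A_iso]
  show thesis by (rule that[OF p.period_axioms cb.to_A_iso(1) inv])
qed

end

section \<open>Variations from period matrices\<close>

text \<open>Gaussian elimination with a pivot that does not vanish near \<open>z0\<close>.\<close>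

lemma holomorphic_solution:
  fixes A :: "'j \<Rightarrow> 'k \<Rightarrow> complex \<Rightarrow> complex"
  assumes "finite K" "open N" "z0 \<in> N"
    and "\<And>j k. j \<in> J \<Longrightarrow> k \<in> K \<Longrightarrow> A j k holomorphic_on N" "\<And>j. j \<in> J \<Longrightarrow> b j holomorphic_on N"
    and "\<And>x. (\<And>j. j \<in> J \<Longrightarrow> (\<Sum>k\<in>K. A j k z0 * x k) = 0) \<Longrightarrow> \<forall>k\<in>K. x k = 0"
    and "\<And>j z. j \<in> J \<Longrightarrow> z \<in> N \<Longrightarrow> (\<Sum>k\<in>K. A j k z * x k z) = b j z"
  shows "\<exists>N'. open N' \<and> z0 \<in> N' \<and> N' \<subseteq> N \<and> (\<forall>k\<in>K. x k holomorphic_on N')"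
  using assms
proof (induction K arbitrary: A b N rule: finite_induct)
  case empty then show ?case by blast
next
  case (insert k0 K)
  have "\<exists>j0\<in>J. A j0 k0 z0 \<noteq> 0"
  proof (rule ccontr)
    assume h: "\<not> (\<exists>j0\<in>J. A j0 k0 z0 \<noteq> 0)"
    have "(\<Sum>k\<in>insert k0 K. A j k z0 * (if k = k0 then 1 else 0)) = 0" if "j \<in> J" for j
      using h that by (auto intro!: sum.neutral)
    from insert.prems(5)[OF this] show False by auto
  qed
  then obtain j0 where j0: "j0 \<in> J" "A j0 k0 z0 \<noteq> 0" by blast
  have hol0: "A j0 k0 holomorphic_on N" using insert.prems(3) j0 by blast
  define N1 where "N1 = {z\<in>N. A j0 k0 z \<noteq> 0}"
  have "open N1"
  proof -
    have "N1 = N \<inter> A j0 k0 -` (- {0})" by (auto simp: N1_def)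
    then show ?thesis using continuous_open_preimage[OF holomorphic_on_imp_continuous_on[OF hol0] insert.prems(1)] by auto
  qed
  have N1: "z0 \<in> N1" "N1 \<subseteq> N" using insert.prems(2) j0 by (auto simp: N1_def)
  have nz: "A j0 k0 z \<noteq> 0" if "z \<in> N1" for z using that by (simp add: N1_def)
  let ?q = "\<lambda>j z. A j k0 z / A j0 k0 z"
  let ?A = "\<lambda>j k z. A j k z - ?q j z * A j0 k z"
  let ?b = "\<lambda>j z. b j z - ?q j z * b j0 z"
  have hq: "?q j holomorphic_on N1" if "j \<in> J" for j
    using insert.prems(3)[OF that, of k0] hol0 N1 nz by (intro holomorphic_intros) (auto intro: holomorphic_on_subset)
  have "\<exists>N'. open N' \<and> z0 \<in> N' \<and> N' \<subseteq> N1 \<and> (\<forall>k\<in>K. x k holomorphic_on N')"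
  proof (rule insert.IH[of N1 ?A ?b])
    show "open N1" "z0 \<in> N1" by fact+
    show "?A j k holomorphic_on N1" if "j \<in> J" "k \<in> K" for j k
      using insert.prems(3)[OF that(1), of k] insert.prems(3)[OF j0(1), of k] that hq[OF that(1)] N1
      by (intro holomorphic_on_diff holomorphic_on_mult) (auto intro: holomorphic_on_subset)
    show "?b j holomorphic_on N1" if "j \<in> J" for j
      using insert.prems(4)[OF that] insert.prems(4)[OF j0(1)] hq[OF that] N1
      by (intro holomorphic_on_diff holomorphic_on_mult) (auto intro: holomorphic_on_subset)
    show "\<forall>k\<in>K. y k = 0" if y: "\<And>j. j \<in> J \<Longrightarrow> (\<Sum>k\<in>K. ?A j k z0 * y k) = 0" for y
    proof -
      \<comment> \<open>A solution of the eliminated homogeneous system extends to the full one by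
        solving the pivot equation for the unknown \<open>k0\<close>.\<close>
      let ?y = "\<lambda>k. if k = k0 then - (\<Sum>k\<in>K. A j0 k z0 * y k) / A j0 k0 z0 else y k"
      have "(\<Sum>k\<in>insert k0 K. A j k z0 * ?y k) = 0" if "j \<in> J" for j
      proof -
        have "(\<Sum>k\<in>K. A j k z0 * ?y k) = (\<Sum>k\<in>K. A j k z0 * y k)"
          using insert.hyps(2) by (intro sum.cong) auto
        moreover have "(\<Sum>k\<in>K. A j k z0 * y k) = ?q j z0 * (\<Sum>k\<in>K. A j0 k z0 * y k)"
          using y[OF that] by (simp add: left_diff_distrib sum_subtractf sum_distrib_left mult.assoc)
        ultimately show ?thesis using insert.hyps by simp
      qed
      from insert.prems(5)[OF this] show ?thesis using insert.hyps(2) by (metis insertCI)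
    qed
    show "(\<Sum>k\<in>K. ?A j k z * x k z) = ?b j z" if "j \<in> J" "z \<in> N1" for j z
    proof -
      have "A j k0 z * x k0 z + (\<Sum>k\<in>K. A j k z * x k z) = b j z" "A j0 k0 z * x k0 z + (\<Sum>k\<in>K. A j0 k z * x k z) = b j0 z"
        using insert.prems(6)[of j z] insert.prems(6)[OF j0(1), of z] that N1(2) insert.hyps by auto
      then have 1: "(\<Sum>k\<in>K. A j k z * x k z) = b j z - A j k0 z * x k0 z" "(\<Sum>k\<in>K. A j0 k z * x k z) = b j0 z - A j0 k0 z * x k0 z"
        by (simp_all add: eq_diff_eq add.commute)
      have "(\<Sum>k\<in>K. ?A j k z * x k z) = (\<Sum>k\<in>K. A j k z * x k z) - ?q j z * (\<Sum>k\<in>K. A j0 k z * x k z)"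
        by (simp add: left_diff_distrib sum_subtractf sum_distrib_left mult.assoc)
      also have "\<dots> = ?b j z" unfolding 1 using nz[OF that(2)] by (simp add: field_simps)
      finally show ?thesis .
    qed
  qed
  then obtain N' where N': "open N'" "z0 \<in> N'" "N' \<subseteq> N1" "\<forall>k\<in>K. x k holomorphic_on N'" by blast
  have "x k0 holomorphic_on N'"
  proof (rule holomorphic_transform)
    show "(\<lambda>z. (b j0 z - (\<Sum>k\<in>K. A j0 k z * x k z)) / A j0 k0 z) holomorphic_on N'"
    proof -
      have s: "N' \<subseteq> N" using N' N1(2) by blast
      have "b j0 holomorphic_on N'" "\<And>k. k \<in> insert k0 K \<Longrightarrow> A j0 k holomorphic_on N'"
        using holomorphic_on_subset[OF _ s] insert.prems(3,4) j0(1) by blast+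
      then show ?thesis using N' nz by (intro holomorphic_intros) auto
    qed
    fix z assume z: "z \<in> N'"
    then have "A j0 k0 z * x k0 z + (\<Sum>k\<in>K. A j0 k z * x k z) = b j0 z"
      using insert.prems(6)[OF j0(1), of z] N'(3) N1(2) insert.hyps by auto
    then show "(b j0 z - (\<Sum>k\<in>K. A j0 k z * x k z)) / A j0 k0 z = x k0 z"
      using nz[of z] z N'(3) by (auto simp: field_simps)
  qed
  then show ?case using N' N1(2) by blast
qed

section \<open>Complexification and unipotent frames\<close>

lemma lookup_map_zero: "f 0 = 0 \<Longrightarrow> lookup (Poly_Mapping.map f v) i = f (lookup v i)"
  by (simp add: Poly_Mapping.map.rep_eq when_def)

lemma lookup_ctens [simp]: "lookup (ctens c v) i = c * of_rat (lookup v i)"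
  by (simp add: ctens_def lookup_map_zero)

lemma ctens_add: "ctens c (u + v) = ctens c u + ctens c v"
  and ctens_scl: "ctens c (scl q v) = scl (of_rat q) (ctens c v)"
  and ctens_mult: "ctens (c * c') v = scl c (ctens c' v)"
  and ctens_zero [simp]: "ctens c 0 = 0"
  by (rule poly_mapping_eqI; simp add: Poly_Mapping.lookup_add of_rat_add of_rat_mult algebra_simps)+

lemma ctens_sum: "ctens c (\<Sum>i\<in>K. f i) = (\<Sum>i\<in>K. ctens c (f i))"
  by (induction K rule: infinite_finite_induct) (auto simp: ctens_add)

lemma complexification_supp: "complexification (supp_in K) = supp_in K"
proof
  have "ctens 1 ` supp_in K \<subseteq> (supp_in K :: cvec set)" by (auto simp: supp_in_def Poly_Mapping.in_keys_iff)
  then show "complexification (supp_in K) \<subseteq> supp_in K"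
    unfolding complexification_def by (rule pm.span_minimal[OF _ supp_in_subspace])
  have "single i (1::complex) = ctens 1 (single i 1)" for i
    by (rule poly_mapping_eqI) (simp add: Poly_Mapping.lookup_single when_def)
  then have "(\<lambda>i. single i (1::complex)) ` K \<subseteq> ctens 1 ` supp_in K"
    using single_in_supp by fastforce
  then show "supp_in K \<subseteq> complexification (supp_in K)"
    unfolding supp_in_eq_span complexification_def by (rule pm.span_mono)
qed

lemma span_image_sum:
  assumes "finite K" "y \<in> pm.span (u ` K)"
  obtains c where "y = (\<Sum>i\<in>K. scl (c i) (u i))"
proof -
  have "\<exists>c. y = (\<Sum>i\<in>K. scl (c i) (u i))"
    using assms(2)
  proof (induction rule: pm.span_induct_alt)
    case base then show ?case by (intro exI[of _ "\<lambda>_. 0"]) (simp add: pm.scale_zero_left)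
  next
    case (step q s y)
    then obtain i c where i: "i \<in> K" "s = u i" and c: "y = (\<Sum>i\<in>K. scl (c i) (u i))" by blast
    have "(\<Sum>l\<in>K. scl ((if l = i then q else 0) + c l) (u l)) = (\<Sum>l\<in>K. if l = i then scl q (u i) else 0) + y"
      unfolding c sum.distrib[symmetric] by (rule sum.cong) (auto simp: pm.scale_left_distrib pm.scale_zero_left)
    also have "\<dots> = scl q s + y" using assms(1) i by simp
    finally show ?case by metis
  qed
  then show ?thesis using that by blast
qed

lemma sum_in_span_image: "(\<Sum>i\<in>K. scl (c i) (u i)) \<in> pm.span (u ` K)"
  by (intro pm.span_sum pm.span_scale pm.span_base) auto

text \<open>Conjugation is an antilinear involution, so the second inclusion is the first one
  applied to the conjugate set.\<close>

lemma conj_space_span: "conj_space (pm.span S) = pm.span (Poly_Mapping.map cnj ` S)"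
proof
  let ?m = "Poly_Mapping.map cnj :: cvec \<Rightarrow> cvec"
  have lk: "lookup (?m v) i = cnj (lookup v i)" for v i by (simp add: lookup_map_zero)
  have lin: "?m (scl c x + y) = scl (cnj c) (?m x) + ?m y" "?m 0 = 0" for c x y
    by (rule poly_mapping_eqI; simp add: lk Poly_Mapping.lookup_add)+
  have inv: "?m (?m x) = x" for x by (rule poly_mapping_eqI) (simp add: lk)
  have sub: "?m x \<in> pm.span (?m ` S)" if "x \<in> pm.span S" for x S
    using that by (induction rule: pm.span_induct_alt) (auto simp: lin pm.span_zero intro!: pm.span_add pm.span_scale intro: pm.span_base)
  show "conj_space (pm.span S) \<subseteq> pm.span (?m ` S)" unfolding conj_space_def using sub by blast
  show "pm.span (?m ` S) \<subseteq> conj_space (pm.span S)"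
  proof
    fix y assume "y \<in> pm.span (?m ` S)"
    from sub[OF this] have "?m y \<in> pm.span S" by (simp add: image_image inv)
    then show "y \<in> conj_space (pm.span S)" unfolding conj_space_def using inv by (metis imageI)
  qed
qed

text \<open>The rows of a period matrix at one point: \<open>u i\<close> is the basis vector
  \<open>i\<close> plus terms of smaller degree.\<close>

locale unipotent =
  fixes I :: "nat set" and d :: "nat \<Rightarrow> int" and u :: "nat \<Rightarrow> cvec"
  assumes fin: "finite I" and diag: "i \<in> I \<Longrightarrow> lookup (u i) i = 1"
    and tri: "i \<in> I \<Longrightarrow> j \<noteq> i \<Longrightarrow> j \<notin> I \<or> d i \<le> d j \<Longrightarrow> lookup (u i) j = 0"
begin

text \<open>Take a nonzero coefficient of maximal degree. At its own position no other row
  contributes: rows of at most that degree vanish there by triangularity, and rows of larger degree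
  have coefficient zero.\<close>

lemma coeff_zero:
  assumes K: "K \<subseteq> I" and z: "\<And>j. j \<in> K \<Longrightarrow> p \<le> d j \<Longrightarrow> lookup (\<Sum>i\<in>K. scl (c i) (u i)) j = 0"
    and i: "i \<in> K" "p \<le> d i"
  shows "c i = 0"
proof (rule ccontr)
  assume "c i \<noteq> 0"
  let ?Z = "{i\<in>K. p \<le> d i \<and> c i \<noteq> 0}"
  have Z: "finite ?Z" "?Z \<noteq> {}" using fin K i \<open>c i \<noteq> 0\<close> by (auto intro: finite_subset[of _ I])
  then have "Max (d ` ?Z) \<in> d ` ?Z" by (intro Max_in) auto
  then obtain m where m1: "m \<in> ?Z" "Max (d ` ?Z) = d m" by (rule imageE)
  have m2: "d l \<le> d m" if "l \<in> ?Z" for l unfolding m1(2)[symmetric] using Z(1) that by (intro Max_ge) auto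
  note m = m1(1) m2
  have "0 = lookup (\<Sum>i\<in>K. scl (c i) (u i)) m" using z m by simp
  also have "\<dots> = (\<Sum>i\<in>K. if i = m then c m else 0)"
    unfolding Poly_Mapping.lookup_sum
  proof (rule sum.cong[OF refl])
    fix l assume l: "l \<in> K"
    show "lookup (scl (c l) (u l)) m = (if l = m then c m else 0)"
    proof (cases "l = m")
      case True then show ?thesis using diag K l by auto
    next
      case False
      show ?thesis
      proof (cases "d l \<le> d m")
        case True then show ?thesis using tri[of l m] K l False by auto
      next
        case F: False
        then have "c l = 0" using m l by force
        then show ?thesis using False by simp
      qed
    qed
  qed
  also have "\<dots> = c m" using m K fin finite_subset[of K I] by simp
  finally show False using m by simp
qed

lemma independent:
  assumes K: "K \<subseteq> I" shows "inj_on u K" "pm.independent (u ` K)"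
proof -
  have finK: "finite K" using K fin finite_subset by blast
  have z: "c i = 0" if "(\<Sum>i\<in>K. scl (c i) (u i)) = 0" "i \<in> K" for c i
    by (rule coeff_zero[OF K, of "d i"]) (use that in auto)
  show inj: "inj_on u K"
  proof (rule inj_onI, rule ccontr)
    fix i j assume ij: "i \<in> K" "j \<in> K" "u i = u j" "i \<noteq> j"
    have "(\<Sum>l\<in>K. scl ((if l = i then 1 else 0) + (if l = j then -1 else 0)) (u l))
       = (\<Sum>l\<in>K. (if l = i then u i else 0) + (if l = j then - u j else 0))"
      by (rule sum.cong) (use ij in \<open>auto simp: pm.scale_zero_left\<close>)
    also have "\<dots> = 0" using ij finK by (simp add: sum.distrib)
    finally show False using z[of "\<lambda>l. (if l = i then 1 else 0) + (if l = j then -1 else 0)" i] ij by auto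
  qed
  show "pm.independent (u ` K)"
  proof
    assume "pm.dependent (u ` K)"
    then obtain c v where c: "v \<in> u ` K" "c v \<noteq> 0" "(\<Sum>v\<in>u ` K. scl (c v) v) = 0"
      using pm.dependent_finite[of "u ` K"] finK by auto
    then have "(\<Sum>i\<in>K. scl (c (u i)) (u i)) = 0" by (simp add: sum.reindex[OF inj])
    then show False using z[of "\<lambda>i. c (u i)"] c by auto
  qed
qed

definition G :: "int \<Rightarrow> cvec set" where "G p = pm.span (u ` {i\<in>I. p \<le> d i})"
definition WC :: "int \<Rightarrow> cvec set" where "WC m = supp_in {i\<in>I. 2 * d i \<le> m}"

lemma WC_iff: "y \<in> WC m \<longleftrightarrow> (\<forall>j. j \<notin> I \<or> m < 2 * d j \<longrightarrow> lookup y j = 0)"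
  unfolding WC_def supp_in_def by (auto simp: subset_iff Poly_Mapping.in_keys_iff not_le)

text \<open>For \<open>m = 2n\<close> and \<open>p \<le> n\<close> the entries of degree
  \<open>n\<close> of a vector of weight \<open>m\<close> are matched by rows of degree
  \<open>n\<close>, which lie in \<open>G p\<close>. For \<open>p > n\<close>,
  \<open>coeff_zero\<close> shows that \<open>G p\<close> meets \<open>WC m\<close> only in zero.
  Odd weights have no graded piece.\<close>

lemma graded_filtration:
  "sum_space (G p \<inter> WC m) (WC (m - 1)) = (if 2 * p \<le> m then WC m else WC (m - 1))"
proof -
  have sub: "WC (m - 1) \<subseteq> WC m" by (auto simp: WC_def supp_in_def)
  have sW: "pm.subspace (WC m)" "pm.subspace (WC (m - 1))" by (simp_all add: WC_def supp_in_subspace)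
  have zG: "0 \<in> G p" by (simp add: G_def pm.span_zero)
  have le: "sum_space (G p \<inter> WC m) (WC (m - 1)) \<subseteq> WC m"
    unfolding sum_space_def using sub pm.subspace_add[OF sW(1)] by blast
  have ge: "WC (m - 1) \<subseteq> sum_space (G p \<inter> WC m) (WC (m - 1))"
    unfolding sum_space_def using zG pm.subspace_0[OF sW(1)] by force
  show ?thesis
  proof (cases "odd m")
    case True
    then have "2 * d i \<le> m \<longleftrightarrow> 2 * d i \<le> m - 1" for i by presburger
    then have "WC m = WC (m - 1)" by (simp add: WC_def)
    then show ?thesis using le ge by auto
  next
    case False
    then obtain n where n: "m = 2 * n" by blast
    show ?thesis
    proof (cases "p \<le> n")
      case True
      have "WC m \<subseteq> sum_space (G p \<inter> WC m) (WC (m - 1))"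
      proof
        fix y assume y: "y \<in> WC m"
        let ?K = "{i\<in>I. d i = n}"
        define f where "f = (\<Sum>i\<in>?K. scl (lookup y i) (u i))"
        have fK: "finite ?K" using fin by simp
        have y0: "lookup y j = 0" if "j \<notin> I \<or> n < d j" for j
          using y that n by (auto simp: WC_def supp_in_def subset_iff Poly_Mapping.in_keys_iff)
        have f0: "lookup f j = (if j \<in> ?K then lookup y j else 0)" if "j \<notin> I \<or> n \<le> d j" for j
        proof -
          have "lookup f j = (\<Sum>i\<in>?K. if i = j then lookup y j else 0)"
            unfolding f_def Poly_Mapping.lookup_sum
          proof (rule sum.cong[OF refl])
            fix l assume "l \<in> ?K"
            then show "lookup (scl (lookup y l) (u l)) j = (if l = j then lookup y j else 0)"
              using diag[of l] tri[of l j] that by (cases "l = j") auto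
          qed
          then show ?thesis using fK by simp
        qed
        have "f \<in> G p"
          unfolding f_def G_def by (intro pm.span_sum pm.span_scale pm.span_base) (use True in auto)
        moreover have "f \<in> WC m" unfolding WC_iff using f0 n by auto
        moreover have "y - f \<in> WC (m - 1)"
        proof -
          have "lookup y j - lookup f j = 0" if "j \<notin> I \<or> m - 1 < 2 * d j" for j
            using f0[of j] y0[of j] that n by (cases "d j = n") auto
          then show ?thesis unfolding WC_iff Poly_Mapping.lookup_minus by blast
        qed
        moreover have "y = f + (y - f)" by simp
        ultimately show "y \<in> sum_space (G p \<inter> WC m) (WC (m - 1))"
          unfolding sum_space_def by blast
      qed
      then show ?thesis using le True n by auto
    next
      case False
      have "y = 0" if y: "y \<in> G p" "y \<in> WC m" for y
      proof -
        let ?K = "{i\<in>I. p \<le> d i}"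
        obtain c where c: "y = (\<Sum>i\<in>?K. scl (c i) (u i))" using span_image_sum[of ?K y u] y(1) fin unfolding G_def by auto
        have "c i = 0" if "i \<in> ?K" for i
        proof (rule coeff_zero[of ?K p c])
          fix j assume "j \<in> ?K"
          then show "lookup (\<Sum>i\<in>?K. scl (c i) (u i)) j = 0"
            unfolding c[symmetric] using y(2) False n by (auto simp: WC_def supp_in_def subset_iff Poly_Mapping.in_keys_iff)
        qed (use that in auto)
        then show ?thesis unfolding c by (simp add: pm.scale_zero_left)
      qed
      then have "G p \<inter> WC m \<subseteq> {0}" by blast
      then have "sum_space (G p \<inter> WC m) (WC (m - 1)) \<subseteq> {x + y |x y. x \<in> {0} \<and> y \<in> WC (m - 1)}" unfolding sum_space_def by blast
      also have "\<dots> \<subseteq> WC (m - 1)" by auto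
      finally have "sum_space (G p \<inter> WC m) (WC (m - 1)) \<subseteq> WC (m - 1)" .
      then show ?thesis using ge False n by auto
    qed
  qed
qed

end

lemma sum_space_absorb:
  assumes "pm.subspace S" "pm.subspace S'" "S' \<subseteq> S"
  shows "sum_space S S' = S" "sum_space S' S = S"
proof -
  have "x \<in> sum_space S S'" "x \<in> sum_space S' S" if "x \<in> S" for x
    unfolding sum_space_def using that pm.subspace_0[OF assms(2)]
    by (auto intro: exI[of _ x] exI[of _ 0])
  moreover have "sum_space S S' \<subseteq> S" "sum_space S' S \<subseteq> S"
    unfolding sum_space_def using pm.subspace_add[OF assms(1)] assms(3) by blast+
  ultimately show "sum_space S S' = S" "sum_space S' S = S" by blast+
qed

text \<open>The conjugate rows are unipotent as well, so \<open>F\<close> and its conjugate induce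
  the same filtration on the graded piece of weight \<open>m\<close>: everything for
  \<open>2p \<le> m\<close> and zero beyond.\<close>

lemma hodge_tate_unipotent:
  assumes "unipotent I d u"
  shows "hodge_tate (\<lambda>m. supp_in {i\<in>I. 2 * d i \<le> m}) (\<lambda>p. pm.span (u ` {i\<in>I. p \<le> d i}))"
proof -
  interpret unipotent I d u by fact
  let ?v = "\<lambda>i. Poly_Mapping.map cnj (u i)"
  interpret cj: unipotent I d ?v
    by unfold_locales (use fin diag tri in \<open>auto simp: lookup_map_zero\<close>)
  let ?W = "\<lambda>m. supp_in {i\<in>I. 2 * d i \<le> m} :: qvec set"
  have cW: "complexification (?W m) = WC m" for m by (simp add: complexification_supp WC_def)
  have cW': "complexification (?W m) = cj.WC m" for m by (simp add: complexification_supp cj.WC_def)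
  have g: "gr_filt ?W m (pm.span (u ` {i\<in>I. p \<le> d i})) = (if 2 * p \<le> m then WC m else WC (m - 1))" for m p
    unfolding gr_filt_def cW G_def[symmetric] by (rule graded_filtration)
  have g': "gr_filt ?W m (conj_space (pm.span (u ` {i\<in>I. p \<le> d i}))) = (if 2 * p \<le> m then WC m else WC (m - 1))" for m p
  proof -
    have "conj_space (pm.span (u ` {i\<in>I. p \<le> d i})) = cj.G p" by (simp add: conj_space_span cj.G_def image_image)
    then show ?thesis using cj.graded_filtration[of p m] unfolding gr_filt_def cW' by (simp add: cj.WC_def WC_def)
  qed
  have odd: "WC m = WC (m - 1)" "?W m = ?W (m - 1)" if "odd m" for m
  proof -
    have "2 * d i \<le> m \<longleftrightarrow> 2 * d i \<le> m - 1" for i using that by presburger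
    then show "WC m = WC (m - 1)" "?W m = ?W (m - 1)" by (simp_all add: WC_def)
  qed
  have sW: "pm.subspace (WC m)" for m by (simp add: WC_def supp_in_subspace)
  have sub: "WC (m - 1) \<subseteq> WC m" for m by (auto simp: WC_def supp_in_def)
  have ss: "sum_space (WC m) (WC (m - 1)) = WC m" "sum_space (WC (m - 1)) (WC m) = WC m" "sum_space (WC m) (WC m) = WC m" for m
    by (simp_all add: sum_space_absorb sW sub)
  show ?thesis
    unfolding hodge_tate_def mixed_hodge_def g g' cW
  proof (intro conjI allI impI)
    fix m p :: int
    \<comment> \<open>The condition \<open>2(m + 1 - p) \<le> m\<close> means
      \<open>m + 2 \<le> 2p\<close>. So exactly one of the opposed steps is everything, except for
      \<open>2p = m + 1\<close>, when \<open>m\<close> is odd and the graded piece vanishes.\<close>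
    have "2 * p \<le> m \<or> m + 2 \<le> 2 * p \<or> (odd m \<and> 2 * p = m + 1)" by presburger
    then consider "2 * p \<le> m" | "m + 2 \<le> 2 * p" | "odd m" "2 * p = m + 1" by blast
    then have "(if 2 * p \<le> m then WC m else WC (m - 1)) \<inter> (if 2 * (m + 1 - p) \<le> m then WC m else WC (m - 1)) = WC (m - 1)
      \<and> sum_space (if 2 * p \<le> m then WC m else WC (m - 1)) (if 2 * (m + 1 - p) \<le> m then WC m else WC (m - 1)) = WC m"
    proof cases
      case 1 then show ?thesis using sub[of m] ss by auto
    next
      case 2 then show ?thesis using sub[of m] ss by auto
    next
      case 3 then show ?thesis using odd[OF 3(1)] ss by auto
    qed
    then show "(if 2 * p \<le> m then WC m else WC (m - 1)) \<inter> (if 2 * (m + 1 - p) \<le> m then WC m else WC (m - 1)) = WC (m - 1)"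
      "sum_space (if 2 * p \<le> m then WC m else WC (m - 1)) (if 2 * (m + 1 - p) \<le> m then WC m else WC (m - 1)) = WC m"
      by blast+
  qed (use odd in auto)
qed

section \<open>Constant local systems and their flat sections\<close>

lemma subtopology_const_total:
  "W \<subseteq> V \<Longrightarrow> subtopology (prod_topology (top_of_set U) (discrete_topology V)) (U \<times> W) = prod_topology (top_of_set U) (discrete_topology W)"
  by (simp add: subtopology_Times subtopology_subtopology inf.absorb2)

lemma local_system_const:
  assumes "open U" "findim V"
  shows "local_system U (prod_topology (top_of_set U) (discrete_topology V)) (\<lambda>_. V)"
  unfolding local_system_def
proof (intro conjI ballI)
  show "continuous_map (prod_topology (top_of_set U) (discrete_topology V)) (top_of_set U) fst" by (rule continuous_map_fst)
  fix z0 assume z0: "z0 \<in> U"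
  have "homeomorphic_map (prod_topology (top_of_set U) (discrete_topology V)) (prod_topology (top_of_set U) (discrete_topology V)) (\<lambda>(z, v). (z, v))"
    by (simp add: homeomorphic_map_id[unfolded id_def])
  then show "\<exists>N W \<tau>. open N \<and> z0 \<in> N \<and> N \<subseteq> U \<and> findim W \<and> (\<forall>z\<in>N. qlinear W V (\<tau> z)) \<and>
     homeomorphic_map (prod_topology (top_of_set N) (discrete_topology W)) (subtopology (prod_topology (top_of_set U) (discrete_topology V)) (N \<times> V)) (\<lambda>(z, v). (z, \<tau> z v))"
    using assms z0 by (intro exI[of _ U] exI[of _ V] exI[of _ "\<lambda>z v. v"]) (simp add: subtopology_const_total qlinear_def)
qed (use assms in auto)

lemma flat_const_iff:
  "flat_section (prod_topology (top_of_set U) (discrete_topology V)) N \<sigma> \<longleftrightarrow>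
     N \<subseteq> U \<and> continuous_map (top_of_set N) (discrete_topology V) \<sigma>"
  unfolding flat_section_def continuous_map_paired by (auto simp: Pi_def)

lemma flat_const: "v \<in> V \<Longrightarrow> N \<subseteq> U \<Longrightarrow> flat_section (prod_topology (top_of_set U) (discrete_topology V)) N (\<lambda>_. v)"
  by (simp add: flat_const_iff)

lemma flat_const_in: "flat_section (prod_topology (top_of_set U) (discrete_topology V)) N \<sigma> \<Longrightarrow> z \<in> N \<Longrightarrow> \<sigma> z \<in> V"
  unfolding flat_const_iff by (auto simp: continuous_map_def Pi_def)

lemma flat_locally_const:
  assumes "flat_section (prod_topology (top_of_set U) (discrete_topology V)) N \<sigma>" "open N" "z0 \<in> N"
  obtains N' where "open N'" "z0 \<in> N'" "N' \<subseteq> N" "\<And>z. z \<in> N' \<Longrightarrow> \<sigma> z = \<sigma> z0"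
proof (rule that[of "{z \<in> N. \<sigma> z \<in> {\<sigma> z0}}"])
  have "openin (top_of_set N) {z \<in> topspace (top_of_set N). \<sigma> z \<in> {\<sigma> z0}}"
    by (rule openin_continuous_map_preimage[of _ "discrete_topology V"]) (use assms flat_const_in[OF assms(1,3)] in \<open>auto simp: flat_const_iff\<close>)
  then show "open {z \<in> N. \<sigma> z \<in> {\<sigma> z0}}" using assms(2) by (simp add: openin_open_eq)
qed (use assms in auto)

lemma hval_Nil [simp]: "hval [] z = 0" and hnabla_Nil [simp]: "hnabla [] z = 0"
  and hval_Cons: "hval (x # ps) z = ctens (fst x z) (snd x z) + hval ps z"
  and hnabla_Cons: "hnabla (x # ps) z = ctens (deriv (fst x) z) (snd x z) + hnabla ps z"
  by (simp_all add: hval_def hnabla_def split_beta)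

text \<open>Flat sections of a constant system are locally constant, so \<open>\<nabla>\<close>
  differentiates the coordinates, whatever expression represents the section.\<close>

lemma hval_deriv:
  assumes "ps \<in> hexprs (prod_topology (top_of_set U) (discrete_topology V)) N" "open N" "z \<in> N"
  shows "((\<lambda>w. lookup (hval ps w) j) has_field_derivative lookup (hnabla ps z) j) (at z)"
  using assms(1)
proof (induction ps)
  case Nil then show ?case by simp
next
  case (Cons x ps)
  obtain f \<sigma> where x: "x = (f, \<sigma>)" by (cases x)
  have f: "f holomorphic_on N" and \<sigma>: "flat_section (prod_topology (top_of_set U) (discrete_topology V)) N \<sigma>"
    and ps: "ps \<in> hexprs (prod_topology (top_of_set U) (discrete_topology V)) N"
    using Cons.prems by (auto simp: hexprs_def x)
  obtain N' where N': "open N'" "z \<in> N'" "N' \<subseteq> N" "\<And>w. w \<in> N' \<Longrightarrow> \<sigma> w = \<sigma> z"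
    using flat_locally_const[OF \<sigma> assms(2,3)] by blast
  let ?c = "of_rat (lookup (\<sigma> z) j) :: complex"
  have "(f has_field_derivative deriv f z) (at z)" using holomorphic_derivI[OF f assms(2,3)] .
  from DERIV_cmult_right[OF this, of ?c]
  have "((\<lambda>w. f w * ?c) has_field_derivative deriv f z * ?c) (at z)" by simp
  then have "((\<lambda>w. f w * of_rat (lookup (\<sigma> w) j)) has_field_derivative deriv f z * ?c) (at z)"
    by (rule has_field_derivative_transform_within_open[OF _ N'(1,2)]) (use N'(4) in simp)
  from DERIV_add[OF this Cons.IH[OF ps]] show ?case
    by (simp add: hval_Cons hnabla_Cons x Poly_Mapping.lookup_add)
qed

lemma hval_map_list:
  "distinct xs \<Longrightarrow> hval (map (\<lambda>j. (f j, \<sigma> j)) xs) z = (\<Sum>j\<in>set xs. ctens (f j z) (\<sigma> j z))"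
  and hnabla_map_list:
  "distinct xs \<Longrightarrow> hnabla (map (\<lambda>j. (f j, \<sigma> j)) xs) z = (\<Sum>j\<in>set xs. ctens (deriv (f j) z) (\<sigma> j z))"
  by (simp_all add: hval_def hnabla_def o_def sum_list_distinct_conv_sum_set)

section \<open>The category of variations\<close>

lemma variation_homD:
  assumes "f \<in> variation_hom U X Y"
  shows "z \<in> U \<Longrightarrow> qlinear (vt_fib X z) (vt_fib Y z) (f z)"
    and "z \<in> U \<Longrightarrow> v \<in> vt_fib X z \<Longrightarrow> f z v \<in> vt_fib Y z"
    and "z \<notin> U \<or> v \<notin> vt_fib X z \<Longrightarrow> f z v = 0"
    and "continuous_map (vt_top X) (vt_top Y) (\<lambda>(z, v). (z, f z v))"
    and "z \<in> U \<Longrightarrow> f z ` vt_W X m z \<subseteq> vt_W Y m z"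
    and "z \<in> U \<Longrightarrow> complexified_maps (vt_fib X z) (f z) (vt_F X p z) (vt_F Y p z)"
proof -
  note a = assms[unfolded variation_hom_def mem_Collect_eq]
  show 1: "z \<in> U \<Longrightarrow> qlinear (vt_fib X z) (vt_fib Y z) (f z)" using a by (elim conjE) simp
  show "z \<in> U \<Longrightarrow> v \<in> vt_fib X z \<Longrightarrow> f z v \<in> vt_fib Y z" using 1 by (auto simp: qlinear_def)
  show "z \<notin> U \<or> v \<notin> vt_fib X z \<Longrightarrow> f z v = 0" using a by (elim conjE) simp
  show "continuous_map (vt_top X) (vt_top Y) (\<lambda>(z, v). (z, f z v))" using a by (elim conjE)
  show "z \<in> U \<Longrightarrow> f z ` vt_W X m z \<subseteq> vt_W Y m z" using a by (elim conjE) simp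
  show "z \<in> U \<Longrightarrow> complexified_maps (vt_fib X z) (f z) (vt_F X p z) (vt_F Y p z)" using a by (elim conjE) simp
qed

lemma category_variation_cat: "category (variation_cat U)"
proof -
  have sub: "pm.subspace (vt_fib X z)" if "X \<in> ob (variation_cat U)" "z \<in> U" for X z
    using that findim_subspace by (auto simp: variation_cat_def HT_variation_def local_system_def)
  have top: "topspace (vt_top X) = Sigma U (vt_fib X)" if "X \<in> ob (variation_cat U)" for X
    using that by (auto simp: variation_cat_def HT_variation_def local_system_def)
  have Wf: "vt_W X m z \<subseteq> vt_fib X z" if "X \<in> ob (variation_cat U)" "z \<in> U" for X m z
    using that by (auto simp: variation_cat_def HT_variation_def)
  have z0: "\<phi> z 0 = 0" if "\<phi> \<in> variation_hom U X Y" "X \<in> ob (variation_cat U)" for \<phi> X Y z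
  proof (cases "z \<in> U")
    case True
    then have "qlinear (vt_fib X z) (vt_fib Y z) (\<phi> z)" by (rule variation_homD(1)[OF that(1)])
    then show ?thesis using pm.subspace_0[OF sub[OF that(2) True]] unfolding qlinear_def by (metis pm.scale_zero_left)
  next
    case False then show ?thesis by (intro variation_homD(3)[OF that(1)]) simp
  qed
  show ?thesis
    unfolding category_def
  proof (intro conjI ballI)
    fix X assume X: "X \<in> ob (variation_cat U)"
    have "(\<lambda>z v. if z \<in> U \<and> v \<in> vt_fib X z then v else 0) \<in> variation_hom U X X"
      unfolding variation_hom_def
    proof (intro CollectI conjI allI ballI impI)
      fix z assume z: "z \<in> U"
      show "qlinear (vt_fib X z) (vt_fib X z) (\<lambda>v. if z \<in> U \<and> v \<in> vt_fib X z then v else 0)"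
        using sub[OF X z] z by (auto simp: qlinear_def pm.subspace_add pm.subspace_scale)
      show "(\<lambda>v. if z \<in> U \<and> v \<in> vt_fib X z then v else 0) ` vt_W X m z \<subseteq> vt_W X m z" for m
        using Wf[OF X z, of m] z by auto
      show "complexified_maps (vt_fib X z) (\<lambda>v. if z \<in> U \<and> v \<in> vt_fib X z then v else 0) (vt_F X p z) (vt_F X p z)" for p
        unfolding complexified_maps_def
      proof (intro allI impI)
        fix cs :: "(complex \<times> qvec) list" assume a: "snd ` set cs \<subseteq> vt_fib X z \<and> (\<Sum>(c, v)\<leftarrow>cs. ctens c v) \<in> vt_F X p z"
        have e: "map (\<lambda>(c, v). ctens c (if z \<in> U \<and> v \<in> vt_fib X z then v else 0)) cs = map (\<lambda>(c, v). ctens c v) cs"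
          using a z by (intro map_cong) auto
        show "(\<Sum>(c, v)\<leftarrow>cs. ctens c (if z \<in> U \<and> v \<in> vt_fib X z then v else 0)) \<in> vt_F X p z" unfolding e using a by blast
      qed
    next
      show "continuous_map (vt_top X) (vt_top X) (\<lambda>(z, v). (z, if z \<in> U \<and> v \<in> vt_fib X z then v else 0))"
        by (rule continuous_map_eq[OF continuous_map_id]) (auto simp: top[OF X])
    qed auto
    then show "idn (variation_cat U) X \<in> hom (variation_cat U) X X" by (simp add: variation_cat_def)
  next
    fix X Y Z f g
    assume o: "X \<in> ob (variation_cat U)" "Y \<in> ob (variation_cat U)" "Z \<in> ob (variation_cat U)"
      and h: "f \<in> hom (variation_cat U) X Y" "g \<in> hom (variation_cat U) Y Z"
    have f: "f \<in> variation_hom U X Y" and g: "g \<in> variation_hom U Y Z" using h by (simp_all add: variation_cat_def)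
    have fin: "f z v \<in> vt_fib Y z" if "z \<in> U" "v \<in> vt_fib X z" for z v
      by (rule variation_homD(2)[OF f that])
    have "(\<lambda>z v. g z (f z v)) \<in> variation_hom U X Z"
      unfolding variation_hom_def
    proof (intro CollectI conjI allI ballI impI)
      fix z assume z: "z \<in> U"
      have qf: "qlinear (vt_fib X z) (vt_fib Y z) (f z)" and qg: "qlinear (vt_fib Y z) (vt_fib Z z) (g z)"
        by (rule variation_homD(1)[OF f z], rule variation_homD(1)[OF g z])
      show "qlinear (vt_fib X z) (vt_fib Z z) (\<lambda>v. g z (f z v))"
        using qf qg fin[OF z] unfolding qlinear_def by (auto simp: image_subset_iff)
      show "(\<lambda>v. g z (f z v)) ` vt_W X m z \<subseteq> vt_W Z m z" for m
        using variation_homD(5)[OF f z, of m] variation_homD(5)[OF g z, of m] by blast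
      fix p
      have cf: "complexified_maps (vt_fib X z) (f z) (vt_F X p z) (vt_F Y p z)"
        and cg: "complexified_maps (vt_fib Y z) (g z) (vt_F Y p z) (vt_F Z p z)"
        by (rule variation_homD(6)[OF f z], rule variation_homD(6)[OF g z])
      show "complexified_maps (vt_fib X z) (\<lambda>v. g z (f z v)) (vt_F X p z) (vt_F Z p z)"
        unfolding complexified_maps_def
      proof (intro allI impI)
        fix cs :: "(complex \<times> qvec) list" assume a: "snd ` set cs \<subseteq> vt_fib X z \<and> (\<Sum>(c, v)\<leftarrow>cs. ctens c v) \<in> vt_F X p z"
        let ?ds = "map (\<lambda>(c, v). (c, f z v)) cs"
        have e1: "map (\<lambda>(c, v). ctens c v) ?ds = map (\<lambda>(c, v). ctens c (f z v)) cs"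
          and e2: "map (\<lambda>(c, v). ctens c (g z v)) ?ds = map (\<lambda>(c, v). ctens c (g z (f z v))) cs"
          by (simp_all add: o_def split_beta)
        have "(\<Sum>(c, v)\<leftarrow>?ds. ctens c v) \<in> vt_F Y p z"
          unfolding e1 using cf a unfolding complexified_maps_def by blast
        moreover have "snd ` set ?ds \<subseteq> vt_fib Y z" using a fin[OF z] by force
        ultimately have "(\<Sum>(c, v)\<leftarrow>?ds. ctens c (g z v)) \<in> vt_F Z p z"
          using cg unfolding complexified_maps_def by blast
        then show "(\<Sum>(c, v)\<leftarrow>cs. ctens c (g z (f z v))) \<in> vt_F Z p z" unfolding e2 .
      qed
    next
      fix z v assume "z \<notin> U \<or> v \<notin> vt_fib X z"
      then have "f z v = 0" by (rule variation_homD(3)[OF f])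
      then show "g z (f z v) = 0" using z0[OF g o(2)] by simp
    next
      have "continuous_map (vt_top X) (vt_top Y) (\<lambda>(z, v). (z, f z v))" "continuous_map (vt_top Y) (vt_top Z) (\<lambda>(z, v). (z, g z v))"
        by (rule variation_homD(4)[OF f], rule variation_homD(4)[OF g])
      from continuous_map_compose[OF this]
      show "continuous_map (vt_top X) (vt_top Z) (\<lambda>(z, v). (z, g z (f z v)))" by (simp add: o_def case_prod_unfold)
    qed
    then show "cmp (variation_cat U) g f \<in> hom (variation_cat U) X Z" by (simp add: variation_cat_def)
  next
    fix X Y f
    assume o: "X \<in> ob (variation_cat U)" "Y \<in> ob (variation_cat U)" and "f \<in> hom (variation_cat U) X Y"
    then have f: "f \<in> variation_hom U X Y" by (simp add: variation_cat_def)
    have out: "f z v = 0" if "z \<notin> U \<or> v \<notin> vt_fib X z" for z v by (rule variation_homD(3)[OF f that])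
    have fin: "f z v \<in> vt_fib Y z" if "z \<in> U" "v \<in> vt_fib X z" for z v
      by (rule variation_homD(2)[OF f that])
    show "cmp (variation_cat U) f (idn (variation_cat U) X) = f"
      using out z0[OF f o(1)] by (fastforce simp: variation_cat_def fun_eq_iff)
    show "cmp (variation_cat U) (idn (variation_cat U) Y) f = f"
      using out fin by (fastforce simp: variation_cat_def fun_eq_iff)
  qed (simp add: variation_cat_def)
qed

section \<open>The variation of a period matrix\<close>

context period begin

definition s :: "nat \<Rightarrow> complex \<Rightarrow> cvec" where
  "s i z = (\<Sum>j\<in>I. single j (S i j z))"

lemma lookup_s: "lookup (s i z) j = (if j \<in> I then S i j z else 0)"
  using fin_I by (simp add: s_def Poly_Mapping.lookup_sum Poly_Mapping.lookup_single when_def)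

definition B :: variation where
  "B = \<lparr> vt_fib = (\<lambda>_. supp_in I), vt_top = prod_topology (top_of_set U) (discrete_topology (supp_in I)),
     vt_W = (\<lambda>m _. supp_in {i\<in>I. 2 * d i \<le> m}),
     vt_F = (\<lambda>p z. pm.span ((\<lambda>i. s i z) ` {i\<in>I. p \<le> d i})) \<rparr>"

lemma B_simps [simp]: "vt_fib B z = supp_in I"
  "vt_top B = prod_topology (top_of_set U) (discrete_topology (supp_in I))"
  "vt_W B m z = supp_in {i\<in>I. 2 * d i \<le> m}"
  "vt_F B p z = pm.span ((\<lambda>i. s i z) ` {i\<in>I. p \<le> d i})"
  by (simp_all add: B_def)

lemma unipotent_s: "z \<in> U \<Longrightarrow> unipotent I d (\<lambda>i. s i z)"
  by unfold_locales (auto simp: fin_I lookup_s S_diag S_tri)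

lemma holo_section_s: "i \<in> I \<Longrightarrow> holo_section (vt_top B) U (s i)"
  unfolding holo_section_def
proof
  fix z0 assume i: "i \<in> I" and "z0 \<in> U"
  let ?xs = "sorted_list_of_set I"
  let ?ps = "map (\<lambda>j. (S i j, \<lambda>_. single j 1)) ?xs"
  have "?ps \<in> hexprs (vt_top B) U"
    using S_holo[OF i] fin_I by (auto simp: hexprs_def holo_funs_def intro!: flat_const single_in_supp)
  moreover have "s i z = hval ?ps z" for z
  proof -
    have "ctens (S i j z) (single j 1) = single j (S i j z)" for j
      by (rule poly_mapping_eqI) (simp add: Poly_Mapping.lookup_single when_def)
    then show ?thesis using fin_I by (simp add: hval_map_list s_def)
  qed
  ultimately show "\<exists>N' ps. open N' \<and> z0 \<in> N' \<and> N' \<subseteq> U \<and> ps \<in> hexprs (vt_top B) N' \<and> (\<forall>z\<in>N'. s i z = hval ps z)"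
    using U_open \<open>z0 \<in> U\<close> by blast
qed

text \<open>A section of \<open>F p\<close> has holomorphic coefficients in the frame of rows, so it
  can be differentiated termwise; by \<open>S_ode\<close> the derivative of row \<open>i\<close> is
  a combination of rows of degree \<open>d i - 1\<close>.\<close>

lemma griffiths_B: "griffiths_transversal U (vt_top B) (vt_F B)"
  unfolding griffiths_transversal_def
proof (intro allI impI ballI)
  fix p N ps z0
  assume a: "open N \<and> N \<subseteq> U \<and> ps \<in> hexprs (vt_top B) N \<and> (\<forall>z\<in>N. hval ps z \<in> vt_F B p z)" and z0: "z0 \<in> N"
  have N: "open N" "N \<subseteq> U" using a by blast+
  let ?K = "{i\<in>I. p \<le> d i}"
  have fK: "finite ?K" using fin_I by simp
  have "\<forall>z\<in>N. \<exists>c. hval ps z = (\<Sum>i\<in>?K. scl (c i) (s i z))"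
  proof
    fix z assume "z \<in> N"
    then have "hval ps z \<in> pm.span ((\<lambda>i. s i z) ` ?K)" using a by simp
    then obtain c where "hval ps z = (\<Sum>i\<in>?K. scl (c i) (s i z))" by (rule span_image_sum[OF fK])
    then show "\<exists>c. hval ps z = (\<Sum>i\<in>?K. scl (c i) (s i z))" by blast
  qed
  \<comment> \<open>The coefficients are chosen point by point. They solve a linear system with
    holomorphic entries whose homogeneous version at \<open>z0\<close> has only the zero solution,
    and this makes them holomorphic near \<open>z0\<close>.\<close>
  from bchoice[OF this] obtain c where c: "\<And>z. z \<in> N \<Longrightarrow> hval ps z = (\<Sum>i\<in>?K. scl (c z i) (s i z))" by blast
  have der: "((\<lambda>w. lookup (hval ps w) j) has_field_derivative lookup (hnabla ps z) j) (at z)" if "z \<in> N" for z j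
    by (rule hval_deriv[of ps U "supp_in I" N z j]) (use a that in simp_all)
  have lk: "lookup (hval ps z) j = (\<Sum>i\<in>?K. S i j z * c z i)" if "z \<in> N" "j \<in> I" for z j
    using that by (simp add: c Poly_Mapping.lookup_sum lookup_s mult.commute)
  have "\<exists>N'. open N' \<and> z0 \<in> N' \<and> N' \<subseteq> N \<and> (\<forall>i\<in>?K. (\<lambda>z. c z i) holomorphic_on N')"
  proof (rule holomorphic_solution[OF fK N(1) z0, of I "\<lambda>j i. S i j" "\<lambda>j z. lookup (hval ps z) j" "\<lambda>i z. c z i"])
    show "S i j holomorphic_on N" if "j \<in> I" "i \<in> ?K" for i j
      using S_holo[of i j] that N(2) by (auto simp: holo_funs_def intro: holomorphic_on_subset)
    show "(\<lambda>z. lookup (hval ps z) j) holomorphic_on N" for j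
      using der by (auto simp: holomorphic_on_def field_differentiable_def intro: DERIV_subset[OF _ subset_UNIV])
    show "(\<Sum>i\<in>?K. S i j z * c z i) = lookup (hval ps z) j" if "j \<in> I" "z \<in> N" for j z using lk that by simp
    interpret u: unipotent I d "\<lambda>i. s i z0" using unipotent_s z0 N(2) by blast
    show "\<forall>i\<in>?K. x i = 0" if x: "\<And>j. j \<in> I \<Longrightarrow> (\<Sum>i\<in>?K. S i j z0 * x i) = 0" for x
    proof
      fix i assume i: "i \<in> ?K"
      show "x i = 0"
      proof (rule u.coeff_zero[of ?K p x])
        fix j assume "j \<in> ?K"
        then show "lookup (\<Sum>i\<in>?K. scl (x i) (s i z0)) j = 0" using x[of j] by (simp add: Poly_Mapping.lookup_sum lookup_s mult.commute)
      qed (use i in auto)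
    qed
  qed
  then obtain N' where N': "open N'" "z0 \<in> N'" "N' \<subseteq> N" "\<And>i. i \<in> ?K \<Longrightarrow> (\<lambda>z. c z i) holomorphic_on N'" by blast
  have zU: "z0 \<in> U" using z0 N(2) by blast
  let ?c' = "\<lambda>i. deriv (\<lambda>z. c z i) z0"
  have "hnabla ps z0 = (\<Sum>i\<in>?K. scl (?c' i) (s i z0)) + (\<Sum>i\<in>?K. scl (c z0 i) (\<Sum>l\<in>{l\<in>I. d l = d i - 1}. scl (deriv (S i l) z0) (s l z0)))"
    (is "_ = ?R")
  proof (rule poly_mapping_eqI)
    fix j
    show "lookup (hnabla ps z0) j = lookup ?R j"
    proof (cases "j \<in> I")
      case True
      have "((\<lambda>z. \<Sum>i\<in>?K. S i j z * c z i) has_field_derivative (\<Sum>i\<in>?K. S i j z0 * ?c' i + deriv (S i j) z0 * c z0 i)) (at z0)"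
      proof (rule DERIV_sum)
        fix i assume i: "i \<in> ?K"
        have 1: "(S i j has_field_derivative deriv (S i j) z0) (at z0)"
          using S_holo[of i j] i True zU U_open by (auto simp: holo_funs_def intro: holomorphic_derivI)
        have 2: "((\<lambda>z. c z i) has_field_derivative ?c' i) (at z0)" using holomorphic_derivI[OF N'(4)[OF i] N'(1,2)] .
        from DERIV_mult[OF 1 2] show "((\<lambda>z. S i j z * c z i) has_field_derivative S i j z0 * ?c' i + deriv (S i j) z0 * c z0 i) (at z0)"
          by (simp add: add.commute mult.commute)
      qed
      then have "((\<lambda>z. lookup (hval ps z) j) has_field_derivative (\<Sum>i\<in>?K. S i j z0 * ?c' i + deriv (S i j) z0 * c z0 i)) (at z0)"
        by (rule has_field_derivative_transform_within_open[OF _ N(1) z0]) (use lk True in simp)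
      from DERIV_unique[OF der[OF z0, of j] this]
      have "lookup (hnabla ps z0) j = (\<Sum>i\<in>?K. S i j z0 * ?c' i + deriv (S i j) z0 * c z0 i)" .
      also have "\<dots> = (\<Sum>i\<in>?K. ?c' i * S i j z0 + c z0 i * (\<Sum>l\<in>{l\<in>I. d l = d i - 1}. deriv (S i l) z0 * S l j z0))"
        by (rule sum.cong[OF refl]) (use S_ode[OF _ True zU] in \<open>auto simp: mult.commute\<close>)
      also have "\<dots> = lookup ?R j" using True by (simp add: Poly_Mapping.lookup_add Poly_Mapping.lookup_sum lookup_s sum.distrib)
      finally show ?thesis .
    next
      case False
      have "((\<lambda>_. 0 :: complex) has_field_derivative 0) (at z0)" by simp
      then have "((\<lambda>z. lookup (hval ps z) j) has_field_derivative 0) (at z0)"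
        by (rule has_field_derivative_transform_within_open[OF _ N(1) z0]) (use False in \<open>simp add: c Poly_Mapping.lookup_sum lookup_s\<close>)
      from DERIV_unique[OF der[OF z0, of j] this] show ?thesis using False by (simp add: Poly_Mapping.lookup_add Poly_Mapping.lookup_sum lookup_s)
    qed
  qed
  also have "\<dots> \<in> vt_F B (p - 1) z0"
    unfolding B_simps
    by (intro pm.span_add pm.span_sum pm.span_scale; intro pm.span_base; auto)
  finally show "hnabla ps z0 \<in> vt_F B (p - 1) z0" .
qed

lemma HT_variation_B: "HT_variation U B"
  unfolding HT_variation_def
proof (intro conjI allI ballI)
  show "local_system U (vt_top B) (vt_fib B)"
    using local_system_const[OF U_open findim_supp_in[OF fin_I]] by (simp add: B_def)
  show "vt_W B m z \<subseteq> vt_W B (m + 1) z" "vt_W B m z \<subseteq> vt_fib B z" for m z by (auto simp: supp_in_def)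
  show "local_system U (subtopology (vt_top B) (Sigma U (vt_W B m))) (vt_W B m)" for m
  proof -
    have sub: "supp_in {i\<in>I. 2 * d i \<le> m} \<subseteq> (supp_in I :: qvec set)" by (auto simp: supp_in_def)
    have "findim (supp_in {i\<in>I. 2 * d i \<le> m})" using fin_I by (intro findim_supp_in) simp
    from local_system_const[OF U_open this] show ?thesis by (simp add: B_def subtopology_const_total[OF sub])
  qed
  obtain K where K: "\<And>i. i \<in> I \<Longrightarrow> \<bar>d i\<bar> \<le> K"
    using finite_imageI[OF fin_I, of "\<lambda>i. \<bar>d i\<bar>"] by (metis Max_ge imageI)
  have 1: "{i\<in>I. 2 * d i \<le> - 2 * K - 2} = {}" using K by force
  have 2: "{i\<in>I. 2 * d i \<le> 2 * K} = I" using K by force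
  have "supp_in {} = {0 :: qvec}" by (auto simp: supp_in_def)
  then have "\<forall>z\<in>U. vt_W B (- 2 * K - 2) z = {0} \<and> vt_W B (2 * K) z = vt_fib B z" unfolding B_simps 1 2 by simp
  then show "\<exists>a b. \<forall>z\<in>U. vt_W B a z = {0} \<and> vt_W B b z = vt_fib B z" by blast
  show "holo_subbundle U (vt_top B) (vt_F B p)" for p
    unfolding holo_subbundle_def
  proof
    fix z0 assume z0: "z0 \<in> U"
    let ?K = "{i\<in>I. p \<le> d i}"
    let ?xs = "sorted_list_of_set ?K"
    have fK: "finite ?K" using fin_I by simp
    let ?ss = "map s ?xs"
    have "\<forall>z\<in>U. distinct (map (\<lambda>s. s z) ?ss) \<and> \<not> pm.dependent (set (map (\<lambda>s. s z) ?ss)) \<and> pm.span (set (map (\<lambda>s. s z) ?ss)) = vt_F B p z"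
    proof
      fix z assume z: "z \<in> U"
      interpret u: unipotent I d "\<lambda>i. s i z" using unipotent_s[OF z] .
      have set: "set (map (\<lambda>s. s z) ?ss) = (\<lambda>i. s i z) ` ?K" using fK by (simp add: image_image)
      have "distinct (map (\<lambda>s. s z) ?ss)" using u.independent(1)[of ?K] fK by (simp add: o_def distinct_map)
      moreover have "pm.independent ((\<lambda>i. s i z) ` ?K)" by (rule u.independent(2)) auto
      ultimately show "distinct (map (\<lambda>s. s z) ?ss) \<and> \<not> pm.dependent (set (map (\<lambda>s. s z) ?ss)) \<and> pm.span (set (map (\<lambda>s. s z) ?ss)) = vt_F B p z"
        unfolding set by simp
    qed
    moreover have "\<forall>s\<in>set ?ss. holo_section (vt_top B) U s" using holo_section_s fK by auto
    ultimately show "\<exists>N ss. open N \<and> z0 \<in> N \<and> N \<subseteq> U \<and> (\<forall>s\<in>set ss. holo_section (vt_top B) N s) \<and>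
        (\<forall>z\<in>N. distinct (map (\<lambda>s. s z) ss) \<and> \<not> pm.dependent (set (map (\<lambda>s. s z) ss)) \<and> pm.span (set (map (\<lambda>s. s z) ss)) = vt_F B p z)"
      using U_open z0 by blast
  qed
  show "vt_F B (p + 1) z \<subseteq> vt_F B p z" for p z unfolding B_simps by (intro pm.span_mono) auto
  show "griffiths_transversal U (vt_top B) (vt_F B)" by (rule griffiths_B)
  show "hodge_tate (\<lambda>m. vt_W B m z) (\<lambda>p. vt_F B p z)" if "z \<in> U" for z
    using hodge_tate_unipotent[OF unipotent_s[OF that]] by simp
qed

end

section \<open>Local systems on a disc\<close>

locale locsys =
  fixes U :: "complex set" and T :: "(complex \<times> qvec) topology" and H :: "complex \<Rightarrow> qvec set"
  assumes ls: "local_system U T H"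
begin

definition triv :: "complex set \<Rightarrow> qvec set \<Rightarrow> (complex \<Rightarrow> qvec \<Rightarrow> qvec) \<Rightarrow> bool" where
  "triv N V \<tau> \<longleftrightarrow> open N \<and> N \<subseteq> U \<and> findim V \<and> (\<forall>z\<in>N. qlinear V (H z) (\<tau> z)) \<and>
     homeomorphic_map (prod_topology (top_of_set N) (discrete_topology V))
          (subtopology T (Sigma N H)) (\<lambda>(z, v). (z, \<tau> z v))"

lemma triv_exists: "z \<in> U \<Longrightarrow> \<exists>N V \<tau>. z \<in> N \<and> triv N V \<tau>"
  using ls unfolding local_system_def triv_def by blast

lemma topspace_T: "topspace T = Sigma U H" and findim_H: "z \<in> U \<Longrightarrow> findim (H z)"
  and cont_fst: "continuous_map T (top_of_set U) fst"
  using ls unfolding local_system_def by blast+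

lemma triv_bij: assumes "triv N V \<tau>" "z \<in> N" shows "bij_betw (\<tau> z) V (H z)"
proof -
  let ?h = "\<lambda>(z, v). (z, \<tau> z v)"
  have h: "homeomorphic_map (prod_topology (top_of_set N) (discrete_topology V)) (subtopology T (Sigma N H)) ?h" and NU: "N \<subseteq> U"
    using assms(1) unfolding triv_def by blast+
  have inj: "inj_on ?h (N \<times> V)" using homeomorphic_imp_injective_map[OF h] by simp
  have "Sigma U H \<inter> Sigma N H = Sigma N H" using NU by auto
  then have im: "?h ` (N \<times> V) = Sigma N H" using homeomorphic_imp_surjective_map[OF h] by (simp add: topspace_T)
  show ?thesis
    unfolding bij_betw_def
  proof
    show "inj_on (\<tau> z) V"
    proof (rule inj_onI)
      fix u v assume "u \<in> V" "v \<in> V" "\<tau> z u = \<tau> z v"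
      then show "u = v" using inj_onD[OF inj, of "(z, u)" "(z, v)"] assms(2) by auto
    qed
    show "\<tau> z ` V = H z"
    proof
      show "\<tau> z ` V \<subseteq> H z"
      proof
        fix x assume "x \<in> \<tau> z ` V"
        then have "(z, x) \<in> ?h ` (N \<times> V)" using assms(2) by force
        then show "x \<in> H z" unfolding im by simp
      qed
      show "H z \<subseteq> \<tau> z ` V"
      proof
        fix x assume "x \<in> H z"
        then have "(z, x) \<in> ?h ` (N \<times> V)" unfolding im using assms(2) by simp
        then show "x \<in> \<tau> z ` V" by auto
      qed
    qed
  qed
qed

lemma triv_sheet_open:
  assumes "triv N V \<tau>" "u \<in> V" "open N'" "N' \<subseteq> N"
  shows "openin T {(z, \<tau> z u) | z. z \<in> N'}"
proof -
  let ?h = "\<lambda>(z, v). (z, \<tau> z v)"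
  have h: "homeomorphic_map (prod_topology (top_of_set N) (discrete_topology V)) (subtopology T (Sigma N H)) ?h"
    and NU: "N \<subseteq> U" "open N" using assms(1) unfolding triv_def by blast+
  have "openin (prod_topology (top_of_set N) (discrete_topology V)) (N' \<times> {u})"
    unfolding openin_prod_Times_iff using assms NU by (simp add: openin_open_eq)
  then have "openin (subtopology T (Sigma N H)) (?h ` (N' \<times> {u}))"
    using homeomorphic_map_openness_eq[OF h] by blast
  moreover have "openin T (Sigma N H)"
  proof -
    have "openin (top_of_set U) N" using NU openin_open_eq[of N U] open_openin openin_subset_trans by (metis openin_open inf.absorb_iff2)
    then have "openin T {x \<in> topspace T. fst x \<in> N}" using cont_fst by (rule openin_continuous_map_preimage[rotated])
    moreover have "{x \<in> topspace T. fst x \<in> N} = Sigma N H" using NU by (auto simp: topspace_T)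
    ultimately show ?thesis by simp
  qed
  ultimately have "openin T (?h ` (N' \<times> {u}))" by (rule openin_trans_full)
  moreover have "?h ` (N' \<times> {u}) = {(z, \<tau> z u) | z. z \<in> N'}" by auto
  ultimately show ?thesis by simp
qed

lemma flat_in: assumes "flat_section T S \<sigma>" "z \<in> S" shows "z \<in> U" "\<sigma> z \<in> H z"
  using continuous_map_image_subset_topspace[OF assms(1)[unfolded flat_section_def]] assms(2) by (auto simp: topspace_T)

text \<open>The sheet through \<open>\<sigma> z0\<close> is open in the total space, so the section
  stays in it near \<open>z0\<close>.\<close>

lemma flat_local:
  assumes f: "flat_section T S \<sigma>" and z0: "z0 \<in> S" "z0 \<in> N" and tr: "triv N V \<tau>"
  obtains u N' where "u \<in> V" "open N'" "z0 \<in> N'" "N' \<subseteq> N" "\<And>z. z \<in> N' \<inter> S \<Longrightarrow> \<sigma> z = \<tau> z u"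
proof -
  have "\<sigma> z0 \<in> \<tau> z0 ` V" using flat_in[OF f z0(1)] triv_bij[OF tr z0(2)] by (auto simp: bij_betw_def)
  then obtain u where u: "u \<in> V" "\<sigma> z0 = \<tau> z0 u" by blast
  have N: "open N" using tr triv_def by blast
  have "openin (top_of_set S) {z \<in> topspace (top_of_set S). (z, \<sigma> z) \<in> {(z, \<tau> z u) | z. z \<in> N}}"
    by (rule openin_continuous_map_preimage[OF f[unfolded flat_section_def] triv_sheet_open[OF tr u(1) N order_refl]])
  then obtain G where G: "open G" "{z \<in> S. (z, \<sigma> z) \<in> {(z, \<tau> z u) | z. z \<in> N}} = S \<inter> G"
    unfolding openin_open by auto
  show ?thesis
  proof (rule that[of u "G \<inter> N"])
    show "z0 \<in> G \<inter> N" using G(2) z0 u(2) by blast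
    show "\<sigma> z = \<tau> z u" if "z \<in> G \<inter> N \<inter> S" for z using G(2) that by blast
  qed (use u G N in auto)
qed

lemma flatI:
  assumes "\<And>z0. z0 \<in> S \<Longrightarrow> \<exists>N V \<tau> u N'. triv N V \<tau> \<and> u \<in> V \<and> open N' \<and> z0 \<in> N' \<and> N' \<subseteq> N \<and> (\<forall>z\<in>N' \<inter> S. \<sigma> z = \<tau> z u)"
  shows "flat_section T S \<sigma>"
  unfolding flat_section_def continuous_map_def
proof (intro conjI allI impI)
  show "(\<lambda>z. (z, \<sigma> z)) \<in> topspace (top_of_set S) \<rightarrow> topspace T"
  proof
    fix z assume "z \<in> topspace (top_of_set S)"
    then obtain N V \<tau> u N' where t: "triv N V \<tau>" "u \<in> V" "z \<in> N'" "N' \<subseteq> N" "\<sigma> z = \<tau> z u" using assms[of z] by auto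
    then have "\<sigma> z \<in> H z" using triv_bij[OF t(1), of z] by (auto simp: bij_betw_def)
    moreover have "z \<in> U" using t by (auto simp: triv_def)
    ultimately show "(z, \<sigma> z) \<in> topspace T" by (simp add: topspace_T)
  qed
next
  fix G assume G: "openin T G"
  show "openin (top_of_set S) {z \<in> topspace (top_of_set S). (z, \<sigma> z) \<in> G}"
  proof (subst openin_subopen, intro ballI)
    fix z0 assume z0: "z0 \<in> {z \<in> topspace (top_of_set S). (z, \<sigma> z) \<in> G}"
    then obtain N V \<tau> u N' where t: "triv N V \<tau>" "u \<in> V" "open N'" "z0 \<in> N'" "N' \<subseteq> N" "\<And>z. z \<in> N' \<inter> S \<Longrightarrow> \<sigma> z = \<tau> z u"
      using assms[of z0] by auto
    let ?h = "\<lambda>(z, v). (z, \<tau> z v)"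
    have h: "continuous_map (prod_topology (top_of_set N) (discrete_topology V)) (subtopology T (Sigma N H)) ?h"
      using t(1) unfolding triv_def by (blast intro: homeomorphic_imp_continuous_map)
    have "continuous_map (top_of_set N) (prod_topology (top_of_set N) (discrete_topology V)) (\<lambda>z. (z, u))"
      using t(2) by (simp add: continuous_map_paired)
    from continuous_map_compose[OF this h] have "continuous_map (top_of_set N) T (\<lambda>z. (z, \<tau> z u))"
      by (simp add: o_def continuous_map_in_subtopology)
    from openin_continuous_map_preimage[OF this G] have "openin (top_of_set N) {z \<in> N. (z, \<tau> z u) \<in> G}" by simp
    moreover have "open N" using t(1) triv_def by blast
    ultimately have "open {z \<in> N. (z, \<tau> z u) \<in> G}" by (simp add: openin_open_eq)
    then have "openin (top_of_set S) (S \<inter> ({z \<in> N. (z, \<tau> z u) \<in> G} \<inter> N'))" using t(3) by (intro openin_open_Int) auto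
    moreover have "z0 \<in> S \<inter> ({z \<in> N. (z, \<tau> z u) \<in> G} \<inter> N')" using z0 t(4,5) t(6)[of z0] by auto
    moreover have "S \<inter> ({z \<in> N. (z, \<tau> z u) \<in> G} \<inter> N') \<subseteq> {z \<in> topspace (top_of_set S). (z, \<sigma> z) \<in> G}" using t(6) by auto
    ultimately show "\<exists>W. openin (top_of_set S) W \<and> z0 \<in> W \<and> W \<subseteq> {z \<in> topspace (top_of_set S). (z, \<sigma> z) \<in> G}" by blast
  qed
qed

lemma flat_subset: "flat_section T S \<sigma> \<Longrightarrow> S' \<subseteq> S \<Longrightarrow> flat_section T S' \<sigma>"
  unfolding flat_section_def by (rule continuous_map_from_subtopology_mono)

lemma flat_cong: "flat_section T S \<sigma> \<Longrightarrow> (\<And>z. z \<in> S \<Longrightarrow> \<sigma> z = \<sigma>' z) \<Longrightarrow> flat_section T S \<sigma>'"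
  unfolding flat_section_def by (erule continuous_map_eq) simp

text \<open>In a common trivialisation both sections are constant near each point, so that agreement
  and disagreement are both open conditions.\<close>

lemma flat_unique:
  assumes "flat_section T S \<sigma>" "flat_section T S \<sigma>'" "connected S" "a \<in> S" "b \<in> S" "\<sigma> a = \<sigma>' a"
  shows "\<sigma> b = \<sigma>' b"
proof -
  have "\<forall>z0\<in>S. eventually (\<lambda>z. (\<sigma> z0 = \<sigma>' z0) = (\<sigma> z = \<sigma>' z)) (at z0 within S)"
  proof
    fix z0 assume z0: "z0 \<in> S"
    obtain N V \<tau> where t: "z0 \<in> N" "triv N V \<tau>" using triv_exists[OF flat_in(1)[OF assms(1) z0]] by blast
    obtain u N1 where 1: "u \<in> V" "open N1" "z0 \<in> N1" "N1 \<subseteq> N" "\<And>z. z \<in> N1 \<inter> S \<Longrightarrow> \<sigma> z = \<tau> z u"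
      using flat_local[OF assms(1) z0 t] by blast
    obtain v N2 where 2: "v \<in> V" "open N2" "z0 \<in> N2" "N2 \<subseteq> N" "\<And>z. z \<in> N2 \<inter> S \<Longrightarrow> \<sigma>' z = \<tau> z v"
      using flat_local[OF assms(2) z0 t] by blast
    have e: "(\<sigma> z = \<sigma>' z) = (u = v)" if "z \<in> N1 \<inter> N2 \<inter> S" for z
    proof -
      have "inj_on (\<tau> z) V" using triv_bij[OF t(2), of z] that 1(4) by (auto simp: bij_betw_def)
      then show ?thesis using 1(1) 1(5)[of z] 2(1) 2(5)[of z] that by (auto dest: inj_onD)
    qed
    show "eventually (\<lambda>z. (\<sigma> z0 = \<sigma>' z0) = (\<sigma> z = \<sigma>' z)) (at z0 within S)"
      unfolding eventually_at_topological
      by (intro exI[of _ "N1 \<inter> N2"]) (use 1 2 z0 e in auto)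
  qed
  from connected_local_const[OF assms(3,4,5) this] show ?thesis using assms(6) by simp
qed

lemma flat_lincomb:
  assumes "S \<subseteq> U" "\<And>i. i \<in> J \<Longrightarrow> flat_section T S (\<sigma> i)" "finite J"
  shows "flat_section T S (\<lambda>z. \<Sum>i\<in>J. scl (q i) (\<sigma> i z))"
proof (rule flatI)
  fix z0 assume z0: "z0 \<in> S"
  obtain N V \<tau> where t: "z0 \<in> N" "triv N V \<tau>" using triv_exists[of z0] z0 assms(1) by blast
  have "\<forall>i\<in>J. \<exists>u N'. u \<in> V \<and> open N' \<and> z0 \<in> N' \<and> N' \<subseteq> N \<and> (\<forall>z\<in>N' \<inter> S. \<sigma> i z = \<tau> z u)"
  proof
    fix i assume "i \<in> J"
    from flat_local[OF assms(2)[OF this] z0 t]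
    show "\<exists>u N'. u \<in> V \<and> open N' \<and> z0 \<in> N' \<and> N' \<subseteq> N \<and> (\<forall>z\<in>N' \<inter> S. \<sigma> i z = \<tau> z u)" by metis
  qed
  then obtain u N' where u: "\<And>i. i \<in> J \<Longrightarrow> u i \<in> V \<and> open (N' i) \<and> z0 \<in> N' i \<and> N' i \<subseteq> N \<and> (\<forall>z\<in>N' i \<inter> S. \<sigma> i z = \<tau> z (u i))"
    by metis
  have V: "pm.subspace V" and q: "\<And>z. z \<in> N \<Longrightarrow> qlinear V (H z) (\<tau> z)" and oN: "open N" using t(2) findim_subspace unfolding triv_def by blast+
  let ?N = "N \<inter> (\<Inter>i\<in>J. N' i)"
  have "open ?N" using u assms(3) oN by (intro open_Int open_INT) auto
  moreover have "(\<Sum>i\<in>J. scl (q i) (u i)) \<in> V" using u V by (auto intro!: pm.subspace_sum pm.subspace_scale)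
  moreover have "(\<Sum>i\<in>J. scl (q i) (\<sigma> i z)) = \<tau> z (\<Sum>i\<in>J. scl (q i) (u i))" if "z \<in> ?N \<inter> S" for z
  proof -
    have "\<tau> z (\<Sum>i\<in>J. scl (q i) (u i)) = (\<Sum>i\<in>J. scl (q i) (\<tau> z (u i)))"
      by (rule qlinear_sum[OF q V]) (use that u in auto)
    also have "\<dots> = (\<Sum>i\<in>J. scl (q i) (\<sigma> i z))" by (rule sum.cong) (use that u in auto)
    finally show ?thesis by simp
  qed
  moreover have "z0 \<in> ?N" using u t by auto
  ultimately show "\<exists>N V \<tau> v N'. triv N V \<tau> \<and> v \<in> V \<and> open N' \<and> z0 \<in> N' \<and> N' \<subseteq> N \<and> (\<forall>z\<in>N' \<inter> S. (\<Sum>i\<in>J. scl (q i) (\<sigma> i z)) = \<tau> z v)"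
    using t(2) by blast
qed

text \<open>For \<open>K = U\<close> this is triviality of the local system. The set
  \<open>K\<close> need not be open, which permits gluing over closed cells.\<close>

definition ext :: "complex set \<Rightarrow> bool" where
  "ext K \<longleftrightarrow> K \<subseteq> U \<and> (\<forall>z\<in>K. \<forall>v\<in>H z. \<exists>\<sigma>. flat_section T K \<sigma> \<and> \<sigma> z = v)"

lemma ext_small: assumes "triv N V \<tau>" "K \<subseteq> N" shows "ext K"
  unfolding ext_def
proof (intro conjI ballI)
  show "K \<subseteq> U" using assms by (auto simp: triv_def)
  fix z v assume z: "z \<in> K" "v \<in> H z"
  then have "z \<in> N" using assms(2) by blast
  then have "v \<in> \<tau> z ` V" using triv_bij[OF assms(1)] z(2) by (simp add: bij_betw_def)
  then obtain u where u: "u \<in> V" "\<tau> z u = v" by blast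
  have "flat_section T K (\<lambda>z. \<tau> z u)"
  proof (rule flatI)
    fix z0 assume "z0 \<in> K"
    moreover have "open N" using assms(1) by (simp add: triv_def)
    ultimately show "\<exists>N V \<tau>' u' N'. triv N V \<tau>' \<and> u' \<in> V \<and> open N' \<and> z0 \<in> N' \<and> N' \<subseteq> N \<and> (\<forall>z\<in>N' \<inter> K. \<tau> z u = \<tau>' z u')"
      using assms u(1) by blast
  qed
  then show "\<exists>\<sigma>. flat_section T K \<sigma> \<and> \<sigma> z = v" using u by blast
qed

text \<open>Connectedness of the union makes the closed pieces meet, and sections that agree at one
  point of the connected intersection agree on all of it. The glued section is flat because a point
  of one piece only has a neighbourhood that misses the other.\<close>

lemma ext_union_aux:
  assumes e: "ext K1" "ext K2" and cl: "closed K1" "closed K2" and con: "connected (K1 \<union> K2)" "connected (K1 \<inter> K2)"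
    and z: "z \<in> K1" "v \<in> H z"
  shows "\<exists>\<sigma>. flat_section T (K1 \<union> K2) \<sigma> \<and> \<sigma> z = v"
proof -
  obtain \<sigma>1 where s1: "flat_section T K1 \<sigma>1" "\<sigma>1 z = v" using e(1) z unfolding ext_def by blast
  show ?thesis
  proof (cases "K2 = {}")
    case True then show ?thesis using s1 by auto
  next
    case False
    have "K1 \<inter> K2 \<noteq> {}"
    proof
      assume "K1 \<inter> K2 = {}"
      then have "K1 \<inter> (K1 \<union> K2) = {} \<or> K2 \<inter> (K1 \<union> K2) = {}"
        using connected_closedD[OF con(1), of K1 K2] cl by blast
      then show False using z(1) False by blast
    qed
    then obtain y where y: "y \<in> K1" "y \<in> K2" by blast
    obtain \<sigma>2 where s2: "flat_section T K2 \<sigma>2" "\<sigma>2 y = \<sigma>1 y" using e(2) y flat_in[OF s1(1) y(1)] unfolding ext_def by blast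
    have agree: "\<sigma>1 x = \<sigma>2 x" if "x \<in> K1 \<inter> K2" for x
      by (rule flat_unique[OF flat_subset[OF s1(1), of "K1 \<inter> K2"] flat_subset[OF s2(1), of "K1 \<inter> K2"] con(2), of y])
         (use that y s2(2) in auto)
    let ?\<sigma> = "\<lambda>x. if x \<in> K1 then \<sigma>1 x else \<sigma>2 x"
    have "flat_section T (K1 \<union> K2) ?\<sigma>"
    proof (rule flatI)
      fix z0 assume z0: "z0 \<in> K1 \<union> K2"
      have "z0 \<in> U" using z0 flat_in(1)[OF s1(1)] flat_in(1)[OF s2(1)] by blast
      then obtain N V \<tau> where t: "z0 \<in> N" "triv N V \<tau>" using triv_exists by blast
      consider "z0 \<in> K1" "z0 \<in> K2" | "z0 \<in> K1" "z0 \<notin> K2" | "z0 \<notin> K1" "z0 \<in> K2" using z0 by blast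
      then have "\<exists>u N'. u \<in> V \<and> open N' \<and> z0 \<in> N' \<and> N' \<subseteq> N \<and> (\<forall>z\<in>N' \<inter> (K1 \<union> K2). ?\<sigma> z = \<tau> z u)"
      proof cases
        case 1
        obtain u N1 where a: "u \<in> V" "open N1" "z0 \<in> N1" "N1 \<subseteq> N" "\<And>z. z \<in> N1 \<inter> K1 \<Longrightarrow> \<sigma>1 z = \<tau> z u"
          using flat_local[OF s1(1) 1(1) t] by blast
        obtain v N2 where b: "v \<in> V" "open N2" "z0 \<in> N2" "N2 \<subseteq> N" "\<And>z. z \<in> N2 \<inter> K2 \<Longrightarrow> \<sigma>2 z = \<tau> z v"
          using flat_local[OF s2(1) 1(2) t] by blast
        have "u = v" using a(1,3) a(5)[of z0] b(1,3) b(5)[of z0] 1 agree[of z0] triv_bij[OF t(2,1)] by (auto simp: bij_betw_def dest: inj_onD)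
        then show ?thesis using a b by (intro exI[of _ u] exI[of _ "N1 \<inter> N2"]) auto
      next
        case 2
        obtain u N1 where a: "u \<in> V" "open N1" "z0 \<in> N1" "N1 \<subseteq> N" "\<And>z. z \<in> N1 \<inter> K1 \<Longrightarrow> \<sigma>1 z = \<tau> z u"
          using flat_local[OF s1(1) 2(1) t] by blast
        have "open (N1 - K2)" using a(2) cl(2) by blast
        then show ?thesis using a 2 by (intro exI[of _ u] exI[of _ "N1 - K2"]) auto
      next
        case 3
        obtain u N1 where a: "u \<in> V" "open N1" "z0 \<in> N1" "N1 \<subseteq> N" "\<And>z. z \<in> N1 \<inter> K2 \<Longrightarrow> \<sigma>2 z = \<tau> z u"
          using flat_local[OF s2(1) 3(2) t] by blast
        have "open (N1 - K1)" using a(2) cl(1) by blast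
        then show ?thesis using a 3 by (intro exI[of _ u] exI[of _ "N1 - K1"]) auto
      qed
      then show "\<exists>N V \<tau> u N'. triv N V \<tau> \<and> u \<in> V \<and> open N' \<and> z0 \<in> N' \<and> N' \<subseteq> N \<and> (\<forall>z\<in>N' \<inter> (K1 \<union> K2). ?\<sigma> z = \<tau> z u)"
        using t(2) by blast
    qed
    then show ?thesis using s1(2) z(1) by (intro exI[of _ ?\<sigma>]) simp
  qed
qed

lemma ext_union:
  assumes e: "ext K1" "ext K2" and cl: "closed K1" "closed K2" and con: "connected (K1 \<union> K2)" "connected (K1 \<inter> K2)"
  shows "ext (K1 \<union> K2)"
proof -
  have "\<exists>\<sigma>. flat_section T (K1 \<union> K2) \<sigma> \<and> \<sigma> z = v" if "z \<in> K1 \<union> K2" "v \<in> H z" for z v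
  proof (cases "z \<in> K1")
    case True then show ?thesis using ext_union_aux[OF e cl con _ that(2)] by blast
  next
    case False
    then have "z \<in> K2" using that by blast
    then have "\<exists>\<sigma>. flat_section T (K2 \<union> K1) \<sigma> \<and> \<sigma> z = v"
      by (intro ext_union_aux[OF e(2,1) cl(2,1) _ _ _ that(2)]) (use con in \<open>simp_all add: Un_commute Int_commute\<close>)
    then show ?thesis by (simp add: Un_commute)
  qed
  then show ?thesis using e unfolding ext_def by blast
qed

definition box :: "complex set \<Rightarrow> real \<Rightarrow> real \<Rightarrow> real \<Rightarrow> real \<Rightarrow> complex set" where
  "box K a b c d = {x\<in>K. a \<le> Re x \<and> Re x \<le> b \<and> c \<le> Im x \<and> Im x \<le> d}"

lemma box_split_Im: "c \<le> y \<Longrightarrow> y \<le> d \<Longrightarrow> box K a b c d = box K a b c y \<union> box K a b y d"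
  and box_split_Re: "a \<le> x \<Longrightarrow> x \<le> b \<Longrightarrow> box K a b c d = box K a x c d \<union> box K x b c d"
  and box_meet_Im: "c \<le> y \<Longrightarrow> y \<le> d \<Longrightarrow> box K a b c y \<inter> box K a b y d = box K a b y y"
  and box_meet_Re: "a \<le> x \<Longrightarrow> x \<le> b \<Longrightarrow> box K a x c d \<inter> box K x b c d = box K x x c d"
  by (auto simp: box_def)

lemma box_convex_closed: assumes "convex K" "closed K" shows "convex (box K a b c d)" "closed (box K a b c d)"
proof -
  have e: "box K a b c d = K \<inter> {x. Re x \<ge> a} \<inter> {x. Re x \<le> b} \<inter> {x. Im x \<ge> c} \<inter> {x. Im x \<le> d}" by (auto simp: box_def)
  show "convex (box K a b c d)" unfolding e
    by (intro convex_Int assms convex_halfspace_Re_ge convex_halfspace_Re_le convex_halfspace_Im_ge convex_halfspace_Im_le)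
  show "closed (box K a b c d)" unfolding e
    by (intro closed_Int assms closed_halfspace_Re_ge closed_halfspace_Re_le closed_halfspace_Im_ge closed_halfspace_Im_le)
qed

text \<open>Gluing along a grid that is fine enough (Heine--Borel) for every cell to be trivialised.\<close>

lemma ext_compact_convex:
  assumes K: "convex K" "compact K" "K \<subseteq> U" shows "ext K"
proof -
  let ?C = "{N. \<exists>V \<tau>. triv N V \<tau>}"
  have sub: "K \<subseteq> \<Union>?C" using K(3) triv_exists by blast
  have opn: "open G" if "G \<in> ?C" for G using that by (auto simp: triv_def)
  obtain \<epsilon> where \<epsilon>: "\<epsilon> > 0" "\<And>x. x \<in> K \<Longrightarrow> \<exists>G\<in>?C. ball x \<epsilon> \<subseteq> G"
    using Heine_Borel_lemma[OF K(2) sub opn] by blast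
  \<comment> \<open>Two points of a square cell of side \<open>h\<close> are at most
    \<open>2 * h < \<epsilon>\<close> apart, so each cell lies in one trivialising set.\<close>
  define h where "h = \<epsilon> / 3"
  have h: "h > 0" using \<epsilon>(1) by (simp add: h_def)
  have clK: "closed K" using K(2) compact_imp_closed by blast
  have cell: "ext (box K a (a + h) b (b + h))" for a b
  proof (cases "box K a (a + h) b (b + h) = {}")
    case True then show ?thesis by (simp add: ext_def)
  next
    case False
    then obtain x where x: "x \<in> box K a (a + h) b (b + h)" by blast
    then obtain N V \<tau> where t: "triv N V \<tau>" "ball x \<epsilon> \<subseteq> N" using \<epsilon>(2)[of x] by (auto simp: box_def)
    have "box K a (a + h) b (b + h) \<subseteq> ball x \<epsilon>"
    proof
      fix y assume y: "y \<in> box K a (a + h) b (b + h)"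
      have "dist x y \<le> \<bar>Re (x - y)\<bar> + \<bar>Im (x - y)\<bar>" unfolding dist_norm by (rule cmod_le)
      also have "\<dots> \<le> h + h" using x y by (auto simp: box_def)
      also have "\<dots> < \<epsilon>" using \<epsilon>(1) by (simp add: h_def)
      finally show "y \<in> ball x \<epsilon>" by simp
    qed
    then show ?thesis using ext_small[OF t(1)] t(2) by blast
  qed
  have glue: "ext B" if "B = B1 \<union> B2" "B1 \<inter> B2 = B3" "ext B1" "ext B2" "closed B1" "closed B2" "convex B" "convex B3" for B B1 B2 B3
    using ext_union[OF that(3-6)] that convex_connected by metis
  note cc = box_convex_closed[OF K(1) clK]
  have column: "ext (box K a (a + h) b (b + real m * h))" for a b m
  proof (induction m)
    case 0
    have "ext (box K a (a + h) b (b + h))" by (rule cell)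
    moreover have "box K a (a + h) b (b + real 0 * h) \<subseteq> box K a (a + h) b (b + h)" using h by (auto simp: box_def)
    ultimately show ?case unfolding ext_def by (meson flat_subset subset_iff)
  next
    case (Suc m)
    show ?case
    proof (rule glue[OF _ _ Suc cell[of a "b + real m * h"] cc(2) cc(2) cc(1)])
      have m: "b \<le> b + real m * h" "b + real m * h \<le> b + real m * h + h" using h by simp_all
      have e: "b + real (Suc m) * h = b + real m * h + h" by (simp add: algebra_simps)
      show "box K a (a + h) b (b + real (Suc m) * h) = box K a (a + h) b (b + real m * h) \<union> box K a (a + h) (b + real m * h) (b + real m * h + h)"
        unfolding e by (rule box_split_Im[OF m])
      show "box K a (a + h) b (b + real m * h) \<inter> box K a (a + h) (b + real m * h) (b + real m * h + h) = box K a (a + h) (b + real m * h) (b + real m * h)"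
        by (rule box_meet_Im[OF m])
      show "convex (box K a (a + h) (b + real m * h) (b + real m * h))" by (rule cc)
    qed
  qed
  have rect: "ext (box K a (a + real n * h) b (b + real m * h))" for a b m n
  proof (induction n)
    case 0
    have "box K a (a + real 0 * h) b (b + real m * h) \<subseteq> box K a (a + h) b (b + real m * h)" using h by (auto simp: box_def)
    then show ?case using column[of a b m] unfolding ext_def by (meson flat_subset subset_iff)
  next
    case (Suc n)
    show ?case
    proof (rule glue[OF _ _ Suc column[of "a + real n * h" b m] cc(2) cc(2) cc(1)])
      have n: "a \<le> a + real n * h" "a + real n * h \<le> a + real n * h + h" using h by simp_all
      have e: "a + real (Suc n) * h = a + real n * h + h" by (simp add: algebra_simps)
      show "box K a (a + real (Suc n) * h) b (b + real m * h) = box K a (a + real n * h) b (b + real m * h) \<union> box K (a + real n * h) (a + real n * h + h) b (b + real m * h)"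
        unfolding e by (rule box_split_Re[OF n])
      show "box K a (a + real n * h) b (b + real m * h) \<inter> box K (a + real n * h) (a + real n * h + h) b (b + real m * h) = box K (a + real n * h) (a + real n * h) b (b + real m * h)"
        by (rule box_meet_Re[OF n])
      show "convex (box K (a + real n * h) (a + real n * h) b (b + real m * h))" by (rule cc)
    qed
  qed
  \<comment> \<open>The grid starts at the corner with both coordinates \<open>-B\<close> and makes
    \<open>n\<close> steps of size \<open>h\<close> in each direction, with
    \<open>n * h \<ge> 2 * B\<close>; hence it covers \<open>K\<close>.\<close>
  obtain B where B: "\<And>x. x \<in> K \<Longrightarrow> norm x \<le> B" using compact_imp_bounded[OF K(2)] by (auto simp: bounded_iff)
  obtain n where n: "2 * B \<le> real n * h" using spec[OF reals_Archimedean3[OF h], of "2 * B"] by (metis less_imp_le)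
  have "box K (-B) (-B + real n * h) (-B) (-B + real n * h) = K"
  proof -
    have "-B \<le> Re x \<and> Re x \<le> -B + real n * h \<and> -B \<le> Im x \<and> Im x \<le> -B + real n * h" if "x \<in> K" for x
      using B[OF that] abs_Re_le_cmod[of x] abs_Im_le_cmod[of x] n by auto
    then show ?thesis by (auto simp: box_def)
  qed
  then show ?thesis using rect by metis
qed

text \<open>Exhaust the disc by closed discs around the centre. Sections with the same value at
  \<open>z\<close> agree wherever both are defined, so the value at \<open>w\<close> may be read off
  on the smallest closed disc containing \<open>z\<close> and \<open>w\<close>.\<close>

lemma ext_ball:
  assumes U: "U = ball c r" shows "ext U"
  unfolding ext_def
proof (intro conjI ballI order_refl)
  fix z v assume z: "z \<in> U" and v: "v \<in> H z"
  have ex: "\<exists>\<sigma>. flat_section T (cball c \<rho>) \<sigma> \<and> \<sigma> z = v" if "dist c z \<le> \<rho>" "\<rho> < r" for \<rho>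
  proof -
    have "ext (cball c \<rho>)" by (rule ext_compact_convex) (use that U in auto)
    then show ?thesis using that(1) v unfolding ext_def by auto
  qed
  define s where "s \<rho> = (SOME \<sigma>. flat_section T (cball c \<rho>) \<sigma> \<and> \<sigma> z = v)" for \<rho>
  have s: "flat_section T (cball c \<rho>) (s \<rho>)" "s \<rho> z = v" if "dist c z \<le> \<rho>" "\<rho> < r" for \<rho>
    using someI_ex[OF ex[OF that]] unfolding s_def by blast+
  define \<sigma> where "\<sigma> w = s (max (dist c z) (dist c w)) w" for w
  have eq: "\<sigma> w = s \<rho> w" if "dist c z \<le> \<rho>" "\<rho> < r" "dist c w \<le> \<rho>" for w \<rho>
  proof -
    let ?m = "max (dist c z) (dist c w)"
    have m: "dist c z \<le> ?m" "?m < r" "?m \<le> \<rho>" using that by auto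
    show ?thesis unfolding \<sigma>_def
      by (rule flat_unique[OF s(1)[OF m(1,2)] flat_subset[OF s(1)[OF that(1,2)]], of z])
         (use m s(2) that in auto)
  qed
  have "flat_section T U \<sigma>"
  proof (rule flatI)
    fix w0 assume w0: "w0 \<in> U"
    then have "max (dist c z) (dist c w0) < r" using z U by auto
    \<comment> \<open>A radius strictly beyond \<open>w0\<close>, so that a whole neighbourhood of
      \<open>w0\<close> lies in the closed disc on which \<open>s \<rho>\<close> is flat.\<close>
    then obtain \<rho> where \<rho>: "max (dist c z) (dist c w0) < \<rho>" "\<rho> < r" using dense by blast
    have r: "dist c z \<le> \<rho>" "w0 \<in> cball c \<rho>" using \<rho> by auto
    obtain N V \<tau> where t: "w0 \<in> N" "triv N V \<tau>" using triv_exists[OF w0] by blast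
    obtain u N' where a: "u \<in> V" "open N'" "w0 \<in> N'" "N' \<subseteq> N" "\<And>x. x \<in> N' \<inter> cball c \<rho> \<Longrightarrow> s \<rho> x = \<tau> x u"
      using flat_local[OF s(1)[OF r(1) \<rho>(2)] r(2) t] by blast
    have "\<forall>x\<in>(N' \<inter> ball c \<rho>) \<inter> U. \<sigma> x = \<tau> x u" using a(5) eq[OF r(1) \<rho>(2)] by auto
    moreover have "open (N' \<inter> ball c \<rho>)" "w0 \<in> N' \<inter> ball c \<rho>" using a \<rho> by auto
    ultimately show "\<exists>N V \<tau> u N'. triv N V \<tau> \<and> u \<in> V \<and> open N' \<and> w0 \<in> N' \<and> N' \<subseteq> N \<and> (\<forall>x\<in>N' \<inter> U. \<sigma> x = \<tau> x u)"
      using t(2) a(1,4) by (meson inf.coboundedI1)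
  qed
  moreover have "\<sigma> z = v" using s(2)[of "dist c z"] z U by (simp add: \<sigma>_def)
  ultimately show "\<exists>\<sigma>. flat_section T U \<sigma> \<and> \<sigma> z = v" by blast
qed

end

section \<open>Morphisms between the variations of period matrices\<close>

lemma linext_ctens: "linext (\<lambda>i. ctens 1 (r i)) (ctens c v) = ctens c (linext r v)"
proof -
  have ks: "keys (ctens c v) \<subseteq> keys v" by (auto simp: Poly_Mapping.in_keys_iff)
  have lk: "lookup (linext (\<lambda>i. ctens 1 (r i)) (ctens c v)) k
      = (\<Sum>i\<in>keys v. c * of_rat (lookup v i) * of_rat (lookup (r i) k))" for k
    unfolding lookup_linext_superset'[OF Poly_Mapping.finite_keys ks] by simp
  show ?thesis
    by (rule poly_mapping_eqI) (unfold lk lookup_ctens, simp add: lookup_linext of_rat_sum of_rat_mult sum_distrib_left mult.assoc)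
qed

context gauge begin

lemma e_lincomb: "e (\<lambda>z. \<Sum>j\<in>J. of_rat (q j) * f j z) = (\<Sum>j\<in>J. q j * e (f j))"
proof -
  have "(\<lambda>z. \<Sum>j\<in>J. of_rat (q j) * f j z) = (\<Sum>j\<in>J. qsc (q j) (f j))" by (simp add: fun_eq_iff sum_fun_apply qsc_def)
  then show ?thesis by (simp only: e_sum e_scl)
qed

end

context period begin

text \<open>On the diagonal \<open>2\<pi>i S\<close> is the constant \<open>2\<pi>i\<close>. Thus
  \<open>e\<close> turns a rational linear relation between entries of period matrices into a
  relation between its coefficients.\<close>

lemma e_S: "i \<in> I \<Longrightarrow> j \<in> I \<Longrightarrow> e (\<lambda>z. 2 * pi * \<i> * S i j z) = (if i = j then 1 else 0)"
proof (cases "i = j")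
  case True
  assume i: "i \<in> I" "j \<in> I"
  have "(\<lambda>z. 2 * pi * \<i> * S i i z) = fst t"
    using S_diag[OF i(1)] S_holo[OF i(1) i(1)] by (auto simp: fun_eq_iff tform_def const_form_def holo_funs_def)
  then show ?thesis unfolding True[symmetric] using e_t by simp
next
  case False
  assume "i \<in> I" "j \<in> I"
  from S_gauge[OF this False] show ?thesis using False by (simp only: if_False)
qed

end

context period_pair begin

definition row :: "(int \<Rightarrow> qvec \<Rightarrow> qvec) \<Rightarrow> nat \<Rightarrow> qvec" where
  "row f i = f (pd X i) (single i 1)"

definition toV :: "(int \<Rightarrow> qvec \<Rightarrow> qvec) \<Rightarrow> complex \<Rightarrow> qvec \<Rightarrow> qvec" where
  "toV f z v = (if z \<in> U \<and> v \<in> supp_in (pI X) then linext (row f) v else 0)"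

lemma row_in: "graded_linear f \<Longrightarrow> i \<in> pI X \<Longrightarrow> row f i \<in> supp_in {j\<in>pI Y. pd Y j = pd X i}"
  unfolding row_def graded_linear_def qlinear_def using single_in_supp[of i "{j\<in>pI X. pd X j = pd X i}" 1] by fastforce

lemma linext_in_supp: "(\<And>i. i \<in> keys v \<Longrightarrow> f i \<in> supp_in K) \<Longrightarrow> linext f v \<in> supp_in K"
  unfolding linext_def by (intro pm.subspace_sum pm.subspace_scale supp_in_subspace) auto

lemma supp_in_mono: "v \<in> supp_in K \<Longrightarrow> K \<subseteq> K' \<Longrightarrow> v \<in> supp_in K'" by (auto simp: supp_in_def)

text \<open>The constant matrix of \<open>f\<close> preserves \<open>F\<close> because intertwining
  says that it sends row \<open>i\<close> of one period matrix to a rational combination of rows of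
  the same degree of the other.\<close>

lemma toV_hom:
  assumes f: "f \<in> comodule_hom (H0_hopf U) src.A tgt.A"
  shows "toV f \<in> variation_hom U src.B tgt.B"
proof -
  have gl: "graded_linear f" and it: "intertwines (mat f)" using f unfolding hom_iff_intertwines by blast+
  have in1: "linext (row f) v \<in> supp_in (pI Y)" if "v \<in> supp_in (pI X)" for v
    by (rule linext_in_supp, rule supp_in_mono[OF row_in[OF gl]]) (use that in \<open>auto simp: supp_in_def\<close>)
  have sX: "pm.subspace (supp_in (pI X) :: qvec set)" by (rule supp_in_subspace)
  show ?thesis
    unfolding variation_hom_def mem_Collect_eq
  proof (intro conjI allI ballI impI)
    fix z assume z: "z \<in> U"
    show "qlinear (vt_fib src.B z) (vt_fib tgt.B z) (toV f z)"
      using z in1 pm.subspace_add[OF sX] pm.subspace_scale[OF sX]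
      by (auto simp: qlinear_def toV_def linext_add linext_scl)
    show "toV f z ` vt_W src.B m z \<subseteq> vt_W tgt.B m z" for m
    proof
      fix y assume "y \<in> toV f z ` vt_W src.B m z"
      then obtain v where v: "v \<in> supp_in {i\<in>pI X. 2 * pd X i \<le> m}" "y = toV f z v" by auto
      have "v \<in> supp_in (pI X)" using v(1) by (rule supp_in_mono) auto
      then have "y = linext (row f) v" using v(2) z by (simp add: toV_def)
      also have "\<dots> \<in> supp_in {i\<in>pI Y. 2 * pd Y i \<le> m}"
      proof (rule linext_in_supp)
        fix i assume "i \<in> keys v"
        then have i: "i \<in> pI X" "2 * pd X i \<le> m" using v(1) by (auto simp: supp_in_def)
        show "row f i \<in> supp_in {i\<in>pI Y. 2 * pd Y i \<le> m}" by (rule supp_in_mono[OF row_in[OF gl i(1)]]) (use i in auto)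
      qed
      finally show "y \<in> vt_W tgt.B m z" by simp
    qed
    fix p
    define L where "L = linext (\<lambda>i. ctens 1 (row f i))"
    have Lc: "L (ctens c v) = ctens c (linext (row f) v)" for c v unfolding L_def by (rule linext_ctens)
    have Ls: "L (src.s i z) = (\<Sum>l\<in>{l\<in>pI Y. pd Y l = pd X i}. scl (of_rat (mat f i l)) (tgt.s l z))" if i: "i \<in> pI X" for i
    proof (rule poly_mapping_eqI)
      fix k
      have ks: "keys (src.s i z) \<subseteq> pI X" by (auto simp: Poly_Mapping.in_keys_iff src.lookup_s split: if_splits)
      have l: "lookup (L (src.s i z)) k = (\<Sum>j\<in>pI X. pS X i j z * of_rat (mat f j k))"
        unfolding L_def lookup_linext_superset'[OF src.fin_I ks] by (rule sum.cong[OF refl]) (simp add: src.lookup_s row_def mat_def)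
      have r: "lookup (\<Sum>l\<in>{l\<in>pI Y. pd Y l = pd X i}. scl (of_rat (mat f i l)) (tgt.s l z)) k
        = (if k \<in> pI Y then \<Sum>l\<in>pI Y. of_rat (mat f i l) * pS Y l k z else 0)"
      proof (cases "k \<in> pI Y")
        case True
        have "(\<Sum>l\<in>{l\<in>pI Y. pd Y l = pd X i}. of_rat (mat f i l) * pS Y l k z) = (\<Sum>l\<in>pI Y. of_rat (mat f i l) * pS Y l k z)"
          by (rule sum.mono_neutral_left) (use tgt.fin_I mat_zero[OF gl i] in auto)
        then show ?thesis using True by (simp add: Poly_Mapping.lookup_sum tgt.lookup_s)
      qed (simp add: Poly_Mapping.lookup_sum tgt.lookup_s)
      show "lookup (L (src.s i z)) k = lookup (\<Sum>l\<in>{l\<in>pI Y. pd Y l = pd X i}. scl (of_rat (mat f i l)) (tgt.s l z)) k"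
      proof (cases "k \<in> pI Y")
        case True then show ?thesis using it i z unfolding l r intertwines_def by simp
      next
        case False then show ?thesis unfolding l r using mat_zero[OF gl] by simp
      qed
    qed
    show "complexified_maps (vt_fib src.B z) (toV f z) (vt_F src.B p z) (vt_F tgt.B p z)"
      unfolding complexified_maps_def
    proof (intro allI impI)
      fix cs :: "(complex \<times> qvec) list" assume a: "snd ` set cs \<subseteq> vt_fib src.B z \<and> (\<Sum>(c, v)\<leftarrow>cs. ctens c v) \<in> vt_F src.B p z"
      have e: "map (\<lambda>(c, v). ctens c (toV f z v)) cs = map (\<lambda>(c, v). L (ctens c v)) cs"
      proof (rule map_cong[OF refl])
        fix x assume "x \<in> set cs"
        then have "snd x \<in> supp_in (pI X)" using a by auto
        then show "(case x of (c, v) \<Rightarrow> ctens c (toV f z v)) = (case x of (c, v) \<Rightarrow> L (ctens c v))"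
          using z by (cases x) (simp add: Lc toV_def)
      qed
      have "(\<Sum>(c, v)\<leftarrow>xs. L (ctens c v)) = L (\<Sum>(c, v)\<leftarrow>xs. ctens c v)" for xs
        by (induction xs) (auto simp: L_def linext_add)
      then have "(\<Sum>(c, v)\<leftarrow>cs. ctens c (toV f z v)) = L (\<Sum>(c, v)\<leftarrow>cs. ctens c v)" unfolding e by simp
      moreover have "L y \<in> pm.span ((\<lambda>i. tgt.s i z) ` {i\<in>pI Y. p \<le> pd Y i})" if "y \<in> pm.span ((\<lambda>i. src.s i z) ` {i\<in>pI X. p \<le> pd X i})" for y
        unfolding L_def
      proof (rule linext_in_span[OF that])
        fix x assume "x \<in> (\<lambda>i. src.s i z) ` {i\<in>pI X. p \<le> pd X i}"
        then obtain i where i: "i \<in> pI X" "p \<le> pd X i" "x = src.s i z" by blast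
        show "linext (\<lambda>i. ctens 1 (row f i)) x \<in> pm.span ((\<lambda>i. tgt.s i z) ` {i\<in>pI Y. p \<le> pd Y i})"
          unfolding i(3) L_def[symmetric] Ls[OF i(1)]
          by (intro pm.span_sum pm.span_scale; intro pm.span_base) (use i in auto)
      qed
      ultimately show "(\<Sum>(c, v)\<leftarrow>cs. ctens c (toV f z v)) \<in> vt_F tgt.B p z" using a by simp
    qed
  next
    fix z v assume "z \<notin> U \<or> v \<notin> vt_fib src.B z" then show "toV f z v = 0" by (auto simp: toV_def)
  next
    have "continuous_map (discrete_topology (supp_in (pI X))) (discrete_topology (supp_in (pI Y))) (linext (row f))"
      using in1 by (simp add: Pi_def)
    then have c1: "continuous_map (vt_top src.B) (discrete_topology (supp_in (pI Y))) (linext (row f) \<circ> snd)"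
      unfolding src.B_simps by (rule continuous_map_compose[OF continuous_map_snd])
    have c2: "continuous_map (vt_top src.B) (top_of_set U) fst" by (simp add: continuous_map_fst)
    have "continuous_map (vt_top src.B) (vt_top tgt.B) (\<lambda>x. (fst x, (linext (row f) \<circ> snd) x))"
      unfolding tgt.B_simps by (rule continuous_map_pairedI[OF c2 c1])
    then show "continuous_map (vt_top src.B) (vt_top tgt.B) (\<lambda>(z, v). (z, toV f z v))"
      by (rule continuous_map_eq) (auto simp: toV_def)
  qed
qed

lemma toV_inj:
  assumes f: "f \<in> comodule_hom (H0_hopf U) src.A tgt.A" and g: "g \<in> comodule_hom (H0_hopf U) src.A tgt.A" and e: "toV f = toV g"
  shows "f = g"
proof (intro ext)
  fix n v
  obtain z where z: "z \<in> U" using src.U_ne by blast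
  note f' = f[unfolded hom_iff_intertwines] and g' = g[unfolded hom_iff_intertwines]
  note gl = conjunct1[OF f'] conjunct1[OF g'] and o = conjunct1[OF conjunct2[OF f']] conjunct1[OF conjunct2[OF g']]
  note q = gl(1)[unfolded graded_linear_def src.A_simps, rule_format] gl(2)[unfolded graded_linear_def src.A_simps, rule_format]
  show "f n v = g n v"
  proof (cases "v \<in> supp_in {i\<in>pI X. pd X i = n}")
    case True
    have "row f i = row g i" if "i \<in> pI X" for i
    proof -
      have "toV f z (single i 1) = toV g z (single i 1)" using e by simp
      then show ?thesis using that z by (simp add: toV_def single_in_supp)
    qed
    then have "f n (single i 1) = g n (single i 1)" if "i \<in> keys v" for i
      using True that by (auto simp: row_def supp_in_def)
    then show ?thesis unfolding qlinear_linext[OF q(1) True] qlinear_linext[OF q(2) True] by (rule linext_cong)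
  next
    case False
    then have "v \<notin> cm_space src.A n" by simp
    then show ?thesis using o by metis
  qed
qed

text \<open>A morphism is a constant matrix \<open>m\<close> that a priori respects only the weight
  filtration. Respecting \<open>F\<close> gives \<open>S m = m' S'\<close>, where \<open>m'\<close>
  is the degree preserving part of \<open>m\<close> and \<open>S\<close>, \<open>S'\<close> are the
  two period matrices. Multiplying by \<open>2\<pi>i\<close> and applying \<open>e\<close> turns
  \<open>S\<close> and \<open>S'\<close> into identity matrices, whence
  \<open>m = m'\<close>.\<close>

lemma toV_surj:
  assumes \<phi>: "\<phi> \<in> variation_hom U src.B tgt.B" and con: "connected U"
  obtains f where "f \<in> comodule_hom (H0_hopf U) src.A tgt.A" "toV f = \<phi>"
proof -
  obtain z0 where z0: "z0 \<in> U" using src.U_ne by blast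
  note D = variation_homD[OF \<phi>, unfolded src.B_simps tgt.B_simps]
  have const: "\<phi> z v = \<phi> z0 v" if z: "z \<in> U" and v: "v \<in> supp_in (pI X)" for z v
  proof -
    have "continuous_map (top_of_set U) (vt_top src.B) (\<lambda>z. (z, v))" using flat_const[OF v, of U U] by (simp add: flat_section_def)
    from continuous_map_compose[OF this variation_homD(4)[OF \<phi>]]
    have fl: "flat_section (prod_topology (top_of_set U) (discrete_topology (supp_in (pI Y)))) U (\<lambda>z. \<phi> z v)"
      by (simp add: flat_section_def o_def)
    have "\<forall>a\<in>U. eventually (\<lambda>b. \<phi> a v = \<phi> b v) (at a within U)"
    proof
      fix a assume a: "a \<in> U"
      show "eventually (\<lambda>b. \<phi> a v = \<phi> b v) (at a within U)"
      proof (rule flat_locally_const[OF fl src.U_open a])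
        fix N' assume N': "open N'" "a \<in> N'" "\<And>b. b \<in> N' \<Longrightarrow> \<phi> b v = \<phi> a v"
        show ?thesis unfolding eventually_at_topological by (intro exI[of _ N'] conjI ballI impI N'(1,2)) (rule N'(3)[symmetric])
      qed
    qed
    from connected_local_const[OF con z z0 this] show ?thesis .
  qed
  define m where "m i j = lookup (\<phi> z0 (single i 1)) j" for i j
  have m_low: "m i k = 0" if "i \<in> pI X" "\<not> (k \<in> pI Y \<and> pd Y k \<le> pd X i)" for i k
  proof -
    have "single i 1 \<in> supp_in {j\<in>pI X. 2 * pd X j \<le> 2 * pd X i}" using that by (intro single_in_supp) auto
    then have "\<phi> z0 (single i 1) \<in> supp_in {j\<in>pI Y. 2 * pd Y j \<le> 2 * pd X i}" using D(5)[OF z0, of "2 * pd X i"] by blast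
    then show ?thesis using that by (auto simp: m_def supp_in_def Poly_Mapping.in_keys_iff subset_iff)
  qed
  \<comment> \<open>The image of row \<open>i\<close> lies in the span of the rows of degree at
    least \<open>pd X i\<close> and has no entries of larger degree. By unipotency only rows of
    degree \<open>pd X i\<close> occur, with coefficients read off at their own positions.\<close>
  have rel: "(\<Sum>j\<in>pI X. pS X i j z * of_rat (m j k)) = (\<Sum>l\<in>{l\<in>pI Y. pd Y l = pd X i}. of_rat (m i l) * pS Y l k z)"
    if i: "i \<in> pI X" and k: "k \<in> pI Y" and z: "z \<in> U" for i k z
  proof -
    interpret u: unipotent "pI Y" "pd Y" "\<lambda>i. tgt.s i z" by (rule tgt.unipotent_s[OF z])
    let ?y = "\<Sum>j\<in>pI X. ctens (pS X i j z) (\<phi> z0 (single j 1))"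
    let ?K = "{l\<in>pI Y. pd X i \<le> pd Y l}" let ?E = "{l\<in>pI Y. pd Y l = pd X i}"
    have fK: "finite ?K" "finite ?E" using tgt.fin_I by auto
    have lky: "lookup ?y k = (\<Sum>j\<in>pI X. pS X i j z * of_rat (m j k))" for k by (simp add: Poly_Mapping.lookup_sum m_def)
    have "?y \<in> pm.span ((\<lambda>i. tgt.s i z) ` ?K)"
    proof -
      let ?cs = "map (\<lambda>j. (pS X i j z, single j (1::rat))) (sorted_list_of_set (pI X))"
      have 1: "(\<Sum>(c, v)\<leftarrow>?cs. ctens c v) = src.s i z"
      proof -
        have "ctens (pS X i j z) (single j 1) = single j (pS X i j z)" for j
          by (rule poly_mapping_eqI) (simp add: Poly_Mapping.lookup_single when_def)
        then show ?thesis using src.fin_I by (simp add: o_def src.s_def sum_list_distinct_conv_sum_set)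
      qed
      have "(\<Sum>(c, v)\<leftarrow>?cs. ctens c v) \<in> pm.span ((\<lambda>i. src.s i z) ` {j\<in>pI X. pd X i \<le> pd X j})"
        unfolding 1 by (rule pm.span_base) (use i in auto)
      moreover have "snd ` set ?cs \<subseteq> supp_in (pI X)" using src.fin_I by (auto intro: single_in_supp)
      ultimately have "(\<Sum>(c, v)\<leftarrow>?cs. ctens c (\<phi> z v)) \<in> pm.span ((\<lambda>i. tgt.s i z) ` ?K)"
        using D(6)[OF z, of "pd X i"] unfolding complexified_maps_def by blast
      moreover have "(\<Sum>(c, v)\<leftarrow>?cs. ctens c (\<phi> z v)) = (\<Sum>j\<in>pI X. ctens (pS X i j z) (\<phi> z (single j 1)))"
        using src.fin_I by (simp add: o_def sum_list_distinct_conv_sum_set)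
      moreover have "\<dots> = ?y" by (rule sum.cong[OF refl]) (simp add: const[OF z single_in_supp])
      ultimately show ?thesis by simp
    qed
    then obtain c where c: "?y = (\<Sum>l\<in>?K. scl (c l) (tgt.s l z))" by (rule span_image_sum[OF fK(1)])
    have y0: "lookup ?y l = 0" if "pd X i < pd Y l" for l
      unfolding lky
    proof (rule sum.neutral, rule ballI)
      fix j assume j: "j \<in> pI X"
      show "pS X i j z * of_rat (m j l) = 0"
      proof (cases "j = i \<or> pd X j < pd X i")
        case True
        then have "m j l = 0" using that by (intro m_low j) auto
        then show ?thesis by simp
      next
        case False then show ?thesis using src.S_tri[OF i j] by auto
      qed
    qed
    have c0: "c l = 0" if "l \<in> ?K" "pd X i < pd Y l" for l
    proof (rule u.coeff_zero[of ?K "pd X i + 1" c])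
      fix j assume "j \<in> ?K" "pd X i + 1 \<le> pd Y j"
      then show "lookup (\<Sum>l\<in>?K. scl (c l) (tgt.s l z)) j = 0" unfolding c[symmetric] using y0 by simp
    qed (use that in auto)
    have yE: "?y = (\<Sum>l\<in>?E. scl (c l) (tgt.s l z))"
      unfolding c
    proof (rule sum.mono_neutral_right[OF fK(1)])
      show "\<forall>l\<in>?K - ?E. scl (c l) (tgt.s l z) = 0"
      proof
        fix l assume "l \<in> ?K - ?E"
        then have "c l = 0" by (intro c0) auto
        then show "scl (c l) (tgt.s l z) = 0" by (simp only: pm.scale_zero_left)
      qed
    qed auto
    have cE: "c l = of_rat (m i l)" if l: "l \<in> ?E" for l
    proof -
      have "lookup ?y l = (\<Sum>l'\<in>?E. if l' = l then c l else 0)"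
        unfolding yE Poly_Mapping.lookup_sum
        by (rule sum.cong[OF refl]) (use l tgt.S_diag[of l z] tgt.S_tri[of _ l] z in \<open>auto simp: tgt.lookup_s\<close>)
      then have "c l = lookup ?y l" using l fK by simp
      also have "\<dots> = (\<Sum>j\<in>pI X. if j = i then of_rat (m i l) else 0)"
        unfolding lky
      proof (rule sum.cong[OF refl])
        fix j assume j: "j \<in> pI X"
        consider "j = i" | "j \<noteq> i" "pd X i \<le> pd X j" | "pd X j < pd X i" by linarith
        then show "pS X i j z * of_rat (m j l) = (if j = i then of_rat (m i l) else 0)"
        proof cases
          case 1 then show ?thesis using src.S_diag[OF i z] by simp
        next
          case 2 then show ?thesis using src.S_tri[OF i j] by auto
        next
          case 3
          then have "m j l = 0" using l by (intro m_low j) auto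
          then show ?thesis using 3 by auto
        qed
      qed
      also have "\<dots> = of_rat (m i l)" using i src.fin_I by simp
      finally show ?thesis .
    qed
    have "(\<Sum>j\<in>pI X. pS X i j z * of_rat (m j k)) = lookup ?y k" using lky by simp
    also have "\<dots> = (\<Sum>l\<in>?E. of_rat (m i l) * pS Y l k z)"
      unfolding yE Poly_Mapping.lookup_sum by (rule sum.cong[OF refl]) (use cE k in \<open>simp add: tgt.lookup_s\<close>)
    finally show ?thesis .
  qed
  have m_graded: "m i k = 0" if i: "i \<in> pI X" and k: "k \<in> pI Y" "pd Y k \<noteq> pd X i" for i k
  proof -
    have "(\<lambda>z. \<Sum>j\<in>pI X. of_rat (m j k) * (2 * pi * \<i> * pS X i j z)) = (\<lambda>z. \<Sum>l\<in>{l\<in>pI Y. pd Y l = pd X i}. of_rat (m i l) * (2 * pi * \<i> * pS Y l k z))"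
    proof
      fix z
      let ?c = "2 * complex_of_real pi * \<i>"
      show "(\<Sum>j\<in>pI X. of_rat (m j k) * (2 * pi * \<i> * pS X i j z)) = (\<Sum>l\<in>{l\<in>pI Y. pd Y l = pd X i}. of_rat (m i l) * (2 * pi * \<i> * pS Y l k z))"
      proof (cases "z \<in> U")
        case True
        have 1: "(\<Sum>j\<in>pI X. of_rat (m j k) * (2 * pi * \<i> * pS X i j z)) = ?c * (\<Sum>j\<in>pI X. pS X i j z * of_rat (m j k))"
          unfolding sum_distrib_left by (rule sum.cong[OF refl]) simp
        have 2: "(\<Sum>l\<in>{l\<in>pI Y. pd Y l = pd X i}. of_rat (m i l) * (2 * pi * \<i> * pS Y l k z)) = ?c * (\<Sum>l\<in>{l\<in>pI Y. pd Y l = pd X i}. of_rat (m i l) * pS Y l k z)"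
          unfolding sum_distrib_left by (rule sum.cong[OF refl]) simp
        show ?thesis unfolding 1 2 using rel[OF i k(1) True] by simp
      next
        case False
        have "pS X i j z = 0" if "j \<in> pI X" for j using src.S_holo[OF i that] False by (simp add: holo_funs_def)
        moreover have "pS Y l k z = 0" if "l \<in> pI Y" for l using tgt.S_holo[OF that k(1)] False by (simp add: holo_funs_def)
        ultimately show ?thesis by simp
      qed
    qed
    from arg_cong[OF this, of e]
    have "(\<Sum>j\<in>pI X. m j k * e (\<lambda>z. 2 * pi * \<i> * pS X i j z)) = (\<Sum>l\<in>{l\<in>pI Y. pd Y l = pd X i}. m i l * e (\<lambda>z. 2 * pi * \<i> * pS Y l k z))"
      unfolding src.e_lincomb .
    moreover have "(\<Sum>j\<in>pI X. m j k * e (\<lambda>z. 2 * pi * \<i> * pS X i j z)) = (\<Sum>j\<in>pI X. if j = i then m i k else 0)"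
    proof (rule sum.cong[OF refl])
      fix j assume "j \<in> pI X"
      show "m j k * e (\<lambda>z. 2 * pi * \<i> * pS X i j z) = (if j = i then m i k else 0)"
        unfolding src.e_S[OF i \<open>j \<in> pI X\<close>] by auto
    qed
    moreover have "(\<Sum>l\<in>{l\<in>pI Y. pd Y l = pd X i}. m i l * e (\<lambda>z. 2 * pi * \<i> * pS Y l k z)) = 0"
      by (rule sum.neutral) (use k tgt.e_S[OF _ k(1)] in auto)
    ultimately show ?thesis using i src.fin_I by simp
  qed
  have m_zero: "m i k = 0" if "i \<in> pI X" "\<not> (k \<in> pI Y \<and> pd Y k = pd X i)" for i k
    using m_low[OF that(1), of k] m_graded[OF that(1), of k] that(2) by blast
  define f where "f n v = (if v \<in> supp_in {i\<in>pI X. pd X i = n} then \<phi> z0 v else 0)" for n v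
  have q0: "qlinear (supp_in (pI X)) (supp_in (pI Y)) (\<phi> z0)" using D(1)[OF z0] .
  have sub: "v \<in> supp_in (pI X)" if "v \<in> supp_in {i\<in>pI X. pd X i = n}" for v n using that by (auto simp: supp_in_def)
  have rowf: "f (pd X i) (single i 1) = \<phi> z0 (single i 1)" if "i \<in> pI X" for i
    using that by (simp add: f_def single_in_supp)
  have matf: "mat f i j = m i j" if "i \<in> pI X" for i j using rowf[OF that] by (simp add: mat_def m_def)
  have gl: "graded_linear f"
    unfolding graded_linear_def src.A_simps tgt.A_simps
  proof
    fix n
    have im: "\<phi> z0 v \<in> supp_in {i\<in>pI Y. pd Y i = n}" if v: "v \<in> supp_in {i\<in>pI X. pd X i = n}" for v
    proof -
      have "\<phi> z0 v = linext (\<lambda>i. \<phi> z0 (single i 1)) v" by (rule qlinear_linext[OF q0 sub[OF v]])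
      also have "\<dots> \<in> supp_in {i\<in>pI Y. pd Y i = n}"
      proof (rule linext_in_supp)
        fix i assume "i \<in> keys v"
        then have i: "i \<in> pI X" "pd X i = n" using v by (auto simp: supp_in_def)
        show "\<phi> z0 (single i 1) \<in> supp_in {i\<in>pI Y. pd Y i = n}"
          using m_zero[OF i(1)] i(2) by (auto simp: supp_in_def m_def Poly_Mapping.in_keys_iff)
      qed
      finally show ?thesis .
    qed
    show "qlinear (supp_in {i\<in>pI X. pd X i = n}) (supp_in {i\<in>pI Y. pd Y i = n}) (f n)"
      unfolding qlinear_def
    proof (intro conjI ballI allI)
      show "f n ` supp_in {i\<in>pI X. pd X i = n} \<subseteq> supp_in {i\<in>pI Y. pd Y i = n}" using im by (auto simp: f_def)
    next
      fix u v :: qvec assume uv: "u \<in> supp_in {i\<in>pI X. pd X i = n}" "v \<in> supp_in {i\<in>pI X. pd X i = n}"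
      then show "f n (u + v) = f n u + f n v"
        using q0 sub[OF uv(1)] sub[OF uv(2)] pm.subspace_add[OF supp_in_subspace uv] by (simp add: f_def qlinear_def)
    next
      fix r and v :: qvec assume v: "v \<in> supp_in {i\<in>pI X. pd X i = n}"
      then show "f n (scl r v) = scl r (f n v)"
        using q0 sub[OF v] pm.subspace_scale[OF supp_in_subspace v] by (simp add: f_def qlinear_def)
    qed
  qed
  have it: "intertwines (mat f)"
    unfolding intertwines_def
  proof (intro ballI)
    fix i k z assume h: "i \<in> pI X" "k \<in> pI Y" "z \<in> U"
    have "(\<Sum>j\<in>pI X. pS X i j z * of_rat (mat f j k)) = (\<Sum>j\<in>pI X. pS X i j z * of_rat (m j k))"
      by (rule sum.cong[OF refl]) (simp add: matf)
    also have "\<dots> = (\<Sum>l\<in>{l\<in>pI Y. pd Y l = pd X i}. of_rat (m i l) * pS Y l k z)" by (rule rel[OF h])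
    also have "\<dots> = (\<Sum>l\<in>pI Y. of_rat (mat f i l) * pS Y l k z)"
      by (rule sum.mono_neutral_cong_left) (use tgt.fin_I m_zero[OF h(1)] matf[OF h(1)] in auto)
    finally show "(\<Sum>j\<in>pI X. pS X i j z * of_rat (mat f j k)) = (\<Sum>j\<in>pI Y. of_rat (mat f i j) * pS Y j k z)" .
  qed
  have "f \<in> comodule_hom (H0_hopf U) src.A tgt.A" unfolding hom_iff_intertwines using gl it by (auto simp: f_def)
  moreover have "toV f = \<phi>"
  proof (intro ext)
    fix z v
    show "toV f z v = \<phi> z v"
    proof (cases "z \<in> U \<and> v \<in> supp_in (pI X)")
      case True
      have "linext (row f) v = linext (\<lambda>i. \<phi> z0 (single i 1)) v"
        by (rule linext_cong) (use True rowf in \<open>auto simp: row_def supp_in_def\<close>)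
      also have "\<dots> = \<phi> z0 v" using qlinear_linext[OF q0, of v] True by simp
      finally show ?thesis using True const by (simp add: toV_def)
    next
      case False then show ?thesis using D(3)[of z v] by (auto simp: toV_def)
    qed
  qed
  ultimately show ?thesis using that by blast
qed

lemma bij_toV: "connected U \<Longrightarrow> bij_betw toV (comodule_hom (H0_hopf U) src.A tgt.A) (variation_hom U src.B tgt.B)"
proof (rule bij_betw_imageI)
  show "inj_on toV (comodule_hom (H0_hopf U) src.A tgt.A)" by (rule inj_onI) (rule toV_inj)
  assume c: "connected U"
  show "toV ` comodule_hom (H0_hopf U) src.A tgt.A = variation_hom U src.B tgt.B"
  proof (intro equalityI subsetI)
    fix \<phi> assume "\<phi> \<in> toV ` comodule_hom (H0_hopf U) src.A tgt.A"
    then obtain f where "\<phi> = toV f" "f \<in> comodule_hom (H0_hopf U) src.A tgt.A" by (elim imageE)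
    then show "\<phi> \<in> variation_hom U src.B tgt.B" using toV_hom by simp
  next
    fix \<phi> assume "\<phi> \<in> variation_hom U src.B tgt.B"
    from toV_surj[OF this c] obtain f where "f \<in> comodule_hom (H0_hopf U) src.A tgt.A" "toV f = \<phi>" .
    then show "\<phi> \<in> toV ` comodule_hom (H0_hopf U) src.A tgt.A" by (intro image_eqI[OF sym])
  qed
qed

end

lemma toV_id:
  assumes "period U e X"
  shows "period_pair.toV U X (idn (comodule_cat (H0_hopf U)) (period.A U X)) = idn (variation_cat U) (period.B U X)"
proof -
  interpret p: period U e X by fact
  interpret pp: period_pair U e X X ..
  have r: "pp.row (\<lambda>n v. if v \<in> cm_space p.A n then v else 0) i = single i 1" if "i \<in> pI X" for i
    using that by (simp add: pp.row_def single_in_supp)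
  have "linext (pp.row (\<lambda>n v. if v \<in> cm_space p.A n then v else 0)) v = v" if "v \<in> supp_in (pI X)" for v
    using linext_cong[of v "pp.row (\<lambda>n v. if v \<in> cm_space p.A n then v else 0)" "\<lambda>i. single i 1"] r that
    by (simp only: linext_id) (auto simp: supp_in_def linext_id)
  then show ?thesis by (simp add: fun_eq_iff pp.toV_def comodule_cat_def variation_cat_def)
qed

lemma toV_cmp:
  assumes "period U e X" "period U e Y" "period U e Z"
    and f: "f \<in> comodule_hom (H0_hopf U) (period.A U X) (period.A U Y)"
    and g: "g \<in> comodule_hom (H0_hopf U) (period.A U Y) (period.A U Z)"
  shows "period_pair.toV U X (\<lambda>n v. g n (f n v)) = (\<lambda>z v. period_pair.toV U Y g z (period_pair.toV U X f z v))"
proof -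
  interpret X: period U e X by fact
  interpret Y: period U e Y by fact
  interpret Z: period U e Z by fact
  interpret xy: period_pair U e X Y ..
  interpret yz: period_pair U e Y Z ..
  have glf: "xy.graded_linear f" and glg: "yz.graded_linear g"
    using f g unfolding xy.hom_iff_intertwines yz.hom_iff_intertwines by blast+
  have r: "g (pd X i) (xy.row f i) = linext (yz.row g) (xy.row f i)" if i: "i \<in> pI X" for i
  proof -
    have q: "qlinear (supp_in {j\<in>pI Y. pd Y j = pd X i}) (cm_space Z.A (pd X i)) (g (pd X i))"
      using glg unfolding yz.graded_linear_def by simp
    have "g (pd X i) (xy.row f i) = linext (\<lambda>j. g (pd X i) (single j 1)) (xy.row f i)"
      by (rule qlinear_linext[OF q xy.row_in[OF glf i]])
    also have "\<dots> = linext (yz.row g) (xy.row f i)"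
      by (rule linext_cong) (use xy.row_in[OF glf i] in \<open>auto simp: yz.row_def supp_in_def\<close>)
    finally show ?thesis .
  qed
  have main: "linext (\<lambda>i. g (pd X i) (xy.row f i)) v = linext (yz.row g) (linext (xy.row f) v)" if "v \<in> supp_in (pI X)" for v
    unfolding linext_linext by (rule linext_cong, rule r) (use that in \<open>auto simp: supp_in_def\<close>)
  have inY: "linext (xy.row f) v \<in> supp_in (pI Y)" if "v \<in> supp_in (pI X)" for v
    by (rule xy.linext_in_supp, rule xy.supp_in_mono[OF xy.row_in[OF glf]]) (use that in \<open>auto simp: supp_in_def\<close>)
  have row: "xy.row (\<lambda>n v. g n (f n v)) = (\<lambda>i. g (pd X i) (xy.row f i))" by (simp add: fun_eq_iff xy.row_def)
  show ?thesis
    by (auto simp: fun_eq_iff xy.toV_def yz.toV_def row main inY)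
qed

section \<open>The period matrix of a variation\<close>

text \<open>Induction on the number of indices of smaller degree: \<open>x i\<close> is
  \<open>x' i\<close> minus vectors that are already expressed.\<close>

lemma unitriangular_span:
  fixes x x' :: "nat \<Rightarrow> ('b \<Rightarrow>\<^sub>0 'k::field)"
  assumes fin: "finite I" and x': "\<And>i. i \<in> I \<Longrightarrow> x' i = x i + (\<Sum>j\<in>{j\<in>I. d j < d i}. scl (a i j) (x j))"
    and i: "i \<in> I"
  shows "x i \<in> pm.span (x' ` {l\<in>I. d l \<le> (d i :: int)})"
  using i
proof (induction "card {l\<in>I. d l < d i}" arbitrary: i rule: less_induct)
  case less
  have "x j \<in> pm.span (x' ` {l\<in>I. d l \<le> d i})" if j: "j \<in> {j\<in>I. d j < d i}" for j
  proof -
    have "{l\<in>I. d l < d j} \<subset> {l\<in>I. d l < d i}" using j by auto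
    then have "card {l\<in>I. d l < d j} < card {l\<in>I. d l < d i}" using fin by (intro psubset_card_mono) auto
    from less.hyps[OF this] have "x j \<in> pm.span (x' ` {l\<in>I. d l \<le> d j})" using j by simp
    moreover have "x' ` {l\<in>I. d l \<le> d j} \<subseteq> x' ` {l\<in>I. d l \<le> d i}" using j by auto
    ultimately show ?thesis using pm.span_mono by blast
  qed
  then have "(\<Sum>j\<in>{j\<in>I. d j < d i}. scl (a i j) (x j)) \<in> pm.span (x' ` {l\<in>I. d l \<le> d i})"
    by (intro pm.span_sum pm.span_scale)
  moreover have "x' i \<in> pm.span (x' ` {l\<in>I. d l \<le> d i})" by (intro pm.span_base) (use less.prems in auto)
  ultimately have "x' i - (\<Sum>j\<in>{j\<in>I. d j < d i}. scl (a i j) (x j)) \<in> pm.span (x' ` {l\<in>I. d l \<le> d i})"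
    by (rule pm.span_diff[rotated])
  then show ?case using x'[OF less.prems] by simp
qed

text \<open>At an index of maximal degree among those with \<open>q \<noteq> 0\<close> only the
  diagonal entry contributes.\<close>

lemma unitriangular_zero:
  fixes q :: "nat \<Rightarrow> 'k::field" and d :: "nat \<Rightarrow> int"
  assumes fin: "finite I" and a: "\<And>i. i \<in> I \<Longrightarrow> a i i = 1" "\<And>i j. i \<in> I \<Longrightarrow> j \<in> I \<Longrightarrow> i \<noteq> j \<Longrightarrow> d i \<le> d j \<Longrightarrow> a i j = 0"
    and z: "\<And>j. j \<in> I \<Longrightarrow> (\<Sum>i\<in>I. q i * a i j) = 0" and i: "i \<in> I"
  shows "q i = 0"
proof (rule ccontr)
  assume "q i \<noteq> 0"
  let ?Z = "{i\<in>I. q i \<noteq> 0}"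
  have Z: "finite ?Z" "?Z \<noteq> {}" using fin i \<open>q i \<noteq> 0\<close> by auto
  then have "Max (d ` ?Z) \<in> d ` ?Z" by (intro Max_in) auto
  then obtain m where m: "m \<in> ?Z" "Max (d ` ?Z) = d m" by (rule imageE)
  have m2: "d l \<le> d m" if "l \<in> ?Z" for l unfolding m(2)[symmetric] using Z(1) that by (intro Max_ge) auto
  have "0 = (\<Sum>i\<in>I. q i * a i m)" using z m by simp
  also have "\<dots> = (\<Sum>i\<in>I. if i = m then q m else 0)"
  proof (rule sum.cong[OF refl])
    fix l assume l: "l \<in> I"
    show "q l * a l m = (if l = m then q m else 0)"
    proof (cases "l = m \<or> q l = 0")
      case True then show ?thesis using a(1) m by auto
    next
      case False
      then have "d l \<le> d m" using m2 l by simp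
      then have "a l m = 0" using a(2)[of l m] l m(1) False by simp
      then show ?thesis using False by simp
    qed
  qed
  also have "\<dots> = q m" using m(1) fin by simp
  finally show False using m(1) by simp
qed

text \<open>\<open>g x\<close> records the step at which the basis vector \<open>x\<close> enters
  while the basis is extended along the chain.\<close>

lemma chain_basis:
  fixes V :: "nat \<Rightarrow> qvec set"
  assumes "V 0 = {0}" "\<And>k. findim (V k)" "\<And>k. V k \<subseteq> V (Suc k)"
  shows "\<exists>B g. finite B \<and> pm.independent B \<and> (\<forall>x\<in>B. 0 < g x \<and> g x \<le> K) \<and> (\<forall>k\<le>K. V k = pm.span {x\<in>B. g x \<le> k})"
proof (induction K)
  case 0 show ?case by (rule exI[of _ "{}"]) (simp add: assms(1) pm.span_empty pm.independent_empty)
next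
  case (Suc K)
  then obtain B g where B0: "finite B" "pm.independent B" "\<forall>x\<in>B. 0 < g x \<and> g x \<le> K" "\<forall>k\<le>K. V k = pm.span {x\<in>B. g x \<le> k}"
    by (elim exE conjE)
  note B = B0(1,2) bspec[OF B0(3)] B0(4)[rule_format]
  have "{x\<in>B. g x \<le> K} = B" using B(3) by blast
  then have "V K = pm.span B" using B(4)[of K] by simp
  then have BV: "B \<subseteq> V (Suc K)" using assms(3)[of K] pm.span_superset[of B] by blast
  obtain B' where B': "B \<subseteq> B'" "B' \<subseteq> V (Suc K)" "pm.independent B'" "V (Suc K) \<subseteq> pm.span B'"
    by (rule pm.maximal_independent_subset_extend[OF BV B(2)])
  obtain D where D: "finite D" "V (Suc K) = pm.span D" using assms(2) unfolding findim_def by blast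
  have fB': "finite B'" using pm.independent_span_bound[OF D(1) B'(3)] B'(2) D(2) by blast
  let ?g = "\<lambda>x. if x \<in> B then g x else Suc K"
  have 1: "\<forall>k\<le>Suc K. V k = pm.span {x\<in>B'. ?g x \<le> k}"
  proof (intro allI impI)
    fix k assume "k \<le> Suc K"
    then consider "k \<le> K" | "k = Suc K" by linarith
    then show "V k = pm.span {x\<in>B'. ?g x \<le> k}"
    proof cases
      case 1
      then have "{x\<in>B'. ?g x \<le> k} = {x\<in>B. g x \<le> k}" using B'(1) by auto
      then show ?thesis using B(4)[OF 1] by simp
    next
      case 2
      have "{x\<in>B'. ?g x \<le> k} = B'" using B(3) 2 by force
      moreover have "pm.span B' \<subseteq> V (Suc K)" unfolding D(2) by (rule pm.span_minimal[OF _ pm.subspace_span]) (use B'(2) D(2) in blast)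
      ultimately show ?thesis using B'(4) 2 by auto
    qed
  qed
  have 2: "\<forall>x\<in>B'. 0 < ?g x \<and> ?g x \<le> Suc K"
  proof
    fix x show "0 < ?g x \<and> ?g x \<le> Suc K" using B(3)[of x] by (cases "x \<in> B") auto
  qed
  show ?case by (intro exI[of _ B'] exI[of _ ?g] conjI fB' B'(3) 1 2)
qed

text \<open>The complex linear extension of the rational functional \<open>wsum c\<close>. As
  \<open>linext\<close> yields vectors, the scalar is stored at coordinate 0.\<close>

definition wc :: "(nat \<Rightarrow> rat) \<Rightarrow> cvec \<Rightarrow> complex" where
  "wc c y = lookup (linext (\<lambda>k. single (0::nat) (of_rat (c k))) y) 0"

lemma wc_sum: "wc c (\<Sum>i\<in>K. scl (q i) (u i)) = (\<Sum>i\<in>K. q i * wc c (u i))"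
  by (simp add: wc_def linext_sum linext_scl Poly_Mapping.lookup_sum)

lemma wc_ctens: "wc c (ctens 1 v) = of_rat (wsum c v)"
proof -
  have k: "keys (ctens 1 v) \<subseteq> keys v" by (auto simp: Poly_Mapping.in_keys_iff)
  show ?thesis
    unfolding wc_def lookup_linext_superset'[OF Poly_Mapping.finite_keys k] by (simp add: wsum_def of_rat_sum of_rat_mult of_rat_eq_id)
qed

text \<open>Rational dual functionals, extended by complex linearity, still read off the
  coefficients.\<close>

lemma complex_independent:
  fixes x :: "nat \<Rightarrow> qvec"
  assumes fin: "finite I" and ind: "\<And>q. (\<Sum>i\<in>I. scl (q i) (x i)) = 0 \<Longrightarrow> \<forall>i\<in>I. q i = 0"
    and z: "(\<Sum>i\<in>I. scl (y i) (ctens 1 (x i))) = 0" and i: "i \<in> I"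
  shows "y i = 0"
proof -
  have inj: "inj_on x I"
  proof (rule inj_onI, rule ccontr)
    fix k l assume kl: "k \<in> I" "l \<in> I" "x k = x l" "k \<noteq> l"
    have "(\<Sum>i\<in>I. scl ((if i = k then 1 else 0) + (if i = l then -1 else 0)) (x i)) = (\<Sum>i\<in>I. (if i = k then x k else 0) + (if i = l then - x l else 0))"
      by (rule sum.cong) (use kl in \<open>auto simp: pm.scale_zero_left\<close>)
    also have "\<dots> = 0" using kl fin by (simp add: sum.distrib)
    finally show False using ind[of "\<lambda>i. (if i = k then 1 else 0) + (if i = l then -1 else 0)"] kl by auto
  qed
  have indep: "pm.independent (x ` I)"
  proof
    assume "pm.dependent (x ` I)"
    then obtain c v where c: "v \<in> x ` I" "c v \<noteq> 0" "(\<Sum>v\<in>x ` I. scl (c v) v) = 0"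
      using pm.dependent_finite[of "x ` I"] fin by auto
    then have "(\<Sum>i\<in>I. scl (c (x i)) (x i)) = 0" by (simp add: sum.reindex[OF inj])
    then show False using ind[of "\<lambda>i. c (x i)"] c by auto
  qed
  obtain c :: "qvec \<Rightarrow> nat \<Rightarrow> rat" where c: "\<And>b b'. b \<in> x ` I \<Longrightarrow> b' \<in> x ` I \<Longrightarrow> wsum (c b) b' = (if b = b' then 1 else 0)"
    using dual_functionals[OF indep] by metis
  have "0 = wc (c (x i)) (\<Sum>i\<in>I. scl (y i) (ctens 1 (x i)))" unfolding z by (simp add: wc_def)
  also have "\<dots> = (\<Sum>l\<in>I. if l = i then y i else 0)"
    unfolding wc_sum wc_ctens by (rule sum.cong[OF refl]) (use c i inj in \<open>auto dest: inj_onD\<close>)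
  also have "\<dots> = y i" using i fin by simp
  finally show ?thesis by simp
qed

lemma complexification_span:
  "complexification (pm.span (x ` K)) = pm.span ((\<lambda>i. ctens 1 (x i)) ` K)"
proof
  have "ctens 1 v \<in> pm.span ((\<lambda>i. ctens 1 (x i)) ` K)" if "v \<in> pm.span (x ` K)" for v
    using that
  proof (induction rule: pm.span_induct_alt)
    case base show ?case by (simp add: pm.span_zero)
  next
    case (step q b v)
    then have "ctens 1 b \<in> (\<lambda>i. ctens 1 (x i)) ` K" by auto
    then have "scl (of_rat q) (ctens 1 b) \<in> pm.span ((\<lambda>i. ctens 1 (x i)) ` K)" by (intro pm.span_scale pm.span_base)
    with step(2) show ?case unfolding ctens_add ctens_scl by (intro pm.span_add)
  qed
  then show "complexification (pm.span (x ` K)) \<subseteq> pm.span ((\<lambda>i. ctens 1 (x i)) ` K)"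
    unfolding complexification_def by (intro pm.span_minimal pm.subspace_span) blast
  show "pm.span ((\<lambda>i. ctens 1 (x i)) ` K) \<subseteq> complexification (pm.span (x ` K))"
    unfolding complexification_def using pm.span_base[of _ "x ` K"] by (intro pm.span_mono) blast
qed

section \<open>Flat frames adapted to the weight filtration\<close>

locale disc_variation = gauge U e for U e +
  fixes X :: variation and c :: complex and r :: real
  assumes U_ball: "U = ball c r" and r_pos: "0 < r" and HT: "HT_variation U X"
begin

abbreviation "H \<equiv> vt_fib X"
abbreviation "T \<equiv> vt_top X"
abbreviation "W \<equiv> vt_W X"
abbreviation "F \<equiv> vt_F X"

lemma lsH: "local_system U T H" using HT by (simp add: HT_variation_def)
lemma lsW: "local_system U (subtopology T (Sigma U (W m))) (W m)" using HT by (simp add: HT_variation_def)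
lemma W_mono: "z \<in> U \<Longrightarrow> W m z \<subseteq> W (m + 1) z" using HT by (simp add: HT_variation_def)
lemma W_H: "z \<in> U \<Longrightarrow> W m z \<subseteq> H z" using HT by (simp add: HT_variation_def)
lemma W_bound: "\<exists>a b. \<forall>z\<in>U. W a z = {0} \<and> W b z = H z" using HT by (simp add: HT_variation_def)
lemma F_bundle: "holo_subbundle U T (F p)" using HT by (simp add: HT_variation_def)
lemma F_mono: "z \<in> U \<Longrightarrow> F (p + 1) z \<subseteq> F p z" using HT by (simp add: HT_variation_def)
lemma griff: "griffiths_transversal U T F" using HT by (simp add: HT_variation_def)
lemma ht: "z \<in> U \<Longrightarrow> hodge_tate (\<lambda>m. W m z) (\<lambda>p. F p z)" using HT by (simp add: HT_variation_def)

sublocale LH: locsys U T H by unfold_locales (rule lsH)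

lemma c_U: "c \<in> U" using U_ball r_pos by simp
lemma con_U: "connected U" using U_ball by simp

lemma W_odd: "z \<in> U \<Longrightarrow> odd m \<Longrightarrow> W m z = W (m - 1) z"
  using ht[of z] unfolding hodge_tate_def by blast

lemma F_subspace: "z \<in> U \<Longrightarrow> pm.subspace (F p z)"
proof -
  assume "z \<in> U"
  from bspec[OF F_bundle[of p, unfolded holo_subbundle_def] this]
  obtain N ss where "z \<in> N" and f: "\<forall>z\<in>N. distinct (map (\<lambda>s. s z) ss) \<and> \<not> pm.dependent (set (map (\<lambda>s. s z) ss))
      \<and> pm.span (set (map (\<lambda>s. s z) ss)) = F p z" by (elim exE conjE)
  from bspec[OF f \<open>z \<in> N\<close>] have "F p z = pm.span (set (map (\<lambda>s. s z) ss))" by (elim conjE) (rule sym)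
  then show ?thesis by (simp only: pm.subspace_span)
qed

lemma F_anti: "z \<in> U \<Longrightarrow> F (p + int k) z \<subseteq> F p z"
proof (induction k)
  case (Suc k)
  then show ?case using F_mono[of z "p + int k"] by (simp add: algebra_simps)
qed simp

lemma W_up: "z \<in> U \<Longrightarrow> W m z \<subseteq> W (m + int k) z"
proof (induction k)
  case (Suc k)
  then show ?case using W_mono[of z "m + int k"] by (simp add: algebra_simps)
qed simp

text \<open>\<open>W m\<close> is a local system on the disc in its own right, so the extension can
  be made inside it.\<close>

lemma flat_W:
  assumes "z \<in> U" "v \<in> W m z"
  obtains \<sigma> where "flat_section T U \<sigma>" "\<sigma> z = v" "\<And>w. w \<in> U \<Longrightarrow> \<sigma> w \<in> W m w"
proof -
  interpret LW: locsys U "subtopology T (Sigma U (W m))" "W m" by unfold_locales (rule lsW)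
  obtain \<sigma> where s: "flat_section (subtopology T (Sigma U (W m))) U \<sigma>" "\<sigma> z = v"
    using LW.ext_ball[OF U_ball] assms unfolding LW.ext_def by blast
  have "flat_section T U \<sigma>" using s(1) unfolding flat_section_def by (rule continuous_map_into_fulltopology)
  then show ?thesis using that s(2) LW.flat_in(2)[OF s(1)] by blast
qed

definition adapted :: "nat \<Rightarrow> (nat \<Rightarrow> int) \<Rightarrow> (nat \<Rightarrow> complex \<Rightarrow> qvec) \<Rightarrow> bool" where
  "adapted N d \<sigma> \<longleftrightarrow> (\<forall>i<N. flat_section T U (\<sigma> i)) \<and>
     (\<forall>z\<in>U. \<forall>q. (\<Sum>i<N. scl (q i) (\<sigma> i z)) = 0 \<longrightarrow> (\<forall>i<N. q i = 0)) \<and>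
     (\<forall>z\<in>U. \<forall>m. W m z = pm.span ((\<lambda>i. \<sigma> i z) ` {i. i < N \<and> 2 * d i \<le> m})) \<and>
     (\<forall>z\<in>U. H z = pm.span ((\<lambda>i. \<sigma> i z) ` {..<N}))"

text \<open>A basis of the fibre at the centre that is adapted to \<open>W\<close> is extended by
  flat sections inside the steps of \<open>W\<close>. A flat section on \<open>U\<close> is
  determined by its value at one point, so independence and spanning carry over from the centre to
  every fibre.\<close>

lemma adapted_exists: obtains N d \<sigma> where "adapted N d \<sigma>"
proof -
  obtain a b where ab': "\<forall>z\<in>U. W a z = {0} \<and> W b z = H z" using W_bound by (elim exE)
  note ab = conjunct1[OF bspec[OF ab']] conjunct2[OF bspec[OF ab']]
  \<comment> \<open>\<open>2 * n0\<close> lies below \<open>a\<close>, so \<open>W\<close> vanishes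
    at the centre up to that weight, and \<open>K\<close> steps of weight two lead beyond
    \<open>b\<close>.\<close>
  define n0 where "n0 = min a b div 2 - 1"
  define K where "K = nat (\<bar>b\<bar> + \<bar>n0\<bar> + 1)"
  have le: "W m z \<subseteq> W m' z" if "z \<in> U" "m \<le> m'" for m m' z using W_up[OF that(1), of m "nat (m' - m)"] that(2) by simp
  have Wsub: "pm.subspace (W m z)" and Wfd: "findim (W m z)" if "z \<in> U" for m z
  proof -
    interpret LW: locsys U "subtopology T (Sigma U (W m))" "W m" by unfold_locales (rule lsW)
    show "findim (W m z)" using LW.findim_H[OF that] .
    then show "pm.subspace (W m z)" by (rule findim_subspace)
  qed
  have low: "W m c = {0}" if "m \<le> 2 * n0" for m
  proof -
    have "W m c \<subseteq> W a c" by (rule le[OF c_U]) (use that in \<open>simp add: n0_def\<close>)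
    then show ?thesis using ab(1)[OF c_U] pm.subspace_0[OF Wsub[OF c_U, of m]] by auto
  qed
  have high: "W m c = H c" if "2 * (n0 + int K) \<le> m" for m
  proof -
    have "b \<le> 2 * (n0 + int K)" unfolding K_def by simp
    then have "b \<le> m" using that by linarith
    then show ?thesis using le[OF c_U, of b m] ab(2)[OF c_U] W_H[OF c_U, of m] by blast
  qed
  let ?V = "\<lambda>k. W (2 * (n0 + int k)) c"
  have "\<exists>B g. finite B \<and> pm.independent B \<and> (\<forall>x\<in>B. 0 < g x \<and> g x \<le> K) \<and> (\<forall>k\<le>K. ?V k = pm.span {x\<in>B. g x \<le> k})"
    by (rule chain_basis) (use low Wfd[OF c_U] le[OF c_U] in auto)
  then obtain B g where B0: "finite B" "pm.independent B" "\<forall>x\<in>B. 0 < g x \<and> g x \<le> K"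
    "\<forall>k\<le>K. ?V k = pm.span {x\<in>B. g x \<le> k}" by (elim exE conjE)
  note B = B0(1,2) bspec[OF B0(3)] B0(4)[rule_format]
  obtain N h where h: "bij_betw h {..<N::nat} B" using ex_bij_betw_nat_finite[OF B(1)] by (auto simp: atLeast0LessThan)
  define d where "d i = n0 + int (g (h i))" for i
  have hB: "h i \<in> B" if "i < N" for i using h that by (auto simp: bij_betw_def)
  have img: "h ` {i. i < N \<and> P (h i)} = {x\<in>B. P x}" for P using h unfolding bij_betw_def by auto
  have allB: "{x\<in>B. g x \<le> K} = B" using B(3) by blast
  have Hc: "H c = pm.span B" using B(4)[of K] high[of "2 * (n0 + int K)"] allB by simp
  have Wc: "W m c = pm.span (h ` {i. i < N \<and> 2 * d i \<le> m})" for m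
  proof -
    define n where "n = m div 2"
    have Wm: "W m c = W (2 * n) c"
    proof (cases "even m")
      case False
      then have "m - 1 = 2 * n" unfolding n_def by presburger
      then show ?thesis using W_odd[OF c_U False] by simp
    qed (simp add: n_def)
    have dm: "2 * d i \<le> m \<longleftrightarrow> d i \<le> n" for i unfolding n_def by linarith
    have "{i. i < N \<and> 2 * d i \<le> m} = {i. i < N \<and> n0 + int (g (h i)) \<le> n}" unfolding dm by (simp only: d_def)
    then have im: "h ` {i. i < N \<and> 2 * d i \<le> m} = {x\<in>B. n0 + int (g x) \<le> n}" by (simp only: img[where P = "\<lambda>x. n0 + int (g x) \<le> n"])
    consider "n \<le> n0" | k where "n = n0 + int k" "k \<le> K" | "n0 + int K < n"
    proof -
      have "n \<le> n0 \<or> (n = n0 + int (nat (n - n0)) \<and> nat (n - n0) \<le> K) \<or> n0 + int K < n" by linarith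
      then show ?thesis using that by blast
    qed
    then show ?thesis
    proof cases
      case 1
      have e: "{x\<in>B. n0 + int (g x) \<le> n} = {}" using B(3) 1 by force
      show ?thesis unfolding Wm im e using low[of "2 * n"] 1 by (simp add: pm.span_empty)
    next
      case 2 then show ?thesis unfolding Wm im using B(4)[OF 2(2)] by simp
    next
      case 3
      have "{x\<in>B. n0 + int (g x) \<le> n} = B" using B(3) 3 by force
      then show ?thesis unfolding Wm im using high[of "2 * n"] 3 Hc by simp
    qed
  qed
  have "\<forall>i. \<exists>\<sigma>. i < N \<longrightarrow> flat_section T U \<sigma> \<and> \<sigma> c = h i \<and> (\<forall>w\<in>U. \<sigma> w \<in> W (2 * d i) w)"
  proof
    fix i
    show "\<exists>\<sigma>. i < N \<longrightarrow> flat_section T U \<sigma> \<and> \<sigma> c = h i \<and> (\<forall>w\<in>U. \<sigma> w \<in> W (2 * d i) w)"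
    proof (cases "i < N")
      case True
      have "h i \<in> W (2 * d i) c" unfolding Wc using True by (intro pm.span_base) auto
      from flat_W[OF c_U this] obtain \<sigma> where "flat_section T U \<sigma>" "\<sigma> c = h i" "\<And>w. w \<in> U \<Longrightarrow> \<sigma> w \<in> W (2 * d i) w" by blast
      then show ?thesis by blast
    qed simp
  qed
  from choice[OF this] obtain \<sigma> where s: "\<And>i. i < N \<Longrightarrow> flat_section T U (\<sigma> i)" "\<And>i. i < N \<Longrightarrow> \<sigma> i c = h i"
    "\<And>i w. i < N \<Longrightarrow> w \<in> U \<Longrightarrow> \<sigma> i w \<in> W (2 * d i) w" by blast
  have comb: "flat_section T U (\<lambda>z. \<Sum>i\<in>J. scl (q i) (\<sigma> i z))" if "J \<subseteq> {..<N}" for J q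
    by (rule LH.flat_lincomb) (use that s finite_subset[OF that] in auto)
  have zero: "flat_section T U (\<lambda>z. 0)" using comb[of "{}"] by simp
  have ind: "\<forall>i<N. q i = 0" if z: "z \<in> U" and q: "(\<Sum>i<N. scl (q i) (\<sigma> i z)) = 0" for z q
  proof -
    have "(\<Sum>i<N. scl (q i) (\<sigma> i c)) = 0"
      by (rule LH.flat_unique[OF comb[OF order_refl] zero con_U z c_U q])
    then have "(\<Sum>i<N. scl (q i) (h i)) = 0" using s(2) by simp
    moreover have "(\<Sum>i<N. scl (q i) (h i)) = (\<Sum>x\<in>B. scl (q (the_inv_into {..<N} h x)) x)"
      using sum.reindex_bij_betw[OF h, of "\<lambda>x. scl (q (the_inv_into {..<N} h x)) x"] h
      by (simp add: bij_betw_def the_inv_into_f_f)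
    moreover have "\<forall>u. (\<Sum>x\<in>B. scl (u x) x) = 0 \<longrightarrow> (\<forall>x\<in>B. u x = 0)"
      using B(2) unfolding pm.dependent_finite[OF B(1)] by blast
    ultimately have q0: "\<forall>x\<in>B. q (the_inv_into {..<N} h x) = 0"
      by (auto dest: spec[of _ "\<lambda>x. q (the_inv_into {..<N} h x)"])
    show ?thesis
    proof (intro allI impI)
      fix i assume i: "i < N"
      have "the_inv_into {..<N} h (h i) = i" using h i by (intro the_inv_into_f_f) (auto simp: bij_betw_def)
      then show "q i = 0" using bspec[OF q0 hB[OF i]] by simp
    qed
  qed
  have span: "W' z = pm.span ((\<lambda>i. \<sigma> i z) ` J)"
    if z: "z \<in> U" and J: "J \<subseteq> {..<N}" and c: "W' c = pm.span (h ` J)" and sub: "pm.subspace (W' z)"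
      and mem: "\<And>i. i \<in> J \<Longrightarrow> \<sigma> i z \<in> W' z" and ex: "\<And>v. v \<in> W' z \<Longrightarrow> \<exists>\<tau>. flat_section T U \<tau> \<and> \<tau> z = v \<and> \<tau> c \<in> W' c" for W' z J
  proof
    show "pm.span ((\<lambda>i. \<sigma> i z) ` J) \<subseteq> W' z" using mem sub by (intro pm.span_minimal) auto
    show "W' z \<subseteq> pm.span ((\<lambda>i. \<sigma> i z) ` J)"
    proof
      fix v assume "v \<in> W' z"
      then obtain \<tau> where t: "flat_section T U \<tau>" "\<tau> z = v" "\<tau> c \<in> W' c" using ex by blast
      have "\<tau> c \<in> pm.span (h ` J)" using t(3) c by simp
      then obtain q where q: "\<tau> c = (\<Sum>i\<in>J. scl (q i) (h i))" by (rule span_image_sum[OF finite_subset[OF J finite_lessThan]])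
      also have "\<dots> = (\<Sum>i\<in>J. scl (q i) (\<sigma> i c))" by (rule sum.cong) (use s(2) J in auto)
      finally have "\<tau> z = (\<Sum>i\<in>J. scl (q i) (\<sigma> i z))"
        by (rule LH.flat_unique[OF t(1) comb[OF J] con_U c_U z])
      then show "v \<in> pm.span ((\<lambda>i. \<sigma> i z) ` J)" using t(2) sum_in_span_image by metis
    qed
  qed
  have "adapted N d \<sigma>"
    unfolding adapted_def
  proof (intro conjI ballI allI impI)
    show "flat_section T U (\<sigma> i)" if "i < N" for i using s(1) that .
    show "q i = 0" if "z \<in> U" "(\<Sum>i<N. scl (q i) (\<sigma> i z)) = 0" "i < N" for z q i using ind[OF that(1,2)] that(3) by blast
    fix z assume z: "z \<in> U"
    show "W m z = pm.span ((\<lambda>i. \<sigma> i z) ` {i. i < N \<and> 2 * d i \<le> m})" for m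
    proof (rule span[OF z _ Wc Wsub[OF z]])
      show "\<sigma> i z \<in> W m z" if "i \<in> {i. i < N \<and> 2 * d i \<le> m}" for i
        using s(3)[of i z] that z le[OF z, of "2 * d i" m] by blast
      show "\<exists>\<tau>. flat_section T U \<tau> \<and> \<tau> z = v \<and> \<tau> c \<in> W m c" if v: "v \<in> W m z" for v
      proof -
        show ?thesis
        proof (rule flat_W[OF z v])
          fix \<tau> assume "flat_section T U \<tau>" "\<tau> z = v" "\<And>w. w \<in> U \<Longrightarrow> \<tau> w \<in> W m w"
          then show ?thesis using c_U by blast
        qed
      qed
    qed auto
    show "H z = pm.span ((\<lambda>i. \<sigma> i z) ` {..<N})"
    proof (rule span[OF z order_refl])
      show "H c = pm.span (h ` {..<N})" using Hc h by (simp add: bij_betw_def)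
      show "pm.subspace (H z)" using LH.findim_H[OF z] findim_subspace by blast
      show "\<sigma> i z \<in> H z" if "i \<in> {..<N}" for i using LH.flat_in(2)[OF s(1) z] that by simp
      show "\<exists>\<tau>. flat_section T U \<tau> \<and> \<tau> z = v \<and> \<tau> c \<in> H c" if v: "v \<in> H z" for v
      proof -
        obtain \<tau> where "flat_section T U \<tau>" "\<tau> z = v" using LH.ext_ball[OF U_ball] z v unfolding LH.ext_def by blast
        then show ?thesis using LH.flat_in(2)[of U \<tau> c] c_U by blast
      qed
    qed
  qed
  then show ?thesis by (rule that)
qed

end

section \<open>The splitting of the weight filtration by the Hodge filtration\<close>

lemma complexification_subspace: "pm.subspace (complexification V)"
  by (simp add: complexification_def pm.subspace_span)

lemma ctens_eq_scl: "ctens c v = scl c (ctens 1 v)"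
  by (rule poly_mapping_eqI) simp

lemma unitriangular_expand:
  fixes x :: "nat \<Rightarrow> ('b \<Rightarrow>\<^sub>0 'k::field)" and d :: "nat \<Rightarrow> int"
  assumes fin: "finite I" and i: "i \<in> I" and a: "a i = 1" "\<And>j. j \<in> I \<Longrightarrow> j \<noteq> i \<Longrightarrow> d i \<le> d j \<Longrightarrow> a j = 0"
  shows "(\<Sum>j\<in>I. scl (a j) (x j)) = x i + (\<Sum>j\<in>{j\<in>I. d j < d i}. scl (a j) (x j))"
proof -
  have "(\<Sum>j\<in>I - {i}. scl (a j) (x j)) = (\<Sum>j\<in>{j\<in>I. d j < d i}. scl (a j) (x j))"
  proof (rule sum.mono_neutral_right)
    show "\<forall>j\<in>I - {i} - {j\<in>I. d j < d i}. scl (a j) (x j) = 0"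
    proof
      fix j assume "j \<in> I - {i} - {j\<in>I. d j < d i}"
      then have "a j = 0" by (intro a(2)) auto
      then show "scl (a j) (x j) = 0" by (simp only: pm.scale_zero_left)
    qed
  qed (use fin in auto)
  then show ?thesis unfolding sum.remove[OF fin i] by (simp only: a(1) pm.scale_one)
qed

lemma unitriangular_span_eq:
  fixes x x' :: "nat \<Rightarrow> ('b \<Rightarrow>\<^sub>0 'k::field)" and d :: "nat \<Rightarrow> int"
  assumes fin: "finite I" and x': "\<And>i. i \<in> I \<Longrightarrow> x' i = x i + (\<Sum>j\<in>{j\<in>I. d j < d i}. scl (a i j) (x j))"
    and K: "K \<subseteq> I" "\<And>i j. i \<in> K \<Longrightarrow> j \<in> I \<Longrightarrow> d j \<le> d i \<Longrightarrow> j \<in> K"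
  shows "pm.span (x' ` K) = pm.span (x ` K)"
proof
  show "pm.span (x' ` K) \<subseteq> pm.span (x ` K)"
  proof (rule pm.span_minimal[OF image_subsetI pm.subspace_span])
    fix i assume i: "i \<in> K"
    have "x j \<in> pm.span (x ` K)" if "j \<in> I" "d j \<le> d i" for j using K(2)[OF i that] by (intro pm.span_base imageI)
    then show "x' i \<in> pm.span (x ` K)" unfolding x'[OF subsetD[OF K(1) i]] using K(1) i
      by (intro pm.span_add pm.span_sum pm.span_scale) auto
  qed
  show "pm.span (x ` K) \<subseteq> pm.span (x' ` K)"
  proof (rule pm.span_minimal[OF image_subsetI pm.subspace_span])
    fix i assume i: "i \<in> K"
    have "x i \<in> pm.span (x' ` {l\<in>I. d l \<le> d i})" by (rule unitriangular_span[OF fin x']) (use i K(1) in auto)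
    moreover have "pm.span (x' ` {l\<in>I. d l \<le> d i}) \<subseteq> pm.span (x' ` K)" using K(2)[OF i] by (intro pm.span_mono image_mono) auto
    ultimately show "x i \<in> pm.span (x' ` K)" by blast
  qed
qed

lemma independent_image_zero:
  fixes f :: "'i \<Rightarrow> ('b \<Rightarrow>\<^sub>0 'k::field)"
  assumes fin: "finite K" and inj: "inj_on f K" and ind: "pm.independent (f ` K)"
    and z: "(\<Sum>s\<in>K. scl (x s) (f s)) = 0" and s: "s \<in> K"
  shows "x s = 0"
proof -
  let ?y = "\<lambda>v. x (the_inv_into K f v)"
  have "(\<Sum>v\<in>f ` K. scl (?y v) v) = (\<Sum>s\<in>K. scl (x s) (f s))"
    unfolding sum.reindex[OF inj] by (rule sum.cong[OF refl]) (simp add: the_inv_into_f_f[OF inj])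
  then have "?y (f s) = 0" using z s fin by (intro pm.independentD[OF ind, of "f ` K"]) auto
  then show ?thesis by (simp add: the_inv_into_f_f[OF inj s])
qed

context disc_variation begin

abbreviation "WC m z \<equiv> complexification (W m z)"

lemma WC_mono: assumes "z \<in> U" "m \<le> m'" shows "WC m z \<subseteq> WC m' z"
proof -
  have "W m z \<subseteq> W m' z" using W_up[OF assms(1), of m "nat (m' - m)"] assms(2) by simp
  then show ?thesis unfolding complexification_def by (intro pm.span_mono image_mono)
qed

lemma WC_odd: "z \<in> U \<Longrightarrow> WC (2 * n - 1) z = WC (2 * n - 2) z"
  using W_odd[of z "2 * n - 1"] by simp

lemma gr_opposed:
  assumes "z \<in> U"
  shows "gr_filt (\<lambda>m. W m z) m (F p z) \<inter> gr_filt (\<lambda>m. W m z) m (conj_space (F (m + 1 - p) z)) = WC (m - 1) z"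
proof -
  have "mixed_hodge (\<lambda>m. W m z) (\<lambda>p. F p z)" using ht[OF assms] unfolding hodge_tate_def by (elim conjE)
  from this[unfolded mixed_hodge_def, rule_format, of m p] show ?thesis by (rule conjunct1)
qed

lemma gr_tate:
  assumes "z \<in> U"
  shows "WC (2 * n) z = gr_filt (\<lambda>m. W m z) (2 * n) (F n z) \<inter> gr_filt (\<lambda>m. W m z) (2 * n) (conj_space (F n z))"
proof -
  have "\<forall>n. WC (2 * n) z = gr_filt (\<lambda>m. W m z) (2 * n) (F n z) \<inter> gr_filt (\<lambda>m. W m z) (2 * n) (conj_space (F n z))"
    using ht[OF assms] unfolding hodge_tate_def by (elim conjE)
  then show ?thesis by (rule spec)
qed

text \<open>In weight \<open>2n\<close> the conjugate of \<open>F n\<close> induces the whole graded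
  piece by \<open>gr_tate\<close>, so the opposed step \<open>F (n + 1)\<close> induces zero. The
  odd weight in between is skipped by \<open>WC_odd\<close>.\<close>

lemma F_meet_W:
  assumes z: "z \<in> U" and y: "y \<in> F (n + 1) z" "y \<in> WC (2 * n) z"
  shows "y \<in> WC (2 * n - 2) z"
proof -
  have 0: "0 \<in> WC (2 * n - 1) z" by (rule pm.subspace_0[OF complexification_subspace])
  have "y + 0 \<in> gr_filt (\<lambda>m. W m z) (2 * n) (F (n + 1) z)"
    unfolding gr_filt_def sum_space_def using y 0 by blast
  then have 1: "y \<in> gr_filt (\<lambda>m. W m z) (2 * n) (F (n + 1) z)" by simp
  have 2: "y \<in> gr_filt (\<lambda>m. W m z) (2 * n) (conj_space (F n z))" using y(2) unfolding gr_tate[OF z] by (rule IntD2)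
  have e: "2 * n + 1 - (n + 1) = n" by simp
  have "y \<in> WC (2 * n - 1) z" using IntI[OF 1 2] unfolding gr_opposed[OF z, of "2 * n" "n + 1", unfolded e] .
  then show ?thesis unfolding WC_odd[OF z] .
qed

text \<open>As \<open>F p\<close> lies in every earlier step of the filtration,
  \<open>F_meet_W\<close> can be applied again and again; it pushes the vector down two weights at a
  time until \<open>W\<close> vanishes.\<close>

lemma F_WC_zero:
  assumes z: "z \<in> U" and y: "y \<in> F p z" "y \<in> WC (2 * p - 2) z"
  shows "y = 0"
proof -
  have step: "y \<in> WC (2 * (p - 1 - int k)) z" for k
  proof (induction k)
    case 0
    have "2 * p - 2 = 2 * (p - 1 - int 0)" by simp
    then show ?case using y(2) by (simp only:)
  next
    case (Suc k)
    have "p = (p - 1 - int k) + 1 + int k" by simp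
    then have "F p z \<subseteq> F (p - 1 - int k + 1) z" using F_anti[OF z, of "p - 1 - int k + 1" k] by (simp only:)
    then have "y \<in> F (p - 1 - int k + 1) z" using y(1) by blast
    from F_meet_W[OF z this Suc.IH] have "y \<in> WC (2 * (p - 1 - int k) - 2) z" .
    moreover have "2 * (p - 1 - int k) - 2 = 2 * (p - 1 - int (Suc k))" by simp
    ultimately show ?case by (simp only:)
  qed
  obtain a b where ab: "\<forall>z\<in>U. W a z = {0} \<and> W b z = H z" using W_bound by (elim exE)
  define k where "k = nat (\<bar>p\<bar> + \<bar>a\<bar>)"
  have "int k = \<bar>p\<bar> + \<bar>a\<bar>" by (simp add: k_def)
  then have "2 * (p - 1 - int k) \<le> a" using abs_ge_self[of p] abs_ge_minus_self[of a] abs_ge_zero[of a] by (simp add: algebra_simps)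
  from WC_mono[OF z this] step have "y \<in> WC a z" by blast
  moreover have "W a z = {0}" using ab z by simp
  ultimately show ?thesis by (simp add: complexification_def pm.span_insert_0 pm.span_empty)
qed

text \<open>The Tate condition says that \<open>F n\<close> induces the whole graded piece of weight
  \<open>2n\<close>. Together with \<open>F_WC_zero\<close> this splits off
  \<open>WC (2 * n - 2)\<close> from \<open>WC (2 * n)\<close>.\<close>

lemma F_split:
  assumes z: "z \<in> U" and v: "v \<in> WC (2 * n) z"
  obtains y where "y \<in> WC (2 * n - 2) z" "v + y \<in> F n z"
proof -
  have "v \<in> gr_filt (\<lambda>m. W m z) (2 * n) (F n z)" using v unfolding gr_tate[OF z] by (rule IntD1)
  then obtain f w where fw: "v = f + w" "f \<in> F n z" "w \<in> WC (2 * n - 1) z" unfolding gr_filt_def sum_space_def by blast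
  have "w \<in> WC (2 * n - 2) z" using fw(3) unfolding WC_odd[OF z] .
  then have "- w \<in> WC (2 * n - 2) z" by (rule pm.subspace_neg[OF complexification_subspace])
  moreover have "v + - w = f" using fw(1) by simp
  ultimately show ?thesis using that[of "- w"] fw(2) by simp
qed

lemma hval_in_H: "ps \<in> hexprs T M \<Longrightarrow> z \<in> M \<Longrightarrow> hval ps z \<in> complexification (H z)"
proof (induction ps)
  case Nil show ?case by (simp add: pm.subspace_0[OF complexification_subspace])
next
  case (Cons x ps)
  obtain f \<tau> where x: "x = (f, \<tau>)" by (cases x)
  have t: "flat_section T M \<tau>" and ps: "ps \<in> hexprs T M" using Cons.prems(1) by (auto simp: hexprs_def x)
  have "\<tau> z \<in> H z" by (rule LH.flat_in(2)[OF t Cons.prems(2)])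
  then have "ctens 1 (\<tau> z) \<in> complexification (H z)" unfolding complexification_def by (intro pm.span_base imageI)
  then have "scl (f z) (ctens 1 (\<tau> z)) \<in> complexification (H z)" by (rule pm.subspace_scale[OF complexification_subspace])
  from pm.subspace_add[OF complexification_subspace this Cons.IH[OF ps Cons.prems(2)]]
  show ?case unfolding hval_Cons x fst_conv snd_conv ctens_eq_scl[of "f z"] .
qed

text \<open>Local frames of \<open>F\<close> consist of holomorphic sections, whose values are
  complex combinations of flat sections.\<close>

lemma F_in_H:
  assumes z: "z \<in> U" and y: "y \<in> F p z" shows "y \<in> complexification (H z)"
proof -
  from bspec[OF F_bundle[of p, unfolded holo_subbundle_def] z]
  obtain M ss where M: "z \<in> M" and hs: "\<forall>s\<in>set ss. holo_section T M s"
    and fr: "\<forall>z\<in>M. distinct (map (\<lambda>s. s z) ss) \<and> \<not> pm.dependent (set (map (\<lambda>s. s z) ss))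
      \<and> pm.span (set (map (\<lambda>s. s z) ss)) = F p z" by (elim exE conjE)
  from bspec[OF fr M] have e: "F p z = pm.span (set (map (\<lambda>s. s z) ss))" by (elim conjE) (rule sym)
  have "s z \<in> complexification (H z)" if "s \<in> set ss" for s
  proof -
    from bspec[OF bspec[OF hs that, unfolded holo_section_def] M]
    obtain M' ps where "z \<in> M'" "ps \<in> hexprs T M'" "\<forall>z\<in>M'. s z = hval ps z" by (elim exE conjE)
    then show ?thesis using hval_in_H by simp
  qed
  then have "pm.span (set (map (\<lambda>s. s z) ss)) \<subseteq> complexification (H z)"
    by (intro pm.span_minimal complexification_subspace) auto
  then show ?thesis using y unfolding e by blast
qed

end

locale framed = disc_variation U e X c r for U e X c r +
  fixes N :: nat and d :: "nat \<Rightarrow> int" and \<sigma> :: "nat \<Rightarrow> complex \<Rightarrow> qvec"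
  assumes ad: "adapted N d \<sigma>"
begin

abbreviation "u i z \<equiv> ctens 1 (\<sigma> i z)"
abbreviation "comb x z \<equiv> \<Sum>j<N. scl (x j) (u j z)"

lemmas flat = conjunct1[OF ad[unfolded adapted_def], rule_format]
  and ind = conjunct1[OF conjunct2[OF ad[unfolded adapted_def]], rule_format]
  and W_span = conjunct1[OF conjunct2[OF conjunct2[OF ad[unfolded adapted_def]]], rule_format]
  and H_span = conjunct2[OF conjunct2[OF conjunct2[OF ad[unfolded adapted_def]]], rule_format]

lemma comb_zero:
  assumes z: "z \<in> U" and c: "comb x z = 0" and i: "i < N"
  shows "x i = 0"
proof (rule complex_independent[of "{..<N}" "\<lambda>i. \<sigma> i z" x i])
  show "\<forall>i\<in>{..<N}. q i = 0" if "(\<Sum>i\<in>{..<N}. scl (q i) (\<sigma> i z)) = 0" for q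
    using ind[OF z that] by blast
qed (use c i in auto)

lemma comb_diff: "comb (\<lambda>j. x j - y j) z = comb x z - comb y z"
  by (simp add: pm.scale_left_diff_distrib sum_subtractf)

lemma comb_unique:
  assumes z: "z \<in> U" and "comb x z = comb y z" and i: "i < N"
  shows "x i = y i"
proof -
  have "comb (\<lambda>j. x j - y j) z = 0" unfolding comb_diff assms(2) by simp
  from comb_zero[OF z this i] show ?thesis by simp
qed

lemma comb_sum: "(\<Sum>s\<in>K. scl (a s) (comb (b s) z)) = comb (\<lambda>j. \<Sum>s\<in>K. b s j * a s) z"
proof -
  have "(\<Sum>s\<in>K. scl (a s) (comb (b s) z)) = (\<Sum>s\<in>K. \<Sum>j<N. scl (b s j * a s) (u j z))"
    by (simp add: pm.scale_sum_right mult.commute)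
  also have "\<dots> = (\<Sum>j<N. \<Sum>s\<in>K. scl (b s j * a s) (u j z))" by (rule sum.swap)
  also have "\<dots> = comb (\<lambda>j. \<Sum>s\<in>K. b s j * a s) z" by (simp add: pm.scale_sum_left)
  finally show ?thesis .
qed

lemma WC_span: "z \<in> U \<Longrightarrow> WC m z = pm.span ((\<lambda>i. u i z) ` {i. i < N \<and> 2 * d i \<le> m})"
  unfolding W_span by (rule complexification_span)

text \<open>\<open>F_WC_zero\<close> in coordinates: a vector whose coordinates of degree at least
  \<open>p\<close> vanish has weight at most \<open>2 * p - 2\<close>. Hence vectors of
  \<open>F p\<close> are determined by those coordinates.\<close>

lemma F_coords_zero:
  assumes z: "z \<in> U" and y: "comb x z \<in> F p z" and x: "\<And>j. j < N \<Longrightarrow> p \<le> d j \<Longrightarrow> x j = 0" and j: "j < N"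
  shows "x j = 0"
proof -
  let ?K = "{i. i < N \<and> 2 * d i \<le> 2 * p - 2}"
  have "comb x z = (\<Sum>j\<in>?K. scl (x j) (u j z))"
  proof (rule sum.mono_neutral_right)
    show "\<forall>i\<in>{..<N} - ?K. scl (x i) (u i z) = 0"
    proof
      fix i assume "i \<in> {..<N} - ?K"
      then have "x i = 0" by (intro x) auto
      then show "scl (x i) (u i z) = 0" by (simp only: pm.scale_zero_left)
    qed
  qed auto
  also have "\<dots> \<in> WC (2 * p - 2) z" unfolding WC_span[OF z] by (rule sum_in_span_image)
  finally have "comb x z = 0" by (rule F_WC_zero[OF z y])
  then show ?thesis by (rule comb_zero[OF z _ j])
qed

lemma F_coords_unique:
  assumes z: "z \<in> U" and y: "comb x z \<in> F p z" "comb x' z \<in> F p z"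
    and x: "\<And>j. j < N \<Longrightarrow> p \<le> d j \<Longrightarrow> x j = x' j" and j: "j < N"
  shows "x j = x' j"
proof -
  have "comb (\<lambda>j. x j - x' j) z \<in> F p z" unfolding comb_diff by (rule pm.subspace_diff[OF F_subspace[OF z] y])
  from F_coords_zero[OF z this _ j] show ?thesis using x by simp
qed

text \<open>On a ball, being connected, a flat section is a fixed rational combination of the frame;
  one ball serves all entries of the list.\<close>

lemma hval_coords:
  assumes ps: "ps \<in> hexprs T M" and M: "open M" "z0 \<in> M" "M \<subseteq> U"
  shows "\<exists>M' \<phi>. open M' \<and> z0 \<in> M' \<and> M' \<subseteq> M \<and> (\<forall>j. \<phi> j holomorphic_on M') \<and> (\<forall>z\<in>M'. hval ps z = comb (\<lambda>j. \<phi> j z) z)"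
proof -
  obtain \<epsilon> where eps: "0 < \<epsilon>" "ball z0 \<epsilon> \<subseteq> M" using M(1,2) open_contains_ball by blast
  let ?M = "ball z0 \<epsilon>"
  have "\<exists>\<phi>. (\<forall>j. \<phi> j holomorphic_on ?M) \<and> (\<forall>z\<in>?M. hval ps z = comb (\<lambda>j. \<phi> j z) z)"
    using ps
  proof (induction ps)
    case Nil show ?case by (intro exI[of _ "\<lambda>_ _. 0"]) (simp add: pm.scale_zero_left)
  next
    case (Cons x ps)
    obtain f \<tau> where x: "x = (f, \<tau>)" by (cases x)
    have f: "f holomorphic_on M" and t: "flat_section T M \<tau>" and ps: "ps \<in> hexprs T M" using Cons.prems by (auto simp: hexprs_def x)
    obtain \<phi> where p: "\<forall>j. \<phi> j holomorphic_on ?M" "\<forall>z\<in>?M. hval ps z = comb (\<lambda>j. \<phi> j z) z"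
      using Cons.IH[OF ps] by (elim exE conjE)
    have "\<tau> z0 \<in> pm.span ((\<lambda>i. \<sigma> i z0) ` {..<N})" using LH.flat_in(2)[OF t M(2)] H_span[of z0] M(2,3) by blast
    then obtain q where q: "\<tau> z0 = (\<Sum>j<N. scl (q j) (\<sigma> j z0))" by (rule span_image_sum[OF finite_lessThan])
    have fl: "flat_section T U (\<lambda>z. \<Sum>j<N. scl (q j) (\<sigma> j z))" by (rule LH.flat_lincomb) (auto intro: flat)
    have tau: "\<tau> z = (\<Sum>j<N. scl (q j) (\<sigma> j z))" if z: "z \<in> ?M" for z
    proof (rule LH.flat_unique[where S = ?M and a = z0])
      show "flat_section T ?M \<tau>" by (rule LH.flat_subset[OF t eps(2)])
      show "flat_section T ?M (\<lambda>z. \<Sum>j<N. scl (q j) (\<sigma> j z))" by (rule LH.flat_subset[OF fl]) (use eps(2) M(3) in blast)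
    qed (use z eps q in auto)
    have "hval (x # ps) z = comb (\<lambda>j. f z * of_rat (q j) + \<phi> j z) z" if z: "z \<in> ?M" for z
    proof -
      have "ctens (f z) (\<tau> z) = comb (\<lambda>j. f z * of_rat (q j)) z"
        unfolding tau[OF z] ctens_sum by (rule sum.cong[OF refl], rule poly_mapping_eqI) (simp add: of_rat_mult mult.assoc)
      then show ?thesis using bspec[OF p(2) z] by (simp add: hval_Cons x pm.scale_left_distrib sum.distrib)
    qed
    moreover have "(\<lambda>z. f z * of_rat (q j) + \<phi> j z) holomorphic_on ?M" for j
      using holomorphic_on_subset[OF f eps(2)] p(1) by (intro holomorphic_intros) auto
    ultimately show ?case by (intro exI[of _ "\<lambda>j z. f z * of_rat (q j) + \<phi> j z"]) blast
  qed
  then obtain \<phi> where "\<forall>j. \<phi> j holomorphic_on ?M" "\<forall>z\<in>?M. hval ps z = comb (\<lambda>j. \<phi> j z) z" by (elim exE conjE)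
  then show ?thesis using eps by (intro exI[of _ ?M] exI[of _ \<phi>]) auto
qed

text \<open>Row \<open>i\<close> lifts the class of \<open>\<sigma> i\<close> in its graded piece to
  \<open>F\<close>: it is a vector of \<open>F (d i)\<close> that differs from
  \<open>\<sigma> i\<close> by terms of smaller degree. Values outside \<open>U\<close> are set to
  zero so that entries are elements of the function space.\<close>

definition splits :: "(nat \<Rightarrow> nat \<Rightarrow> complex \<Rightarrow> complex) \<Rightarrow> bool" where
  "splits S \<longleftrightarrow> (\<forall>i<N. \<forall>z\<in>U. comb (\<lambda>j. S i j z) z \<in> F (d i) z) \<and> (\<forall>i<N. \<forall>z\<in>U. S i i z = 1) \<and>
     (\<forall>i j. j \<noteq> i \<longrightarrow> d i \<le> d j \<longrightarrow> S i j = 0) \<and> (\<forall>i j z. z \<notin> U \<longrightarrow> S i j z = 0)"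

text \<open>The rows are chosen point by point: the correction from \<open>F_split\<close> has
  weight at most \<open>2 * d i - 2\<close>, hence only coordinates of smaller degree. Holomorphy
  comes later from uniqueness.\<close>

lemma splits_exists: "\<exists>S. splits S"
proof -
  let ?P = "\<lambda>i z x. comb x z \<in> F (d i) z \<and> x i = 1 \<and> (\<forall>j<N. j \<noteq> i \<longrightarrow> d i \<le> d j \<longrightarrow> x j = 0)"
  have ex: "\<exists>x. ?P i z x" if z: "z \<in> U" and i: "i < N" for i z
  proof -
    let ?K = "{l. l < N \<and> 2 * d l \<le> 2 * d i - 2}"
    have "u i z \<in> WC (2 * d i) z" unfolding WC_span[OF z] using i by (intro pm.span_base imageI) simp
    then obtain y where y: "y \<in> WC (2 * d i - 2) z" "u i z + y \<in> F (d i) z" by (rule F_split[OF z])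
    have fK: "finite ?K" by simp
    have "y \<in> pm.span ((\<lambda>l. u l z) ` ?K)" using y(1) unfolding WC_span[OF z] .
    then obtain x where x: "y = (\<Sum>l\<in>?K. scl (x l) (u l z))" by (rule span_image_sum[OF fK])
    define x' where "x' j = (if j = i then 1 else if d j < d i then x j else 0)" for j
    have "comb x' z = u i z + (\<Sum>j\<in>{j\<in>{..<N}. d j < d i}. scl (x' j) (u j z))"
      by (rule unitriangular_expand) (use i in \<open>auto simp: x'_def\<close>)
    also have "(\<Sum>j\<in>{j\<in>{..<N}. d j < d i}. scl (x' j) (u j z)) = y"
      unfolding x by (rule sum.cong) (auto simp: x'_def)
    finally have "comb x' z \<in> F (d i) z" using y(2) by simp
    moreover have "x' i = 1" "\<forall>j<N. j \<noteq> i \<longrightarrow> d i \<le> d j \<longrightarrow> x' j = 0" by (auto simp: x'_def)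
    ultimately show ?thesis by blast
  qed
  define x where "x i z = (SOME x. ?P i z x)" for i z
  have x: "?P i z (x i z)" if "z \<in> U" "i < N" for i z unfolding x_def by (rule someI_ex[OF ex[OF that]])
  define S where "S i j z = (if z \<in> U \<and> \<not> (j \<noteq> i \<and> d i \<le> d j) then x i z j else 0)" for i j z
  have "comb (\<lambda>j. S i j z) z = comb (x i z) z" if "z \<in> U" "i < N" for i z
    by (rule sum.cong[OF refl]) (use x[OF that] that in \<open>auto simp: S_def\<close>)
  then have "splits S" unfolding splits_def using x by (auto simp: S_def fun_eq_iff)
  then show ?thesis by (intro exI[of _ S])
qed

end

section \<open>Holomorphy and differential equation of the splitting\<close>

locale split_framed = framed U e X c r N d \<sigma> for U e X c r N d \<sigma> +
  fixes S :: "nat \<Rightarrow> nat \<Rightarrow> complex \<Rightarrow> complex"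
  assumes sp: "splits S"
begin

lemmas s_F = conjunct1[OF sp[unfolded splits_def], rule_format]
  and S_one = conjunct1[OF conjunct2[OF sp[unfolded splits_def]], rule_format]
  and S_zero = conjunct1[OF conjunct2[OF conjunct2[OF sp[unfolded splits_def]]], rule_format]
  and S_out = conjunct2[OF conjunct2[OF conjunct2[OF sp[unfolded splits_def]]], rule_format]

abbreviation "s i z \<equiv> comb (\<lambda>j. S i j z) z"

lemma s_expand:
  assumes "i < N" "z \<in> U"
  shows "s i z = u i z + (\<Sum>j\<in>{j\<in>{..<N}. d j < d i}. scl (S i j z) (u j z))"
  by (rule unitriangular_expand) (use assms S_one S_zero[of _ i] in auto)

lemma s_WC: assumes i: "i < N" and z: "z \<in> U" shows "s i z \<in> WC (2 * d i) z"
  unfolding s_expand[OF i z] WC_span[OF z] using i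
  by (intro pm.span_add pm.span_sum pm.span_scale; intro pm.span_base imageI) auto

text \<open>The rows span \<open>H\<close> over the complex numbers, by a unitriangular change of
  frame. Once the rows of degree at least \<open>p\<close> are subtracted from a vector of
  \<open>F p\<close>, the rest lies in \<open>F p\<close> and in \<open>WC (2 * p - 2)\<close>, so
  it is zero.\<close>

lemma F_span:
  assumes z: "z \<in> U" shows "F p z = pm.span ((\<lambda>i. s i z) ` {i. i < N \<and> p \<le> d i})"
proof
  let ?K = "{i. i < N \<and> p \<le> d i}"
  have sK: "s i z \<in> F p z" if "i \<in> ?K" for i
  proof -
    have "F (d i) z \<subseteq> F p z" using F_anti[OF z, of p "nat (d i - p)"] that by simp
    then show ?thesis using s_F[OF _ z, of i] that by blast
  qed
  then show "pm.span ((\<lambda>i. s i z) ` ?K) \<subseteq> F p z" by (intro pm.span_minimal F_subspace[OF z]) blast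
  show "F p z \<subseteq> pm.span ((\<lambda>i. s i z) ` ?K)"
  proof
    fix y assume y: "y \<in> F p z"
    have "y \<in> pm.span ((\<lambda>i. u i z) ` {..<N})" using F_in_H[OF z y] unfolding H_span[OF z] complexification_span .
    also have "pm.span ((\<lambda>i. u i z) ` {..<N}) = pm.span ((\<lambda>i. s i z) ` {..<N})"
      by (rule unitriangular_span_eq[symmetric, OF finite_lessThan s_expand]) (use z in auto)
    finally obtain b where b: "y = (\<Sum>i<N. scl (b i) (s i z))" by (rule span_image_sum[OF finite_lessThan])
    let ?y = "\<Sum>i\<in>{..<N} - ?K. scl (b i) (s i z)"
    have split: "y = ?y + (\<Sum>i\<in>?K. scl (b i) (s i z))"
      unfolding b by (rule sum.subset_diff) auto
    have "(\<Sum>i\<in>?K. scl (b i) (s i z)) \<in> F p z"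
      by (intro pm.subspace_sum[OF F_subspace[OF z]] pm.subspace_scale[OF F_subspace[OF z]] sK)
    from pm.subspace_diff[OF F_subspace[OF z] y this] have 1: "?y \<in> F p z" using split by simp
    have sW: "s i z \<in> WC (2 * p - 2) z" if "i \<in> {..<N} - ?K" for i
    proof -
      have "WC (2 * d i) z \<subseteq> WC (2 * p - 2) z" by (rule WC_mono[OF z]) (use that in auto)
      then show ?thesis using s_WC[OF _ z, of i] that by blast
    qed
    have "?y \<in> WC (2 * p - 2) z"
      by (rule pm.subspace_sum[OF complexification_subspace]) (rule pm.subspace_scale[OF complexification_subspace], rule sW)
    then have "?y = 0" by (rule F_WC_zero[OF z 1])
    then have "y = (\<Sum>i\<in>?K. scl (b i) (s i z))" using split by simp
    then show "y \<in> pm.span ((\<lambda>i. s i z) ` ?K)" using sum_in_span_image[of b "\<lambda>i. s i z" ?K] by (simp only:)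
  qed
qed

lemma S_high: "i < N \<Longrightarrow> d i \<le> d j \<Longrightarrow> z \<in> U \<Longrightarrow> S i j z = (if j = i then 1 else 0)"
  using S_one[of i z] S_zero[of j i] by auto

text \<open>Relative to a local holomorphic frame of \<open>F (d i)\<close> the coefficients of row
  \<open>i\<close> solve a linear system: its coordinates of degree at least \<open>d i\<close> are
  prescribed constants 0 or 1. Elimination makes the coefficients holomorphic, and then also the
  remaining coordinates of the row.\<close>

lemma S_holomorphic_near:
  assumes i: "i < N" and j: "j < N" and z0: "z0 \<in> U"
  shows "\<exists>M. open M \<and> z0 \<in> M \<and> S i j holomorphic_on M"
proof -
  from bspec[OF F_bundle[of "d i", unfolded holo_subbundle_def] z0]
  obtain M ss where M: "open M" "z0 \<in> M" "M \<subseteq> U" and hs: "\<forall>s\<in>set ss. holo_section T M s"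
    and fr: "\<forall>z\<in>M. distinct (map (\<lambda>s. s z) ss) \<and> \<not> pm.dependent (set (map (\<lambda>s. s z) ss))
      \<and> pm.span (set (map (\<lambda>s. s z) ss)) = F (d i) z" by (elim exE conjE)
  let ?K = "set ss"
  have "\<forall>s\<in>?K. \<exists>M' \<phi>. open M' \<and> z0 \<in> M' \<and> M' \<subseteq> M \<and> (\<forall>j. \<phi> j holomorphic_on M') \<and> (\<forall>z\<in>M'. s z = comb (\<lambda>j. \<phi> j z) z)"
  proof
    fix s assume "s \<in> ?K"
    from bspec[OF bspec[OF hs this, unfolded holo_section_def] M(2)]
    obtain M1 ps where 1: "open M1" "z0 \<in> M1" "M1 \<subseteq> M" "ps \<in> hexprs T M1" "\<forall>z\<in>M1. s z = hval ps z" by (elim exE conjE)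
    have "M1 \<subseteq> U" using 1(3) M(3) by blast
    from hval_coords[OF 1(4,1,2) this]
    obtain M2 \<phi> where 2: "open M2" "z0 \<in> M2" "M2 \<subseteq> M1" "\<forall>j. \<phi> j holomorphic_on M2" "\<forall>z\<in>M2. hval ps z = comb (\<lambda>j. \<phi> j z) z"
      by (elim exE conjE)
    have "\<forall>z\<in>M2. s z = comb (\<lambda>j. \<phi> j z) z"
    proof
      fix z assume z: "z \<in> M2"
      then have "s z = hval ps z" using 1(5) 2(3) by blast
      also have "\<dots> = comb (\<lambda>j. \<phi> j z) z" by (rule bspec[OF 2(5) z])
      finally show "s z = comb (\<lambda>j. \<phi> j z) z" .
    qed
    then show "\<exists>M' \<phi>. open M' \<and> z0 \<in> M' \<and> M' \<subseteq> M \<and> (\<forall>j. \<phi> j holomorphic_on M') \<and> (\<forall>z\<in>M'. s z = comb (\<lambda>j. \<phi> j z) z)"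
      using 1(3) 2(1-4) by (intro exI[of _ M2] exI[of _ \<phi>] conjI) auto
  qed
  from bchoice[OF this] obtain Ms where "\<forall>s\<in>?K. \<exists>\<phi>. open (Ms s) \<and> z0 \<in> Ms s \<and> Ms s \<subseteq> M \<and> (\<forall>j. \<phi> j holomorphic_on Ms s) \<and> (\<forall>z\<in>Ms s. s z = comb (\<lambda>j. \<phi> j z) z)"
    by (elim exE)
  from bchoice[OF this] obtain \<phi> where ph: "\<forall>s\<in>?K. open (Ms s) \<and> z0 \<in> Ms s \<and> Ms s \<subseteq> M \<and> (\<forall>j. \<phi> s j holomorphic_on Ms s) \<and> (\<forall>z\<in>Ms s. s z = comb (\<lambda>j. \<phi> s j z) z)"
    by (elim exE)
  let ?M = "M \<inter> (\<Inter>s\<in>?K. Ms s)"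
  have oM: "open ?M" and zM: "z0 \<in> ?M" using M ph by (auto intro!: open_Int open_INT)
  have MU: "z \<in> U" if "z \<in> ?M" for z using that M(3) by blast
  have hol: "\<phi> s j holomorphic_on ?M" if "s \<in> ?K" for s j
    by (rule holomorphic_on_subset[of _ "Ms s"]) (use ph that in auto)
  have sz: "s z = comb (\<lambda>j. \<phi> s j z) z" if s: "s \<in> ?K" and z: "z \<in> ?M" for s z
  proof -
    have "\<forall>z\<in>Ms s. s z = comb (\<lambda>j. \<phi> s j z) z" using bspec[OF ph s] by (elim conjE)
    then show ?thesis using z s by blast
  qed
  have sumz: "(\<Sum>s\<in>?K. scl (x s) (s z)) = comb (\<lambda>j. \<Sum>s\<in>?K. \<phi> s j z * x s) z" if "z \<in> ?M" for x z
    unfolding comb_sum[symmetric] by (rule sum.cong[OF refl]) (simp only: sz[OF _ that])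
  have Fz: "F (d i) z = pm.span ((\<lambda>s. s z) ` ?K)" and inj: "inj_on (\<lambda>s. s z) ?K" and indep: "pm.independent ((\<lambda>s. s z) ` ?K)" if "z \<in> M" for z
    using bspec[OF fr that] by (simp_all add: distinct_map)
  have "\<forall>z\<in>?M. \<exists>x. s i z = (\<Sum>s\<in>?K. scl (x s) (s z))"
  proof
    fix z assume z: "z \<in> ?M"
    then have "s i z \<in> pm.span ((\<lambda>s. s z) ` ?K)" using s_F[OF i MU[OF z]] Fz by blast
    then obtain x where "s i z = (\<Sum>s\<in>?K. scl (x s) (s z))" by (rule span_image_sum[OF finite_set])
    then show "\<exists>x. s i z = (\<Sum>s\<in>?K. scl (x s) (s z))" by (intro exI[of _ x])
  qed
  from bchoice[OF this] obtain x where x: "\<forall>z\<in>?M. s i z = (\<Sum>s\<in>?K. scl (x z s) (s z))" by (elim exE)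
  have Sx: "S i j z = (\<Sum>s\<in>?K. \<phi> s j z * x z s)" if z: "z \<in> ?M" and j: "j < N" for j z
    by (rule comb_unique[OF MU[OF z] _ j]) (use bspec[OF x z] sumz[OF z] in \<open>simp only:\<close>)
  have "\<exists>M'. open M' \<and> z0 \<in> M' \<and> M' \<subseteq> ?M \<and> (\<forall>s\<in>?K. (\<lambda>z. x z s) holomorphic_on M')"
  proof (rule holomorphic_solution[OF finite_set oM zM, where J = "{j. j < N \<and> d i \<le> d j}" and A = "\<lambda>j s. \<phi> s j" and b = "\<lambda>j. S i j" and x = "\<lambda>s z. x z s"])
    show "\<phi> s j holomorphic_on ?M" if "s \<in> ?K" for j s by (rule hol[OF that])
    show "S i j holomorphic_on ?M" if "j \<in> {j. j < N \<and> d i \<le> d j}" for j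
      by (rule holomorphic_transform[OF holomorphic_on_const[of "if j = i then 1 else 0"]]) (use that S_high[OF i, of j] MU in auto)
    show "(\<Sum>s\<in>?K. \<phi> s j z * x z s) = S i j z" if "j \<in> {j. j < N \<and> d i \<le> d j}" "z \<in> ?M" for j z
      using Sx[OF that(2), of j] that(1) by simp
    \<comment> \<open>A kernel vector at \<open>z0\<close> gives an element of
      \<open>F (d i)\<close> without coordinates of degree at least \<open>d i\<close>; this is
      zero, and the frame is independent.\<close>
    show "\<forall>s\<in>?K. y s = 0" if y: "\<And>j. j \<in> {j. j < N \<and> d i \<le> d j} \<Longrightarrow> (\<Sum>s\<in>?K. \<phi> s j z0 * y s) = 0" for y
    proof
      fix s assume s: "s \<in> ?K"
      have "(\<Sum>s\<in>?K. scl (y s) (s z0)) \<in> F (d i) z0" unfolding Fz[OF M(2)] by (rule sum_in_span_image)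
      then have cF: "comb (\<lambda>j. \<Sum>s\<in>?K. \<phi> s j z0 * y s) z0 \<in> F (d i) z0" unfolding sumz[OF zM] .
      have "(\<Sum>s\<in>?K. \<phi> s j z0 * y s) = 0" if "j < N" for j
        by (rule F_coords_zero[OF z0 cF _ that]) (rule y, simp)
      then have "comb (\<lambda>j. \<Sum>s\<in>?K. \<phi> s j z0 * y s) z0 = 0" by (simp add: pm.scale_zero_left)
      then have "(\<Sum>s\<in>?K. scl (y s) (s z0)) = 0" unfolding sumz[OF zM] .
      then show "y s = 0" by (rule independent_image_zero[OF finite_set inj[OF M(2)] indep[OF M(2)] _ s])
    qed
  qed
  then obtain M' where M': "open M'" "z0 \<in> M'" "M' \<subseteq> ?M" "\<forall>s\<in>?K. (\<lambda>z. x z s) holomorphic_on M'" by (elim exE conjE)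
  have "S i j holomorphic_on M'"
  proof (rule holomorphic_transform[of "\<lambda>z. \<Sum>s\<in>?K. \<phi> s j z * x z s"])
    show "(\<lambda>z. \<Sum>s\<in>?K. \<phi> s j z * x z s) holomorphic_on M'"
    proof (intro holomorphic_on_sum holomorphic_on_mult)
      fix s assume "s \<in> ?K"
      then show "\<phi> s j holomorphic_on M'" "(\<lambda>z. x z s) holomorphic_on M'"
        using holomorphic_on_subset[OF hol M'(3)] M'(4) by auto
    qed
    show "(\<Sum>s\<in>?K. \<phi> s j z * x z s) = S i j z" if "z \<in> M'" for z
      using Sx[OF subsetD[OF M'(3) that] j] by simp
  qed
  then show ?thesis using M'(1,2) by blast
qed

lemma S_holomorphic: assumes "i < N" "j < N" shows "S i j holomorphic_on U"
  unfolding holomorphic_on_def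
proof
  fix z0 assume z0: "z0 \<in> U"
  obtain M where "open M" "z0 \<in> M" "S i j holomorphic_on M" using S_holomorphic_near[OF assms z0] by (elim exE conjE)
  then have "S i j field_differentiable at z0" using holomorphic_on_imp_differentiable_at by blast
  then show "S i j field_differentiable at z0 within U" by (rule field_differentiable_at_within)
qed

text \<open>By transversality the derivative of row \<open>i\<close> lies in
  \<open>F (d i - 1)\<close>, so it is determined by its coordinates of degree at least
  \<open>d i - 1\<close>. There it agrees with the combination of the rows of degree
  \<open>d i - 1\<close>, because row \<open>i\<close> is constant in degrees at least
  \<open>d i\<close>.\<close>

lemma S_ode:
  assumes i: "i < N" and j: "j < N" and z: "z \<in> U"
  shows "deriv (S i j) z = (\<Sum>l\<in>{l\<in>{..<N}. d l = d i - 1}. deriv (S i l) z * S l j z)"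
proof -
  let ?ps = "map (\<lambda>j. (S i j, \<sigma> j)) [0..<N]"
  let ?K = "{l\<in>{..<N}. d l = d i - 1}"
  let ?D = "\<lambda>l. deriv (S i l) z"
  have set: "set [0..<N] = {..<N}" by auto
  have ps: "?ps \<in> hexprs T U" using i by (auto simp: hexprs_def S_holomorphic flat)
  have hv: "hval ?ps w = s i w" for w unfolding hval_map_list[OF distinct_upt] set by (rule sum.cong[OF refl]) (rule ctens_eq_scl)
  have hn: "hnabla ?ps w = comb (\<lambda>j. deriv (S i j) w) w" for w
    unfolding hnabla_map_list[OF distinct_upt] set by (rule sum.cong[OF refl]) (rule ctens_eq_scl)
  have "open U \<and> U \<subseteq> U \<and> ?ps \<in> hexprs T U \<and> (\<forall>z\<in>U. hval ?ps z \<in> F (d i) z)"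
    using U_open ps s_F[OF i] unfolding hv by blast
  from griff[unfolded griffiths_transversal_def, rule_format, OF this z]
  have 1: "comb ?D z \<in> F (d i - 1) z" unfolding hn .
  have "scl (?D l) (s l z) \<in> F (d i - 1) z" if "l \<in> ?K" for l
    by (rule pm.subspace_scale[OF F_subspace[OF z]]) (use s_F[OF _ z, of l] that in auto)
  then have "(\<Sum>l\<in>?K. scl (?D l) (s l z)) \<in> F (d i - 1) z" by (rule pm.subspace_sum[OF F_subspace[OF z]])
  from pm.subspace_diff[OF F_subspace[OF z] 1 this]
  have 2: "comb (\<lambda>j. ?D j - (\<Sum>l\<in>?K. S l j z * ?D l)) z \<in> F (d i - 1) z" unfolding comb_diff comb_sum .
  have "?D j - (\<Sum>l\<in>?K. S l j z * ?D l) = 0"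
  proof (rule F_coords_zero[OF z 2 _ j])
    fix j assume j: "j < N" "d i - 1 \<le> d j"
    show "?D j - (\<Sum>l\<in>?K. S l j z * ?D l) = 0"
    proof (cases "d i \<le> d j")
      case True
      have "((\<lambda>_. if j = i then 1 else 0 :: complex) has_field_derivative 0) (at z)" by simp
      then have "(S i j has_field_derivative 0) (at z)"
        by (rule has_field_derivative_transform_within_open[OF _ U_open z]) (simp add: S_high[OF i True])
      then have "?D j = 0" by (rule DERIV_imp_deriv)
      moreover have "(\<Sum>l\<in>?K. S l j z * ?D l) = 0"
      proof (rule sum.neutral, rule ballI)
        fix l assume "l \<in> ?K"
        then have "S l j = 0" using True by (intro S_zero) auto
        then show "S l j z * ?D l = 0" by simp
      qed
      ultimately show ?thesis by simp
    next
      case False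
      then have dj: "d j = d i - 1" using j(2) by simp
      have "(\<Sum>l\<in>?K. S l j z * ?D l) = (\<Sum>l\<in>?K. if l = j then ?D j else 0)"
        by (rule sum.cong[OF refl]) (use dj S_high[of _ j z] z in auto)
      then show ?thesis using dj j(1) by simp
    qed
  qed
  then show ?thesis by (simp add: mult.commute)
qed

end

section \<open>Regauging the frame, and the isomorphism with a period variation\<close>

lemma (in locsys) flat_image_open:
  assumes f: "flat_section T G \<rho>" and G: "open G"
  shows "openin T {(z, \<rho> z) | z. z \<in> G}"
proof (subst openin_subopen, intro ballI)
  fix y assume "y \<in> {(z, \<rho> z) | z. z \<in> G}"
  then obtain z0 where z0: "z0 \<in> G" "y = (z0, \<rho> z0)" by blast
  obtain N V \<tau> where t: "z0 \<in> N" "triv N V \<tau>" using triv_exists[OF flat_in(1)[OF f z0(1)]] by (elim exE conjE)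
  show "\<exists>W. openin T W \<and> y \<in> W \<and> W \<subseteq> {(z, \<rho> z) | z. z \<in> G}"
  proof (rule flat_local[OF f z0(1) t])
    fix u N' assume n: "u \<in> V" "open N'" "z0 \<in> N'" "N' \<subseteq> N" "\<And>z. z \<in> N' \<inter> G \<Longrightarrow> \<rho> z = \<tau> z u"
    have "openin T {(z, \<tau> z u) | z. z \<in> N' \<inter> G}" by (rule triv_sheet_open[OF t(2) n(1)]) (use n G in auto)
    moreover have "{(z, \<tau> z u) | z. z \<in> N' \<inter> G} = {(z, \<rho> z) | z. z \<in> N' \<inter> G}" using n(5) by auto
    ultimately have "openin T {(z, \<rho> z) | z. z \<in> N' \<inter> G}" by (simp only:)
    moreover have "y \<in> {(z, \<rho> z) | z. z \<in> N' \<inter> G}" using z0 n(3) by blast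
    moreover have "{(z, \<rho> z) | z. z \<in> N' \<inter> G} \<subseteq> {(z, \<rho> z) | z. z \<in> G}" by blast
    ultimately show ?thesis by blast
  qed
qed

lemma (in locsys) cont_from_const:
  assumes f: "\<And>v. v \<in> V \<Longrightarrow> flat_section T U (\<lambda>z. h z v)"
  shows "continuous_map (prod_topology (top_of_set U) (discrete_topology V)) T (\<lambda>(z, v). (z, h z v))"
  unfolding continuous_map_def
proof (intro conjI allI impI)
  show "(\<lambda>(z, v). (z, h z v)) \<in> topspace (prod_topology (top_of_set U) (discrete_topology V)) \<rightarrow> topspace T"
    using flat_in(2)[OF f] by (auto simp: topspace_T)
  fix G assume G: "openin T G"
  let ?G = "\<lambda>v. {z \<in> topspace (top_of_set U). (z, h z v) \<in> G}"
  have e: "{x \<in> topspace (prod_topology (top_of_set U) (discrete_topology V)). (case x of (z, v) \<Rightarrow> (z, h z v)) \<in> G} = (\<Union>v\<in>V. ?G v \<times> {v})"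
    by auto
  have "openin (prod_topology (top_of_set U) (discrete_topology V)) (?G v \<times> {v})" if v: "v \<in> V" for v
  proof -
    have "openin (top_of_set U) (?G v)" by (rule openin_continuous_map_preimage[OF f[OF v, unfolded flat_section_def] G])
    then show ?thesis using v by (simp add: openin_prod_Times_iff)
  qed
  then show "openin (prod_topology (top_of_set U) (discrete_topology V))
      {x \<in> topspace (prod_topology (top_of_set U) (discrete_topology V)). (case x of (z, v) \<Rightarrow> (z, h z v)) \<in> G}"
    unfolding e by (intro openin_Union) blast
qed

context split_framed begin

definition gauged :: bool where
  "gauged \<longleftrightarrow> (\<forall>i<N. \<forall>j<N. i \<noteq> j \<longrightarrow> e (\<lambda>z. 2 * pi * \<i> * S i j z) = 0)"

text \<open>Replacing \<open>\<sigma>\<^sub>i\<close> by \<open>\<Sum>\<^sub>j e(2\<pi>i S\<^sub>i\<^sub>j) \<sigma>\<^sub>j\<close> enforces the gauge condition: by uniqueness of the splitting,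
  the new period matrix \<open>S'\<close> satisfies \<open>S = S' E\<close> with \<open>E = e(2\<pi>i S)\<close>, so \<open>E = e(2\<pi>i S') E\<close>.\<close>

lemma regauge: "\<exists>\<sigma>' S'. split_framed U e X c r N d \<sigma>' S' \<and> split_framed.gauged e N S'"
proof -
  define E where "E i j = e (\<lambda>z. 2 * pi * \<i> * S i j z)" for i j
  have E1: "E i i = 1" if "i < N" for i
  proof -
    have "(\<lambda>z. 2 * pi * \<i> * S i i z) = fst (tform U)"
      using S_one[OF that] S_out by (auto simp: fun_eq_iff tform_def const_form_def)
    then show ?thesis unfolding E_def by (simp only: e_t)
  qed
  have E0: "E i j = 0" if "j \<noteq> i" "d i \<le> d j" for i j
  proof -
    have "(\<lambda>z. 2 * pi * \<i> * S i j z) = 0" unfolding S_zero[OF that] by (simp add: fun_eq_iff)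
    then show ?thesis unfolding E_def by (simp only: e_zero)
  qed
  define \<sigma>' where "\<sigma>' i z = (\<Sum>j<N. scl (E i j) (\<sigma> j z))" for i z
  have x': "\<sigma>' i z = \<sigma> i z + (\<Sum>j\<in>{j\<in>{..<N}. d j < d i}. scl (E i j) (\<sigma> j z))" if "i \<in> {..<N}" for i z
    unfolding \<sigma>'_def by (rule unitriangular_expand) (use that E1 E0 in auto)
  have ad': "adapted N d \<sigma>'"
    unfolding adapted_def
  proof (intro conjI ballI allI impI)
    show "flat_section T U (\<sigma>' i)" for i
      using LH.flat_lincomb[OF order_refl flat finite_lessThan, of N "\<lambda>j. j" "E i"] by (simp add: \<sigma>'_def[abs_def])
  next
    fix z q i assume z: "z \<in> U" and q: "(\<Sum>i<N. scl (q i) (\<sigma>' i z)) = 0" and i: "i < N"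
    have "(\<Sum>i<N. scl (q i) (\<sigma>' i z)) = (\<Sum>i<N. \<Sum>j<N. scl (q i * E i j) (\<sigma> j z))"
      by (simp add: \<sigma>'_def pm.scale_sum_right)
    also have "\<dots> = (\<Sum>j<N. \<Sum>i<N. scl (q i * E i j) (\<sigma> j z))" by (rule sum.swap)
    also have "\<dots> = (\<Sum>j<N. scl (\<Sum>i<N. q i * E i j) (\<sigma> j z))" by (simp add: pm.scale_sum_left)
    finally have "(\<Sum>j<N. scl (\<Sum>i<N. q i * E i j) (\<sigma> j z)) = 0" using q by simp
    from ind[OF z this] have 0: "(\<Sum>i<N. q i * E i j) = 0" if "j < N" for j using that by blast
    show "q i = 0"
      by (rule unitriangular_zero[OF finite_lessThan[of N], of E d q]) (use E1 E0 0 i in auto)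
  next
    fix z m assume z: "z \<in> U"
    show "W m z = pm.span ((\<lambda>i. \<sigma>' i z) ` {i. i < N \<and> 2 * d i \<le> m})"
      unfolding W_span[OF z] by (rule unitriangular_span_eq[symmetric, OF finite_lessThan[of N] x']) auto
  next
    fix z assume z: "z \<in> U"
    show "H z = pm.span ((\<lambda>i. \<sigma>' i z) ` {..<N})"
      unfolding H_span[OF z] by (rule unitriangular_span_eq[symmetric, OF finite_lessThan[of N] x']) auto
  qed
  interpret F': framed U e X c r N d \<sigma>' by unfold_locales (rule ad')
  obtain S' where S': "F'.splits S'" using F'.splits_exists by (elim exE)
  interpret T: split_framed U e X c r N d \<sigma>' S' by unfold_locales (rule S')
  have u': "ctens 1 (\<sigma>' k z) = comb (\<lambda>j. of_rat (E k j)) z" for k z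
    unfolding \<sigma>'_def ctens_sum ctens_scl ..
  \<comment> \<open>Written in the old frame, row \<open>i\<close> of the new splitting has the same
    coordinates of degree at least \<open>d i\<close> as row \<open>i\<close> of the old one, so the
    two coincide by \<open>F_coords_unique\<close>.\<close>
  have eq: "S i j z = (\<Sum>k<N. of_rat (E k j) * S' i k z)" if i: "i < N" and j: "j < N" and z: "z \<in> U" for i j z
  proof (rule F_coords_unique[OF z s_F[OF i z] _ _ j])
    show "comb (\<lambda>j. \<Sum>k<N. of_rat (E k j) * S' i k z) z \<in> F (d i) z"
      using T.s_F[OF i z] unfolding u' comb_sum .
    fix j assume j: "j < N" "d i \<le> d j"
    have "(\<Sum>k<N. of_rat (E k j) * S' i k z) = (\<Sum>k<N. if k = i then of_rat (E i j) else 0)"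
    proof (rule sum.cong[OF refl])
      fix k assume "k \<in> {..<N}"
      consider "k = i" | "k \<noteq> i" "d i \<le> d k" | "k \<noteq> i" "d k < d i" by linarith
      then show "of_rat (E k j) * S' i k z = (if k = i then of_rat (E i j) else 0)"
      proof cases
        case 1 then show ?thesis using T.S_one[OF i z] by simp
      next
        case 2 then show ?thesis using T.S_zero[of k i] by simp
      next
        case 3
        then have "E k j = 0" using j(2) by (intro E0) auto
        then show ?thesis using 3 by simp
      qed
    qed
    also have "\<dots> = of_rat (E i j)" using i by simp
    also have "\<dots> = S i j z" using S_high[OF i j(2) z] E1[OF i] E0[of j i] j(2) by (cases "j = i") auto
    finally show "S i j z = (\<Sum>k<N. of_rat (E k j) * S' i k z)" by simp
  qed
  have "e (\<lambda>z. 2 * pi * \<i> * S' i j z) = 0" if i: "i < N" and j: "j < N" and ij: "i \<noteq> j" for i j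
  proof -
    let ?e = "\<lambda>k. e (\<lambda>z. 2 * pi * \<i> * S' i k z)"
    have 1: "E i k = (\<Sum>l<N. E l k * ?e l)" if k: "k < N" for k
    proof -
      have "(\<lambda>z. 2 * pi * \<i> * S i k z) = (\<lambda>z. \<Sum>l<N. of_rat (E l k) * (2 * pi * \<i> * S' i l z))"
      proof
        fix z
        show "2 * pi * \<i> * S i k z = (\<Sum>l<N. of_rat (E l k) * (2 * pi * \<i> * S' i l z))"
        proof (cases "z \<in> U")
          case True
          show ?thesis unfolding eq[OF i k True] sum_distrib_left by (rule sum.cong[OF refl]) (simp only: mult_ac)
        next
          case False then show ?thesis by (simp add: S_out T.S_out)
        qed
      qed
      then show ?thesis unfolding E_def[of i k] by (simp only: e_lincomb)
    qed
    \<comment> \<open>The difference of row \<open>i\<close> of \<open>e(2\<pi>i S')\<close> and row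
      \<open>i\<close> of the identity is annihilated by the unitriangular matrix \<open>E\<close>,
      hence zero.\<close>
    have "(\<Sum>l<N. (?e l - (if l = i then 1 else 0)) * E l k) = 0" if k: "k < N" for k
    proof -
      have "(\<Sum>l<N. (?e l - (if l = i then 1 else 0)) * E l k) = (\<Sum>l<N. E l k * ?e l) - (\<Sum>l<N. if l = i then E i k else 0)"
        unfolding sum_subtractf[symmetric] by (rule sum.cong[OF refl]) (simp add: algebra_simps)
      also have "\<dots> = 0" using 1[OF k] i by simp
      finally show ?thesis .
    qed
    then have "?e j - (if j = i then 1 else 0) = 0"
      using E1 E0 j by (intro unitriangular_zero[OF finite_lessThan[of N], of E d "\<lambda>l. ?e l - (if l = i then 1 else 0)"]) auto
    then show ?thesis using ij by simp
  qed
  then have "T.gauged" unfolding T.gauged_def by blast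
  then show ?thesis using T.split_framed_axioms by blast
qed

text \<open>The frame \<open>\<sigma>\<close> identifies the constant system with \<open>H\<close>.
  By \<open>W_span\<close> and \<open>F_span\<close> both filtrations correspond exactly, so the
  inverse is a morphism too.\<close>

lemma iso_to_variation:
  assumes g: gauged
  shows "\<exists>Y. period U e Y \<and> (\<exists>h. is_iso (variation_cat U) (period.B U Y) X h)"
proof -
  define Y where "Y = \<lparr>pI = {..<N}, pd = d, pS = S\<rparr>"
  have Y [simp]: "pI Y = {..<N}" "pd Y = d" "pS Y = S" by (simp_all add: Y_def)
  interpret p: period U e Y
  proof unfold_locales
    show "finite (pI Y)" by simp
    show "pS Y i j \<in> holo_funs U" if "i \<in> pI Y" "j \<in> pI Y" for i j using that by (simp add: holo_funs_def S_holomorphic S_out)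
    show "pS Y i i z = 1" if "i \<in> pI Y" "z \<in> U" for i z using that S_one by simp
    show "pS Y i j = 0" if "i \<in> pI Y" "j \<in> pI Y" "i \<noteq> j" "pd Y i \<le> pd Y j" for i j using that S_zero[of j i] by simp
    show "e (\<lambda>z. 2 * pi * \<i> * pS Y i j z) = 0" if "i \<in> pI Y" "j \<in> pI Y" "i \<noteq> j" for i j
      using g that unfolding gauged_def by simp
    show "deriv (pS Y i j) z = (\<Sum>l\<in>{l\<in>pI Y. pd Y l = pd Y i - 1}. deriv (pS Y i l) z * pS Y l j z)"
      if "i \<in> pI Y" "j \<in> pI Y" "z \<in> U" for i j z using S_ode[of i j z] that by simp
  qed
  let ?V = "supp_in {..<N} :: qvec set"
  define f where "f z v = (if z \<in> U \<and> v \<in> ?V then linext (\<lambda>i. \<sigma> i z) v else 0)" for z v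
  have sV: "pm.subspace ?V" by (rule supp_in_subspace)
  have fs: "f z v = (\<Sum>i\<in>K. scl (lookup v i) (\<sigma> i z))" if "z \<in> U" "K \<subseteq> {..<N}" "v \<in> supp_in K" for z v K
    unfolding f_def using that lookup_linext_superset[OF finite_subset[OF that(2)], of v] by (auto simp: supp_in_def)
  have img: "f z ` supp_in K = pm.span ((\<lambda>i. \<sigma> i z) ` K)" if z: "z \<in> U" and K: "K \<subseteq> {..<N}" for z K
  proof
    show "f z ` supp_in K \<subseteq> pm.span ((\<lambda>i. \<sigma> i z) ` K)" using fs[OF z K] sum_in_span_image[of _ "\<lambda>i. \<sigma> i z" K] by auto
    show "pm.span ((\<lambda>i. \<sigma> i z) ` K) \<subseteq> f z ` supp_in K"
    proof
      fix y assume "y \<in> pm.span ((\<lambda>i. \<sigma> i z) ` K)"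
      then obtain q where q: "y = (\<Sum>i\<in>K. scl (q i) (\<sigma> i z))" by (rule span_image_sum[OF finite_subset[OF K finite_lessThan]])
      let ?v = "\<Sum>i\<in>K. single i (q i)"
      have v: "?v \<in> supp_in K" by (intro pm.subspace_sum[OF supp_in_subspace] single_in_supp)
      then have "?v \<in> ?V" using K unfolding supp_in_def by blast
      then have "f z ?v = y" using z unfolding q by (simp add: f_def linext_sum)
      then show "y \<in> f z ` supp_in K" using v by blast
    qed
  qed
  have inj: "inj_on (f z) ?V" if z: "z \<in> U" for z
  proof (rule inj_onI)
    fix v w assume vw: "v \<in> ?V" "w \<in> ?V" "f z v = f z w"
    have "(\<Sum>i<N. scl (lookup v i - lookup w i) (\<sigma> i z)) = 0"
      using vw(3) unfolding fs[OF z order_refl vw(1)] fs[OF z order_refl vw(2)] by (simp add: pm.scale_left_diff_distrib sum_subtractf)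
    from ind[OF z this] have "lookup v i = lookup w i" if "i < N" for i using that by simp
    moreover have "lookup v i = lookup w i" if "\<not> i < N" for i
    proof -
      have "i \<notin> keys v" "i \<notin> keys w" using vw(1,2) that unfolding supp_in_def by auto
      then show ?thesis by (simp add: Poly_Mapping.in_keys_iff)
    qed
    ultimately show "v = w" by (intro poly_mapping_eqI) blast
  qed
  have bij: "bij_betw (f z) ?V (H z)" if z: "z \<in> U" for z
    unfolding bij_betw_def using inj[OF z] img[OF z order_refl] H_span[OF z] by simp
  define g where "g z x = (if z \<in> U \<and> x \<in> H z then inv_into ?V (f z) x else 0)" for z x
  have fV: "f z v \<in> H z" and gf: "g z (f z v) = v" if "z \<in> U" "v \<in> ?V" for z v
  proof -
    show 1: "f z v \<in> H z" using bij[OF that(1)] that(2) by (rule bij_betwE[rule_format])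
    show "g z (f z v) = v" unfolding g_def using 1 that inv_into_f_f[OF inj[OF that(1)] that(2)] by simp
  qed
  have gV: "g z x \<in> ?V" and fg: "f z (g z x) = x" if "z \<in> U" "x \<in> H z" for z x
  proof -
    have x: "x \<in> f z ` ?V" using bij[OF that(1)] that(2) unfolding bij_betw_def by simp
    show "g z x \<in> ?V" "f z (g z x) = x" unfolding g_def using that inv_into_into[OF x] f_inv_into_f[OF x] by simp_all
  qed
  have sH: "pm.subspace (H z)" if "z \<in> U" for z unfolding H_span[OF that] by (rule pm.subspace_span)
  have fadd: "f z (v + w) = f z v + f z w" if "z \<in> U" "v \<in> ?V" "w \<in> ?V" for z v w
    using that pm.subspace_add[OF sV that(2,3)] by (simp add: f_def linext_add)
  have fscl: "f z (scl q v) = scl q (f z v)" if "z \<in> U" "v \<in> ?V" for z q v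
    using that pm.subspace_scale[OF sV that(2)] by (simp add: f_def linext_scl)
  have gadd: "g z (x + y) = g z x + g z y" if "z \<in> U" "x \<in> H z" "y \<in> H z" for z x y
  proof -
    have "g z (f z (g z x + g z y)) = g z x + g z y" by (rule gf[OF that(1) pm.subspace_add[OF sV gV[OF that(1,2)] gV[OF that(1,3)]]])
    then show ?thesis by (simp only: fadd[OF that(1) gV[OF that(1,2)] gV[OF that(1,3)]] fg[OF that(1,2)] fg[OF that(1,3)])
  qed
  have gscl: "g z (scl q x) = scl q (g z x)" if "z \<in> U" "x \<in> H z" for z q x
  proof -
    have "g z (f z (scl q (g z x))) = scl q (g z x)" by (rule gf[OF that(1) pm.subspace_scale[OF sV gV[OF that]]])
    then show ?thesis by (simp only: fscl[OF that(1) gV[OF that]] fg[OF that])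
  qed
  have fl: "flat_section T U (\<lambda>z. f z v)" if v: "v \<in> ?V" for v
  proof -
    have "flat_section T U (\<lambda>z. \<Sum>i<N. scl (lookup v i) (\<sigma> i z))"
      by (rule LH.flat_lincomb) (auto intro: flat)
    then show ?thesis by (rule LH.flat_cong) (simp add: fs[OF _ order_refl v])
  qed
  define L where "L z = linext (\<lambda>i. u i z)" for z
  have Lf: "L z (ctens a v) = ctens a (f z v)" if "z \<in> U" "v \<in> ?V" for z a v
    using that linext_ctens[of "\<lambda>i. \<sigma> i z" a v] by (simp add: L_def f_def)
  have Lsum: "(\<Sum>(a, v)\<leftarrow>xs. ctens a (f z v)) = L z (\<Sum>(a, v)\<leftarrow>xs. ctens a v)" if "z \<in> U" "snd ` set xs \<subseteq> ?V" for z and xs :: "(complex \<times> qvec) list"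
    using that(2)
  proof (induction xs)
    case Nil show ?case by (simp add: L_def linext_def)
  next
    case (Cons x xs)
    then show ?case using Lf[OF that(1), of "snd x" "fst x"] by (simp add: split_beta L_def linext_add)
  qed
  have Ls: "L z (p.s i z) = s i z" for i z unfolding p.s_def L_def by (simp add: linext_sum)
  have Linj: "y = y'" if z: "z \<in> U" and y: "y \<in> supp_in {..<N}" "y' \<in> supp_in {..<N}" "L z y = L z y'" for z y y'
  proof -
    have Lc: "L z y = comb (lookup y) z" if "y \<in> supp_in {..<N}" for y
      unfolding L_def using that by (intro lookup_linext_superset) (auto simp: supp_in_def)
    have "lookup y i = lookup y' i" if "i < N" for i
      by (rule comb_unique[OF z _ that]) (use y Lc in simp)
    moreover have "lookup y i = lookup y' i" if "\<not> i < N" for i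
    proof -
      have "i \<notin> keys y" "i \<notin> keys y'" using y(1,2) that unfolding supp_in_def by auto
      then show ?thesis by (simp add: Poly_Mapping.in_keys_iff)
    qed
    ultimately show ?thesis by (intro poly_mapping_eqI) blast
  qed
  have fhom: "f \<in> variation_hom U p.B X"
    unfolding variation_hom_def mem_Collect_eq p.B_simps Y
  proof (intro conjI allI ballI impI)
    fix z assume z: "z \<in> U"
    show "qlinear ?V (H z) (f z)" unfolding qlinear_def using fV[OF z] fadd[OF z] fscl[OF z] by blast
    show "f z ` supp_in {i \<in> {..<N}. 2 * d i \<le> m} \<subseteq> W m z" for m
      using img[OF z, of "{i \<in> {..<N}. 2 * d i \<le> m}"] W_span[OF z, of m] by auto
    fix q
    show "complexified_maps ?V (f z) (pm.span ((\<lambda>i. p.s i z) ` {i \<in> {..<N}. q \<le> d i})) (F q z)"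
      unfolding complexified_maps_def
    proof (intro allI impI, elim conjE)
      fix cs :: "(complex \<times> qvec) list"
      assume cs: "snd ` set cs \<subseteq> ?V" "(\<Sum>(c, v)\<leftarrow>cs. ctens c v) \<in> pm.span ((\<lambda>i. p.s i z) ` {i \<in> {..<N}. q \<le> d i})"
      show "(\<Sum>(c, v)\<leftarrow>cs. ctens c (f z v)) \<in> F q z"
        unfolding Lsum[OF z cs(1)] F_span[OF z] L_def
      proof (rule linext_in_span[OF cs(2)])
        fix y assume "y \<in> (\<lambda>i. p.s i z) ` {i \<in> {..<N}. q \<le> d i}"
        then obtain i where i: "i < N" "q \<le> d i" "y = p.s i z" by auto
        show "linext (\<lambda>i. u i z) y \<in> pm.span ((\<lambda>i. s i z) ` {i. i < N \<and> q \<le> d i})"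
          unfolding i(3) L_def[symmetric] Ls by (rule pm.span_base) (use i in auto)
      qed
    qed
  next
    fix z v assume "z \<notin> U \<or> v \<notin> ?V" then show "f z v = 0" by (auto simp: f_def)
  next
    show "continuous_map (prod_topology (top_of_set U) (discrete_topology ?V)) T (\<lambda>(z, v). (z, f z v))"
      by (rule LH.cont_from_const[OF fl])
  qed
  have ghom: "g \<in> variation_hom U X p.B"
    unfolding variation_hom_def mem_Collect_eq p.B_simps Y
  proof (intro conjI allI ballI impI)
    fix z assume z: "z \<in> U"
    show "qlinear (H z) ?V (g z)" unfolding qlinear_def using gV[OF z] gadd[OF z] gscl[OF z] by blast
    show "g z ` W m z \<subseteq> supp_in {i \<in> {..<N}. 2 * d i \<le> m}" for m
    proof
      fix y assume "y \<in> g z ` W m z"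
      then obtain x where x: "x \<in> W m z" "y = g z x" by blast
      have "{i. i < N \<and> 2 * d i \<le> m} = {i \<in> {..<N}. 2 * d i \<le> m}" by auto
      then have "x \<in> f z ` supp_in {i \<in> {..<N}. 2 * d i \<le> m}"
        using x(1) img[OF z, of "{i \<in> {..<N}. 2 * d i \<le> m}"] W_span[OF z, of m] by auto
      then obtain v where v: "v \<in> supp_in {i \<in> {..<N}. 2 * d i \<le> m}" "x = f z v" by blast
      have "v \<in> ?V" using v(1) by (auto simp: supp_in_def)
      then show "y \<in> supp_in {i \<in> {..<N}. 2 * d i \<le> m}" using gf[OF z, of v] x(2) v by simp
    qed
    fix q
    show "complexified_maps (H z) (g z) (F q z) (pm.span ((\<lambda>i. p.s i z) ` {i \<in> {..<N}. q \<le> d i}))"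
      unfolding complexified_maps_def
    proof (intro allI impI, elim conjE)
      fix cs :: "(complex \<times> qvec) list"
      assume cs: "snd ` set cs \<subseteq> H z" "(\<Sum>(c, v)\<leftarrow>cs. ctens c v) \<in> F q z"
      let ?ds = "map (\<lambda>(c, v). (c, g z v)) cs"
      let ?y = "\<Sum>(c, v)\<leftarrow>?ds. ctens c v"
      let ?S = "{i \<in> {..<N}. q \<le> d i}"
      have dsV: "snd ` set ?ds \<subseteq> ?V" using cs(1) gV[OF z] by force
      have ey: "?y = (\<Sum>(c, v)\<leftarrow>cs. ctens c (g z v))" by (simp add: o_def case_prod_unfold)
      have m: "map (\<lambda>(c, v). ctens c (f z v)) ?ds = map (\<lambda>(c, v). ctens c v) cs"
        using cs(1) fg[OF z] by (auto simp: image_subset_iff)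
      have "L z ?y = (\<Sum>(c, v)\<leftarrow>cs. ctens c v)" using Lsum[OF z dsV] unfolding m by (rule sym)
      then have "L z ?y \<in> F q z" using cs(2) by simp
      then have LF: "L z ?y \<in> pm.span ((\<lambda>i. s i z) ` {i. i < N \<and> q \<le> d i})" unfolding F_span[OF z] .
      have fS: "finite {i. i < N \<and> q \<le> d i}" by simp
      obtain b where b: "L z ?y = (\<Sum>i\<in>{i. i < N \<and> q \<le> d i}. scl (b i) (s i z))" by (rule span_image_sum[OF fS LF])
      \<comment> \<open>A vector of \<open>F q\<close> is a combination of the rows
        \<open>s i z\<close>; the same combination of the rows of the model is its preimage, by
        injectivity of \<open>L z\<close>.\<close>
      define y' where "y' = (\<Sum>i\<in>?S. scl (b i) (p.s i z))"
      have "L z y' = (\<Sum>i\<in>?S. scl (b i) (s i z))" unfolding y'_def L_def linext_sum linext_scl unfolding L_def[symmetric] Ls ..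
      also have "\<dots> = L z ?y" unfolding b by (rule sum.cong) auto
      finally have "L z ?y = L z y'" by (rule sym)
      moreover have "?y \<in> supp_in {..<N}"
      proof -
        have "ctens a v \<in> supp_in {..<N}" if "v \<in> ?V" for a v using that by (auto simp: supp_in_def Poly_Mapping.in_keys_iff)
        then have "(\<Sum>(c, v)\<leftarrow>xs. ctens c v) \<in> supp_in {..<N}" if "snd ` set xs \<subseteq> ?V" for xs :: "(complex \<times> qvec) list"
          using that by (induction xs) (auto intro!: pm.subspace_0[OF supp_in_subspace] pm.subspace_add[OF supp_in_subspace])
        then show ?thesis using dsV by blast
      qed
      moreover have "y' \<in> supp_in {..<N}"
      proof -
        have "p.s i z \<in> supp_in {..<N}" for i by (auto simp: supp_in_def Poly_Mapping.in_keys_iff p.lookup_s split: if_splits)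
        then show ?thesis unfolding y'_def by (intro pm.subspace_sum[OF supp_in_subspace] pm.subspace_scale[OF supp_in_subspace])
      qed
      ultimately have "?y = y'" using Linj[OF z] by blast
      then show "(\<Sum>(c, v)\<leftarrow>cs. ctens c (g z v)) \<in> pm.span ((\<lambda>i. p.s i z) ` ?S)"
        unfolding ey y'_def using sum_in_span_image[of b "\<lambda>i. p.s i z" ?S] by (simp only:)
    qed
  next
    fix z x assume "z \<notin> U \<or> x \<notin> H z" then show "g z x = 0" by (auto simp: g_def)
  next
    have "continuous_map T (discrete_topology ?V) (\<lambda>y. g (fst y) (snd y))"
      unfolding continuous_map_def
    proof (intro conjI allI impI)
      show "(\<lambda>y. g (fst y) (snd y)) \<in> topspace T \<rightarrow> topspace (discrete_topology ?V)"
        using gV by (auto simp: LH.topspace_T)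
      fix G assume "openin (discrete_topology ?V) G"
      then have G: "G \<subseteq> ?V" by simp
      \<comment> \<open>The preimage of a set of vectors is a union of graphs of flat sections, and
        these graphs are open in the total space.\<close>
      have "{y \<in> topspace T. g (fst y) (snd y) \<in> G} = (\<Union>v\<in>G. {(z, f z v) | z. z \<in> U})"
      proof (intro equalityI subsetI)
        fix y assume "y \<in> {y \<in> topspace T. g (fst y) (snd y) \<in> G}"
        then obtain z x where zx: "y = (z, x)" "z \<in> U" "x \<in> H z" "g z x \<in> G" by (cases y) (auto simp: LH.topspace_T)
        then have "y = (z, f z (g z x))" using fg by simp
        then show "y \<in> (\<Union>v\<in>G. {(z, f z v) | z. z \<in> U})" using zx by blast
      next
        fix y assume "y \<in> (\<Union>v\<in>G. {(z, f z v) | z. z \<in> U})"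
        then obtain v z where "v \<in> G" "z \<in> U" "y = (z, f z v)" by blast
        then show "y \<in> {y \<in> topspace T. g (fst y) (snd y) \<in> G}" using G fV gf by (auto simp: LH.topspace_T)
      qed
      moreover have "openin T (\<Union>v\<in>G. {(z, f z v) | z. z \<in> U})"
        using LH.flat_image_open[OF fl U_open] G by (intro openin_Union) blast
      ultimately show "openin T {y \<in> topspace T. g (fst y) (snd y) \<in> G}" by (simp only:)
    qed
    then have "continuous_map T (prod_topology (top_of_set U) (discrete_topology ?V)) (\<lambda>y. (fst y, g (fst y) (snd y)))"
      by (intro continuous_map_pairedI LH.cont_fst)
    then show "continuous_map T (prod_topology (top_of_set U) (discrete_topology ?V)) (\<lambda>(z, x). (z, g z x))"
      by (simp add: case_prod_unfold)
  qed
  have z0: "f z 0 = 0" "g z 0 = 0" for z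
  proof -
    show "f z 0 = 0" by (simp add: f_def linext_def)
    then show "g z 0 = 0" using gf[of z 0] pm.subspace_0[OF sV] by (cases "z \<in> U") (auto simp: g_def)
  qed
  have 1: "(\<lambda>z v. g z (f z v)) = (\<lambda>z v. if z \<in> U \<and> v \<in> ?V then v else 0)"
  proof (intro ext)
    fix z v show "g z (f z v) = (if z \<in> U \<and> v \<in> ?V then v else 0)"
      using gf[of z v] z0(2)[of z] by (cases "z \<in> U \<and> v \<in> ?V") (auto simp: f_def)
  qed
  have 2: "(\<lambda>z x. f z (g z x)) = (\<lambda>z x. if z \<in> U \<and> x \<in> H z then x else 0)"
  proof (intro ext)
    fix z x show "f z (g z x) = (if z \<in> U \<and> x \<in> H z then x else 0)"
      using fg[of z x] z0(1)[of z] by (cases "z \<in> U \<and> x \<in> H z") (auto simp: g_def)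
  qed
  have "is_iso (variation_cat U) p.B X f"
    unfolding is_iso_def variation_cat_def cat.simps p.B_simps Y
    by (intro conjI bexI[of _ g] fhom ghom 1 2)
  then show ?thesis using p.period_axioms by blast
qed

end

lemma (in disc_variation) variation_iso_to_period:
  "\<exists>Y. period U e Y \<and> (\<exists>h. is_iso (variation_cat U) (period.B U Y) X h)"
proof (rule adapted_exists)
  fix N d \<sigma> assume ad: "adapted N d \<sigma>"
  interpret F: framed U e X c r N d \<sigma> by unfold_locales (rule ad)
  obtain S where S: "F.splits S" using F.splits_exists by (elim exE)
  interpret s: split_framed U e X c r N d \<sigma> S by unfold_locales (rule S)
  obtain \<sigma>' S' where r: "split_framed U e X c r N d \<sigma>' S'" "split_framed.gauged e N S'"
    using s.regauge by (elim exE conjE)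
  show ?thesis by (rule split_framed.iso_to_variation[OF r])
qed

section \<open>Compatibility with the fibre functors, and the equivalence\<close>

lemma (in period_pair) toV_graded:
  assumes f: "f \<in> comodule_hom (H0_hopf U) src.A tgt.A" and v: "v \<in> cm_space src.A n" and z: "z \<in> U"
  shows "toV f z v = f n v"
proof -
  have gl: "graded_linear f" using f[unfolded hom_iff_intertwines] by (rule conjunct1)
  have v': "v \<in> supp_in {i\<in>pI X. pd X i = n}" using v by simp
  have q: "qlinear (supp_in {i\<in>pI X. pd X i = n}) (cm_space tgt.A n) (f n)"
    using gl unfolding graded_linear_def src.A_simps by (rule spec)
  have "v \<in> supp_in (pI X)" by (rule supp_in_mono[OF v']) auto
  then have "toV f z v = linext (row f) v" using z by (simp add: toV_def)
  also have "\<dots> = linext (\<lambda>i. f n (single i 1)) v"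
    by (rule linext_cong) (use v' in \<open>auto simp: row_def supp_in_def\<close>)
  also have "\<dots> = f n v" by (rule qlinear_linext[OF q v', symmetric])
  finally show ?thesis .
qed

lemma qlinear_zero: "qlinear V V' f \<Longrightarrow> 0 \<in> V \<Longrightarrow> f 0 = 0"
  unfolding qlinear_def by (metis pm.scale_zero_left)

lemma comodule_homD:
  assumes "f \<in> comodule_hom A M M'"
  shows "qlinear (cm_space M n) (cm_space M' n) (f n)" "v \<notin> cm_space M n \<Longrightarrow> f n v = 0"
  using assms unfolding comodule_hom_def by blast+

text \<open>\<open>M\<close> is sent to the variation of the period matrix of its chosen model. That
  variation is built on the same index set as the model, so the isomorphism of \<open>M\<close> with
  its model also identifies its part of degree \<open>n\<close> with the graded piece of weight
  \<open>2n\<close>.\<close>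

theorem corollary4p5:
  fixes U :: "complex set" and c :: complex and r :: real
  assumes "0 < r" and "U = ball c r"
  shows "\<exists>\<Phi> \<Phi>m. is_equivalence (comodule_cat (H0_hopf U)) (variation_cat U) \<Phi> \<Phi>m
                 \<and> gr_compatible (H0_hopf U) U \<Phi> \<Phi>m"
proof -
  have U: "U \<noteq> {}" "open U" "connected U" using assms by auto
  obtain e where ga: "gauge U e" by (rule gauge_exists[OF U(1,2)])
  interpret gauge U e by (rule ga)
  let ?C = "comodule_cat (H0_hopf U)" and ?D = "variation_cat U"
  let ?A = "period.A U" and ?B = "period.B U" and ?t = "\<lambda>X Y. period_pair.toV U X"
  have C: "category ?C" by (rule category_comodule_cat[OF U(1)])
  have Cs: "hom ?C = comodule_hom (H0_hopf U)" "ob ?C = {M. graded_comodule (H0_hopf U) M}"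
    "cmp ?C = (\<lambda>\<psi> \<phi> n v. \<psi> n (\<phi> n v))" "idn ?C = (\<lambda>M n v. if v \<in> cm_space M n then v else 0)"
    by (simp_all add: comodule_cat_def)
  have Ds: "hom ?D = variation_hom U" "ob ?D = {X. HT_variation U X}" "cmp ?D = (\<lambda>\<psi> \<phi> z v. \<psi> z (\<phi> z v))"
    by (simp_all add: variation_cat_def)
  have Ccm: "cmp ?C g f \<in> hom ?C M M''" if "M \<in> ob ?C" "M' \<in> ob ?C" "M'' \<in> ob ?C" "f \<in> hom ?C M M'" "g \<in> hom ?C M' M''" for M M' M'' f g
    using C that unfolding category_def by blast
  have AO: "?A X \<in> ob ?C" if "period U e X" for X
    unfolding Cs using comod.M[OF period.comod_A[OF that]] by simp
  have BO: "?B X \<in> ob ?D" if "period U e X" for X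
    unfolding Ds using period.HT_variation_B[OF that] by simp
  have sub: "0 \<in> cm_space M n" if "M \<in> ob ?C" for M n
    using that findim_subspace[of "cm_space M n"] pm.subspace_0 unfolding Cs graded_comodule_def by blast
  have "\<forall>M. \<exists>k i j. M \<in> ob ?C \<longrightarrow> period U e k \<and> i \<in> hom ?C M (?A k) \<and> j \<in> hom ?C (?A k) M \<and>
      (\<forall>n v. v \<in> cm_space M n \<longrightarrow> j n (i n v) = v) \<and> (\<forall>n v. v \<in> cm_space (?A k) n \<longrightarrow> i n (j n v) = v)"
  proof
    fix M
    show "\<exists>k i j. M \<in> ob ?C \<longrightarrow> period U e k \<and> i \<in> hom ?C M (?A k) \<and> j \<in> hom ?C (?A k) M \<and>
      (\<forall>n v. v \<in> cm_space M n \<longrightarrow> j n (i n v) = v) \<and> (\<forall>n v. v \<in> cm_space (?A k) n \<longrightarrow> i n (j n v) = v)"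
    proof (cases "M \<in> ob ?C")
      case True
      then have "comod U M" using U(1) by (simp add: Cs comod_def)
      then interpret cg: comod_gauge U e M by (intro comod_gauge.intro ga)
      show ?thesis
      proof (rule cg.iso_to_period)
        fix X f g
        assume "period U e X" "f \<in> comodule_hom (H0_hopf U) M (?A X)" "g \<in> comodule_hom (H0_hopf U) (?A X) M"
          "\<And>n v. v \<in> cm_space M n \<Longrightarrow> g n (f n v) = v" "\<And>n v. v \<in> cm_space (?A X) n \<Longrightarrow> f n (g n v) = v"
        then show ?thesis unfolding Cs by (intro exI[of _ X] exI[of _ f] exI[of _ g]) blast
      qed
    next
      case False then show ?thesis by blast
    qed
  qed
  from choice[OF this] obtain k where "\<forall>M. \<exists>i j. M \<in> ob ?C \<longrightarrow> period U e (k M) \<and> i \<in> hom ?C M (?A (k M)) \<and> j \<in> hom ?C (?A (k M)) M \<and>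
      (\<forall>n v. v \<in> cm_space M n \<longrightarrow> j n (i n v) = v) \<and> (\<forall>n v. v \<in> cm_space (?A (k M)) n \<longrightarrow> i n (j n v) = v)" by (elim exE)
  from choice[OF this] obtain i where "\<forall>M. \<exists>j. M \<in> ob ?C \<longrightarrow> period U e (k M) \<and> i M \<in> hom ?C M (?A (k M)) \<and> j \<in> hom ?C (?A (k M)) M \<and>
      (\<forall>n v. v \<in> cm_space M n \<longrightarrow> j n (i M n v) = v) \<and> (\<forall>n v. v \<in> cm_space (?A (k M)) n \<longrightarrow> i M n (j n v) = v)" by (elim exE)
  from choice[OF this] obtain j where kij: "\<forall>M. M \<in> ob ?C \<longrightarrow> period U e (k M) \<and> i M \<in> hom ?C M (?A (k M)) \<and> j M \<in> hom ?C (?A (k M)) M \<and>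
      (\<forall>n v. v \<in> cm_space M n \<longrightarrow> j M n (i M n v) = v) \<and> (\<forall>n v. v \<in> cm_space (?A (k M)) n \<longrightarrow> i M n (j M n v) = v)" by (elim exE)
  have k: "period U e (k M)" and i: "i M \<in> hom ?C M (?A (k M))" and j: "j M \<in> hom ?C (?A (k M)) M"
    and ji: "v \<in> cm_space M n \<Longrightarrow> j M n (i M n v) = v" and ij: "w \<in> cm_space (?A (k M)) n \<Longrightarrow> i M n (j M n w) = w"
    if "M \<in> ob ?C" for M n v w
    using kij that by simp_all
  note iD = comodule_homD[OF i[unfolded Cs(1)]] and jD = comodule_homD[OF j[unfolded Cs(1)]]
  have i0: "i M n 0 = 0" and j0: "j M n 0 = 0" if M: "M \<in> ob ?C" for M n
    using qlinear_zero[OF iD(1)[OF M] sub[OF M]] qlinear_zero[OF jD(1)[OF M] sub[OF AO[OF k[OF M]]]] .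
  let ?F = "\<lambda>M. ?B (k M)" and ?Fm = "\<lambda>M M' f. ?t (k M) (k M') (cmp ?C (i M') (cmp ?C f (j M)))"
  have eqv: "is_equivalence ?C ?D ?F ?Fm"
  proof (rule equivalence_through_common_models[where X = "{X. period U e X}" and A = ?A and B = ?B and t = ?t and k = k and i = i and j = j, OF C category_variation_cat])
    show "?A X \<in> ob ?C" "?B X \<in> ob ?D" if "X \<in> {X. period U e X}" for X using that AO BO by simp_all
    show "bij_betw (?t X Y) (hom ?C (?A X) (?A Y)) (hom ?D (?B X) (?B Y))" if "X \<in> {X. period U e X}" "Y \<in> {X. period U e X}" for X Y
      unfolding Cs Ds using that U(3) by (intro period_pair.bij_toV period_pair.intro) auto
    show "?t X X (idn ?C (?A X)) = idn ?D (?B X)" if "X \<in> {X. period U e X}" for X using that toV_id[of U e X] by simp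
    show "?t X Z (cmp ?C g f) = cmp ?D (?t Y Z g) (?t X Y f)"
      if "X \<in> {X. period U e X}" "Y \<in> {X. period U e X}" "Z \<in> {X. period U e X}" "f \<in> hom ?C (?A X) (?A Y)" "g \<in> hom ?C (?A Y) (?A Z)" for X Y Z f g
      using that toV_cmp[of U e X Y Z f g] unfolding Cs Ds by simp
    show "k M \<in> {X. period U e X}" "i M \<in> hom ?C M (?A (k M))" "j M \<in> hom ?C (?A (k M)) M" if "M \<in> ob ?C" for M
      using k[OF that] i[OF that] j[OF that] by simp_all
    show "cmp ?C (j M) (i M) = idn ?C M" if M: "M \<in> ob ?C" for M
      unfolding Cs
    proof (intro ext)
      fix n v show "j M n (i M n v) = (if v \<in> cm_space M n then v else 0)"
        using ji[OF M, of v n] iD(2)[OF M, of v n] j0[OF M] by (cases "v \<in> cm_space M n") simp_all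
    qed
    show "cmp ?C (i M) (j M) = idn ?C (?A (k M))" if M: "M \<in> ob ?C" for M
      unfolding Cs
    proof (intro ext)
      fix n v show "i M n (j M n v) = (if v \<in> cm_space (?A (k M)) n then v else 0)"
        using ij[OF M, of v n] jD(2)[OF M, of v n] i0[OF M] by (cases "v \<in> cm_space (?A (k M)) n") simp_all
    qed
    show "\<exists>x\<in>{X. period U e X}. \<exists>g. is_iso ?D (?B x) Y g" if "Y \<in> ob ?D" for Y
    proof -
      have "HT_variation U Y" using that unfolding Ds mem_Collect_eq .
      then interpret disc_variation U e Y c r using assms by unfold_locales
      show ?thesis using variation_iso_to_period by blast
    qed
  qed
  have Wk: "vt_W (?F M) m z = supp_in {l\<in>pI (k M). 2 * pd (k M) l \<le> m}" "cm_space (?A (k M)) n = supp_in {l\<in>pI (k M). pd (k M) l = n}"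
    "vt_top (?F M) = prod_topology (top_of_set U) (discrete_topology (supp_in (pI (k M))))" if "M \<in> ob ?C" for M m n z
  proof -
    interpret p: period U e "k M" by (rule k[OF that])
    show "vt_W (?F M) m z = supp_in {l\<in>pI (k M). 2 * pd (k M) l \<le> m}" "cm_space (?A (k M)) n = supp_in {l\<in>pI (k M). pd (k M) l = n}"
      "vt_top (?F M) = prod_topology (top_of_set U) (discrete_topology (supp_in (pI (k M))))" by simp_all
  qed
  have iin: "i M n v \<in> supp_in {l\<in>pI (k M). pd (k M) l = n}" if M: "M \<in> ob ?C" and v: "v \<in> cm_space M n" for M n v
    using iD(1)[OF M, of n] v unfolding qlinear_def Wk(2)[OF M] by blast
  have W0: "x - y \<in> vt_W (?F M) m z" if "M \<in> ob ?C" "x = y" for M m z x y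
    unfolding Wk(1)[OF that(1)] that(2) by (simp add: pm.subspace_0[OF supp_in_subspace])
  have iW: "i M n v \<in> vt_W (?F M) (2 * n) z" if M: "M \<in> ob ?C" and v: "v \<in> cm_space M n" for M n v z
    using iin[OF M v] unfolding Wk(1)[OF M] by (auto simp: supp_in_def)
  have "gr_compatible (H0_hopf U) U ?F ?Fm"
    unfolding gr_compatible_def
  \<comment> \<open>\<open>\<theta>\<close> is the isomorphism \<open>i M\<close> with the model,
    the same for all \<open>z\<close>: in the model the vectors of degree \<open>n\<close> form a
    complement of \<open>W (2 * n - 1)\<close> in \<open>W (2 * n)\<close>.\<close>
  proof (intro exI[of _ "\<lambda>M n z v. i M n v"] conjI ballI allI impI)
    fix M n z assume M: "M \<in> ob ?C" and z: "z \<in> U"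
    note q = iD(1)[OF M, of n, unfolded qlinear_def]
    show "i M n v \<in> vt_W (?F M) (2 * n) z" if "v \<in> cm_space M n" for v by (rule iW[OF M that])
    show "i M n (u + v) - (i M n u + i M n v) \<in> vt_W (?F M) (2 * n - 1) z" if "u \<in> cm_space M n" "v \<in> cm_space M n" for u v
      by (rule W0[OF M]) (use q that in blast)
    show "i M n (scl q' v) - scl q' (i M n v) \<in> vt_W (?F M) (2 * n - 1) z" if "v \<in> cm_space M n" for q' v
      by (rule W0[OF M]) (use q that in blast)
    show "v = 0" if v: "v \<in> cm_space M n" and w: "i M n v \<in> vt_W (?F M) (2 * n - 1) z" for v
    proof -
      have "l \<notin> keys (i M n v)" for l
        using iin[OF M v] w unfolding Wk(1)[OF M] supp_in_def by fastforce
      then have "i M n v = 0" by (intro poly_mapping_eqI) (simp add: Poly_Mapping.in_keys_iff)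
      then show ?thesis using ji[OF M v] j0[OF M, of n] by simp
    qed
    show "\<exists>v\<in>cm_space M n. x - i M n v \<in> vt_W (?F M) (2 * n - 1) z" if x: "x \<in> vt_W (?F M) (2 * n) z" for x
    proof -
      \<comment> \<open>\<open>y\<close> is the part of \<open>x\<close> of degree \<open>n\<close>;
        what is left has degree below \<open>n\<close> and so lies in
        \<open>W (2 * n - 1)\<close>.\<close>
      let ?K = "{l\<in>keys x. pd (k M) l = n}"
      define y where "y = (\<Sum>l\<in>?K. single l (lookup x l))"
      have fK: "finite ?K" by simp
      have ly: "lookup y l = (if l \<in> ?K then lookup x l else 0)" for l
        using fK by (simp add: y_def Poly_Mapping.lookup_sum Poly_Mapping.lookup_single when_def)
      have xs: "keys x \<subseteq> {l\<in>pI (k M). 2 * pd (k M) l \<le> 2 * n}" using x unfolding Wk(1)[OF M] supp_in_def by simp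
      have y: "y \<in> cm_space (?A (k M)) n"
        unfolding Wk(2)[OF M] supp_in_def using xs by (auto simp: Poly_Mapping.in_keys_iff ly split: if_splits)
      have "j M n y \<in> cm_space M n" using jD(1)[OF M, of n] y unfolding qlinear_def by blast
      moreover have "x - i M n (j M n y) \<in> vt_W (?F M) (2 * n - 1) z"
        unfolding ij[OF M y] Wk(1)[OF M] supp_in_def mem_Collect_eq
      proof
        fix l assume "l \<in> keys (x - y)"
        then have "lookup x l \<noteq> lookup y l" by (simp add: Poly_Mapping.in_keys_iff Poly_Mapping.lookup_minus)
        then have "l \<in> keys x" "pd (k M) l \<noteq> n" unfolding ly by (auto simp: Poly_Mapping.in_keys_iff split: if_splits)
        then show "l \<in> {l\<in>pI (k M). 2 * pd (k M) l \<le> 2 * n - 1}" using xs by force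
      qed
      ultimately show ?thesis by blast
    qed
  next
    fix M n v z0 assume M: "M \<in> ob ?C" and v: "v \<in> cm_space M n" and z0: "z0 \<in> U"
    have "flat_section (vt_top (?F M)) U (\<lambda>_. i M n v)"
      unfolding Wk(3)[OF M] by (rule flat_const) (use iin[OF M v] in \<open>auto simp: supp_in_def\<close>)
    then show "\<exists>N \<sigma>. open N \<and> z0 \<in> N \<and> N \<subseteq> U \<and> flat_section (vt_top (?F M)) N \<sigma> \<and>
        (\<forall>z\<in>N. \<sigma> z \<in> vt_W (?F M) (2 * n) z \<and> \<sigma> z - i M n v \<in> vt_W (?F M) (2 * n - 1) z)"
      using U(2) z0 iW[OF M v] W0[OF M refl] by (intro exI[of _ U] exI[of _ "\<lambda>_. i M n v"]) blast
  next
    fix M M' f n v z assume M: "M \<in> ob ?C" "M' \<in> ob ?C" and f: "f \<in> hom ?C M M'" and v: "v \<in> cm_space M n" and z: "z \<in> U"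
    interpret pp: period_pair U e "k M" "k M'" by (intro period_pair.intro k M)
    let ?h = "cmp ?C (i M') (cmp ?C f (j M))"
    have h: "?h \<in> comodule_hom (H0_hopf U) (?A (k M)) (?A (k M'))"
      using Ccm[OF AO[OF k[OF M(1)]] M(2) AO[OF k[OF M(2)]] Ccm[OF AO[OF k[OF M(1)]] M j[OF M(1)] f] i[OF M(2)]] unfolding Cs(1) .
    have w: "i M n v \<in> cm_space (?A (k M)) n" using iin[OF M(1) v] unfolding Wk(2)[OF M(1)] .
    have "?Fm M M' f z (i M n v) = ?h n (i M n v)" by (rule pp.toV_graded[OF h w z])
    also have "\<dots> = i M' n (f n v)" unfolding Cs ji[OF M(1) v] ..
    finally show "?Fm M M' f z (i M n v) - i M' n (f n v) \<in> vt_W (?F M') (2 * n - 1) z" by (rule W0[OF M(2)])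
  qed
  with eqv show ?thesis by blast
qed

end
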